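(* Let $(R,\{\ ,\ ,\ \})$ be a nonzero non-degenerate linear triple Jordan system over a ring $F$ with $1/6$. Then $P(R)$ is a linear Jordan system of $\mathfrak M$-quotients of $R$; $P(R)$ embeds into $Q_m(R)$ identically on $R$; $$O(P(R))\subseteq Q_m(P(R))=O(Q_m(P(R)));$$ and $Q_m(P(R))_B$ is a linear Jordan system of $\mathfrak M$-quotients of $O(P(R))_B$ for any ultrafilter $B$ in $B(R)$.
   Context: $F$ is an associative commutative ring with $1$ containing $1/6$. A linear triple system over $F$ is an $F$-module $R$ with a trilinear composition $\{\ ,\ ,\ \}:R^3\to R$; an ideal is an $F$-submodule $I$ with $\{I,R,R\}+\{R,I,R\}+\{R,R,I\}\subseteq I$. $R$ is $R$-semiprime if $\{I,I,R\}+\{I,R,I\}+\{R,I,I\}\ne\{0\}$ for every nonzero ideal $I$. $M(R)$ is the associative subalgebra of $\mathrm{End}_F(R)$ generated by all operators $\{x,y,\cdot\},\{x,\cdot,y\},\{\cdot,x,y\}$, $x,y\in R$, and $M(R)'=F\,\mathrm{Id}_R+M(R)$, acting on the right. A linear triple Jordan system is a linear triple system with identities $\{x,y,z\}=\{z,y,x\}$ and $\{x,y,\{a,b,c\}\}-\{a,b,\{x,y,c\}\}=\{\{x,y,a\},b,c\}-\{a,\{y,x,b\},c\}$; it is non-degenerate if for every $0\ne x\in R$ the operator $U_x:y\mapsto\{x,y,x\}$ is nonzero (this implies $R$-semiprimeness). For nonzero $R$-semiprime $R$: $I(R)$ is an injective hull of the right $M(R)'$-module $R$; $P(R)=\mathrm{End}(I(R))_{M(R)'}R$;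 $\mathrm{CM}(R)=\mathrm{End}(P(R))_{M(R)'}$ (commutative, von Neumann regular). $P(R)=\mathrm{CM}(R)R$ is regarded as a linear triple system over $\mathrm{CM}(R)$, composition extended from $R$ by $\mathrm{CM}(R)$-linearity; $M(P(R))'=\mathrm{CM}(R)\mathrm{Id}+M(P(R))$; $I(P(R))$ is an injective hull of the right $M(P(R))'$-module $P(R)$. $B(R)$ is the set of idempotents of $\mathrm{CM}(R)$, a Boolean ring with multiplication of $\mathrm{CM}(R)$, addition $\alpha\oplus\beta=(\alpha-\beta)^2$, order $\alpha\le\beta$ iff $\alpha\beta=\alpha$. A subset of $B(R)$ is dense if its annihilator in $B(R)$ is zero, orthogonal if distinct elements have zero product. $S\subseteq I(P(R))$ is orthogonally complete if for every dense orthogonal $\{\xi_a\}_{a\in I}\subseteq B(R)$ and $\{x_a\}_{a\in I}\subseteq S$ there is $x\in S$ (unique, denoted $\sum^\perp_{a\in I}\xi_ax_a$) with $\xi_ax=\xi_ax_a$ for all $a$; $O(S)$ is the intersection of all orthogonally complete subsets of $I(P(R))$ containing $S$ (it is the set of all $\sum^\perp\xi_ax_a$, $x_a\in S$). The operations of $P(R)$ extend to $O(P(R))$ componentwise, $\{\sum^\perp\xi_ax_a,\sum^\perp\chi_by_b,\sum^\perp\eta_cz_c\}=\sum^\perp\xi_a\chi_b\eta_c\{x_a,y_b,z_c\}$, and similarly for $+$. An ultrafilter in $B(R)$ is $B\subseteq B(R)\setminus\{0\}$ closed under products, upward closed for $\le$, and such that for each $\alpha\in B(R)$ either $\alpha\in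 B$ or $\mathrm{Id}-\alpha\in B$. With $P=B(R)\setminus B$, $PS=\{\alpha x\mid\alpha\in P,x\in S\}$, $S_B=S/(S\cap PS)$. A linear triple Jordan system $Q$ is a (linear) Jordan system of $\mathfrak M$-quotients of $R$ if $R$ is a subsystem of $Q$ and for every $0\ne q\in Q$ there is an ideal $I$ of $R$ with $\mathrm{Ann}_RI=\{x\in R\mid\{x,R,I\}=\{x,I,R\}=\{R,x,I\}=\{0\}\}=\{0\}$ and $\{0\}\ne\{q,I,R\}+\{q,R,I\}+\{I,q,R\}\subseteq R$. For non-degenerate $R$ over a ring with $1/6$, $Q_m(R)$ is the maximal system of $\mathfrak M$-quotients: the one into which every system of $\mathfrak M$-quotients of $R$ embeds identically on $R$ (known to exist and be unique up to an isomorphism identical on $R$; realized as the degree $1$ component of the maximal Lie algebra of quotients of the $3$-graded Tits–Kantor–Koecher algebra of the Jordan pair $(R,R)$). $Q_m(P(R))$ is formed for $P(R)$ as a system over $\mathrm{CM}(R)$; it is identified, by an embedding identical on $P(R)$, with an $M(P(R))'$-submodule of $I(P(R))$, $P(R)$ being essential in it. *)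

theory Defs
  imports "HOL-Algebra.Module" "HOL-Algebra.AbelCoset" "HOL-Algebra.Generated_Groups"
begin

section \<open>Linear triple systems\<close>

text \<open>
  As for \<^locale>\<open>module\<close>, the ring multiplication and unit fields that the record inherits
  carry no meaning.
\<close>

record ('k, 'a) triple_system = "('k, 'a) module" +
  triple :: "'a \<Rightarrow> 'a \<Rightarrow> 'a \<Rightarrow> 'a"

definition trilinear ::
    "('k, 'n) ring_scheme \<Rightarrow> ('k, 'a, 'm) module_scheme \<Rightarrow> ('a \<Rightarrow> 'a \<Rightarrow> 'a \<Rightarrow> 'a) \<Rightarrow> bool" where
  "trilinear K V t \<longleftrightarrow>
    (\<forall>x\<in>carrier V. \<forall>y\<in>carrier V. \<forall>z\<in>carrier V. t x y z \<in> carrier V) \<and>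
    (\<forall>x\<in>carrier V. \<forall>x'\<in>carrier V. \<forall>y\<in>carrier V. \<forall>z\<in>carrier V.
       t (x \<oplus>\<^bsub>V\<^esub> x') y z = t x y z \<oplus>\<^bsub>V\<^esub> t x' y z \<and>
       t y (x \<oplus>\<^bsub>V\<^esub> x') z = t y x z \<oplus>\<^bsub>V\<^esub> t y x' z \<and>
       t y z (x \<oplus>\<^bsub>V\<^esub> x') = t y z x \<oplus>\<^bsub>V\<^esub> t y z x') \<and>
    (\<forall>k\<in>carrier K. \<forall>x\<in>carrier V. \<forall>y\<in>carrier V. \<forall>z\<in>carrier V.
       t (k \<odot>\<^bsub>V\<^esub> x) y z = k \<odot>\<^bsub>V\<^esub> t x y z \<and>
       t x (k \<odot>\<^bsub>V\<^esub> y) z = k \<odot>\<^bsub>V\<^esub> t x y z \<and>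
       t x y (k \<odot>\<^bsub>V\<^esub> z) = k \<odot>\<^bsub>V\<^esub> t x y z)"

locale linear_triple_system = module K R
  for K :: "('k, 'n) ring_scheme" (structure)
    and R :: "('k, 'a, 'm) triple_system_scheme" (structure) +
  assumes trilinear_triple: "trilinear K R (triple R)"

locale linear_triple_jordan = linear_triple_system +
  assumes triple_commute:
      "\<lbrakk>x \<in> carrier R; y \<in> carrier R; z \<in> carrier R\<rbrakk> \<Longrightarrow> triple R x y z = triple R z y x"
    and triple_jordan:
      "\<lbrakk>x \<in> carrier R; y \<in> carrier R; a \<in> carrier R; b \<in> carrier R; c \<in> carrier R\<rbrakk> \<Longrightarrow>
        triple R x y (triple R a b c) \<ominus>\<^bsub>R\<^esub> triple R a b (triple R x y c) =
        triple R (triple R x y a) b c \<ominus>\<^bsub>R\<^esub> triple R a (triple R y x b) c"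

definition nondegenerate :: "('k, 'a, 'm) triple_system_scheme \<Rightarrow> bool" where
  "nondegenerate R \<longleftrightarrow>
    (\<forall>x\<in>carrier R. x \<noteq> \<zero>\<^bsub>R\<^esub> \<longrightarrow> (\<exists>y\<in>carrier R. triple R x y x \<noteq> \<zero>\<^bsub>R\<^esub>))"

text \<open>The additive span of all products with factors in the three given sets.\<close>

definition triple_span ::
    "('k, 'a, 'm) triple_system_scheme \<Rightarrow> 'a set \<Rightarrow> 'a set \<Rightarrow> 'a set \<Rightarrow> 'a set" where
  "triple_span R X Y Z = generate (add_monoid R) {triple R x y z | x y z. x \<in> X \<and> y \<in> Y \<and> z \<in> Z}"

definition triple_ideal ::
    "('k, 'n) ring_scheme \<Rightarrow> ('k, 'a, 'm) triple_system_scheme \<Rightarrow> 'a set \<Rightarrow> bool" where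
  "triple_ideal K R I \<longleftrightarrow> submodule I K R \<and>
    triple_span R I (carrier R) (carrier R) <+>\<^bsub>R\<^esub> triple_span R (carrier R) I (carrier R)
      <+>\<^bsub>R\<^esub> triple_span R (carrier R) (carrier R) I \<subseteq> I"

definition triple_annihilator :: "('k, 'a, 'm) triple_system_scheme \<Rightarrow> 'a set \<Rightarrow> 'a set" where
  "triple_annihilator R I = {x \<in> carrier R.
     triple_span R {x} (carrier R) I = {\<zero>\<^bsub>R\<^esub>} \<and>
     triple_span R {x} I (carrier R) = {\<zero>\<^bsub>R\<^esub>} \<and>
     triple_span R (carrier R) {x} I = {\<zero>\<^bsub>R\<^esub>}}"

definition triple_embedding ::
    "('k, 'n) ring_scheme \<Rightarrow> ('k, 'a, 'm) triple_system_scheme \<Rightarrow>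
     ('k, 'b, 'l) triple_system_scheme \<Rightarrow> ('a \<Rightarrow> 'b) \<Rightarrow> bool" where
  "triple_embedding K R Q \<phi> \<longleftrightarrow>
    \<phi> \<in> carrier R \<rightarrow> carrier Q \<and> inj_on \<phi> (carrier R) \<and>
    (\<forall>x\<in>carrier R. \<forall>y\<in>carrier R. \<phi> (x \<oplus>\<^bsub>R\<^esub> y) = \<phi> x \<oplus>\<^bsub>Q\<^esub> \<phi> y) \<and>
    (\<forall>k\<in>carrier K. \<forall>x\<in>carrier R. \<phi> (k \<odot>\<^bsub>R\<^esub> x) = k \<odot>\<^bsub>Q\<^esub> \<phi> x) \<and>
    (\<forall>x\<in>carrier R. \<forall>y\<in>carrier R. \<forall>z\<in>carrier R.
       \<phi> (triple R x y z) = triple Q (\<phi> x) (\<phi> y) (\<phi> z))"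

abbreviation triple_subsystem ::
    "('k, 'n) ring_scheme \<Rightarrow> ('k, 'a, 'm) triple_system_scheme \<Rightarrow>
     ('k, 'a, 'l) triple_system_scheme \<Rightarrow> bool" where
  "triple_subsystem K R Q \<equiv> linear_triple_system K R \<and> triple_embedding K R Q (\<lambda>x. x)"


section \<open>Systems of \<open>\<MM>\<close>-quotients\<close>

text \<open>
  The embedding \<open>\<iota>\<close> is the one along which \<open>R\<close> is regarded as a subsystem of \<open>Q\<close>; it is the
  identity whenever \<open>R\<close> is literally contained in \<open>Q\<close>.
\<close>

definition M_quotients ::
    "('k, 'n) ring_scheme \<Rightarrow> ('k, 'a, 'm) triple_system_scheme \<Rightarrow> ('a \<Rightarrow> 'b) \<Rightarrow>
     ('k, 'b, 'l) triple_system_scheme \<Rightarrow> bool" where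
  "M_quotients K R \<iota> Q \<longleftrightarrow>
    linear_triple_jordan K Q \<and> linear_triple_system K R \<and> triple_embedding K R Q \<iota> \<and>
    (\<forall>q\<in>carrier Q. q \<noteq> \<zero>\<^bsub>Q\<^esub> \<longrightarrow>
      (\<exists>I. triple_ideal K R I \<and> triple_annihilator R I = {\<zero>\<^bsub>R\<^esub>} \<and>
        (let T = triple_span Q {q} (\<iota> ` I) (\<iota> ` carrier R)
             <+>\<^bsub>Q\<^esub> triple_span Q {q} (\<iota> ` carrier R) (\<iota> ` I)
             <+>\<^bsub>Q\<^esub> triple_span Q (\<iota> ` I) {q} (\<iota> ` carrier R)
         in T \<noteq> {\<zero>\<^bsub>Q\<^esub>} \<and> T \<subseteq> \<iota> ` carrier R)))"

text \<open>
  HOL cannot quantify over the carrier types of the competing systems \<open>T\<close>, so one type that is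
  large enough for all of them is fixed.  An element \<open>q\<close> of a system of \<open>\<MM>\<close>-quotients is determined
  by an ideal \<open>I\<close> with \<open>Ann I = 0\<close> and by the three maps \<open>I \<times> R \<rightarrow> R\<close> given by \<open>{q,i,r}\<close>, \<open>{q,r,i}\<close>,
  \<open>{i,q,r}\<close>.  So every such system has at most \<open>2 ^ max \<aleph>\<^sub>0 |R|\<close> elements, and is isomorphic
  over \<open>R\<close> to one with elements in \<^typ>\<open>'a list set\<close>.
\<close>

definition maximal_M_quotients ::
    "('k, 'n) ring_scheme \<Rightarrow> ('k, 'a, 'm) triple_system_scheme \<Rightarrow> ('a \<Rightarrow> 'b) \<Rightarrow>
     ('k, 'b, 'l) triple_system_scheme \<Rightarrow> bool" where
  "maximal_M_quotients K R \<iota> Q \<longleftrightarrow> M_quotients K R \<iota> Q \<and>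
    (\<forall>(T :: ('k, 'a list set) triple_system) \<kappa>. M_quotients K R \<kappa> T \<longrightarrow>
      (\<exists>\<phi>. triple_embedding K T Q \<phi> \<and> (\<forall>x\<in>carrier R. \<phi> (\<kappa> x) = \<iota> x)))"


section \<open>Right modules and injective hulls\<close>

text \<open>
  Right modules over a possibly noncommutative ring also use the \<^const>\<open>smult\<close> field, with the
  scalar written first: \<open>a \<odot> v\<close> stands for \<open>v\<cdot>a\<close>.
\<close>

locale right_module = A?: ring A + V?: abelian_group V
  for A :: "('s, 'n) ring_scheme" (structure)
    and V :: "('s, 'a, 'm) module_scheme" (structure) +
  assumes act_closed: "\<lbrakk>a \<in> carrier A; v \<in> carrier V\<rbrakk> \<Longrightarrow> a \<odot>\<^bsub>V\<^esub> v \<in> carrier V"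
    and act_add_scalar: "\<lbrakk>a \<in> carrier A; b \<in> carrier A; v \<in> carrier V\<rbrakk> \<Longrightarrow>
      (a \<oplus>\<^bsub>A\<^esub> b) \<odot>\<^bsub>V\<^esub> v = a \<odot>\<^bsub>V\<^esub> v \<oplus>\<^bsub>V\<^esub> b \<odot>\<^bsub>V\<^esub> v"
    and act_add_vector: "\<lbrakk>a \<in> carrier A; v \<in> carrier V; w \<in> carrier V\<rbrakk> \<Longrightarrow>
      a \<odot>\<^bsub>V\<^esub> (v \<oplus>\<^bsub>V\<^esub> w) = a \<odot>\<^bsub>V\<^esub> v \<oplus>\<^bsub>V\<^esub> a \<odot>\<^bsub>V\<^esub> w"
    and act_mult: "\<lbrakk>a \<in> carrier A; b \<in> carrier A; v \<in> carrier V\<rbrakk> \<Longrightarrow>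
      (a \<otimes>\<^bsub>A\<^esub> b) \<odot>\<^bsub>V\<^esub> v = b \<odot>\<^bsub>V\<^esub> (a \<odot>\<^bsub>V\<^esub> v)"
    and act_one: "v \<in> carrier V \<Longrightarrow> \<one>\<^bsub>A\<^esub> \<odot>\<^bsub>V\<^esub> v = v"

definition module_hom ::
    "('s, 'n) ring_scheme \<Rightarrow> ('s, 'a, 'm) module_scheme \<Rightarrow> ('s, 'b, 'l) module_scheme \<Rightarrow> ('a \<Rightarrow> 'b) set" where
  "module_hom A V W = {f \<in> carrier V \<rightarrow>\<^sub>E carrier W.
     (\<forall>v\<in>carrier V. \<forall>w\<in>carrier V. f (v \<oplus>\<^bsub>V\<^esub> w) = f v \<oplus>\<^bsub>W\<^esub> f w) \<and>
     (\<forall>a\<in>carrier A. \<forall>v\<in>carrier V. f (a \<odot>\<^bsub>V\<^esub> v) = a \<odot>\<^bsub>W\<^esub> f v)}"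

text \<open>
  The test modules \<open>V\<close> have elements in the type of the scalars.  That type accommodates the regular
  module of \<open>A\<close>, so by Baer's criterion nothing is lost against test modules of arbitrary type.
\<close>

definition injective_module :: "('s, 'n) ring_scheme \<Rightarrow> ('s, 'a, 'm) module_scheme \<Rightarrow> bool" where
  "injective_module A E \<longleftrightarrow> right_module A E \<and>
    (\<forall>(V :: ('s, 's) module) W. right_module A V \<and> submodule W A V \<longrightarrow>
      (\<forall>f \<in> module_hom A (V\<lparr>carrier := W\<rparr>) E.
        \<exists>g \<in> module_hom A V E. \<forall>w\<in>W. g w = f w))"

text \<open>The hulled module \<open>N\<close> is literally a submodule of its hull \<open>E\<close>.\<close>

definition injective_hull ::
    "('s, 'n) ring_scheme \<Rightarrow> ('s, 'a, 'm) module_scheme \<Rightarrow> ('s, 'a, 'l) module_scheme \<Rightarrow> bool" where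
  "injective_hull A N E \<longleftrightarrow> injective_module A E \<and>
    submodule (carrier N) A E \<and>
    (\<forall>x\<in>carrier N. \<forall>y\<in>carrier N. x \<oplus>\<^bsub>N\<^esub> y = x \<oplus>\<^bsub>E\<^esub> y) \<and>
    (\<forall>a\<in>carrier A. \<forall>x\<in>carrier N. a \<odot>\<^bsub>N\<^esub> x = a \<odot>\<^bsub>E\<^esub> x) \<and>
    (\<forall>W. submodule W A E \<and> W \<noteq> {\<zero>\<^bsub>E\<^esub>} \<longrightarrow> W \<inter> carrier N \<noteq> {\<zero>\<^bsub>E\<^esub>})"


section \<open>Rings of operators\<close>

text \<open>Operators on \<open>V\<close> are functions that are \<^const>\<open>undefined\<close> outside the carrier of \<open>V\<close>.\<close>

definition operator_ring :: "('k, 'a, 'm) module_scheme \<Rightarrow> ('a \<Rightarrow> 'a) set \<Rightarrow> ('a \<Rightarrow> 'a) ring" where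
  "operator_ring V S =
    \<lparr>carrier = S,
     mult = (\<lambda>f g. compose (carrier V) f g),
     one = (\<lambda>x\<in>carrier V. x),
     zero = (\<lambda>x\<in>carrier V. \<zero>\<^bsub>V\<^esub>),
     add = (\<lambda>f g. \<lambda>x\<in>carrier V. f x \<oplus>\<^bsub>V\<^esub> g x)\<rparr>"

definition scalar_operator :: "('k, 'a, 'm) module_scheme \<Rightarrow> 'k \<Rightarrow> 'a \<Rightarrow> 'a" where
  "scalar_operator V k = (\<lambda>x\<in>carrier V. k \<odot>\<^bsub>V\<^esub> x)"

definition left_op :: "('k, 'a, 'm) triple_system_scheme \<Rightarrow> 'a \<Rightarrow> 'a \<Rightarrow> 'a \<Rightarrow> 'a" where
  "left_op R x y = (\<lambda>z\<in>carrier R. triple R x y z)"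

definition middle_op :: "('k, 'a, 'm) triple_system_scheme \<Rightarrow> 'a \<Rightarrow> 'a \<Rightarrow> 'a \<Rightarrow> 'a" where
  "middle_op R x y = (\<lambda>z\<in>carrier R. triple R x z y)"

definition right_op :: "('k, 'a, 'm) triple_system_scheme \<Rightarrow> 'a \<Rightarrow> 'a \<Rightarrow> 'a \<Rightarrow> 'a" where
  "right_op R x y = (\<lambda>z\<in>carrier R. triple R z x y)"

inductive_set mult_algebra ::
    "('k, 'n) ring_scheme \<Rightarrow> ('k, 'a, 'm) triple_system_scheme \<Rightarrow> ('a \<Rightarrow> 'a) set"
  for K and R where
    left: "\<lbrakk>x \<in> carrier R; y \<in> carrier R\<rbrakk> \<Longrightarrow> left_op R x y \<in> mult_algebra K R"
  | middle: "\<lbrakk>x \<in> carrier R; y \<in> carrier R\<rbrakk> \<Longrightarrow> middle_op R x y \<in> mult_algebra K R"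
  | right: "\<lbrakk>x \<in> carrier R; y \<in> carrier R\<rbrakk> \<Longrightarrow> right_op R x y \<in> mult_algebra K R"
  | zero: "(\<lambda>x\<in>carrier R. \<zero>\<^bsub>R\<^esub>) \<in> mult_algebra K R"
  | add: "\<lbrakk>f \<in> mult_algebra K R; g \<in> mult_algebra K R\<rbrakk> \<Longrightarrow>
      (\<lambda>x\<in>carrier R. f x \<oplus>\<^bsub>R\<^esub> g x) \<in> mult_algebra K R"
  | smult: "\<lbrakk>k \<in> carrier K; f \<in> mult_algebra K R\<rbrakk> \<Longrightarrow>
      (\<lambda>x\<in>carrier R. k \<odot>\<^bsub>R\<^esub> f x) \<in> mult_algebra K R"
  | mult: "\<lbrakk>f \<in> mult_algebra K R; g \<in> mult_algebra K R\<rbrakk> \<Longrightarrow>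
      compose (carrier R) g f \<in> mult_algebra K R"

text \<open>
  \<open>M(R)' = K Id + M(R)\<close>.  Since it acts on the right, the product of \<open>f\<close> and \<open>g\<close> is \<open>f\<close> followed
  by \<open>g\<close>.
\<close>

definition unital_mult_ring ::
    "('k, 'n) ring_scheme \<Rightarrow> ('k, 'a, 'm) triple_system_scheme \<Rightarrow> ('a \<Rightarrow> 'a) ring" where
  "unital_mult_ring K R =
    (operator_ring R {\<lambda>x\<in>carrier R. scalar_operator R k x \<oplus>\<^bsub>R\<^esub> f x | k f.
        k \<in> carrier K \<and> f \<in> mult_algebra K R})
      \<lparr>mult := (\<lambda>f g. compose (carrier R) g f)\<rparr>"

definition operator_module :: "('k, 'a, 'm) triple_system_scheme \<Rightarrow> ('a \<Rightarrow> 'a, 'a) module" where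
  "operator_module R =
    \<lparr>carrier = carrier R, mult = mult R, one = one R, zero = zero R, add = add R,
     smult = (\<lambda>f x. f x)\<rparr>"

definition is_injective_hull_of ::
    "('k, 'n) ring_scheme \<Rightarrow> ('k, 'a, 'm) triple_system_scheme \<Rightarrow> ('a \<Rightarrow> 'a, 'a) module \<Rightarrow> bool" where
  "is_injective_hull_of K R E \<longleftrightarrow> injective_hull (unital_mult_ring K R) (operator_module R) E"

text \<open>The right \<open>M(R)'\<close>-module \<open>E\<close> as a \<open>K\<close>-module, \<open>k\<close> acting as \<open>k Id\<close>.\<close>

definition scalar_module ::
    "('k, 'a, 'm) triple_system_scheme \<Rightarrow> ('a \<Rightarrow> 'a, 'a) module \<Rightarrow> ('k, 'a) module" where
  "scalar_module R E =
    \<lparr>carrier = carrier E, mult = mult E, one = one E, zero = zero E, add = add E,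
     smult = (\<lambda>k x. scalar_operator R k \<odot>\<^bsub>E\<^esub> x)\<rparr>"

definition with_triple ::
    "('k, 'a) module \<Rightarrow> 'a set \<Rightarrow> ('a \<Rightarrow> 'a \<Rightarrow> 'a \<Rightarrow> 'a) \<Rightarrow> ('k, 'a) triple_system" where
  "with_triple V S t =
    \<lparr>carrier = S, mult = mult V, one = one V, zero = zero V, add = add V, smult = smult V,
     triple = t\<rparr>"


section \<open>The systems \<open>P(R)\<close> over \<open>CM(R)\<close> and over \<open>F\<close>\<close>

text \<open>In this section \<open>E\<close> is an injective hull of the right \<open>M(R)'\<close>-module \<open>R\<close>.\<close>

definition P_carrier ::
    "('k, 'n) ring_scheme \<Rightarrow> ('k, 'a, 'm) triple_system_scheme \<Rightarrow> ('a \<Rightarrow> 'a, 'a) module \<Rightarrow> 'a set" where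
  "P_carrier F R E = generate (add_monoid E)
     {f x | f x. f \<in> module_hom (unital_mult_ring F R) E E \<and> x \<in> carrier R}"

definition CM ::
    "('k, 'n) ring_scheme \<Rightarrow> ('k, 'a, 'm) triple_system_scheme \<Rightarrow> ('a \<Rightarrow> 'a, 'a) module \<Rightarrow> ('a \<Rightarrow> 'a) ring" where
  "CM F R E = (let P = E\<lparr>carrier := P_carrier F R E\<rparr>
     in operator_ring P (module_hom (unital_mult_ring F R) P P))"

definition P_module ::
    "('k, 'n) ring_scheme \<Rightarrow> ('k, 'a, 'm) triple_system_scheme \<Rightarrow> ('a \<Rightarrow> 'a, 'a) module \<Rightarrow> ('a \<Rightarrow> 'a, 'a) module" where
  "P_module F R E =
    \<lparr>carrier = P_carrier F R E, mult = mult E, one = one E, zero = zero E, add = add E,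
     smult = (\<lambda>\<alpha> x. \<alpha> x)\<rparr>"

text \<open>
  The described extension is unique because \<open>P(R) = CM(R)R\<close> and its values outside \<open>P(R)\<close> are fixed.
\<close>

definition P_triple ::
    "('k, 'n) ring_scheme \<Rightarrow> ('k, 'a, 'm) triple_system_scheme \<Rightarrow> ('a \<Rightarrow> 'a, 'a) module \<Rightarrow>
     'a \<Rightarrow> 'a \<Rightarrow> 'a \<Rightarrow> 'a" where
  "P_triple F R E = (THE t. trilinear (CM F R E) (P_module F R E) t \<and>
     (\<forall>x\<in>carrier R. \<forall>y\<in>carrier R. \<forall>z\<in>carrier R. t x y z = triple R x y z) \<and>
     (\<forall>x y z. \<not> (x \<in> P_carrier F R E \<and> y \<in> P_carrier F R E \<and> z \<in> P_carrier F R E) \<longrightarrow>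
        t x y z = undefined))"

definition P_over_CM ::
    "('k, 'n) ring_scheme \<Rightarrow> ('k, 'a, 'm) triple_system_scheme \<Rightarrow> ('a \<Rightarrow> 'a, 'a) module \<Rightarrow>
     ('a \<Rightarrow> 'a, 'a) triple_system" where
  "P_over_CM F R E = with_triple (P_module F R E) (P_carrier F R E) (P_triple F R E)"

definition P_over_base ::
    "('k, 'n) ring_scheme \<Rightarrow> ('k, 'a, 'm) triple_system_scheme \<Rightarrow> ('a \<Rightarrow> 'a, 'a) module \<Rightarrow>
     ('k, 'a) triple_system" where
  "P_over_base F R E = with_triple (scalar_module R E) (P_carrier F R E) (P_triple F R E)"

text \<open>
  \<open>Q\<close> is an \<open>M(P)'\<close>-submodule of the injective hull \<open>E\<close> of \<open>P\<close>, the operators \<open>{x,y,\<cdot>}\<close>, \<open>{x,\<cdot>,y}\<close>,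
  \<open>{\<cdot>,x,y}\<close> with \<open>x,y \<in> P\<close> acting on \<open>Q\<close> through the composition of \<open>Q\<close>.
\<close>

definition submodule_of_hull ::
    "('k, 'n) ring_scheme \<Rightarrow> ('k, 'a, 'm) triple_system_scheme \<Rightarrow> ('a \<Rightarrow> 'a, 'a) module \<Rightarrow>
     ('k, 'a, 'l) triple_system_scheme \<Rightarrow> bool" where
  "submodule_of_hull K P E Q \<longleftrightarrow>
    submodule (carrier Q) (unital_mult_ring K P) E \<and>
    (\<forall>p\<in>carrier Q. \<forall>q\<in>carrier Q. p \<oplus>\<^bsub>Q\<^esub> q = p \<oplus>\<^bsub>E\<^esub> q) \<and>
    (\<forall>k\<in>carrier K. \<forall>q\<in>carrier Q. k \<odot>\<^bsub>Q\<^esub> q = scalar_operator P k \<odot>\<^bsub>E\<^esub> q) \<and>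
    (\<forall>x\<in>carrier P. \<forall>y\<in>carrier P. \<forall>q\<in>carrier Q.
       triple Q x y q = left_op P x y \<odot>\<^bsub>E\<^esub> q \<and>
       triple Q x q y = middle_op P x y \<odot>\<^bsub>E\<^esub> q \<and>
       triple Q q x y = right_op P x y \<odot>\<^bsub>E\<^esub> q)"


section \<open>Idempotents and orthogonal completeness\<close>

definition idempotents :: "('k, 'n) ring_scheme \<Rightarrow> 'k set" where
  "idempotents C = {\<alpha> \<in> carrier C. \<alpha> \<otimes>\<^bsub>C\<^esub> \<alpha> = \<alpha>}"

definition dense_orthogonal :: "('k, 'n) ring_scheme \<Rightarrow> 'k set \<Rightarrow> bool" where
  "dense_orthogonal C \<Xi> \<longleftrightarrow> \<Xi> \<subseteq> idempotents C \<and>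
    {\<alpha> \<in> idempotents C. \<forall>\<xi>\<in>\<Xi>. \<alpha> \<otimes>\<^bsub>C\<^esub> \<xi> = \<zero>\<^bsub>C\<^esub>} = {\<zero>\<^bsub>C\<^esub>} \<and>
    (\<forall>\<xi>\<in>\<Xi>. \<forall>\<eta>\<in>\<Xi>. \<xi> \<noteq> \<eta> \<longrightarrow> \<xi> \<otimes>\<^bsub>C\<^esub> \<eta> = \<zero>\<^bsub>C\<^esub>)"

text \<open>\<open>x\<close> is the orthogonal sum \<open>\<Sum>\<^sup>\<bottom> \<xi> u\<^sub>\<xi>\<close>; families are indexed by the idempotents \<open>\<xi> \<in> \<Xi>\<close> themselves.\<close>

definition orthogonal_sum ::
    "('k, 'n) ring_scheme \<Rightarrow> ('k, 'a, 'm) module_scheme \<Rightarrow> 'a set \<Rightarrow> 'k set \<Rightarrow> ('k \<Rightarrow> 'a) \<Rightarrow> 'a \<Rightarrow> bool" where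
  "orthogonal_sum C V S \<Xi> u x \<longleftrightarrow> dense_orthogonal C \<Xi> \<and> u \<in> \<Xi> \<rightarrow> S \<and>
    (\<forall>\<xi>\<in>\<Xi>. \<xi> \<odot>\<^bsub>V\<^esub> x = \<xi> \<odot>\<^bsub>V\<^esub> u \<xi>)"

definition orthogonally_complete ::
    "('k, 'n) ring_scheme \<Rightarrow> ('k, 'a, 'm) module_scheme \<Rightarrow> 'a set \<Rightarrow> bool" where
  "orthogonally_complete C V S \<longleftrightarrow> S \<subseteq> carrier V \<and>
    (\<forall>\<Xi> u. dense_orthogonal C \<Xi> \<and> u \<in> \<Xi> \<rightarrow> S \<longrightarrow> (\<exists>x\<in>S. orthogonal_sum C V S \<Xi> u x))"

definition orthogonal_closure ::
    "('k, 'n) ring_scheme \<Rightarrow> ('k, 'a, 'm) module_scheme \<Rightarrow> 'a set \<Rightarrow> 'a set" where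
  "orthogonal_closure C V S = \<Inter>{T. orthogonally_complete C V T \<and> S \<subseteq> T}"

text \<open>
  \<open>{\<Sum>\<^sup>\<bottom> \<xi> u\<^sub>\<xi>, \<Sum>\<^sup>\<bottom> \<chi> v\<^sub>\<chi>, \<Sum>\<^sup>\<bottom> \<eta> w\<^sub>\<eta>} = \<Sum>\<^sup>\<bottom> \<xi>\<chi>\<eta> {u\<^sub>\<xi>, v\<^sub>\<chi>, w\<^sub>\<eta>}\<close>, for a system \<open>S\<close> contained in the module \<open>V\<close>.
\<close>

definition componentwise_triple ::
    "('k, 'n) ring_scheme \<Rightarrow> ('k, 'a, 'm) module_scheme \<Rightarrow> ('k, 'a, 'l) triple_system_scheme \<Rightarrow>
     'a \<Rightarrow> 'a \<Rightarrow> 'a \<Rightarrow> 'a" where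
  "componentwise_triple C V S x y z = (THE s. s \<in> orthogonal_closure C V (carrier S) \<and>
    (\<exists>\<Xi> u X v H w. orthogonal_sum C V (carrier S) \<Xi> u x \<and> orthogonal_sum C V (carrier S) X v y \<and>
       orthogonal_sum C V (carrier S) H w z \<and>
       (\<forall>\<xi>\<in>\<Xi>. \<forall>\<chi>\<in>X. \<forall>\<eta>\<in>H.
          (\<xi> \<otimes>\<^bsub>C\<^esub> \<chi> \<otimes>\<^bsub>C\<^esub> \<eta>) \<odot>\<^bsub>V\<^esub> s = (\<xi> \<otimes>\<^bsub>C\<^esub> \<chi> \<otimes>\<^bsub>C\<^esub> \<eta>) \<odot>\<^bsub>V\<^esub> triple S (u \<xi>) (v \<chi>) (w \<eta>))))"

text \<open>
  Componentwise addition and scalar multiplication are those of the ambient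
  module \<open>V\<close>, because scalars act linearly on \<open>V\<close>.
\<close>

definition orthogonal_completion ::
    "('k, 'n) ring_scheme \<Rightarrow> ('k, 'a) module \<Rightarrow> ('k, 'a, 'l) triple_system_scheme \<Rightarrow>
     ('k, 'a) triple_system" where
  "orthogonal_completion C V S =
    with_triple V (orthogonal_closure C V (carrier S)) (componentwise_triple C V S)"


section \<open>Localisation at an ultrafilter\<close>

definition is_ultrafilter :: "('k, 'n) ring_scheme \<Rightarrow> 'k set \<Rightarrow> bool" where
  "is_ultrafilter C B \<longleftrightarrow> B \<subseteq> idempotents C - {\<zero>\<^bsub>C\<^esub>} \<and>
    (\<forall>\<alpha>\<in>B. \<forall>\<beta>\<in>B. \<alpha> \<otimes>\<^bsub>C\<^esub> \<beta> \<in> B) \<and>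
    (\<forall>\<alpha>\<in>B. \<forall>\<beta>\<in>idempotents C. \<alpha> \<otimes>\<^bsub>C\<^esub> \<beta> = \<alpha> \<longrightarrow> \<beta> \<in> B) \<and>
    (\<forall>\<alpha>\<in>idempotents C. \<alpha> \<in> B \<or> \<one>\<^bsub>C\<^esub> \<ominus>\<^bsub>C\<^esub> \<alpha> \<in> B)"

definition local_kernel ::
    "('k, 'n) ring_scheme \<Rightarrow> 'k set \<Rightarrow> ('k, 'a, 'l) triple_system_scheme \<Rightarrow> 'a set" where
  "local_kernel C B S =
    carrier S \<inter> {\<alpha> \<odot>\<^bsub>S\<^esub> x | \<alpha> x. \<alpha> \<in> idempotents C - B \<and> x \<in> carrier S}"

definition localisation ::
    "('k, 'n) ring_scheme \<Rightarrow> 'k set \<Rightarrow> ('k, 'a, 'l) triple_system_scheme \<Rightarrow> ('k, 'a set) triple_system" where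
  "localisation C B S = (let N = local_kernel C B S in
    \<lparr>carrier = a_rcosets\<^bsub>S\<^esub> N, mult = undefined, one = undefined,
     zero = N, add = (\<lambda>X Y. X <+>\<^bsub>S\<^esub> Y),
     smult = (\<lambda>k X. \<Union>x\<in>X. N +>\<^bsub>S\<^esub> (k \<odot>\<^bsub>S\<^esub> x)),
     triple = (\<lambda>X Y Z. \<Union>x\<in>X. \<Union>y\<in>Y. \<Union>z\<in>Z. N +>\<^bsub>S\<^esub> triple S x y z)\<rparr>)"

text \<open>The map \<open>S\<^sub>B \<rightarrow> Q\<^sub>B\<close> induced by an inclusion of \<open>S\<close> in \<open>Q\<close>.\<close>

definition localised_inclusion ::
    "('k, 'n) ring_scheme \<Rightarrow> 'k set \<Rightarrow> ('k, 'a, 'l) triple_system_scheme \<Rightarrow> 'a set \<Rightarrow> 'a set" where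
  "localised_inclusion C B Q X = (\<Union>x\<in>X. local_kernel C B Q +>\<^bsub>Q\<^esub> x)"

end

theory Submission
  imports Defs
begin

text \<open>
  Write \<open>E\<close> for the hull of \<open>R\<close>.  Non-degeneracy makes an endomorphism of \<open>E\<close> that kills an essential ideal
  kill all of \<open>P(R)\<close>.  Hence endomorphisms commute on \<open>P(R)\<close> (they do so on all \<open>{n,r,n}\<close> with \<open>n\<close>
  in an essential ideal), the composition extends linearly from \<open>R\<close> to \<open>P(R)\<close>, and every element has a
  support idempotent: the projection onto the ideal it generates along the annihilator of that ideal.

  By support idempotents, elements of the hull of \<open>P\<close> are determined locally on dense sets of idempotents, and by
  Baer's criterion compatible local data can be glued.  So \<open>O(S)\<close> consists of the elements that are locally in
  \<open>S\<close>.  The composition of \<open>Q = Q\<^sub>m(P)\<close> extends to \<open>O(Q)\<close> locally and makes \<open>O(Q)\<close> a system of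
  \<open>\<MM>\<close>-quotients of \<open>P\<close>, whence \<open>O(Q) = Q\<close> by maximality.

  For the localisation at an ultrafilter, an ideal \<open>J\<close> of \<open>P\<close> is replaced by \<open>O(J)\<close>.  If an element is not locally
  zero, products witnessing that it does not annihilate \<open>J\<close> can be glued along an orthogonal family to
  three products, of which one is not zero in the localisation.
\<close>


section \<open>Elementwise description of systems of quotients\<close>

text \<open>The recurring obstacle is that a local statement supplies a different witness on every
  idempotent. For \<open>x\<close> in the completion of \<open>Q\<close> the ideals belonging to the
  pieces \<alpha>x vary with \<alpha>, and none of them need serve for \<open>x\<close>. The ideal
  used for \<open>x\<close> is therefore the largest submodule of \<open>P\<close> that
  \<open>x\<close> multiplies into \<open>P\<close>; it contains \<alpha>J for every ideal J
  belonging to \<alpha>x.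

  In the localisation the obstacle reappears in another form. An ultrafilter is closed under finite
  products only, whereas an element annihilating an ideal satisfies one condition for each pair of
  arguments, each with its own idempotent. All these conditions must be compressed into finitely
  many products, and the arguments of these products are glued elements, which leave J.

  Conditions on annihilators travel between systems because the elements annihilating a fixed ideal
  form a submodule of the hull: essentiality then lifts Ann I = 0 from the small system to every
  larger system inside the hull. Non-degeneracy enters as the statement that an ideal meets its own
  annihilator in zero.\<close>

context linear_triple_system
begin

lemma triple_closed [simp, intro]:
  "\<lbrakk>x \<in> carrier R; y \<in> carrier R; z \<in> carrier R\<rbrakk> \<Longrightarrow> triple R x y z \<in> carrier R"
  using trilinear_triple unfolding trilinear_def by blast

lemma triple_add:
  assumes "x \<in> carrier R" "x' \<in> carrier R" "y \<in> carrier R" "z \<in> carrier R"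
  shows "triple R (x \<oplus>\<^bsub>R\<^esub> x') y z = triple R x y z \<oplus>\<^bsub>R\<^esub> triple R x' y z"
    and "triple R y (x \<oplus>\<^bsub>R\<^esub> x') z = triple R y x z \<oplus>\<^bsub>R\<^esub> triple R y x' z"
    and "triple R y z (x \<oplus>\<^bsub>R\<^esub> x') = triple R y z x \<oplus>\<^bsub>R\<^esub> triple R y z x'"
  using trilinear_triple assms unfolding trilinear_def by blast+

lemma triple_smult:
  assumes "k \<in> carrier K" "x \<in> carrier R" "y \<in> carrier R" "z \<in> carrier R"
  shows "triple R (k \<odot>\<^bsub>R\<^esub> x) y z = k \<odot>\<^bsub>R\<^esub> triple R x y z"
    and "triple R x (k \<odot>\<^bsub>R\<^esub> y) z = k \<odot>\<^bsub>R\<^esub> triple R x y z"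
    and "triple R x y (k \<odot>\<^bsub>R\<^esub> z) = k \<odot>\<^bsub>R\<^esub> triple R x y z"
  using trilinear_triple assms unfolding trilinear_def by blast+

lemma triple_zero [simp]:
  assumes "y \<in> carrier R" "z \<in> carrier R"
  shows "triple R \<zero>\<^bsub>R\<^esub> y z = \<zero>\<^bsub>R\<^esub>"
    and "triple R y \<zero>\<^bsub>R\<^esub> z = \<zero>\<^bsub>R\<^esub>"
    and "triple R y z \<zero>\<^bsub>R\<^esub> = \<zero>\<^bsub>R\<^esub>"
  using triple_smult[of "\<zero>" "\<zero>\<^bsub>R\<^esub>" y z] triple_smult[of "\<zero>" y "\<zero>\<^bsub>R\<^esub>" z] triple_smult[of "\<zero>" y z "\<zero>\<^bsub>R\<^esub>"] assms
  by simp_all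

lemma triple_span_subset_iff:
  assumes S: "subgroup S (add_monoid R)"
  shows "triple_span R X Y Z \<subseteq> S \<longleftrightarrow> (\<forall>x\<in>X. \<forall>y\<in>Y. \<forall>z\<in>Z. triple R x y z \<in> S)"
proof
  assume sub: "triple_span R X Y Z \<subseteq> S"
  show "\<forall>x\<in>X. \<forall>y\<in>Y. \<forall>z\<in>Z. triple R x y z \<in> S"
  proof (intro ballI)
    fix x y z assume "x \<in> X" "y \<in> Y" "z \<in> Z"
    then have "triple R x y z \<in> triple_span R X Y Z"
      unfolding triple_span_def by (intro generate.incl) blast
    then show "triple R x y z \<in> S" using sub by blast
  qed
next
  assume "\<forall>x\<in>X. \<forall>y\<in>Y. \<forall>z\<in>Z. triple R x y z \<in> S"
  then show "triple_span R X Y Z \<subseteq> S"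
    unfolding triple_span_def
    by (intro group.generate_subgroup_incl[OF M.a_group _ S]) blast
qed

text \<open>Every span contains zero, so a sum of spans lies in a subgroup exactly when each summand
  does. Taking for \<open>S\<close> the zero subgroup or the image of the small system turns both
  conditions on quotients into statements about single products.\<close>

lemma span_sum_subset_iff:
  assumes "X \<union> Y \<union> Z \<union> X' \<union> Y' \<union> Z' \<union> X'' \<union> Y'' \<union> Z'' \<subseteq> carrier R" and S: "subgroup S (add_monoid R)"
  shows "triple_span R X Y Z <+>\<^bsub>R\<^esub> triple_span R X' Y' Z' <+>\<^bsub>R\<^esub> triple_span R X'' Y'' Z'' \<subseteq> S \<longleftrightarrow>
    (\<forall>x\<in>X. \<forall>y\<in>Y. \<forall>z\<in>Z. triple R x y z \<in> S) \<and>
    (\<forall>x\<in>X'. \<forall>y\<in>Y'. \<forall>z\<in>Z'. triple R x y z \<in> S) \<and>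
    (\<forall>x\<in>X''. \<forall>y\<in>Y''. \<forall>z\<in>Z''. triple R x y z \<in> S)"
proof -
  have span: "triple_span R X Y Z \<subseteq> S \<longleftrightarrow> (\<forall>x\<in>X. \<forall>y\<in>Y. \<forall>z\<in>Z. triple R x y z \<in> S)" for X Y Z
    using triple_span_subset_iff[OF S] .
  have carr: "triple_span R X Y Z \<subseteq> carrier R" if "X \<union> Y \<union> Z \<subseteq> carrier R" for X Y Z
    unfolding triple_span_def
    using group.generate_incl[OF M.a_group, of "{triple R x y z |x y z. x \<in> X \<and> y \<in> Y \<and> z \<in> Z}"] that by auto
  have zero: "\<zero>\<^bsub>R\<^esub> \<in> triple_span R X Y Z" for X Y Z
    unfolding triple_span_def using generate.one[of "add_monoid R"] by simp
  have add: "A <+>\<^bsub>R\<^esub> B \<subseteq> S \<longleftrightarrow> A \<subseteq> S \<and> B \<subseteq> S"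
    if A: "A \<subseteq> carrier R" "\<zero>\<^bsub>R\<^esub> \<in> A" and B: "B \<subseteq> carrier R" "\<zero>\<^bsub>R\<^esub> \<in> B" for A B
  proof
    assume sub: "A <+>\<^bsub>R\<^esub> B \<subseteq> S"
    have "a \<in> S" if "a \<in> A" for a
      using sub that A B(2) M.r_zero[of a] unfolding set_add_def' by (metis (no_types, lifting) UN_iff singletonI subsetD)
    moreover have "b \<in> S" if "b \<in> B" for b
      using sub that B A(2) M.l_zero[of b] unfolding set_add_def' by (metis (no_types, lifting) UN_iff singletonI subsetD)
    ultimately show "A \<subseteq> S \<and> B \<subseteq> S" by blast
  next
    assume "A \<subseteq> S \<and> B \<subseteq> S"
    then show "A <+>\<^bsub>R\<^esub> B \<subseteq> S"
      unfolding set_add_def' using subgroup.m_closed[OF S] by auto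
  qed
  have "\<zero>\<^bsub>R\<^esub> \<in> triple_span R X Y Z <+>\<^bsub>R\<^esub> triple_span R X' Y' Z'"
    unfolding set_add_def' using zero M.l_zero[OF M.zero_closed] by (auto intro!: bexI[OF _ zero])
  moreover have "triple_span R X Y Z <+>\<^bsub>R\<^esub> triple_span R X' Y' Z' \<subseteq> carrier R"
    using assms by (intro M.set_add_closed carr) auto
  ultimately show ?thesis
    using assms by (simp add: add carr zero span)
qed

lemma span_sum_eq_zero_iff:
  assumes "X \<union> Y \<union> Z \<union> X' \<union> Y' \<union> Z' \<union> X'' \<union> Y'' \<union> Z'' \<subseteq> carrier R"
  shows "triple_span R X Y Z <+>\<^bsub>R\<^esub> triple_span R X' Y' Z' <+>\<^bsub>R\<^esub> triple_span R X'' Y'' Z'' = {\<zero>\<^bsub>R\<^esub>} \<longleftrightarrow>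
    (\<forall>x\<in>X. \<forall>y\<in>Y. \<forall>z\<in>Z. triple R x y z = \<zero>\<^bsub>R\<^esub>) \<and>
    (\<forall>x\<in>X'. \<forall>y\<in>Y'. \<forall>z\<in>Z'. triple R x y z = \<zero>\<^bsub>R\<^esub>) \<and>
    (\<forall>x\<in>X''. \<forall>y\<in>Y''. \<forall>z\<in>Z''. triple R x y z = \<zero>\<^bsub>R\<^esub>)"
proof -
  have zero: "\<zero>\<^bsub>R\<^esub> \<in> triple_span R X Y Z" for X Y Z
    unfolding triple_span_def using generate.one[of "add_monoid R"] by simp
  have "\<zero>\<^bsub>R\<^esub> \<in> triple_span R X Y Z <+>\<^bsub>R\<^esub> triple_span R X' Y' Z' <+>\<^bsub>R\<^esub> triple_span R X'' Y'' Z''"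
    unfolding set_add_def' using zero
    by (auto intro!: bexI[of _ "\<zero>\<^bsub>R\<^esub>"])
  then show ?thesis
    using span_sum_subset_iff[OF assms, of "{\<zero>\<^bsub>R\<^esub>}"] group.triv_subgroup[OF M.a_group] by auto
qed

lemma triple_span_eq_zero_iff:
  assumes "X \<union> Y \<union> Z \<subseteq> carrier R"
  shows "triple_span R X Y Z = {\<zero>\<^bsub>R\<^esub>} \<longleftrightarrow> (\<forall>x\<in>X. \<forall>y\<in>Y. \<forall>z\<in>Z. triple R x y z = \<zero>\<^bsub>R\<^esub>)"
proof -
  have "\<zero>\<^bsub>R\<^esub> \<in> triple_span R X Y Z"
    unfolding triple_span_def using generate.one[of "add_monoid R"] by simp
  then show ?thesis
    using triple_span_subset_iff[OF group.triv_subgroup[OF M.a_group], of X Y Z] by auto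
qed

end

section \<open>Ideals, annihilators and absorption, product by product\<close>

definition ideal_of ::
    "('k, 'a, 'm) triple_system_scheme \<Rightarrow> 'a set \<Rightarrow> 'a set \<Rightarrow> bool" where
  "ideal_of Q S I \<longleftrightarrow> I \<subseteq> S \<and>
    (\<forall>i\<in>I. \<forall>s\<in>S. \<forall>s'\<in>S. triple Q i s s' \<in> I \<and> triple Q s i s' \<in> I \<and> triple Q s s' i \<in> I)"

text \<open>Of the six orders of \<open>q\<close>, an element of \<open>I\<close> and an element of
  \<open>S\<close> three are listed; \<open>triple_commute\<close> gives the other three. The system
  \<open>Q\<close> in which products are formed is kept apart from \<open>S\<close>, so that
  elements outside \<open>S\<close> can be tested against an ideal of \<open>S\<close>.\<close>

definition annihilates ::
    "('k, 'a, 'm) triple_system_scheme \<Rightarrow> 'a set \<Rightarrow> 'a set \<Rightarrow> 'a \<Rightarrow> bool" where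
  "annihilates Q S I q \<longleftrightarrow> (\<forall>i\<in>I. \<forall>s\<in>S.
    triple Q q s i = \<zero>\<^bsub>Q\<^esub> \<and> triple Q q i s = \<zero>\<^bsub>Q\<^esub> \<and> triple Q i q s = \<zero>\<^bsub>Q\<^esub>)"

definition absorbs ::
    "('k, 'a, 'm) triple_system_scheme \<Rightarrow> 'a set \<Rightarrow> 'a set \<Rightarrow> 'a \<Rightarrow> bool" where
  "absorbs Q S I q \<longleftrightarrow> (\<forall>i\<in>I. \<forall>s\<in>S.
    triple Q q s i \<in> S \<and> triple Q q i s \<in> S \<and> triple Q i q s \<in> S)"

lemma (in linear_triple_system) triple_ideal_iff:
  "triple_ideal K R I \<longleftrightarrow> submodule I K R \<and> ideal_of R (carrier R) I"
proof (cases "submodule I K R")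
  case True
  then interpret I: submodule I K R .
  have "I \<subseteq> carrier R" using submoduleE(1)[OF True] .
  then show ?thesis
    using True span_sum_subset_iff[OF _ I.subgroup_axioms, of I "carrier R" "carrier R" "carrier R" I "carrier R"
        "carrier R" "carrier R" I]
    unfolding triple_ideal_def ideal_of_def by auto
qed (simp add: triple_ideal_def)

lemma (in linear_triple_jordan) triple_annihilator_eq:
  assumes "I \<subseteq> carrier R"
  shows "triple_annihilator R I = {x \<in> carrier R. annihilates R (carrier R) I x}"
proof -
  have "triple_span R {x} (carrier R) I = {\<zero>\<^bsub>R\<^esub>} \<longleftrightarrow> (\<forall>i\<in>I. \<forall>s\<in>carrier R. triple R x s i = \<zero>\<^bsub>R\<^esub>)"
    "triple_span R {x} I (carrier R) = {\<zero>\<^bsub>R\<^esub>} \<longleftrightarrow> (\<forall>i\<in>I. \<forall>s\<in>carrier R. triple R x i s = \<zero>\<^bsub>R\<^esub>)"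
    "triple_span R (carrier R) {x} I = {\<zero>\<^bsub>R\<^esub>} \<longleftrightarrow> (\<forall>i\<in>I. \<forall>s\<in>carrier R. triple R i x s = \<zero>\<^bsub>R\<^esub>)"
    if x: "x \<in> carrier R" for x
  proof -
    have sub: "{x} \<union> carrier R \<union> I \<subseteq> carrier R" "{x} \<union> I \<union> carrier R \<subseteq> carrier R"
      "carrier R \<union> {x} \<union> I \<subseteq> carrier R"
      using assms x by auto
    \<comment> \<open>\<open>triple_annihilator\<close> has the element of the ideal in the last
      place, \<open>annihilates\<close> has it in the first.\<close>
    have "triple R i x s = triple R s x i" if "i \<in> I" "s \<in> carrier R" for i s
      using that assms x by (intro triple_commute) auto
    then show "triple_span R {x} (carrier R) I = {\<zero>\<^bsub>R\<^esub>} \<longleftrightarrow> (\<forall>i\<in>I. \<forall>s\<in>carrier R. triple R x s i = \<zero>\<^bsub>R\<^esub>)"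
      "triple_span R {x} I (carrier R) = {\<zero>\<^bsub>R\<^esub>} \<longleftrightarrow> (\<forall>i\<in>I. \<forall>s\<in>carrier R. triple R x i s = \<zero>\<^bsub>R\<^esub>)"
      "triple_span R (carrier R) {x} I = {\<zero>\<^bsub>R\<^esub>} \<longleftrightarrow> (\<forall>i\<in>I. \<forall>s\<in>carrier R. triple R i x s = \<zero>\<^bsub>R\<^esub>)"
      unfolding sub[THEN triple_span_eq_zero_iff] by auto
  qed
  then show ?thesis
    unfolding triple_annihilator_def annihilates_def by (intro Collect_cong conj_cong refl) auto
qed

section \<open>Embeddings and the transport of the Jordan identities\<close>

lemma embedding_zero:
  assumes "module K R" "module K Q" "triple_embedding K R Q \<iota>"
  shows "\<iota> \<zero>\<^bsub>R\<^esub> = \<zero>\<^bsub>Q\<^esub>"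
proof -
  interpret R: module K R by fact
  interpret Q: module K Q by fact
  have "\<iota> (\<zero>\<^bsub>K\<^esub> \<odot>\<^bsub>R\<^esub> \<zero>\<^bsub>R\<^esub>) = \<zero>\<^bsub>K\<^esub> \<odot>\<^bsub>Q\<^esub> \<iota> \<zero>\<^bsub>R\<^esub>" "\<iota> \<zero>\<^bsub>R\<^esub> \<in> carrier Q"
    using assms(3) R.R.zero_closed R.M.zero_closed unfolding triple_embedding_def by blast+
  then show ?thesis by simp
qed

text \<open>Solved for its first term, the identity says that D(x,y) = {x,y,.} acts as a derivation,
  except that the middle argument is moved by -D(y,x). In this orientation it serves as a rewrite
  rule.\<close>

lemma (in linear_triple_jordan) triple_derivation:
  assumes "x \<in> carrier R" "y \<in> carrier R" "a \<in> carrier R" "b \<in> carrier R" "c \<in> carrier R"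
  shows "triple R x y (triple R a b c) =
    triple R a b (triple R x y c) \<oplus>\<^bsub>R\<^esub> (triple R (triple R x y a) b c \<ominus>\<^bsub>R\<^esub> triple R a (triple R y x b) c)"
proof -
  have "u = v \<oplus>\<^bsub>R\<^esub> w" if "u \<ominus>\<^bsub>R\<^esub> v = w" "u \<in> carrier R" "v \<in> carrier R" for u v w
    using that M.add.inv_solve_right' M.minus_eq M.a_comm by (metis M.add.inv_closed M.add.inv_solve_right M.minus_closed)
  from this[OF triple_jordan[OF assms]] show ?thesis using assms by simp
qed

lemma linear_triple_jordanI:
  assumes "linear_triple_system K R"
    and comm: "\<And>x y z. \<lbrakk>x \<in> carrier R; y \<in> carrier R; z \<in> carrier R\<rbrakk> \<Longrightarrow> triple R x y z = triple R z y x"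
    and jordan: "\<And>x y a b c. \<lbrakk>x \<in> carrier R; y \<in> carrier R; a \<in> carrier R; b \<in> carrier R; c \<in> carrier R\<rbrakk> \<Longrightarrow>
      triple R x y (triple R a b c) =
      triple R a b (triple R x y c) \<oplus>\<^bsub>R\<^esub> (triple R (triple R x y a) b c \<ominus>\<^bsub>R\<^esub> triple R a (triple R y x b) c)"
  shows "linear_triple_jordan K R"
proof -
  interpret linear_triple_system K R by fact
  have [simp]: "(v \<oplus>\<^bsub>R\<^esub> w) \<ominus>\<^bsub>R\<^esub> v = w" if "w \<in> carrier R" "v \<in> carrier R" for v w
    using that by (metis M.a_comm M.add.inv_solve_right M.a_closed M.minus_eq)
  show ?thesis
  proof (unfold_locales, goal_cases)
    case (1 x y z)
    then show ?case by (rule comm)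
  next
    case (2 x y a b c)
    then show ?case by (subst jordan) simp_all
  qed
qed

text \<open>A system of quotients asks the Jordan identities of \<open>Q\<close> and only linearity
  of \<open>R\<close>; injectivity pulls the identities back to \<open>R\<close>.\<close>

lemma jordan_embedding:
  assumes "linear_triple_system K R" "linear_triple_jordan K Q" "triple_embedding K R Q \<iota>"
  shows "linear_triple_jordan K R"
proof -
  interpret R: linear_triple_system K R by fact
  interpret Q: linear_triple_jordan K Q by fact
  have add: "\<iota> (x \<oplus>\<^bsub>R\<^esub> y) = \<iota> x \<oplus>\<^bsub>Q\<^esub> \<iota> y" and inC: "\<iota> x \<in> carrier Q" if "x \<in> carrier R" "y \<in> carrier R" for x y
    using assms(3) that unfolding triple_embedding_def by blast+
  have trip: "\<iota> (triple R x y z) = triple Q (\<iota> x) (\<iota> y) (\<iota> z)"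
    if "x \<in> carrier R" "y \<in> carrier R" "z \<in> carrier R" for x y z
    using assms(3) that unfolding triple_embedding_def by blast
  have inj: "x = y" if "\<iota> x = \<iota> y" "x \<in> carrier R" "y \<in> carrier R" for x y
    using assms(3) that unfolding triple_embedding_def inj_on_def by blast
  have zero: "\<iota> \<zero>\<^bsub>R\<^esub> = \<zero>\<^bsub>Q\<^esub>"
    using embedding_zero[OF R.module_axioms Q.module_axioms assms(3)] .
  have neg: "\<iota> (\<ominus>\<^bsub>R\<^esub> x) = \<ominus>\<^bsub>Q\<^esub> \<iota> x" if "x \<in> carrier R" for x
    using add[of "\<ominus>\<^bsub>R\<^esub> x" x] that zero inC by (simp add: R.M.l_neg Q.M.minus_equality)
  show ?thesis
  proof (rule linear_triple_jordanI[OF assms(1)])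
    fix x y z assume "x \<in> carrier R" "y \<in> carrier R" "z \<in> carrier R"
    then show "triple R x y z = triple R z y x"
      by (intro inj) (simp_all add: trip inC Q.triple_commute[of "\<iota> x" "\<iota> y" "\<iota> z"])
  next
    fix x y a b c assume "x \<in> carrier R" "y \<in> carrier R" "a \<in> carrier R" "b \<in> carrier R" "c \<in> carrier R"
    then show "triple R x y (triple R a b c) =
      triple R a b (triple R x y c) \<oplus>\<^bsub>R\<^esub> (triple R (triple R x y a) b c \<ominus>\<^bsub>R\<^esub> triple R a (triple R y x b) c)"
      by (intro inj) (simp_all add: trip inC add neg R.M.minus_eq Q.M.minus_eq Q.triple_derivation[of "\<iota> x" "\<iota> y" "\<iota> a" "\<iota> b" "\<iota> c"])
  qed
qed

lemma embedding_image_subgroup: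
  assumes "module K R" "module K Q" and emb: "triple_embedding K R Q \<iota>"
  shows "subgroup (\<iota> ` carrier R) (add_monoid Q)"
proof -
  interpret R: module K R by fact
  interpret Q: module K Q by fact
  have im: "\<iota> ` carrier R \<subseteq> carrier Q" using emb unfolding triple_embedding_def by auto
  show ?thesis
  proof (rule group.subgroupI[OF Q.M.a_group])
    show "\<iota> ` carrier R \<subseteq> carrier (add_monoid Q)" using im by simp
    show "\<iota> ` carrier R \<noteq> {}" using R.M.zero_closed by blast
    fix a assume "a \<in> \<iota> ` carrier R"
    then obtain x where x: "x \<in> carrier R" "a = \<iota> x" by auto
    have "\<iota> (\<ominus>\<^bsub>R\<^esub> x) \<oplus>\<^bsub>Q\<^esub> \<iota> x = \<zero>\<^bsub>Q\<^esub>"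
      using x emb embedding_zero[OF assms] R.M.l_neg[of x]
      unfolding triple_embedding_def by (metis R.M.a_inv_closed)
    then have "\<ominus>\<^bsub>Q\<^esub> a = \<iota> (\<ominus>\<^bsub>R\<^esub> x)"
      using Q.M.minus_equality[of "\<iota> (\<ominus>\<^bsub>R\<^esub> x)" "\<iota> x"] x im by (auto simp: image_subset_iff)
    then show "inv\<^bsub>add_monoid Q\<^esub> a \<in> \<iota> ` carrier R" using x by (simp flip: a_inv_def)
  next
    fix a b assume "a \<in> \<iota> ` carrier R" "b \<in> \<iota> ` carrier R"
    then obtain x y where "x \<in> carrier R" "a = \<iota> x" "y \<in> carrier R" "b = \<iota> y" by auto
    moreover from this have "a \<oplus>\<^bsub>Q\<^esub> b = \<iota> (x \<oplus>\<^bsub>R\<^esub> y)" using emb unfolding triple_embedding_def by simp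
    ultimately show "a \<otimes>\<^bsub>add_monoid Q\<^esub> b \<in> \<iota> ` carrier R" by simp
  qed
qed

text \<open>Zero annihilates every ideal, so Ann I = 0 becomes an implication, and sums of spans are
  tested on their generating products. Every later proof that something is a system of quotients
  goes through this form.\<close>

lemma M_quotientsI:
  assumes Q: "linear_triple_jordan K Q" and R: "linear_triple_system K R" and emb: "triple_embedding K R Q \<iota>"
    and ex: "\<And>q. \<lbrakk>q \<in> carrier Q; q \<noteq> \<zero>\<^bsub>Q\<^esub>\<rbrakk> \<Longrightarrow> \<exists>I. submodule I K R \<and> ideal_of R (carrier R) I \<and>
      (\<forall>x\<in>carrier R. annihilates R (carrier R) I x \<longrightarrow> x = \<zero>\<^bsub>R\<^esub>) \<and>
      \<not> annihilates Q (\<iota> ` carrier R) (\<iota> ` I) q \<and> absorbs Q (\<iota> ` carrier R) (\<iota> ` I) q"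
  shows "M_quotients K R \<iota> Q"
proof -
  interpret R: linear_triple_jordan K R using jordan_embedding[OF R Q emb] .
  interpret Q: linear_triple_jordan K Q by fact
  have im: "\<iota> ` carrier R \<subseteq> carrier Q" using emb unfolding triple_embedding_def by auto
  have sub: "subgroup (\<iota> ` carrier R) (add_monoid Q)"
    using embedding_image_subgroup[OF R.module_axioms Q.module_axioms emb] .
  have "\<exists>I. triple_ideal K R I \<and> triple_annihilator R I = {\<zero>\<^bsub>R\<^esub>} \<and>
        (let T = triple_span Q {q} (\<iota> ` I) (\<iota> ` carrier R)
             <+>\<^bsub>Q\<^esub> triple_span Q {q} (\<iota> ` carrier R) (\<iota> ` I)
             <+>\<^bsub>Q\<^esub> triple_span Q (\<iota> ` I) {q} (\<iota> ` carrier R)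
         in T \<noteq> {\<zero>\<^bsub>Q\<^esub>} \<and> T \<subseteq> \<iota> ` carrier R)" if q: "q \<in> carrier Q" "q \<noteq> \<zero>\<^bsub>Q\<^esub>" for q
  proof -
    obtain I where I: "submodule I K R" "ideal_of R (carrier R) I"
      "\<forall>x\<in>carrier R. annihilates R (carrier R) I x \<longrightarrow> x = \<zero>\<^bsub>R\<^esub>"
      "\<not> annihilates Q (\<iota> ` carrier R) (\<iota> ` I) q" "absorbs Q (\<iota> ` carrier R) (\<iota> ` I) q"
      using ex[OF q] by blast
    have IR: "I \<subseteq> carrier R" using I(2) unfolding ideal_of_def by simp
    have z: "annihilates R (carrier R) I \<zero>\<^bsub>R\<^esub>"
      unfolding annihilates_def using IR by auto
    have carr: "{q} \<union> (\<iota> ` I) \<union> (\<iota> ` carrier R) \<union> {q} \<union> (\<iota> ` carrier R) \<union> (\<iota> ` I) \<union> (\<iota> ` I) \<union> {q} \<union> (\<iota> ` carrier R) \<subseteq> carrier Q"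
      using IR im q by auto
    show ?thesis
      using I z R.triple_annihilator_eq[OF IR] Q.span_sum_subset_iff[OF carr sub] Q.span_sum_eq_zero_iff[OF carr]
      unfolding Let_def R.triple_ideal_iff annihilates_def absorbs_def
      by (intro exI[of _ I]) auto
  qed
  then show ?thesis
    unfolding M_quotients_def using assms by blast
qed

lemma M_quotientsE:
  assumes "M_quotients K R \<iota> Q" and q: "q \<in> carrier Q" "q \<noteq> \<zero>\<^bsub>Q\<^esub>"
  obtains I where "submodule I K R" "ideal_of R (carrier R) I"
      "\<And>x. \<lbrakk>x \<in> carrier R; annihilates R (carrier R) I x\<rbrakk> \<Longrightarrow> x = \<zero>\<^bsub>R\<^esub>"
      "\<not> annihilates Q (\<iota> ` carrier R) (\<iota> ` I) q" "absorbs Q (\<iota> ` carrier R) (\<iota> ` I) q"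
proof -
  have Q: "linear_triple_jordan K Q" and R: "linear_triple_system K R" and emb: "triple_embedding K R Q \<iota>"
    using assms unfolding M_quotients_def by auto
  interpret R: linear_triple_jordan K R using jordan_embedding[OF R Q emb] .
  interpret Q: linear_triple_jordan K Q by fact
  obtain I where I: "triple_ideal K R I" "triple_annihilator R I = {\<zero>\<^bsub>R\<^esub>}"
    "triple_span Q {q} (\<iota> ` I) (\<iota> ` carrier R)
             <+>\<^bsub>Q\<^esub> triple_span Q {q} (\<iota> ` carrier R) (\<iota> ` I)
             <+>\<^bsub>Q\<^esub> triple_span Q (\<iota> ` I) {q} (\<iota> ` carrier R) \<noteq> {\<zero>\<^bsub>Q\<^esub>}"
    "triple_span Q {q} (\<iota> ` I) (\<iota> ` carrier R)
             <+>\<^bsub>Q\<^esub> triple_span Q {q} (\<iota> ` carrier R) (\<iota> ` I)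
             <+>\<^bsub>Q\<^esub> triple_span Q (\<iota> ` I) {q} (\<iota> ` carrier R) \<subseteq> \<iota> ` carrier R"
    using assms unfolding M_quotients_def Let_def by meson
  have im: "\<iota> ` carrier R \<subseteq> carrier Q" using emb unfolding triple_embedding_def by auto
  have Ii: "submodule I K R" "ideal_of R (carrier R) I"
    using I(1) unfolding R.triple_ideal_iff by auto
  then have IR: "I \<subseteq> carrier R" unfolding ideal_of_def by simp
  have carr: "{q} \<union> (\<iota> ` I) \<union> (\<iota> ` carrier R) \<union> {q} \<union> (\<iota> ` carrier R) \<union> (\<iota> ` I) \<union> (\<iota> ` I) \<union> {q} \<union> (\<iota> ` carrier R) \<subseteq> carrier Q"
    using IR im q by auto
  have sub: "subgroup (\<iota> ` carrier R) (add_monoid Q)"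
    using embedding_image_subgroup[OF R.module_axioms Q.module_axioms emb] .
  show ?thesis
  proof (rule that[OF Ii])
    show "x = \<zero>\<^bsub>R\<^esub>" if "x \<in> carrier R" "annihilates R (carrier R) I x" for x
      using I(2) that unfolding R.triple_annihilator_eq[OF IR] by blast
    show "\<not> annihilates Q (\<iota> ` carrier R) (\<iota> ` I) q"
      using I(3) unfolding Q.span_sum_eq_zero_iff[OF carr] annihilates_def by auto
    show "absorbs Q (\<iota> ` carrier R) (\<iota> ` I) q"
      using I(4) unfolding Q.span_sum_subset_iff[OF carr sub] absorbs_def by auto
  qed
qed

text \<open>
  By the derivation identity, \<open>D(i,c)\<close> and \<open>D(c,i)\<close> send products containing an annihilating
  element to zero, which settles all cases but one; that one follows from the identity
  applied to the commutator of two operators \<open>D\<close>.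
\<close>

lemma (in linear_triple_jordan) annihilates_triple:
  assumes S: "S \<subseteq> carrier R" and I: "ideal_of R S I" and x: "x \<in> carrier R" "annihilates R S I x"
    and ab: "a \<in> S" "b \<in> S"
  shows "annihilates R S I (triple R x a b)" and "annihilates R S I (triple R a x b)"
proof -
  have IS: "I \<subseteq> S" using I unfolding ideal_of_def by simp
  have C: "i \<in> I \<Longrightarrow> i \<in> carrier R" "i \<in> S \<Longrightarrow> i \<in> carrier R" for i using IS S by auto
  have id: "i \<in> I \<Longrightarrow> s \<in> S \<Longrightarrow> s' \<in> S \<Longrightarrow> triple R i s s' \<in> I"
    "i \<in> I \<Longrightarrow> s \<in> S \<Longrightarrow> s' \<in> S \<Longrightarrow> triple R s i s' \<in> I"
    "i \<in> I \<Longrightarrow> s \<in> S \<Longrightarrow> s' \<in> S \<Longrightarrow> triple R s s' i \<in> I" for i s s'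
    using I unfolding ideal_of_def by blast+
  have z: "i \<in> I \<Longrightarrow> s \<in> S \<Longrightarrow> triple R x s i = \<zero>\<^bsub>R\<^esub>" "i \<in> I \<Longrightarrow> s \<in> S \<Longrightarrow> triple R x i s = \<zero>\<^bsub>R\<^esub>"
    "i \<in> I \<Longrightarrow> s \<in> S \<Longrightarrow> triple R i x s = \<zero>\<^bsub>R\<^esub>" for i s
    using x(2) unfolding annihilates_def by blast+
  have z': "i \<in> I \<Longrightarrow> s \<in> S \<Longrightarrow> triple R i s x = \<zero>\<^bsub>R\<^esub>" "i \<in> I \<Longrightarrow> s \<in> S \<Longrightarrow> triple R s i x = \<zero>\<^bsub>R\<^esub>"
    "i \<in> I \<Longrightarrow> s \<in> S \<Longrightarrow> triple R s x i = \<zero>\<^bsub>R\<^esub>" for i s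
    using z triple_commute[of i s x] triple_commute[of s i x] triple_commute[of s x i] C x(1) by metis+
  note zz = z z' id C x(1) IS[THEN subsetD]
  have outer: "triple R (triple R x a b) s i = \<zero>\<^bsub>R\<^esub>" "triple R (triple R x a b) i s = \<zero>\<^bsub>R\<^esub>"
    "triple R (triple R a x b) s i = \<zero>\<^bsub>R\<^esub>" "triple R (triple R a x b) i s = \<zero>\<^bsub>R\<^esub>"
    if "i \<in> I" "s \<in> S" "a \<in> S" "b \<in> S" for i s a b
  proof -
    have "triple R i s (triple R x a b) = \<zero>\<^bsub>R\<^esub>" "triple R s i (triple R x a b) = \<zero>\<^bsub>R\<^esub>"
      "triple R i s (triple R a x b) = \<zero>\<^bsub>R\<^esub>" "triple R s i (triple R a x b) = \<zero>\<^bsub>R\<^esub>"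
      using that
      by (simp_all add: zz M.minus_eq triple_derivation[of i s x a b] triple_derivation[of s i x a b]
          triple_derivation[of i s a x b] triple_derivation[of s i a x b])
    then show "triple R (triple R x a b) s i = \<zero>\<^bsub>R\<^esub>" "triple R (triple R x a b) i s = \<zero>\<^bsub>R\<^esub>"
      "triple R (triple R a x b) s i = \<zero>\<^bsub>R\<^esub>" "triple R (triple R a x b) i s = \<zero>\<^bsub>R\<^esub>"
      using that by (simp_all add: triple_commute[of "triple R x a b"] triple_commute[of "triple R a x b"] zz)
  qed
  have minus_cancel: "w = \<zero>\<^bsub>R\<^esub>" if "\<ominus>\<^bsub>R\<^esub> \<zero>\<^bsub>R\<^esub> = \<ominus>\<^bsub>R\<^esub> w" "w \<in> carrier R" for w
    using that M.minus_minus M.zero_closed by metis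
  \<comment> \<open>In the identity for D(x,a) applied to {s,b,i} all other terms vanish: {s,b,i}
    lies in \<open>I\<close>, the inner product {x,a,i} is zero, and {x,a,s} is covered by
    \<open>outer\<close>. The case \<open>mid2\<close> exchanges D(x,a) for D(a,x).\<close>
  have mid1: "triple R s (triple R a x b) i = \<zero>\<^bsub>R\<^esub>" if "i \<in> I" "s \<in> S" "a \<in> S" "b \<in> S" for i s a b
  proof -
    have "triple R x a (triple R s b i) = \<zero>\<^bsub>R\<^esub>" "triple R s b (triple R x a i) = \<zero>\<^bsub>R\<^esub>"
      "triple R (triple R x a s) b i = \<zero>\<^bsub>R\<^esub>"
      using that outer by (simp_all add: zz)
    then show ?thesis
      using triple_jordan[of x a s b i] that by (intro minus_cancel) (simp_all add: zz M.minus_eq)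
  qed
  have mid2: "triple R s (triple R x a b) i = \<zero>\<^bsub>R\<^esub>" if "i \<in> I" "s \<in> S" "a \<in> S" "b \<in> S" for i s a b
  proof -
    have "triple R a x (triple R s b i) = \<zero>\<^bsub>R\<^esub>" "triple R s b (triple R a x i) = \<zero>\<^bsub>R\<^esub>"
      "triple R (triple R a x s) b i = \<zero>\<^bsub>R\<^esub>"
      using that outer by (simp_all add: zz)
    then show ?thesis
      using triple_jordan[of a x s b i] that by (intro minus_cancel) (simp_all add: zz M.minus_eq)
  qed
  show "annihilates R S I (triple R x a b)" and "annihilates R S I (triple R a x b)"
    unfolding annihilates_def using outer ab mid1[of _ _ a b] mid2[of _ _ a b]
      triple_commute[of _ "triple R x a b"] triple_commute[of _ "triple R a x b"]
    by (auto simp: zz)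
qed

text \<open>The map \<pi> may identify elements. The lemma serves both the passage to the
  localisation, where \<pi> sends an element to its coset, and an injective recoding of a system in
  another type.\<close>

lemma triple_homomorphic_image:
  assumes S: "linear_triple_system K S"
    and im: "carrier T = \<pi> ` carrier S" and zero: "\<zero>\<^bsub>T\<^esub> = \<pi> \<zero>\<^bsub>S\<^esub>"
    and add: "\<And>x y. \<lbrakk>x \<in> carrier S; y \<in> carrier S\<rbrakk> \<Longrightarrow> \<pi> x \<oplus>\<^bsub>T\<^esub> \<pi> y = \<pi> (x \<oplus>\<^bsub>S\<^esub> y)"
    and smult: "\<And>k x. \<lbrakk>k \<in> carrier K; x \<in> carrier S\<rbrakk> \<Longrightarrow> k \<odot>\<^bsub>T\<^esub> \<pi> x = \<pi> (k \<odot>\<^bsub>S\<^esub> x)"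
    and trip: "\<And>x y z. \<lbrakk>x \<in> carrier S; y \<in> carrier S; z \<in> carrier S\<rbrakk> \<Longrightarrow>
      triple T (\<pi> x) (\<pi> y) (\<pi> z) = \<pi> (triple S x y z)"
  shows "linear_triple_system K T"
    and "linear_triple_jordan K S \<Longrightarrow> linear_triple_jordan K T"
proof -
  interpret S: linear_triple_system K S by fact
  have "abelian_group T"
  proof (rule abelian_groupI)
    fix x assume "x \<in> carrier T"
    then obtain s where "s \<in> carrier S" "x = \<pi> s" using im by auto
    then show "\<exists>y\<in>carrier T. y \<oplus>\<^bsub>T\<^esub> x = \<zero>\<^bsub>T\<^esub>"
      using im zero by (intro bexI[of _ "\<pi> (\<ominus>\<^bsub>S\<^esub> s)"]) (auto simp: add S.M.l_neg)
  qed (auto simp: im zero add S.M.a_ac)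
  moreover have "cring K" by unfold_locales
  ultimately have "module K T"
    by (intro moduleI)
      (auto simp: im add smult S.smult_l_distr S.smult_r_distr S.smult_assoc1)
  then interpret T: module K T .
  show T: "linear_triple_system K T"
    by unfold_locales (auto simp: trilinear_def im add smult trip S.triple_add S.triple_smult)
  have neg: "\<ominus>\<^bsub>T\<^esub> \<pi> x = \<pi> (\<ominus>\<^bsub>S\<^esub> x)" if "x \<in> carrier S" for x
    using that by (intro T.M.minus_equality) (simp_all add: add zero im S.M.l_neg)
  assume "linear_triple_jordan K S"
  then interpret J: linear_triple_jordan K S .
  show "linear_triple_jordan K T"
  proof (rule linear_triple_jordanI[OF T])
    fix x y z assume "x \<in> carrier T" "y \<in> carrier T" "z \<in> carrier T"
    then obtain u v w where *: "x = \<pi> u" "y = \<pi> v" "z = \<pi> w" "u \<in> carrier S" "v \<in> carrier S" "w \<in> carrier S"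
      using im by auto
    then show "triple T x y z = triple T z y x"
      using J.triple_commute[of u v w] by (simp add: trip)
  next
    fix x y a b c
    assume "x \<in> carrier T" "y \<in> carrier T" "a \<in> carrier T" "b \<in> carrier T" "c \<in> carrier T"
    then obtain u v p q r where *: "x = \<pi> u" "y = \<pi> v" "a = \<pi> p" "b = \<pi> q" "c = \<pi> r"
      "u \<in> carrier S" "v \<in> carrier S" "p \<in> carrier S" "q \<in> carrier S" "r \<in> carrier S"
      using im by (auto simp: image_iff)
    then show "triple T x y (triple T a b c) =
      triple T a b (triple T x y c) \<oplus>\<^bsub>T\<^esub> (triple T (triple T x y a) b c \<ominus>\<^bsub>T\<^esub> triple T a (triple T y x b) c)"
      using J.triple_derivation[of u v p q r] by (simp add: trip add neg S.M.minus_eq T.M.minus_eq)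
  qed
qed


section \<open>Injective hulls over the multiplication ring\<close>

lemma unital_mult_ring_simps:
  "a \<oplus>\<^bsub>unital_mult_ring K R\<^esub> b = (\<lambda>x\<in>carrier R. a x \<oplus>\<^bsub>R\<^esub> b x)"
  "a \<otimes>\<^bsub>unital_mult_ring K R\<^esub> b = compose (carrier R) b a"
  "\<one>\<^bsub>unital_mult_ring K R\<^esub> = (\<lambda>x\<in>carrier R. x)"
  "\<zero>\<^bsub>unital_mult_ring K R\<^esub> = (\<lambda>x\<in>carrier R. \<zero>\<^bsub>R\<^esub>)"
  by (simp_all add: unital_mult_ring_def operator_ring_def)

lemma scalar_module_simps [simp]:
  "carrier (scalar_module R E) = carrier E"
  "add (scalar_module R E) = add E"
  "\<zero>\<^bsub>scalar_module R E\<^esub> = \<zero>\<^bsub>E\<^esub>"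
  "k \<odot>\<^bsub>scalar_module R E\<^esub> x = scalar_operator R k \<odot>\<^bsub>E\<^esub> x"
  by (simp_all add: scalar_module_def)

lemma module_restrict:
  assumes "module K V" and W: "submodule W K V" and T: "carrier T = W" "add T = add V" "zero T = zero V" "smult T = smult V"
  shows "module K T"
proof -
  interpret V: module K V by fact
  note E = V.submoduleE[OF W]
  have "\<zero>\<^bsub>V\<^esub> \<in> W" using subgroup.one_closed[OF submodule.axioms(1)[OF W]] by simp
  moreover have W': "x \<in> W \<Longrightarrow> x \<in> carrier V" for x using E(1) by auto
  ultimately have "abelian_group T"
  proof (intro abelian_groupI)
    fix x assume "x \<in> carrier T"
    then show "\<exists>y\<in>carrier T. y \<oplus>\<^bsub>T\<^esub> x = \<zero>\<^bsub>T\<^esub>"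
      using E(3)[of x] W'[of x] V.M.l_neg[of x] by (auto simp: T)
  qed (auto simp: T W' E(5) V.M.a_ac)
  moreover have "cring K" by unfold_locales
  ultimately show ?thesis
    by (intro moduleI) (auto simp: T W' E(4) V.smult_l_distr V.smult_r_distr V.smult_assoc1)
qed

locale hulled_system = linear_triple_system K R
  for K :: "('k, 'n) ring_scheme" (structure)
    and R :: "('k, 'a, 'm) triple_system_scheme" (structure) +
  fixes E :: "('a \<Rightarrow> 'a, 'a) module"
  assumes hull: "is_injective_hull_of K R E"
begin

abbreviation mring :: "('a \<Rightarrow> 'a) ring" where "mring \<equiv> unital_mult_ring K R"

sublocale E: right_module "unital_mult_ring K R" E
  using hull unfolding is_injective_hull_of_def injective_hull_def injective_module_def by blast

lemma submodule_E: "submodule (carrier R) mring E"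
  and R_subset [simp, intro]: "x \<in> carrier R \<Longrightarrow> x \<in> carrier E"
  and R_add: "\<lbrakk>x \<in> carrier R; y \<in> carrier R\<rbrakk> \<Longrightarrow> x \<oplus>\<^bsub>E\<^esub> y = x \<oplus>\<^bsub>R\<^esub> y"
  and R_act: "\<lbrakk>a \<in> carrier mring; x \<in> carrier R\<rbrakk> \<Longrightarrow> a \<odot>\<^bsub>E\<^esub> x = a x"
proof -
  show 1: "submodule (carrier R) mring E"
    using hull unfolding is_injective_hull_of_def injective_hull_def operator_module_def by simp
  show "\<lbrakk>x \<in> carrier R; y \<in> carrier R\<rbrakk> \<Longrightarrow> x \<oplus>\<^bsub>E\<^esub> y = x \<oplus>\<^bsub>R\<^esub> y" "\<lbrakk>a \<in> carrier mring; x \<in> carrier R\<rbrakk> \<Longrightarrow> a \<odot>\<^bsub>E\<^esub> x = a x"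
    using hull unfolding is_injective_hull_of_def injective_hull_def operator_module_def by simp_all
  show "x \<in> carrier R \<Longrightarrow> x \<in> carrier E"
    using subgroup.subset[OF submodule.axioms(1)[OF 1]] by auto
qed

lemma R_zero: "\<zero>\<^bsub>E\<^esub> = \<zero>\<^bsub>R\<^esub>"
proof -
  have "\<zero>\<^bsub>E\<^esub> \<in> carrier R"
    using subgroup.one_closed[OF submodule.axioms(1)[OF submodule_E]] by simp
  moreover from this have "\<zero>\<^bsub>E\<^esub> \<oplus>\<^bsub>R\<^esub> \<zero>\<^bsub>E\<^esub> = \<zero>\<^bsub>E\<^esub>"
    using R_add[of "\<zero>\<^bsub>E\<^esub>" "\<zero>\<^bsub>E\<^esub>"] by simp
  ultimately show ?thesis by (metis M.add.r_cancel_one')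
qed

lemma mult_algebra_funcset: "f \<in> mult_algebra K R \<Longrightarrow> f \<in> carrier R \<rightarrow>\<^sub>E carrier R"
  by (induction rule: mult_algebra.induct)
    (auto simp: left_op_def middle_op_def right_op_def compose_def PiE_iff Pi_iff extensional_def)

lemma mult_algebra_smult:
  "\<lbrakk>f \<in> mult_algebra K R; k \<in> carrier K; x \<in> carrier R\<rbrakk> \<Longrightarrow> f (k \<odot>\<^bsub>R\<^esub> x) = k \<odot>\<^bsub>R\<^esub> f x"
proof (induction arbitrary: k x rule: mult_algebra.induct)
  case (add f g)
  then show ?case
    using PiE_mem[OF mult_algebra_funcset[OF add(1)]] PiE_mem[OF mult_algebra_funcset[OF add(2)]]
    by (simp add: smult_r_distr)
next
  case (smult l f)
  then show ?case
    using PiE_mem[OF mult_algebra_funcset[OF smult(2)]]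
    by (simp add: R.m_comm flip: smult_assoc1)
next
  case (mult f g)
  then show ?case
    using PiE_mem[OF mult_algebra_funcset[OF mult(1)]] PiE_mem[OF mult_algebra_funcset[OF mult(2)]]
    by (simp add: compose_def)
qed (simp_all add: left_op_def middle_op_def right_op_def triple_smult)

lemma mring_iff:
  "a \<in> carrier mring \<longleftrightarrow>
    (\<exists>k\<in>carrier K. \<exists>f\<in>mult_algebra K R. a = (\<lambda>x\<in>carrier R. k \<odot>\<^bsub>R\<^esub> x \<oplus>\<^bsub>R\<^esub> f x))"
proof -
  have "(\<lambda>x\<in>carrier R. scalar_operator R k x \<oplus>\<^bsub>R\<^esub> f x) = (\<lambda>x\<in>carrier R. k \<odot>\<^bsub>R\<^esub> x \<oplus>\<^bsub>R\<^esub> f x)" for k f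
    by (auto simp: scalar_operator_def restrict_def)
  then show ?thesis
    unfolding unital_mult_ring_def operator_ring_def by auto
qed

lemma mring_funcset: "a \<in> carrier mring \<Longrightarrow> a \<in> carrier R \<rightarrow>\<^sub>E carrier R"
  using mult_algebra_funcset unfolding mring_iff by (auto simp: PiE_iff Pi_iff)

lemma mring_smult:
  assumes "a \<in> carrier mring" "k \<in> carrier K" "x \<in> carrier R"
  shows "a (k \<odot>\<^bsub>R\<^esub> x) = k \<odot>\<^bsub>R\<^esub> a x"
proof -
  obtain l f where a: "l \<in> carrier K" "f \<in> mult_algebra K R" "a = (\<lambda>x\<in>carrier R. l \<odot>\<^bsub>R\<^esub> x \<oplus>\<^bsub>R\<^esub> f x)"
    using assms(1) unfolding mring_iff by blast
  have "f x \<in> carrier R" using mult_algebra_funcset[OF a(2)] assms(3) by (rule PiE_mem)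
  moreover have "l \<odot>\<^bsub>R\<^esub> (k \<odot>\<^bsub>R\<^esub> x) = k \<odot>\<^bsub>R\<^esub> (l \<odot>\<^bsub>R\<^esub> x)"
    using a(1) assms by (simp add: R.m_comm flip: smult_assoc1)
  ultimately show ?thesis
    using assms a by (simp add: mult_algebra_smult smult_r_distr)
qed

lemma mult_algebra_mring: "f \<in> mult_algebra K R \<Longrightarrow> f \<in> carrier mring"
proof -
  assume f: "f \<in> mult_algebra K R"
  have "f = (\<lambda>x\<in>carrier R. \<zero> \<odot>\<^bsub>R\<^esub> x \<oplus>\<^bsub>R\<^esub> f x)"
    using mult_algebra_funcset[OF f] by (intro ext) (auto simp: PiE_iff extensional_def)
  then show ?thesis unfolding mring_iff using f by blast
qed

lemma scalar_mring [simp]: "k \<in> carrier K \<Longrightarrow> scalar_operator R k \<in> carrier mring"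
proof -
  assume k: "k \<in> carrier K"
  have "scalar_operator R k = (\<lambda>x\<in>carrier R. k \<odot>\<^bsub>R\<^esub> x \<oplus>\<^bsub>R\<^esub> (\<lambda>x\<in>carrier R. \<zero>\<^bsub>R\<^esub>) x)"
    using k by (intro ext) (auto simp: scalar_operator_def)
  then show ?thesis unfolding mring_iff using k mult_algebra.zero[of R K] by blast
qed

lemma op_mring [simp]:
  assumes "x \<in> carrier R" "y \<in> carrier R"
  shows "left_op R x y \<in> carrier mring" "middle_op R x y \<in> carrier mring" "right_op R x y \<in> carrier mring"
  using assms by (auto intro: mult_algebra_mring mult_algebra.intros)

lemma op_act:
  assumes "x \<in> carrier R" "y \<in> carrier R" "z \<in> carrier R"
  shows "left_op R x y \<odot>\<^bsub>E\<^esub> z = triple R x y z" "middle_op R x y \<odot>\<^bsub>E\<^esub> z = triple R x z y"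
    "right_op R x y \<odot>\<^bsub>E\<^esub> z = triple R z x y"
  using assms by (simp_all add: R_act) (simp_all add: left_op_def middle_op_def right_op_def)

lemma act_compose:
  "\<lbrakk>a \<in> carrier mring; b \<in> carrier mring; w \<in> carrier E\<rbrakk> \<Longrightarrow>
    compose (carrier R) b a \<odot>\<^bsub>E\<^esub> w = b \<odot>\<^bsub>E\<^esub> (a \<odot>\<^bsub>E\<^esub> w)"
  using E.act_mult[of a b w] by (simp add: unital_mult_ring_simps)

lemma act_zero_vector [simp]: "a \<in> carrier mring \<Longrightarrow> a \<odot>\<^bsub>E\<^esub> \<zero>\<^bsub>E\<^esub> = \<zero>\<^bsub>E\<^esub>"
  using E.act_add_vector[of a "\<zero>\<^bsub>E\<^esub>" "\<zero>\<^bsub>E\<^esub>"]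
    E.V.add.r_cancel_one'[of "a \<odot>\<^bsub>E\<^esub> \<zero>\<^bsub>E\<^esub>" "a \<odot>\<^bsub>E\<^esub> \<zero>\<^bsub>E\<^esub>"] E.act_closed[of a "\<zero>\<^bsub>E\<^esub>"] by simp

lemma act_zero_scalar [simp]: "w \<in> carrier E \<Longrightarrow> \<zero>\<^bsub>mring\<^esub> \<odot>\<^bsub>E\<^esub> w = \<zero>\<^bsub>E\<^esub>"
  using E.act_add_scalar[of "\<zero>\<^bsub>mring\<^esub>" "\<zero>\<^bsub>mring\<^esub>" w]
    E.V.add.r_cancel_one'[of "\<zero>\<^bsub>mring\<^esub> \<odot>\<^bsub>E\<^esub> w" "\<zero>\<^bsub>mring\<^esub> \<odot>\<^bsub>E\<^esub> w"] E.act_closed[of "\<zero>\<^bsub>mring\<^esub>" w] by simp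

lemma act_minus_vector: "\<lbrakk>a \<in> carrier mring; w \<in> carrier E\<rbrakk> \<Longrightarrow> a \<odot>\<^bsub>E\<^esub> (\<ominus>\<^bsub>E\<^esub> w) = \<ominus>\<^bsub>E\<^esub> (a \<odot>\<^bsub>E\<^esub> w)"
  using E.act_add_vector[of a "\<ominus>\<^bsub>E\<^esub> w" w] by (intro E.V.minus_equality[symmetric]) (simp_all add: E.V.l_neg E.act_closed)

text \<open>Multiplication operators are linear over \<open>K\<close>, so the scalar operators are
  central in \<open>mring\<close>. Hence scalars act on the hull by module endomorphisms.\<close>

lemma scalar_act_commute:
  assumes "k \<in> carrier K" "a \<in> carrier mring" "w \<in> carrier E"
  shows "scalar_operator R k \<odot>\<^bsub>E\<^esub> (a \<odot>\<^bsub>E\<^esub> w) = a \<odot>\<^bsub>E\<^esub> (scalar_operator R k \<odot>\<^bsub>E\<^esub> w)"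
proof -
  have "compose (carrier R) (scalar_operator R k) a = compose (carrier R) a (scalar_operator R k)"
    using PiE_mem[OF mring_funcset[OF assms(2)]] assms
    by (intro ext) (auto simp: compose_def scalar_operator_def mring_smult)
  then show ?thesis
    using assms by (metis act_compose scalar_mring)
qed

sublocale V: module K "scalar_module R E"
proof (rule moduleI)
  show "cring K" by unfold_locales
  show "abelian_group (scalar_module R E)"
    by (rule abelian_groupI) (auto simp: E.V.a_ac intro: E.V.l_neg exI bexI[of _ "\<ominus>\<^bsub>E\<^esub> _"])
  fix k l x y
  assume "k \<in> carrier K" and x: "x \<in> carrier (scalar_module R E)"
  then show "k \<odot>\<^bsub>scalar_module R E\<^esub> x \<in> carrier (scalar_module R E)"
    by (simp add: E.act_closed)
  show "k \<odot>\<^bsub>scalar_module R E\<^esub> (x \<oplus>\<^bsub>scalar_module R E\<^esub> y) =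
    k \<odot>\<^bsub>scalar_module R E\<^esub> x \<oplus>\<^bsub>scalar_module R E\<^esub> k \<odot>\<^bsub>scalar_module R E\<^esub> y"
    if "y \<in> carrier (scalar_module R E)"
    using that \<open>k \<in> carrier K\<close> x by (simp add: E.act_add_vector)
  assume "l \<in> carrier K"
  have "scalar_operator R (k \<oplus> l) = scalar_operator R k \<oplus>\<^bsub>mring\<^esub> scalar_operator R l"
    using \<open>k \<in> carrier K\<close> \<open>l \<in> carrier K\<close>
    by (auto simp: unital_mult_ring_simps scalar_operator_def restrict_def smult_l_distr)
  then show "(k \<oplus> l) \<odot>\<^bsub>scalar_module R E\<^esub> x =
    k \<odot>\<^bsub>scalar_module R E\<^esub> x \<oplus>\<^bsub>scalar_module R E\<^esub> l \<odot>\<^bsub>scalar_module R E\<^esub> x"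
    using \<open>k \<in> carrier K\<close> \<open>l \<in> carrier K\<close> x by (simp add: E.act_add_scalar)
  have "scalar_operator R (k \<otimes> l) = compose (carrier R) (scalar_operator R k) (scalar_operator R l)"
    using \<open>k \<in> carrier K\<close> \<open>l \<in> carrier K\<close>
    by (auto simp: compose_def scalar_operator_def restrict_def smult_assoc1)
  then show "(k \<otimes> l) \<odot>\<^bsub>scalar_module R E\<^esub> x = k \<odot>\<^bsub>scalar_module R E\<^esub> (l \<odot>\<^bsub>scalar_module R E\<^esub> x)"
    using \<open>k \<in> carrier K\<close> \<open>l \<in> carrier K\<close> x by (simp add: act_compose)
next
  fix x assume x: "x \<in> carrier (scalar_module R E)"
  have "scalar_operator R \<one> = \<one>\<^bsub>mring\<^esub>"
    by (auto simp: scalar_operator_def unital_mult_ring_simps restrict_def)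
  then show "\<one> \<odot>\<^bsub>scalar_module R E\<^esub> x = x"
    using x by (simp add: E.act_one)
qed

lemma R_smult: "\<lbrakk>k \<in> carrier K; x \<in> carrier R\<rbrakk> \<Longrightarrow> scalar_operator R k \<odot>\<^bsub>E\<^esub> x = k \<odot>\<^bsub>R\<^esub> x"
  by (simp add: R_act) (simp add: scalar_operator_def)

section \<open>Submodules of the hull and essentiality\<close>

lemma submodule_mringI:
  assumes W: "W \<subseteq> carrier E" "\<zero>\<^bsub>E\<^esub> \<in> W" and add: "\<And>v w. \<lbrakk>v \<in> W; w \<in> W\<rbrakk> \<Longrightarrow> v \<oplus>\<^bsub>E\<^esub> w \<in> W"
    and scalar: "\<And>k w. \<lbrakk>k \<in> carrier K; w \<in> W\<rbrakk> \<Longrightarrow> scalar_operator R k \<odot>\<^bsub>E\<^esub> w \<in> W"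
    and ops: "\<And>x y w. \<lbrakk>x \<in> carrier R; y \<in> carrier R; w \<in> W\<rbrakk> \<Longrightarrow> left_op R x y \<odot>\<^bsub>E\<^esub> w \<in> W"
      "\<And>x y w. \<lbrakk>x \<in> carrier R; y \<in> carrier R; w \<in> W\<rbrakk> \<Longrightarrow> middle_op R x y \<odot>\<^bsub>E\<^esub> w \<in> W"
      "\<And>x y w. \<lbrakk>x \<in> carrier R; y \<in> carrier R; w \<in> W\<rbrakk> \<Longrightarrow> right_op R x y \<odot>\<^bsub>E\<^esub> w \<in> W"
  shows "submodule W mring E"
proof -
  have sum: "(\<lambda>x\<in>carrier R. f x \<oplus>\<^bsub>R\<^esub> g x) \<odot>\<^bsub>E\<^esub> w = f \<odot>\<^bsub>E\<^esub> w \<oplus>\<^bsub>E\<^esub> g \<odot>\<^bsub>E\<^esub> w"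
    if "f \<in> carrier mring" "g \<in> carrier mring" "w \<in> carrier E" for f g w
    using E.act_add_scalar[OF that] by (simp add: unital_mult_ring_simps)
  have alg: "f \<odot>\<^bsub>E\<^esub> w \<in> W" if "f \<in> mult_algebra K R" "w \<in> W" for f w
    using that
  proof (induction arbitrary: w rule: mult_algebra.induct)
    case zero
    have "(\<lambda>x\<in>carrier R. \<zero>\<^bsub>R\<^esub>) = \<zero>\<^bsub>mring\<^esub>" by (simp add: unital_mult_ring_simps)
    then show ?case using zero W by (auto simp: subset_iff)
  next
    case (add f g)
    have "(\<lambda>x\<in>carrier R. f x \<oplus>\<^bsub>R\<^esub> g x) \<odot>\<^bsub>E\<^esub> w = f \<odot>\<^bsub>E\<^esub> w \<oplus>\<^bsub>E\<^esub> g \<odot>\<^bsub>E\<^esub> w"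
      using add W by (intro sum mult_algebra_mring) auto
    then show ?case using add assms(3) by metis
  next
    case (smult k f)
    have f: "f \<in> carrier R \<rightarrow>\<^sub>E carrier R" using mult_algebra_funcset[OF smult(2)] .
    have "(\<lambda>x\<in>carrier R. k \<odot>\<^bsub>R\<^esub> f x) = compose (carrier R) (scalar_operator R k) f"
      using PiE_mem[OF f] by (auto simp: compose_def scalar_operator_def)
    then show ?case
      using smult W scalar act_compose[of f "scalar_operator R k" w] mult_algebra_mring[OF smult(2)]
      by (auto simp: subset_iff)
  next
    case (mult f g)
    then show ?case
      using W act_compose[of f g w] mult_algebra_mring by (auto simp: subset_iff)
  qed (use ops in auto)
  have act: "a \<odot>\<^bsub>E\<^esub> w \<in> W" if a: "a \<in> carrier mring" and w: "w \<in> W" for a w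
  proof -
    obtain k f where kf: "k \<in> carrier K" "f \<in> mult_algebra K R" "a = (\<lambda>x\<in>carrier R. k \<odot>\<^bsub>R\<^esub> x \<oplus>\<^bsub>R\<^esub> f x)"
      using a unfolding mring_iff by blast
    have "a = (\<lambda>x\<in>carrier R. scalar_operator R k x \<oplus>\<^bsub>R\<^esub> f x)"
      unfolding kf(3) by (auto simp: scalar_operator_def restrict_def)
    then have "a \<odot>\<^bsub>E\<^esub> w = scalar_operator R k \<odot>\<^bsub>E\<^esub> w \<oplus>\<^bsub>E\<^esub> f \<odot>\<^bsub>E\<^esub> w"
      using sum[of "scalar_operator R k" f w] kf mult_algebra_mring w W by (auto simp: subset_iff)
    then show ?thesis using add scalar alg kf w by simp
  qed
  show ?thesis
  proof (intro submodule.intro submodule_axioms.intro act group.subgroupI[OF E.V.a_group])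
    fix w assume w: "w \<in> W"
    have "\<ominus>\<^bsub>E\<^esub> w = (\<ominus>\<^bsub>mring\<^esub> \<one>\<^bsub>mring\<^esub>) \<odot>\<^bsub>E\<^esub> w"
      using E.act_add_scalar[of "\<ominus>\<^bsub>mring\<^esub> \<one>\<^bsub>mring\<^esub>" "\<one>\<^bsub>mring\<^esub>" w] w W
      by (intro E.V.minus_equality) (auto simp: E.A.l_neg E.act_one E.act_closed subset_iff)
    then show "inv\<^bsub>add_monoid E\<^esub> w \<in> W"
      using act[of "\<ominus>\<^bsub>mring\<^esub> \<one>\<^bsub>mring\<^esub>" w] w by (simp flip: a_inv_def)
  qed (use W add in auto)
qed

lemma cyclic_submodule:
  assumes w: "w \<in> carrier E"
  shows "submodule {a \<odot>\<^bsub>E\<^esub> w | a. a \<in> carrier mring} mring E" (is "submodule ?W mring E")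
proof (intro submodule.intro submodule_axioms.intro group.subgroupI[OF E.V.a_group])
  show "?W \<noteq> {}" using E.A.one_closed by blast
  show "?W \<subseteq> carrier (add_monoid E)" using w by (auto simp: E.act_closed)
  fix v assume "v \<in> ?W"
  then obtain a where a: "a \<in> carrier mring" "v = a \<odot>\<^bsub>E\<^esub> w" by blast
  have "\<ominus>\<^bsub>E\<^esub> v = (\<ominus>\<^bsub>mring\<^esub> a) \<odot>\<^bsub>E\<^esub> w"
    using E.act_add_scalar[of "\<ominus>\<^bsub>mring\<^esub> a" a w] w a
    by (intro E.V.minus_equality) (auto simp: E.A.l_neg E.act_closed)
  then show "inv\<^bsub>add_monoid E\<^esub> v \<in> ?W"
    unfolding a_inv_def[symmetric] using a by auto
  show "b \<odot>\<^bsub>E\<^esub> v \<in> ?W" if "b \<in> carrier mring" for b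
  proof -
    have "b \<odot>\<^bsub>E\<^esub> v = (a \<otimes>\<^bsub>mring\<^esub> b) \<odot>\<^bsub>E\<^esub> w" "a \<otimes>\<^bsub>mring\<^esub> b \<in> carrier mring"
      using a that w E.act_mult[of a b w] by auto
    then show ?thesis by blast
  qed
  fix u assume "u \<in> ?W"
  then obtain b where b: "b \<in> carrier mring" "u = b \<odot>\<^bsub>E\<^esub> w" by blast
  show "v \<otimes>\<^bsub>add_monoid E\<^esub> u \<in> ?W"
  proof -
    have "v \<oplus>\<^bsub>E\<^esub> u = (a \<oplus>\<^bsub>mring\<^esub> b) \<odot>\<^bsub>E\<^esub> w" "a \<oplus>\<^bsub>mring\<^esub> b \<in> carrier mring"
      using a b w E.act_add_scalar[of a b w] by auto
    then show ?thesis by auto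
  qed
qed

lemma cyclic_generator: "w \<in> carrier E \<Longrightarrow> w \<in> {a \<odot>\<^bsub>E\<^esub> w | a. a \<in> carrier mring}"
  using E.act_one[of w] by (intro CollectI exI[of _ "\<one>\<^bsub>mring\<^esub>"]) simp

text \<open>Essentiality is applied to the cyclic submodule generated by \<open>w\<close>. In this
  elementwise form it moves a nonzero element of the hull into \<open>R\<close> by one
  operator.\<close>

lemma essential:
  assumes w: "w \<in> carrier E" "w \<noteq> \<zero>\<^bsub>E\<^esub>"
  obtains a where "a \<in> carrier mring" "a \<odot>\<^bsub>E\<^esub> w \<in> carrier R" "a \<odot>\<^bsub>E\<^esub> w \<noteq> \<zero>\<^bsub>E\<^esub>"
proof -
  let ?W = "{a \<odot>\<^bsub>E\<^esub> w | a. a \<in> carrier mring}"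
  note sub = cyclic_submodule[OF w(1)]
  have "?W \<noteq> {\<zero>\<^bsub>E\<^esub>}" using cyclic_generator[OF w(1)] w(2) by blast
  moreover have "W \<inter> carrier R \<noteq> {\<zero>\<^bsub>E\<^esub>}" if "submodule W mring E" "W \<noteq> {\<zero>\<^bsub>E\<^esub>}" for W
    using hull that unfolding is_injective_hull_of_def injective_hull_def operator_module_def by auto
  ultimately have "?W \<inter> carrier R \<noteq> {\<zero>\<^bsub>E\<^esub>}" using sub by blast
  moreover have "\<zero>\<^bsub>E\<^esub> \<in> ?W \<inter> carrier R"
    using subgroup.one_closed[OF submodule.axioms(1)[OF sub]] R_zero by simp
  ultimately show ?thesis using that by blast
qed

section \<open>Consequences of injectivity\<close>

lemma injective:
  fixes X :: "('a \<Rightarrow> 'a, 'a \<Rightarrow> 'a) module"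
  assumes "right_module mring X" "submodule W mring X" "f \<in> module_hom mring (X\<lparr>carrier := W\<rparr>) E"
  obtains g where "g \<in> module_hom mring X E" "\<And>w. w \<in> W \<Longrightarrow> g w = f w"
proof -
  have "injective_module mring E"
    using hull unfolding is_injective_hull_of_def injective_hull_def by blast
  then have "\<exists>g \<in> module_hom mring X E. \<forall>w\<in>W. g w = f w"
    using assms unfolding injective_module_def by simp
  then show ?thesis using that by blast
qed

text \<open>A homomorphism from a right ideal \<open>J\<close> to \<open>E\<close> extends to the
  regular module and is then determined by its value at 1; this value is \<open>w\<close>.\<close>

lemma baer:
  assumes J: "J \<subseteq> carrier mring" "\<zero>\<^bsub>mring\<^esub> \<in> J" "\<And>x y. \<lbrakk>x \<in> J; y \<in> J\<rbrakk> \<Longrightarrow> x \<oplus>\<^bsub>mring\<^esub> y \<in> J"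
      "\<And>x a. \<lbrakk>x \<in> J; a \<in> carrier mring\<rbrakk> \<Longrightarrow> x \<otimes>\<^bsub>mring\<^esub> a \<in> J"
    and f: "\<And>x. x \<in> J \<Longrightarrow> f x \<in> carrier E" "\<And>x y. \<lbrakk>x \<in> J; y \<in> J\<rbrakk> \<Longrightarrow> f (x \<oplus>\<^bsub>mring\<^esub> y) = f x \<oplus>\<^bsub>E\<^esub> f y"
      "\<And>x a. \<lbrakk>x \<in> J; a \<in> carrier mring\<rbrakk> \<Longrightarrow> f (x \<otimes>\<^bsub>mring\<^esub> a) = a \<odot>\<^bsub>E\<^esub> f x"
  obtains w where "w \<in> carrier E" "\<And>x. x \<in> J \<Longrightarrow> x \<odot>\<^bsub>E\<^esub> w = f x"
proof -
  \<comment> \<open>The regular right module: by the convention for right modules, the scalar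
    \<open>a\<close> acts on \<open>v\<close> as the product of \<open>v\<close> and
    \<open>a\<close> in this order.\<close>
  let ?X = "\<lparr>carrier = carrier mring, mult = mult mring, one = one mring, zero = zero mring,
    add = add mring, smult = (\<lambda>a v. v \<otimes>\<^bsub>mring\<^esub> a)\<rparr> :: ('a \<Rightarrow> 'a, 'a \<Rightarrow> 'a) module"
  have ab: "abelian_group ?X"
    by (rule abelian_groupI) (auto simp: E.A.a_ac intro: E.A.l_neg exI bexI[of _ "\<ominus>\<^bsub>mring\<^esub> _"])
  then interpret X: abelian_group ?X .
  have X: "right_module mring ?X"
    by (intro right_module.intro right_module_axioms.intro ab E.A.ring_axioms)
      (auto simp: E.A.r_distr E.A.l_distr E.A.m_assoc)
  have sub: "submodule J mring ?X"
  proof (intro submodule.intro submodule_axioms.intro group.subgroupI[OF X.a_group])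
    fix x assume x: "x \<in> J"
    have "\<ominus>\<^bsub>?X\<^esub> x = x \<otimes>\<^bsub>mring\<^esub> (\<ominus>\<^bsub>mring\<^esub> \<one>\<^bsub>mring\<^esub>)"
      using x J(1) by (intro X.minus_equality) (auto simp: E.A.r_minus E.A.l_neg)
    then show "inv\<^bsub>add_monoid ?X\<^esub> x \<in> J"
      unfolding a_inv_def[symmetric] using J(4)[OF x, of "\<ominus>\<^bsub>mring\<^esub> \<one>\<^bsub>mring\<^esub>"] by simp
  qed (use J in auto)
  have "restrict f J \<in> module_hom mring (?X\<lparr>carrier := J\<rparr>) E"
    unfolding module_hom_def using f J(3,4) by auto
  then obtain g where g: "g \<in> module_hom mring ?X E" "\<And>w. w \<in> J \<Longrightarrow> g w = restrict f J w"
    using injective[OF X sub] by blast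
  have "x \<odot>\<^bsub>E\<^esub> g \<one>\<^bsub>mring\<^esub> = f x" if "x \<in> J" for x
  proof -
    have "x \<in> carrier mring" using that J(1) by auto
    then have "g (\<one>\<^bsub>mring\<^esub> \<otimes>\<^bsub>mring\<^esub> x) = x \<odot>\<^bsub>E\<^esub> g \<one>\<^bsub>mring\<^esub>"
      using g(1) E.A.one_closed \<open>x \<in> carrier mring\<close> unfolding module_hom_def
      by (simp del: E.A.l_one E.A.r_one)
    then show ?thesis using g(2)[OF that] that \<open>x \<in> carrier mring\<close> by simp
  qed
  moreover have "g \<one>\<^bsub>mring\<^esub> \<in> carrier E" using g(1) unfolding module_hom_def by auto
  ultimately show ?thesis using that by blast
qed

text \<open>
  The test modules in \<^const>\<open>injective_module\<close> consist of operators, so \<open>E\<close> itself enters as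
  a test module through the constant functions.
\<close>

lemma extend_hom:
  assumes W: "submodule W mring E"
    and f: "\<And>x. x \<in> W \<Longrightarrow> f x \<in> carrier E" "\<And>x y. \<lbrakk>x \<in> W; y \<in> W\<rbrakk> \<Longrightarrow> f (x \<oplus>\<^bsub>E\<^esub> y) = f x \<oplus>\<^bsub>E\<^esub> f y"
      "\<And>x a. \<lbrakk>x \<in> W; a \<in> carrier mring\<rbrakk> \<Longrightarrow> f (a \<odot>\<^bsub>E\<^esub> x) = a \<odot>\<^bsub>E\<^esub> f x"
  obtains g where "g \<in> module_hom mring E E" "\<And>w. w \<in> W \<Longrightarrow> g w = f w"
proof -
  define c :: "'a \<Rightarrow> 'a \<Rightarrow> 'a" where "c x = (\<lambda>_. x)" for x
  \<comment> \<open>A constant function is recovered from its value at any point;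
    \<open>undefined\<close> is an arbitrary one.\<close>
  define d :: "('a \<Rightarrow> 'a) \<Rightarrow> 'a" where "d h = h undefined" for h
  have dc [simp]: "d (c x) = x" for x by (simp add: c_def d_def)
  have cinj [simp]: "c x = c y \<longleftrightarrow> x = y" for x y by (metis dc)
  let ?X = "\<lparr>carrier = c ` carrier E, mult = undefined, one = undefined, zero = c \<zero>\<^bsub>E\<^esub>,
    add = (\<lambda>v w. c (d v \<oplus>\<^bsub>E\<^esub> d w)), smult = (\<lambda>a v. c (a \<odot>\<^bsub>E\<^esub> d v))\<rparr> :: ('a \<Rightarrow> 'a, 'a \<Rightarrow> 'a) module"
  have ab: "abelian_group ?X"
    by (rule abelian_groupI) (auto simp: E.V.a_ac intro: E.V.l_neg exI bexI[of _ "\<ominus>\<^bsub>E\<^esub> _"])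
  then interpret X: abelian_group ?X .
  have X: "right_module mring ?X"
    by (intro right_module.intro right_module_axioms.intro ab E.A.ring_axioms)
      (auto simp: E.act_closed E.act_add_scalar E.act_add_vector E.act_mult E.act_one)
  have WE: "x \<in> W \<Longrightarrow> x \<in> carrier E" for x
    using subgroup.subset[OF submodule.axioms(1)[OF W]] by auto
  have Wc: "x \<oplus>\<^bsub>E\<^esub> y \<in> W" if "x \<in> W" "y \<in> W" for x y
    using subgroup.m_closed[OF submodule.axioms(1)[OF W] that] by simp
  have Wa: "a \<odot>\<^bsub>E\<^esub> x \<in> W" if "a \<in> carrier mring" "x \<in> W" for a x
    using submodule.smult_closed[OF W that] .
  have Wm: "\<ominus>\<^bsub>E\<^esub> x \<in> W" if "x \<in> W" for x
    using subgroup.m_inv_closed[OF submodule.axioms(1)[OF W] that] by (simp add: a_inv_def)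
  have sub: "submodule (c ` W) mring ?X"
  proof (intro submodule.intro submodule_axioms.intro group.subgroupI[OF X.a_group])
    fix v assume "v \<in> c ` W"
    then obtain x where x: "x \<in> W" "v = c x" by auto
    have "\<ominus>\<^bsub>?X\<^esub> v = c (\<ominus>\<^bsub>E\<^esub> x)"
      using x WE by (intro X.minus_equality) (auto simp: E.V.l_neg)
    then show "inv\<^bsub>add_monoid ?X\<^esub> v \<in> c ` W"
      unfolding a_inv_def[symmetric] using Wm[OF x(1)] by simp
  next
    show "c ` W \<noteq> {}"
      using subgroup.one_closed[OF submodule.axioms(1)[OF W]] by auto
  qed (use WE Wc Wa in auto)
  have "(\<lambda>v\<in>c ` W. f (d v)) \<in> module_hom mring (?X\<lparr>carrier := c ` W\<rparr>) E"
    unfolding module_hom_def using f Wc Wa by auto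
  then obtain g where g: "g \<in> module_hom mring ?X E" "\<And>w. w \<in> c ` W \<Longrightarrow> g w = (\<lambda>v\<in>c ` W. f (d v)) w"
    using injective[OF X sub] by blast
  have "(\<lambda>x\<in>carrier E. g (c x)) \<in> module_hom mring E E"
    using g(1) unfolding module_hom_def by (auto simp: E.act_closed)
  moreover have "(\<lambda>x\<in>carrier E. g (c x)) w = f w" if "w \<in> W" for w
    using that WE[OF that] g(2)[of "c w"] by auto
  ultimately show ?thesis using that by blast
qed

lemma submodule_of_hull_zero:
  assumes "submodule_of_hull K R E Q" and "abelian_group Q"
  shows "\<zero>\<^bsub>Q\<^esub> = \<zero>\<^bsub>E\<^esub>"
proof -
  interpret Q: abelian_group Q by fact
  have "\<zero>\<^bsub>Q\<^esub> \<oplus>\<^bsub>E\<^esub> \<zero>\<^bsub>Q\<^esub> = \<zero>\<^bsub>Q\<^esub>" "\<zero>\<^bsub>Q\<^esub> \<in> carrier E"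
    using assms(1) Q.zero_closed Q.l_zero[OF Q.zero_closed] subgroup.subset[of "carrier Q" "add_monoid E"]
    unfolding submodule_of_hull_def submodule_def by auto
  then show ?thesis by (metis E.V.add.r_cancel_one')
qed

lemma submodule_mringD:
  assumes "submodule W mring E"
  shows "W \<subseteq> carrier E" "\<zero>\<^bsub>E\<^esub> \<in> W" "\<And>v w. \<lbrakk>v \<in> W; w \<in> W\<rbrakk> \<Longrightarrow> v \<oplus>\<^bsub>E\<^esub> w \<in> W"
    "\<And>a w. \<lbrakk>a \<in> carrier mring; w \<in> W\<rbrakk> \<Longrightarrow> a \<odot>\<^bsub>E\<^esub> w \<in> W" "\<And>w. w \<in> W \<Longrightarrow> \<ominus>\<^bsub>E\<^esub> w \<in> W"
  using subgroup.subset[OF submodule.axioms(1)[OF assms]] subgroup.one_closed[OF submodule.axioms(1)[OF assms]]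
    subgroup.m_closed[OF submodule.axioms(1)[OF assms]] submodule.smult_closed[OF assms]
    subgroup.m_inv_closed[OF submodule.axioms(1)[OF assms]] by (auto simp: a_inv_def)

lemma scalar_module_minus: "x \<in> carrier E \<Longrightarrow> \<ominus>\<^bsub>scalar_module R E\<^esub> x = \<ominus>\<^bsub>E\<^esub> x"
  by (rule V.M.minus_equality) (simp_all add: E.V.l_neg)

section \<open>Ideals of the system as submodules of the hull\<close>

lemma submodule_scalar:
  assumes "submodule W mring E"
  shows "submodule W K (scalar_module R E)"
  using submodule_mringD[OF assms]
  by (intro V.submoduleI) (auto simp: scalar_module_minus subset_iff)

lemma submodule_ideal_of:
  assumes "submodule L mring E" "L \<subseteq> carrier R"
  shows "ideal_of R (carrier R) L"
  unfolding ideal_of_def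
proof (intro conjI ballI assms(2))
  fix i s s' assume i: "i \<in> L" "s \<in> carrier R" "s' \<in> carrier R"
  then have "i \<in> carrier R" using assms(2) by auto
  then show "triple R i s s' \<in> L" "triple R s i s' \<in> L" "triple R s s' i \<in> L"
    using submodule_mringD(4)[OF assms(1) op_mring(1) i(1)] submodule_mringD(4)[OF assms(1) op_mring(2) i(1)]
      submodule_mringD(4)[OF assms(1) op_mring(3) i(1)] i op_act by metis+
qed

lemma submodule_base:
  assumes L: "submodule L mring E" "L \<subseteq> carrier R"
  shows "submodule L K R"
proof (rule submoduleI)
  note Ls = submodule_mringD[OF L(1)]
  show "L \<subseteq> carrier R" by fact
  show "\<zero>\<^bsub>R\<^esub> \<in> L" using Ls(2) R_zero by simp
  fix a assume a: "a \<in> L"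
  then have aR: "a \<in> carrier R" using L by auto
  have "\<ominus>\<^bsub>R\<^esub> a = \<ominus>\<^bsub>E\<^esub> a"
    using aR R_add[of "\<ominus>\<^bsub>R\<^esub> a" a] by (intro E.V.minus_equality[symmetric]) (auto simp: M.l_neg R_zero)
  then show "\<ominus>\<^bsub>R\<^esub> a \<in> L" using Ls(5)[OF a] by simp
  show "a \<oplus>\<^bsub>R\<^esub> b \<in> L" if "b \<in> L" for b
    using Ls(3)[OF a that] R_add[OF aR, of b] that L(2) by auto
  show "k \<odot>\<^bsub>R\<^esub> a \<in> L" if "k \<in> carrier K" for k
    using Ls(4)[OF scalar_mring[OF that] a] R_smult[OF that aR] by simp
qed

lemma ideal_submodule:
  assumes L: "submodule L K R" "ideal_of R (carrier R) L"
  shows "submodule L mring E"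
proof (rule submodule_mringI)
  note Ls = submoduleE[OF L(1)]
  have LR: "x \<in> carrier R" if "x \<in> L" for x using Ls(1) that by auto
  show "L \<subseteq> carrier E" using LR by auto
  show "\<zero>\<^bsub>E\<^esub> \<in> L" using subgroup.one_closed[OF submodule.axioms(1)[OF L(1)]] R_zero by simp
  fix w assume w: "w \<in> L"
  show "v \<oplus>\<^bsub>E\<^esub> w \<in> L" if "v \<in> L" for v using Ls(5)[OF that w] R_add[OF LR[OF that] LR[OF w]] by simp
  show "scalar_operator R k \<odot>\<^bsub>E\<^esub> w \<in> L" if "k \<in> carrier K" for k
    using Ls(4)[OF that w] R_smult[OF that LR[OF w]] by simp
  fix x y assume xy: "x \<in> carrier R" "y \<in> carrier R"
  then have "triple R x y w \<in> L" "triple R x w y \<in> L" "triple R w x y \<in> L"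
    using L(2) w unfolding ideal_of_def by blast+
  then show "left_op R x y \<odot>\<^bsub>E\<^esub> w \<in> L" "middle_op R x y \<odot>\<^bsub>E\<^esub> w \<in> L" "right_op R x y \<odot>\<^bsub>E\<^esub> w \<in> L"
    using op_act[OF xy LR[OF w]] by simp_all
qed

text \<open>By \<open>annihilates_triple\<close> the multiplication operators by elements of
  \<open>R\<close> preserve annihilation. Being a submodule of the hull, the set becomes accessible
  to essentiality of \<open>R\<close>.\<close>

lemma annihilator_submodule:
  assumes Q: "linear_triple_jordan K Q" and sub: "submodule_of_hull K R E Q"
    and emb: "triple_embedding K R Q (\<lambda>x. x)" and I: "ideal_of R (carrier R) I"
  shows "submodule {q \<in> carrier Q. annihilates Q (carrier R) I q} mring E"
proof -
  interpret Q: linear_triple_jordan K Q by fact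
  let ?W = "{q \<in> carrier Q. annihilates Q (carrier R) I q}"
  have z: "\<zero>\<^bsub>Q\<^esub> = \<zero>\<^bsub>E\<^esub>" using submodule_of_hull_zero[OF sub Q.M.abelian_group_axioms] .
  have RQ: "carrier R \<subseteq> carrier Q" and trip: "\<And>x y z. \<lbrakk>x \<in> carrier R; y \<in> carrier R; z \<in> carrier R\<rbrakk> \<Longrightarrow>
    triple R x y z = triple Q x y z"
    using emb unfolding triple_embedding_def by auto
  have IR: "I \<subseteq> carrier R" using I unfolding ideal_of_def by simp
  have IQ: "ideal_of Q (carrier R) I"
    using I IR unfolding ideal_of_def by (auto simp: subset_iff trip[symmetric])
  have sm: "submodule (carrier Q) mring E" using sub unfolding submodule_of_hull_def by simp
  have QE: "carrier Q \<subseteq> carrier E" using subgroup.subset[OF submodule.axioms(1)[OF sm]] by simp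
  show "submodule ?W mring E"
  proof (rule submodule_mringI)
    show "?W \<subseteq> carrier E" using QE by auto
    show "\<zero>\<^bsub>E\<^esub> \<in> ?W" using IR RQ unfolding annihilates_def z[symmetric] by (auto simp: subset_iff)
    fix v assume v: "v \<in> ?W"
    have Q1: "i \<in> I \<Longrightarrow> i \<in> carrier Q" "s \<in> carrier R \<Longrightarrow> s \<in> carrier Q" for i s using IR RQ by auto
    show "v \<oplus>\<^bsub>E\<^esub> w \<in> ?W" if "w \<in> ?W" for w
    proof -
      have "v \<oplus>\<^bsub>E\<^esub> w = v \<oplus>\<^bsub>Q\<^esub> w" using sub v that unfolding submodule_of_hull_def by simp
      then show ?thesis using v that Q1 unfolding annihilates_def by (auto simp: Q.triple_add)
    qed
    show "scalar_operator R k \<odot>\<^bsub>E\<^esub> v \<in> ?W" if "k \<in> carrier K" for k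
    proof -
      have "scalar_operator R k \<odot>\<^bsub>E\<^esub> v = k \<odot>\<^bsub>Q\<^esub> v" using sub v that unfolding submodule_of_hull_def by simp
      then show ?thesis using v that Q1 unfolding annihilates_def by (auto simp: Q.triple_smult)
    qed
    fix x y assume x: "x \<in> carrier R" and y: "y \<in> carrier R"
    \<comment> \<open>Symmetry of the composition brings \<open>v\<close> to the first or the middle
      place, the two positions treated in \<open>annihilates_triple\<close>.\<close>
    have eq: "left_op R x y \<odot>\<^bsub>E\<^esub> v = triple Q v y x" "middle_op R x y \<odot>\<^bsub>E\<^esub> v = triple Q x v y"
      "right_op R x y \<odot>\<^bsub>E\<^esub> v = triple Q v x y"
      using sub v x y Q1 Q.triple_commute[of x y v] unfolding submodule_of_hull_def by simp_all
    show "left_op R x y \<odot>\<^bsub>E\<^esub> v \<in> ?W" "middle_op R x y \<odot>\<^bsub>E\<^esub> v \<in> ?W" "right_op R x y \<odot>\<^bsub>E\<^esub> v \<in> ?W"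
      unfolding eq using Q.annihilates_triple[OF RQ IQ, of v] v x y Q1 by simp_all
  qed
qed

text \<open>Some operator moves a nonzero annihilating element of \<open>Q\<close> to a nonzero
  element of \<open>R\<close>, which still annihilates \<open>I\<close> and contradicts
  \<open>ann\<close>.\<close>

lemma annihilator_zero:
  assumes Q: "linear_triple_jordan K Q" and sub: "submodule_of_hull K R E Q"
    and emb: "triple_embedding K R Q (\<lambda>x. x)" and I: "ideal_of R (carrier R) I"
    and ann: "\<And>x. \<lbrakk>x \<in> carrier R; annihilates R (carrier R) I x\<rbrakk> \<Longrightarrow> x = \<zero>\<^bsub>R\<^esub>"
    and q: "q \<in> carrier Q" "annihilates Q (carrier R) I q"
  shows "q = \<zero>\<^bsub>E\<^esub>"
proof (rule ccontr)
  interpret Q: linear_triple_jordan K Q by fact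
  have z: "\<zero>\<^bsub>Q\<^esub> = \<zero>\<^bsub>E\<^esub>" using submodule_of_hull_zero[OF sub Q.M.abelian_group_axioms] .
  have trip: "triple R x y z = triple Q x y z" if "x \<in> carrier R" "y \<in> carrier R" "z \<in> carrier R" for x y z
    using emb that unfolding triple_embedding_def by auto
  have IR: "I \<subseteq> carrier R" using I unfolding ideal_of_def by simp
  note W = submodule_mringD[OF annihilator_submodule[OF Q sub emb I]]
  assume "q \<noteq> \<zero>\<^bsub>E\<^esub>"
  then obtain a where a: "a \<in> carrier mring" "a \<odot>\<^bsub>E\<^esub> q \<in> carrier R" "a \<odot>\<^bsub>E\<^esub> q \<noteq> \<zero>\<^bsub>E\<^esub>"
    using essential[of q] q W(1) by auto
  then have "annihilates Q (carrier R) I (a \<odot>\<^bsub>E\<^esub> q)" using W(4)[of a q] q by simp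
  then have "annihilates R (carrier R) I (a \<odot>\<^bsub>E\<^esub> q)"
    using trip a(2) IR z R_zero unfolding annihilates_def by (simp add: subset_iff)
  then show False using ann a R_zero by simp
qed

end


section \<open>Endomorphisms of the hull of a non-degenerate system\<close>

locale nondegenerate_hull = hulled_system K R E + linear_triple_jordan K R
  for K :: "('k, 'n) ring_scheme" (structure)
    and R :: "('k, 'a, 'm) triple_system_scheme" (structure)
    and E :: "('a \<Rightarrow> 'a, 'a) module" +
  assumes nondegenerate: "nondegenerate R"
begin

section \<open>Endomorphisms of the hull\<close>

abbreviation endo :: "('a \<Rightarrow> 'a) set" where "endo \<equiv> module_hom mring E E"

lemma endo_closed [simp, intro]: "\<lbrakk>f \<in> endo; x \<in> carrier E\<rbrakk> \<Longrightarrow> f x \<in> carrier E"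
  and endo_add: "\<lbrakk>f \<in> endo; x \<in> carrier E; y \<in> carrier E\<rbrakk> \<Longrightarrow> f (x \<oplus>\<^bsub>E\<^esub> y) = f x \<oplus>\<^bsub>E\<^esub> f y"
  and endo_act: "\<lbrakk>f \<in> endo; a \<in> carrier mring; x \<in> carrier E\<rbrakk> \<Longrightarrow> f (a \<odot>\<^bsub>E\<^esub> x) = a \<odot>\<^bsub>E\<^esub> f x"
  unfolding module_hom_def by auto

lemma endo_zero [simp]: "f \<in> endo \<Longrightarrow> f \<zero>\<^bsub>E\<^esub> = \<zero>\<^bsub>E\<^esub>"
  using endo_add[of f "\<zero>\<^bsub>E\<^esub>" "\<zero>\<^bsub>E\<^esub>"] E.V.add.r_cancel_one'[of "f \<zero>\<^bsub>E\<^esub>" "f \<zero>\<^bsub>E\<^esub>"] by simp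

lemma endo_minus: "\<lbrakk>f \<in> endo; x \<in> carrier E\<rbrakk> \<Longrightarrow> f (\<ominus>\<^bsub>E\<^esub> x) = \<ominus>\<^bsub>E\<^esub> f x"
  using endo_add[of f "\<ominus>\<^bsub>E\<^esub> x" x] by (intro E.V.minus_equality[symmetric]) (simp_all add: E.V.l_neg)

lemma endoI:
  assumes "\<And>x. x \<in> carrier E \<Longrightarrow> f x \<in> carrier E"
    and "\<And>x y. \<lbrakk>x \<in> carrier E; y \<in> carrier E\<rbrakk> \<Longrightarrow> f (x \<oplus>\<^bsub>E\<^esub> y) = f x \<oplus>\<^bsub>E\<^esub> f y"
    and "\<And>a x. \<lbrakk>a \<in> carrier mring; x \<in> carrier E\<rbrakk> \<Longrightarrow> f (a \<odot>\<^bsub>E\<^esub> x) = a \<odot>\<^bsub>E\<^esub> f x"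
  shows "(\<lambda>x\<in>carrier E. f x) \<in> endo"
  unfolding module_hom_def using assms by (auto simp: E.act_closed)

lemma endo_id: "(\<lambda>x\<in>carrier E. x) \<in> endo"
  unfolding module_hom_def by (auto simp: E.act_closed)

lemma endo_compose:
  assumes "f \<in> endo" "g \<in> endo" shows "(\<lambda>x\<in>carrier E. f (g x)) \<in> endo"
  using assms by (intro endoI) (simp_all add: endo_add endo_act)

text \<open>Equations between endomorphisms are proved below by showing that a difference kills an
  essential ideal.\<close>

lemma endo_diff:
  assumes f: "f \<in> endo" and g: "g \<in> endo" shows "(\<lambda>x\<in>carrier E. f x \<ominus>\<^bsub>E\<^esub> g x) \<in> endo"
proof -
  have "(f x \<oplus>\<^bsub>E\<^esub> f y) \<ominus>\<^bsub>E\<^esub> (g x \<oplus>\<^bsub>E\<^esub> g y) = (f x \<ominus>\<^bsub>E\<^esub> g x) \<oplus>\<^bsub>E\<^esub> (f y \<ominus>\<^bsub>E\<^esub> g y)"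
    if "x \<in> carrier E" "y \<in> carrier E" for x y
    using that f g by (simp add: E.V.minus_eq E.V.minus_add E.V.a_ac)
  moreover have "a \<odot>\<^bsub>E\<^esub> (f x \<ominus>\<^bsub>E\<^esub> g x) = a \<odot>\<^bsub>E\<^esub> f x \<ominus>\<^bsub>E\<^esub> a \<odot>\<^bsub>E\<^esub> g x"
    if "a \<in> carrier mring" "x \<in> carrier E" for a x
    using that f g by (simp add: E.V.minus_eq E.act_add_vector act_minus_vector)
  ultimately show ?thesis
    using f g by (intro endoI) (simp_all add: endo_add endo_act)
qed

lemma endo_scalar:
  assumes "k \<in> carrier K" shows "(\<lambda>x\<in>carrier E. scalar_operator R k \<odot>\<^bsub>E\<^esub> x) \<in> endo"
  using assms unfolding module_hom_def by (auto simp: E.act_closed E.act_add_vector scalar_act_commute)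

lemma diff_zero_iff:
  "\<lbrakk>x \<in> carrier E; y \<in> carrier E\<rbrakk> \<Longrightarrow> x \<ominus>\<^bsub>E\<^esub> y = \<zero>\<^bsub>E\<^esub> \<longleftrightarrow> x = y"
  using E.V.minus_equality[of x "\<ominus>\<^bsub>E\<^esub> y"] by (auto simp: E.V.minus_eq E.V.r_neg)

text \<open>Essential in the whole of \<open>E\<close>, not merely in \<open>R\<close>: preimages
  are taken under endomorphisms whose values on \<open>R\<close> may lie outside
  \<open>R\<close>.\<close>

definition essential_ideal :: "'a set \<Rightarrow> bool" where
  "essential_ideal L \<longleftrightarrow> submodule L mring E \<and> L \<subseteq> carrier R \<and>
    (\<forall>w\<in>carrier E. w \<noteq> \<zero>\<^bsub>E\<^esub> \<longrightarrow> (\<exists>a\<in>carrier mring. a \<odot>\<^bsub>E\<^esub> w \<in> L \<and> a \<odot>\<^bsub>E\<^esub> w \<noteq> \<zero>\<^bsub>E\<^esub>))"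

lemma essential_ideal_carrier: "essential_ideal (carrier R)"
  unfolding essential_ideal_def using submodule_E essential by blast

lemma submodule_preimage:
  assumes L: "submodule L mring E" and M: "submodule M mring E" and f: "f \<in> endo"
  shows "submodule {x \<in> L. f x \<in> M} mring E"
proof (intro submodule.intro submodule_axioms.intro group.subgroupI[OF E.V.a_group])
  note L = submodule_mringD[OF L] and M = submodule_mringD[OF M]
  show "{x \<in> L. f x \<in> M} \<noteq> {}" using L(2) M(2) f by auto
  show "inv\<^bsub>add_monoid E\<^esub> x \<in> {x \<in> L. f x \<in> M}" if "x \<in> {x \<in> L. f x \<in> M}" for x
    unfolding a_inv_def[symmetric] using that L(1,5) M(5) f by (auto simp: endo_minus subset_iff)
qed (use f submodule_mringD[OF L] submodule_mringD[OF M] in \<open>auto simp: endo_add endo_act subset_iff\<close>)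

text \<open>One operator moves \<open>w\<close> into \<open>L\<close>; if the image under
  \<open>f\<close> is not yet zero, a second one moves that image into \<open>M\<close>. The result
  is nonzero because its image under \<open>f\<close> is nonzero.\<close>

lemma essential_ideal_preimage:
  assumes L: "essential_ideal L" and M: "essential_ideal M" and f: "f \<in> endo"
  shows "essential_ideal {x \<in> L. f x \<in> M}"
proof -
  have subs: "submodule L mring E" "submodule M mring E"
    using L M unfolding essential_ideal_def by simp_all
  note Ls = submodule_mringD[OF subs(1)] and Ms = submodule_mringD[OF subs(2)]
  have "\<exists>a\<in>carrier mring. a \<odot>\<^bsub>E\<^esub> w \<in> {x \<in> L. f x \<in> M} \<and> a \<odot>\<^bsub>E\<^esub> w \<noteq> \<zero>\<^bsub>E\<^esub>"
    if w: "w \<in> carrier E" "w \<noteq> \<zero>\<^bsub>E\<^esub>" for w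
  proof -
    obtain a where a: "a \<in> carrier mring" "a \<odot>\<^bsub>E\<^esub> w \<in> L" "a \<odot>\<^bsub>E\<^esub> w \<noteq> \<zero>\<^bsub>E\<^esub>"
      using L w unfolding essential_ideal_def by blast
    show ?thesis
    proof (cases "f (a \<odot>\<^bsub>E\<^esub> w) = \<zero>\<^bsub>E\<^esub>")
      case True
      then show ?thesis using a Ms(2) by auto
    next
      case False
      then obtain b where b: "b \<in> carrier mring" "b \<odot>\<^bsub>E\<^esub> f (a \<odot>\<^bsub>E\<^esub> w) \<in> M" "b \<odot>\<^bsub>E\<^esub> f (a \<odot>\<^bsub>E\<^esub> w) \<noteq> \<zero>\<^bsub>E\<^esub>"
        using M f a w unfolding essential_ideal_def by (meson E.act_closed endo_closed)
      have eq: "(a \<otimes>\<^bsub>mring\<^esub> b) \<odot>\<^bsub>E\<^esub> w = b \<odot>\<^bsub>E\<^esub> (a \<odot>\<^bsub>E\<^esub> w)"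
        using E.act_mult[OF a(1) b(1) w(1)] .
      have "f (b \<odot>\<^bsub>E\<^esub> (a \<odot>\<^bsub>E\<^esub> w)) = b \<odot>\<^bsub>E\<^esub> f (a \<odot>\<^bsub>E\<^esub> w)"
        using f a b w by (simp add: endo_act E.act_closed)
      then show ?thesis
        using a b eq f Ls(4)[OF b(1) a(2)] by (intro bexI[of _ "a \<otimes>\<^bsub>mring\<^esub> b"]) auto
    qed
  qed
  then show ?thesis
    using L submodule_preimage[OF subs f] unfolding essential_ideal_def by blast
qed

lemma essential_ideal_Int:
  assumes L: "essential_ideal L" and M: "essential_ideal M"
  shows "essential_ideal (L \<inter> M)"
proof -
  have "L \<subseteq> carrier E" using L unfolding essential_ideal_def by auto
  then have "{x \<in> L. (\<lambda>x\<in>carrier E. x) x \<in> M} = L \<inter> M" by auto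
  then show ?thesis using essential_ideal_preimage[OF L M endo_id] by simp
qed

lemma submodule_of_hull_self: "submodule_of_hull K R E R"
  unfolding submodule_of_hull_def using submodule_E by (simp add: R_add R_smult op_act)

lemma triple_embedding_self: "triple_embedding K R R (\<lambda>x. x)"
  unfolding triple_embedding_def by simp

text \<open>Non-degeneracy would give a nonzero product {x,y,x}, in which the last factor is an
  element of \<open>I\<close>. Thus an ideal and its annihilator meet in zero.\<close>

lemma self_annihilating_zero:
  assumes "x \<in> I" "x \<in> carrier R" "annihilates R (carrier R) I x" shows "x = \<zero>\<^bsub>E\<^esub>"
  using nondegenerate assms unfolding nondegenerate_def annihilates_def R_zero by blast

text \<open>If \<open>y\<close> were nonzero, some operator would move it to a nonzero element of
  \<open>L\<close> that still annihilates \<open>L\<close>, against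
  \<open>self_annihilating_zero\<close>.\<close>

lemma essential_ideal_annihilator:
  assumes L: "essential_ideal L" and y: "y \<in> carrier R" "annihilates R (carrier R) L y"
  shows "y = \<zero>\<^bsub>E\<^esub>"
proof (rule ccontr)
  assume "y \<noteq> \<zero>\<^bsub>E\<^esub>"
  have LR: "submodule L mring E" "L \<subseteq> carrier R" using L unfolding essential_ideal_def by auto
  obtain a where a: "a \<in> carrier mring" "a \<odot>\<^bsub>E\<^esub> y \<in> L" "a \<odot>\<^bsub>E\<^esub> y \<noteq> \<zero>\<^bsub>E\<^esub>"
    using L y \<open>y \<noteq> \<zero>\<^bsub>E\<^esub>\<close> unfolding essential_ideal_def by blast
  have "annihilates R (carrier R) L (a \<odot>\<^bsub>E\<^esub> y)"
    using submodule_mringD(4)[OF annihilator_submodule[OF linear_triple_jordan_axioms submodule_of_hull_self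
        triple_embedding_self submodule_ideal_of[OF LR]] a(1), of y] y by simp
  then show False using self_annihilating_zero[of "a \<odot>\<^bsub>E\<^esub> y" L] a LR(2) by auto
qed

text \<open>Endomorphisms commute with all three kinds of multiplication operators and can therefore
  be moved onto any single argument. The condition that the moved argument stays in \<open>R\<close>
  makes the new product meaningful.\<close>

lemma endo_triple:
  assumes "f \<in> endo" "x \<in> carrier R" "y \<in> carrier R" "z \<in> carrier R"
  shows "f x \<in> carrier R \<Longrightarrow> f (triple R x y z) = triple R (f x) y z"
    "f y \<in> carrier R \<Longrightarrow> f (triple R x y z) = triple R x (f y) z"
    "f z \<in> carrier R \<Longrightarrow> f (triple R x y z) = triple R x y (f z)"
  using assms endo_act[of f "right_op R y z" x] endo_act[of f "middle_op R x z" y] endo_act[of f "left_op R x y" z]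
  by (simp_all add: op_act)

text \<open>
  If \<open>f\<close> kills an essential ideal \<open>L\<close>, then every value of \<open>f\<close> in \<open>R\<close> annihilates \<open>L\<close>.
\<close>

lemma endo_vanish_R:
  assumes f: "f \<in> endo" and L: "essential_ideal L" "\<And>x. x \<in> L \<Longrightarrow> f x = \<zero>\<^bsub>E\<^esub>" and r: "r \<in> carrier R"
  shows "f r = \<zero>\<^bsub>E\<^esub>"
proof (rule ccontr)
  assume "f r \<noteq> \<zero>\<^bsub>E\<^esub>"
  then obtain a where a: "a \<in> carrier mring" "a \<odot>\<^bsub>E\<^esub> f r \<in> carrier R" "a \<odot>\<^bsub>E\<^esub> f r \<noteq> \<zero>\<^bsub>E\<^esub>"
    using essential[of "f r"] f r by auto
  have LR: "L \<subseteq> carrier R" and id: "ideal_of R (carrier R) L"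
    using L submodule_ideal_of unfolding essential_ideal_def by auto
  define s where "s = a \<odot>\<^bsub>E\<^esub> r"
  have s: "s \<in> carrier R" "f s = a \<odot>\<^bsub>E\<^esub> f r"
    using submodule_mringD(4)[OF submodule_E a(1) r] f a(1) r by (simp_all add: s_def endo_act)
  then have fs: "f s \<in> carrier R" using a by simp
  have "annihilates R (carrier R) L (f s)"
    unfolding annihilates_def
  proof (intro ballI)
    fix i t assume i: "i \<in> L" "t \<in> carrier R"
    then have iR: "i \<in> carrier R" using LR by auto
    have "triple R s t i \<in> L" "triple R s i t \<in> L" "triple R i s t \<in> L"
      using i s id unfolding ideal_of_def by blast+
    then have "f (triple R s t i) = \<zero>\<^bsub>E\<^esub>" "f (triple R s i t) = \<zero>\<^bsub>E\<^esub>" "f (triple R i s t) = \<zero>\<^bsub>E\<^esub>"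
      using L(2) by blast+
    then show "triple R (f s) t i = \<zero>\<^bsub>R\<^esub> \<and> triple R (f s) i t = \<zero>\<^bsub>R\<^esub> \<and> triple R i (f s) t = \<zero>\<^bsub>R\<^esub>"
      using f s(1) fs i(2) iR by (simp add: endo_triple R_zero)
  qed
  then show False
    using essential_ideal_annihilator[OF L(1) fs] a(3) s(2) by simp
qed

section \<open>Generation of P(R) and endomorphisms on it\<close>

abbreviation P :: "'a set" where "P \<equiv> P_carrier K R E"

lemma P_subset [simp, intro]: "p \<in> P \<Longrightarrow> p \<in> carrier E"
  unfolding P_carrier_def
  using group.generate_in_carrier[OF E.V.a_group, of "{f x |f x. f \<in> endo \<and> x \<in> carrier R}" p] by auto

lemma P_incl: "\<lbrakk>f \<in> endo; r \<in> carrier R\<rbrakk> \<Longrightarrow> f r \<in> P"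
  unfolding P_carrier_def by (rule generate.incl) blast

lemma P_R [simp, intro]: "r \<in> carrier R \<Longrightarrow> r \<in> P"
  using P_incl[OF endo_id, of r] by simp

lemma P_add [simp, intro]: "\<lbrakk>p \<in> P; q \<in> P\<rbrakk> \<Longrightarrow> p \<oplus>\<^bsub>E\<^esub> q \<in> P"
  unfolding P_carrier_def using generate.eng[of p "add_monoid E" _ q] by simp

lemma P_zero [simp, intro]: "\<zero>\<^bsub>E\<^esub> \<in> P"
  unfolding R_zero by simp

text \<open>The inverses that \<open>generate\<close> adds call for no case of their own, since
  -f(r) = f(-r) and \<open>R\<close> is closed under negation.\<close>

lemma P_induct [consumes 1, case_names base add endo]:
  assumes p: "p \<in> P" and base: "\<And>r. r \<in> carrier R \<Longrightarrow> \<Phi> r"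
    and add: "\<And>p q. \<lbrakk>p \<in> P; q \<in> P; \<Phi> p; \<Phi> q\<rbrakk> \<Longrightarrow> \<Phi> (p \<oplus>\<^bsub>E\<^esub> q)"
    and endo: "\<And>f p. \<lbrakk>f \<in> endo; p \<in> P; \<Phi> p\<rbrakk> \<Longrightarrow> \<Phi> (f p)"
  shows "\<Phi> p"
  using p unfolding P_carrier_def
proof (induction rule: generate.induct)
  case one
  show ?case using base[of "\<zero>\<^bsub>R\<^esub>"] by (simp add: R_zero)
next
  case (incl h)
  then show ?case using base endo by blast
next
  case (inv h)
  then obtain f r where h: "f \<in> endo" "r \<in> carrier R" "h = f r" by blast
  have "\<ominus>\<^bsub>E\<^esub> r \<in> carrier R" using submodule_mringD(5)[OF submodule_E h(2)] .
  moreover have "inv\<^bsub>add_monoid E\<^esub> h = f (\<ominus>\<^bsub>E\<^esub> r)"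
    unfolding a_inv_def[symmetric] using h by (simp add: endo_minus)
  ultimately show ?case using base endo h(1) by auto
next
  case (eng p q)
  then show ?case using add[of p q] unfolding P_carrier_def by simp
qed

lemma P_endo [simp, intro]: "\<lbrakk>p \<in> P; f \<in> endo\<rbrakk> \<Longrightarrow> f p \<in> P"
proof (induction arbitrary: f rule: P_induct)
  case (endo g p)
  then show ?case using endo(3)[OF endo_compose[OF endo(4,1)]] by simp
qed (auto simp: endo_add P_incl)

lemma P_act [simp, intro]: "\<lbrakk>p \<in> P; a \<in> carrier mring\<rbrakk> \<Longrightarrow> a \<odot>\<^bsub>E\<^esub> p \<in> P"
proof (induction rule: P_induct)
  case (endo g p)
  then show ?case using P_endo[of "a \<odot>\<^bsub>E\<^esub> p" g] by (simp add: endo_act)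
qed (auto simp: E.act_add_vector submodule_mringD(4)[OF submodule_E])

lemma P_minus [simp, intro]: "p \<in> P \<Longrightarrow> \<ominus>\<^bsub>E\<^esub> p \<in> P"
proof (induction rule: P_induct)
  case (endo f p)
  then show ?case using P_endo[of "\<ominus>\<^bsub>E\<^esub> p" f] by (simp add: endo_minus)
qed (auto simp: E.V.minus_add submodule_mringD(5)[OF submodule_E])

lemma submodule_P: "submodule P mring E"
proof (intro submodule.intro submodule_axioms.intro group.subgroupI[OF E.V.a_group])
  show "inv\<^bsub>add_monoid E\<^esub> p \<in> P" if "p \<in> P" for p
    unfolding a_inv_def[symmetric] using that by simp
  show "P \<noteq> {}" using P_zero by blast
qed auto

text \<open>For p = g(p') the induction hypothesis is applied to the composite of \<open>f\<close>
  and \<open>g\<close>, which kills those x in \<open>L\<close> with g(x) in \<open>L\<close>. This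
  is again an essential ideal, so both \<open>f\<close> and \<open>L\<close> must vary in the
  induction.\<close>

lemma endo_vanish:
  assumes f: "f \<in> endo" and L: "essential_ideal L" "\<And>x. x \<in> L \<Longrightarrow> f x = \<zero>\<^bsub>E\<^esub>" and p: "p \<in> P"
  shows "f p = \<zero>\<^bsub>E\<^esub>"
  using p f L
proof (induction arbitrary: f L rule: P_induct)
  case (base r)
  then show ?case using endo_vanish_R by blast
next
  case (add p q)
  have "f p = \<zero>\<^bsub>E\<^esub>" using add(7) by (rule add(3)[OF add(5,6)])
  moreover have "f q = \<zero>\<^bsub>E\<^esub>" using add(7) by (rule add(4)[OF add(5,6)])
  ultimately show ?case using add(1,2,5) by (simp add: endo_add)
next
  case (endo g p)
  have sub: "x \<in> carrier E" if "x \<in> L" for x using endo(5) that unfolding essential_ideal_def by auto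
  have "(\<lambda>x\<in>carrier E. f (g x)) p = \<zero>\<^bsub>E\<^esub>"
    using endo by (intro endo(3)[OF endo_compose[OF endo(4,1)] essential_ideal_preimage[OF endo(5,5,1)]])
      (auto dest: sub)
  then show ?case using endo by simp
qed

text \<open>The zeros of the commutator \<open>d\<close> in \<open>R\<close> form a submodule. It is
  essential: every nonzero element of the hull has a nonzero multiple n in \<open>N\<close>,
  non-degeneracy gives a nonzero {n,r,n}, and \<open>d\<close> vanishes there.\<close>

lemma endo_commute:
  assumes f: "f \<in> endo" and g: "g \<in> endo" and p: "p \<in> P"
  shows "f (g p) = g (f p)"
proof -
  define d where "d = (\<lambda>x\<in>carrier E. (\<lambda>x\<in>carrier E. f (g x)) x \<ominus>\<^bsub>E\<^esub> (\<lambda>x\<in>carrier E. g (f x)) x)"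
  have d: "d \<in> endo" unfolding d_def using f g by (intro endo_diff endo_compose)
  have d0: "d x = \<zero>\<^bsub>E\<^esub> \<longleftrightarrow> f (g x) = g (f x)" if "x \<in> carrier E" for x
    using that f g by (simp add: d_def diff_zero_iff)
  define N where "N = {x \<in> carrier R. f x \<in> carrier R} \<inter> {x \<in> carrier R. g x \<in> carrier R}"
  have N: "essential_ideal N"
    unfolding N_def using f g essential_ideal_carrier by (intro essential_ideal_Int essential_ideal_preimage)
  let ?L = "{x \<in> carrier R. d x \<in> {\<zero>\<^bsub>E\<^esub>}}"
  have "submodule {\<zero>\<^bsub>E\<^esub>} mring E"
    by (intro submodule.intro submodule_axioms.intro group.triv_subgroup[OF E.V.a_group, simplified]) auto
  then have sub: "submodule ?L mring E" by (intro submodule_preimage submodule_E d)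
  have "\<exists>a\<in>carrier mring. a \<odot>\<^bsub>E\<^esub> w \<in> ?L \<and> a \<odot>\<^bsub>E\<^esub> w \<noteq> \<zero>\<^bsub>E\<^esub>" if w: "w \<in> carrier E" "w \<noteq> \<zero>\<^bsub>E\<^esub>" for w
  proof -
    obtain a where a: "a \<in> carrier mring" "a \<odot>\<^bsub>E\<^esub> w \<in> N" "a \<odot>\<^bsub>E\<^esub> w \<noteq> \<zero>\<^bsub>E\<^esub>"
      using N w unfolding essential_ideal_def by blast
    define n where "n = a \<odot>\<^bsub>E\<^esub> w"
    have n: "n \<in> carrier R" "f n \<in> carrier R" "g n \<in> carrier R" "n \<noteq> \<zero>\<^bsub>E\<^esub>"
      using a unfolding N_def n_def by auto
    then obtain r where r: "r \<in> carrier R" "triple R n r n \<noteq> \<zero>\<^bsub>R\<^esub>"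
      using nondegenerate R_zero unfolding nondegenerate_def by auto
    \<comment> \<open>The two maps are moved onto different occurrences of n, so that neither
      composite has to take n into \<open>R\<close>.\<close>
    have "f (g (triple R n r n)) = triple R (f n) r (g n)" "g (f (triple R n r n)) = triple R (f n) r (g n)"
      using n r f g by (simp_all add: endo_triple(3)[OF g] endo_triple(1)[OF f])
    then have "triple R n r n \<in> ?L" using n r d0[of "triple R n r n"] by simp
    moreover have "(a \<otimes>\<^bsub>mring\<^esub> left_op R n r) \<odot>\<^bsub>E\<^esub> w = triple R n r n"
      using a n r w by (simp add: E.act_mult flip: n_def) (simp add: op_act)
    ultimately show ?thesis
      using r(2) a(1) n r(1) by (intro bexI[of _ "a \<otimes>\<^bsub>mring\<^esub> left_op R n r"]) (auto simp: R_zero)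
  qed
  then have "essential_ideal ?L" using sub unfolding essential_ideal_def by blast
  then have "d p = \<zero>\<^bsub>E\<^esub>" using endo_vanish[OF d _ _ p] by auto
  then show ?thesis using d0 p by simp
qed

text \<open>
  For \<open>r \<in> R\<close> the ideal generated by \<open>r\<close> and its annihilator have an essential direct sum; the
  projection onto the former extends to the support idempotent of \<open>r\<close>.
\<close>

lemma support_R:
  assumes r: "r \<in> carrier R" "r \<noteq> \<zero>\<^bsub>E\<^esub>"
  obtains g where "g \<in> endo" "g r = r" "\<And>p. p \<in> P \<Longrightarrow> g (g p) = g p"
    "\<And>h p. \<lbrakk>h \<in> endo; h r = \<zero>\<^bsub>E\<^esub>; p \<in> P\<rbrakk> \<Longrightarrow> h (g p) = \<zero>\<^bsub>E\<^esub>"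
proof -
  \<comment> \<open>The ideal generated by \<open>r\<close>; \<open>N\<close> below is its
    annihilator in \<open>R\<close>.\<close>
  define M where "M = {a \<odot>\<^bsub>E\<^esub> r | a. a \<in> carrier mring}"
  have MR: "M \<subseteq> carrier R" unfolding M_def using submodule_mringD(4)[OF submodule_E] r by auto
  have M: "submodule M mring E" and rM: "r \<in> M"
    unfolding M_def using cyclic_submodule[of r] cyclic_generator[of r] r by simp_all
  define N where "N = {q \<in> carrier R. annihilates R (carrier R) M q}"
  have N: "submodule N mring E" unfolding N_def
    using annihilator_submodule[OF linear_triple_jordan_axioms submodule_of_hull_self
        triple_embedding_self submodule_ideal_of[OF M MR]] .
  note Ms = submodule_mringD[OF M] and Ns = submodule_mringD[OF N]
  have ME: "x \<in> carrier E" if "x \<in> M" for x using that Ms(1) by auto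
  have NE: "x \<in> carrier E" if "x \<in> N" for x using that Ns(1) by auto
  have disj: "x = \<zero>\<^bsub>E\<^esub>" if "x \<in> M" "x \<in> N" for x
    using that self_annihilating_zero[of x M] unfolding N_def by auto
  have uniq: "m = m'" if "m \<in> M" "m' \<in> M" "n \<in> N" "n' \<in> N" "m \<oplus>\<^bsub>E\<^esub> n = m' \<oplus>\<^bsub>E\<^esub> n'" for m m' n n'
  proof -
    note c = that(1,2)[THEN ME] that(3,4)[THEN NE]
    have "m \<ominus>\<^bsub>E\<^esub> m' = n' \<ominus>\<^bsub>E\<^esub> n"
    proof -
      have "m \<ominus>\<^bsub>E\<^esub> m' = (m \<oplus>\<^bsub>E\<^esub> n) \<oplus>\<^bsub>E\<^esub> (\<ominus>\<^bsub>E\<^esub> n \<oplus>\<^bsub>E\<^esub> \<ominus>\<^bsub>E\<^esub> m')"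
        using c by (simp add: E.V.a_assoc[symmetric] E.V.minus_eq) (simp add: E.V.a_assoc E.V.r_neg)
      also have "\<dots> = n' \<ominus>\<^bsub>E\<^esub> n" unfolding that(5)
        using c E.V.a_comm[of m' n'] E.V.a_comm[of "\<ominus>\<^bsub>E\<^esub> n" "\<ominus>\<^bsub>E\<^esub> m'"]
        by (simp add: E.V.minus_eq E.V.a_assoc) (simp add: E.V.a_assoc[symmetric] E.V.r_neg)
      finally show ?thesis .
    qed
    moreover have "m \<ominus>\<^bsub>E\<^esub> m' \<in> M" "n' \<ominus>\<^bsub>E\<^esub> n \<in> N"
      using that Ms Ns by (auto simp: E.V.minus_eq)
    ultimately have "m \<ominus>\<^bsub>E\<^esub> m' = \<zero>\<^bsub>E\<^esub>" using disj by metis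
    then show ?thesis using c diff_zero_iff by simp
  qed
  define W where "W = {m \<oplus>\<^bsub>E\<^esub> n | m n. m \<in> M \<and> n \<in> N}"
  have WI: "m \<oplus>\<^bsub>E\<^esub> n \<in> W" if "m \<in> M" "n \<in> N" for m n using that unfolding W_def by blast
  have WR: "W \<subseteq> carrier R" unfolding W_def using MR N_def submodule_mringD(3)[OF submodule_E] by auto
  have W: "submodule W mring E"
  proof (intro submodule.intro submodule_axioms.intro group.subgroupI[OF E.V.a_group])
    show "W \<noteq> {}" using WI Ms(2) Ns(2) by blast
    show "W \<subseteq> carrier (add_monoid E)" using WR by auto
    fix v assume "v \<in> W"
    then obtain m n where v: "m \<in> M" "n \<in> N" "v = m \<oplus>\<^bsub>E\<^esub> n" unfolding W_def by blast
    have "\<ominus>\<^bsub>E\<^esub> v = \<ominus>\<^bsub>E\<^esub> m \<oplus>\<^bsub>E\<^esub> \<ominus>\<^bsub>E\<^esub> n"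
      using v ME NE by (simp add: E.V.minus_add)
    then show "inv\<^bsub>add_monoid E\<^esub> v \<in> W"
      unfolding a_inv_def[symmetric] using v Ms(5) Ns(5) WI by auto
    show "b \<odot>\<^bsub>E\<^esub> v \<in> W" if "b \<in> carrier mring" for b
      using v that ME NE Ms(4) Ns(4) WI by (simp add: E.act_add_vector)
    fix u assume "u \<in> W"
    then obtain m' n' where u: "m' \<in> M" "n' \<in> N" "u = m' \<oplus>\<^bsub>E\<^esub> n'" unfolding W_def by blast
    have "v \<oplus>\<^bsub>E\<^esub> u = (m \<oplus>\<^bsub>E\<^esub> m') \<oplus>\<^bsub>E\<^esub> (n \<oplus>\<^bsub>E\<^esub> n')"
      using v u ME NE by (simp add: E.V.a_ac)
    then show "v \<otimes>\<^bsub>add_monoid E\<^esub> u \<in> W" using v u Ms(3) Ns(3) WI by auto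
  qed
  have ess: "essential_ideal W"
    unfolding essential_ideal_def
  proof (intro conjI W WR ballI impI)
    fix w assume w: "w \<in> carrier E" "w \<noteq> \<zero>\<^bsub>E\<^esub>"
    obtain a where a: "a \<in> carrier mring" "a \<odot>\<^bsub>E\<^esub> w \<in> carrier R" "a \<odot>\<^bsub>E\<^esub> w \<noteq> \<zero>\<^bsub>E\<^esub>"
      using essential[OF w] .
    define n where "n = a \<odot>\<^bsub>E\<^esub> w"
    have n: "n \<in> carrier R" "n \<noteq> \<zero>\<^bsub>E\<^esub>" using a n_def by auto
    show "\<exists>a\<in>carrier mring. a \<odot>\<^bsub>E\<^esub> w \<in> W \<and> a \<odot>\<^bsub>E\<^esub> w \<noteq> \<zero>\<^bsub>E\<^esub>"
    proof (cases "\<exists>b\<in>carrier mring. b \<odot>\<^bsub>E\<^esub> n \<in> M \<and> b \<odot>\<^bsub>E\<^esub> n \<noteq> \<zero>\<^bsub>E\<^esub>")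
      case True
      then obtain b where b: "b \<in> carrier mring" "b \<odot>\<^bsub>E\<^esub> n \<in> M" "b \<odot>\<^bsub>E\<^esub> n \<noteq> \<zero>\<^bsub>E\<^esub>" by blast
      moreover have "b \<odot>\<^bsub>E\<^esub> n \<in> W" using WI[OF b(2) Ns(2)] ME[OF b(2)] by simp
      moreover have "(a \<otimes>\<^bsub>mring\<^esub> b) \<odot>\<^bsub>E\<^esub> w = b \<odot>\<^bsub>E\<^esub> n"
        using E.act_mult[OF a(1) b(1) w(1)] n_def by simp
      ultimately show ?thesis using a(1) by (intro bexI[of _ "a \<otimes>\<^bsub>mring\<^esub> b"]) auto
    next
      case False
      have z: "b \<odot>\<^bsub>E\<^esub> n = \<zero>\<^bsub>E\<^esub>" if "b \<in> carrier mring" "b \<odot>\<^bsub>E\<^esub> n \<in> M" for b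
        using False that by blast
      \<comment> \<open>Each product of n with an element of \<open>M\<close> is at once a multiple
        of n and an element of \<open>M\<close>, hence zero in the present case.\<close>
      have "annihilates R (carrier R) M n"
        unfolding annihilates_def
      proof (intro ballI)
        fix i s assume i: "i \<in> M" "s \<in> carrier R"
        then have iR: "i \<in> carrier R" using MR by auto
        have "triple R n s i \<in> M" "triple R n i s \<in> M" "triple R i n s \<in> M"
          using submodule_ideal_of[OF M MR] i n(1) unfolding ideal_of_def by blast+
        then show "triple R n s i = \<zero>\<^bsub>R\<^esub> \<and> triple R n i s = \<zero>\<^bsub>R\<^esub> \<and> triple R i n s = \<zero>\<^bsub>R\<^esub>"
          using z[of "right_op R s i"] z[of "right_op R i s"] z[of "middle_op R i s"] i(2) iR n(1)
          by (simp add: op_act R_zero)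
      qed
      then have "n \<in> N" using n N_def by simp
      then have "n \<in> W" using WI[OF Ms(2) \<open>n \<in> N\<close>] n by simp
      then show ?thesis using a n_def by auto
    qed
  qed
  \<comment> \<open>The projection of the direct sum \<open>W\<close> onto \<open>M\<close> along
    \<open>N\<close>; \<open>uniq\<close> makes the description unambiguous.\<close>
  define f where "f w = (THE m. m \<in> M \<and> (\<exists>n\<in>N. w = m \<oplus>\<^bsub>E\<^esub> n))" for w
  have f: "f (m \<oplus>\<^bsub>E\<^esub> n) = m" if "m \<in> M" "n \<in> N" for m n
    unfolding f_def
  proof (rule the_equality)
    show "m \<in> M \<and> (\<exists>n'\<in>N. m \<oplus>\<^bsub>E\<^esub> n = m \<oplus>\<^bsub>E\<^esub> n')" using that by blast
    show "m' = m" if "m' \<in> M \<and> (\<exists>n'\<in>N. m \<oplus>\<^bsub>E\<^esub> n = m' \<oplus>\<^bsub>E\<^esub> n')" for m'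
      using that uniq \<open>m \<in> M\<close> \<open>n \<in> N\<close> by metis
  qed
  obtain g where g: "g \<in> endo" "\<And>w. w \<in> W \<Longrightarrow> g w = f w"
  proof (rule extend_hom[OF W, of f])
    show "f w \<in> carrier E" if "w \<in> W" for w using that f ME unfolding W_def by auto
    show "f (v \<oplus>\<^bsub>E\<^esub> w) = f v \<oplus>\<^bsub>E\<^esub> f w" if vw: "v \<in> W" "w \<in> W" for v w
    proof -
      obtain m n m' n' where v: "m \<in> M" "n \<in> N" "v = m \<oplus>\<^bsub>E\<^esub> n" "m' \<in> M" "n' \<in> N" "w = m' \<oplus>\<^bsub>E\<^esub> n'"
        using vw unfolding W_def by blast
      have "v \<oplus>\<^bsub>E\<^esub> w = (m \<oplus>\<^bsub>E\<^esub> m') \<oplus>\<^bsub>E\<^esub> (n \<oplus>\<^bsub>E\<^esub> n')"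
        using v ME NE by (simp add: E.V.a_ac)
      then show ?thesis using v f Ms(3) Ns(3) by simp
    qed
    show "f (a \<odot>\<^bsub>E\<^esub> w) = a \<odot>\<^bsub>E\<^esub> f w" if w: "w \<in> W" and a: "a \<in> carrier mring" for a w
    proof -
      obtain m n where v: "m \<in> M" "n \<in> N" "w = m \<oplus>\<^bsub>E\<^esub> n"
        using w unfolding W_def by blast
      then have "a \<odot>\<^bsub>E\<^esub> w = a \<odot>\<^bsub>E\<^esub> m \<oplus>\<^bsub>E\<^esub> a \<odot>\<^bsub>E\<^esub> n"
        using a ME NE by (simp add: E.act_add_vector)
      then show ?thesis using v a f Ms(4) Ns(4) by simp
    qed
  qed (use that in blast)
  have gm: "g (m \<oplus>\<^bsub>E\<^esub> n) = m" if "m \<in> M" "n \<in> N" for m n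
    using g(2)[OF WI[OF that]] f[OF that] by simp
  have gM: "g m = m" if "m \<in> M" for m
    using gm[OF that Ns(2)] ME[OF that] by simp
  show ?thesis
  proof (rule that[OF g(1)])
    show "g r = r" using gM rM .
    show "g (g p) = g p" if p: "p \<in> P" for p
    proof -
      \<comment> \<open>The difference of g composed with g and of g kills the essential ideal
        \<open>W\<close>, so it kills \<open>P\<close>.\<close>
      have "(\<lambda>x\<in>carrier E. (\<lambda>x\<in>carrier E. g (g x)) x \<ominus>\<^bsub>E\<^esub> g x) p = \<zero>\<^bsub>E\<^esub>"
      proof (rule endo_vanish[OF _ ess _ p])
        show "(\<lambda>x\<in>carrier E. (\<lambda>x\<in>carrier E. g (g x)) x \<ominus>\<^bsub>E\<^esub> g x) \<in> endo"
          using g(1) by (intro endo_diff endo_compose)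
        show "(\<lambda>x\<in>carrier E. (\<lambda>x\<in>carrier E. g (g x)) x \<ominus>\<^bsub>E\<^esub> g x) x = \<zero>\<^bsub>E\<^esub>" if "x \<in> W" for x
          using that gm gM ME NE unfolding W_def by (auto simp: diff_zero_iff)
      qed
      then show ?thesis using p g(1) by (simp add: diff_zero_iff)
    qed
    show "h (g p) = \<zero>\<^bsub>E\<^esub>" if h: "h \<in> endo" "h r = \<zero>\<^bsub>E\<^esub>" and p: "p \<in> P" for h p
    proof -
      \<comment> \<open>An endomorphism that kills \<open>r\<close> kills the ideal
        \<open>M\<close>, which contains all values of g on \<open>W\<close>; so h composed with g
        kills an essential ideal.\<close>
      have "h m = \<zero>\<^bsub>E\<^esub>" if "m \<in> M" for m
        using that h r unfolding M_def by (auto simp: endo_act)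
      then have "(\<lambda>x\<in>carrier E. h (g x)) p = \<zero>\<^bsub>E\<^esub>"
        using gm ME NE by (intro endo_vanish[OF endo_compose[OF h(1) g(1)] ess _ p]) (auto simp: W_def)
      then show ?thesis using p by simp
    qed
  qed
qed

end


section \<open>The triple composition of \<open>P(R)\<close>\<close>

context nondegenerate_hull
begin

section \<open>Linear maps on P(R) and their extension from R\<close>

definition endo_linear :: "('a \<Rightarrow> 'a) \<Rightarrow> bool" where
  "endo_linear f \<longleftrightarrow> (\<forall>p\<in>P. f p \<in> P) \<and> (\<forall>p\<in>P. \<forall>q\<in>P. f (p \<oplus>\<^bsub>E\<^esub> q) = f p \<oplus>\<^bsub>E\<^esub> f q) \<and>
    (\<forall>h\<in>endo. \<forall>p\<in>P. f (h p) = h (f p))"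

lemma endo_linearD:
  assumes "endo_linear f"
  shows "p \<in> P \<Longrightarrow> f p \<in> P" "\<lbrakk>p \<in> P; q \<in> P\<rbrakk> \<Longrightarrow> f (p \<oplus>\<^bsub>E\<^esub> q) = f p \<oplus>\<^bsub>E\<^esub> f q"
    "\<lbrakk>h \<in> endo; p \<in> P\<rbrakk> \<Longrightarrow> f (h p) = h (f p)"
  using assms unfolding endo_linear_def by blast+

text \<open>Sums and endomorphisms generate \<open>P\<close> from \<open>R\<close>. Uniqueness at
  every stage of the extension, and each later transfer of an identity from \<open>R\<close> to
  \<open>P\<close>, rests on this.\<close>

lemma endo_linear_eqI:
  assumes f: "endo_linear f" and g: "endo_linear g" and eq: "\<And>r. r \<in> carrier R \<Longrightarrow> f r = g r" and p: "p \<in> P"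
  shows "f p = g p"
  using p by (induction rule: P_induct) (simp_all add: eq endo_linearD[OF f] endo_linearD[OF g])

lemma endo_linear_act: "a \<in> carrier mring \<Longrightarrow> endo_linear (\<lambda>p. a \<odot>\<^bsub>E\<^esub> p)"
  unfolding endo_linear_def by (auto simp: E.act_add_vector endo_act)

lemma endo_linear_add:
  assumes f: "endo_linear f" and g: "endo_linear g" shows "endo_linear (\<lambda>p. f p \<oplus>\<^bsub>E\<^esub> g p)"
  unfolding endo_linear_def
  by (auto simp: endo_linearD[OF f] endo_linearD[OF g] endo_add E.V.a_ac)

text \<open>Composition with \<open>h\<close> preserves linearity because \<open>h\<close> commutes
  on \<open>P\<close> with every other endomorphism. The extension of the composition depends on
  commutativity at this point.\<close>

lemma endo_linear_endo:
  assumes f: "endo_linear f" and h: "h \<in> endo" shows "endo_linear (\<lambda>p. h (f p))"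
  unfolding endo_linear_def using h
  by (auto simp: endo_linearD[OF f] endo_add endo_commute)

lemma endo_linear_minus:
  assumes f: "endo_linear f" shows "endo_linear (\<lambda>p. \<ominus>\<^bsub>E\<^esub> f p)"
  unfolding endo_linear_def
  by (auto simp: endo_linearD[OF f] endo_minus E.V.minus_add)

lemma endo_linear_compose:
  assumes f: "endo_linear f" and g: "endo_linear g" shows "endo_linear (\<lambda>p. f (g p))"
  unfolding endo_linear_def
  by (auto simp: endo_linearD[OF f] endo_linearD[OF g])

lemma endo_linear_id: "endo_linear (\<lambda>p. p)"
  unfolding endo_linear_def by auto

definition extendable :: "('a \<Rightarrow> 'a) \<Rightarrow> bool" where
  "extendable \<phi> \<longleftrightarrow> (\<exists>g. endo_linear g \<and> (\<forall>r\<in>carrier R. g r = \<phi> r))"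

text \<open>On \<open>P\<close> the choice is determined by \<open>endo_linear_eqI\<close>.\<close>

definition linear_ext :: "('a \<Rightarrow> 'a) \<Rightarrow> 'a \<Rightarrow> 'a" where
  "linear_ext \<phi> = (SOME g. endo_linear g \<and> (\<forall>r\<in>carrier R. g r = \<phi> r))"

lemma linear_ext:
  assumes "extendable \<phi>"
  shows "endo_linear (linear_ext \<phi>)" "r \<in> carrier R \<Longrightarrow> linear_ext \<phi> r = \<phi> r"
  using someI_ex[OF assms[unfolded extendable_def], folded linear_ext_def] by auto

lemma extendableI:
  "\<lbrakk>endo_linear g; \<And>r. r \<in> carrier R \<Longrightarrow> g r = \<phi> r\<rbrakk> \<Longrightarrow> extendable \<phi>"
  unfolding extendable_def by blast

lemma extendable_add:
  assumes "extendable \<phi>" "extendable \<psi>" "\<And>r. r \<in> carrier R \<Longrightarrow> \<chi> r = \<phi> r \<oplus>\<^bsub>E\<^esub> \<psi> r"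
  shows "extendable \<chi>"
  using assms linear_ext
  by (intro extendableI[OF endo_linear_add[OF linear_ext(1)[OF assms(1)] linear_ext(1)[OF assms(2)]]]) simp

lemma extendable_endo:
  assumes "extendable \<phi>" "h \<in> endo" "\<And>r. r \<in> carrier R \<Longrightarrow> \<chi> r = h (\<phi> r)"
  shows "extendable \<chi>"
  using assms linear_ext
  by (intro extendableI[OF endo_linear_endo[OF linear_ext(1)[OF assms(1)] assms(2)]]) simp

text \<open>
  The composition is extended one variable at a time; at each stage the extension of a linear
  map from \<open>R\<close> to \<open>P(R)\<close> is unique, but it exists only because \<open>P(R)\<close> is spanned by the
  values of endomorphisms on \<open>R\<close>, which commute.
\<close>

definition triple_PPR :: "'a \<Rightarrow> 'a \<Rightarrow> 'a \<Rightarrow> 'a" where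
  "triple_PPR x y z = linear_ext (\<lambda>s. right_op R s z \<odot>\<^bsub>E\<^esub> x) y"

definition triple_PPP :: "'a \<Rightarrow> 'a \<Rightarrow> 'a \<Rightarrow> 'a" where
  "triple_PPP x y z = linear_ext (triple_PPR x y) z"

text \<open>Induction on \<open>x\<close>: for \<open>x\<close> in \<open>R\<close> the map is given
  by a middle operator, which acts on the whole of \<open>P\<close>, and extendability survives sums
  and endomorphisms.\<close>

lemma extendable_right:
  assumes "x \<in> P" "z \<in> carrier R"
  shows "extendable (\<lambda>s. right_op R s z \<odot>\<^bsub>E\<^esub> x)"
  using assms
proof (induction rule: P_induct)
  case (base r)
  then show ?case
    by (intro extendableI[OF endo_linear_act[of "middle_op R r z"]]) (simp_all add: op_act)
next
  case (add p q)
  then show ?case by (intro extendable_add[OF add(3,4)]) (simp_all add: E.act_add_vector)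
next
  case (endo f p)
  then show ?case by (intro extendable_endo[OF endo(3,1)]) (simp_all add: endo_act)
qed

lemma triple_PPR_linear2: "\<lbrakk>x \<in> P; z \<in> carrier R\<rbrakk> \<Longrightarrow> endo_linear (\<lambda>y. triple_PPR x y z)"
  and triple_PPR_eq: "\<lbrakk>x \<in> P; y \<in> carrier R; z \<in> carrier R\<rbrakk> \<Longrightarrow> triple_PPR x y z = right_op R y z \<odot>\<^bsub>E\<^esub> x"
  using linear_ext[OF extendable_right[of x z]] unfolding triple_PPR_def by simp_all

text \<open>Linearity in \<open>x\<close> is visible where \<open>y\<close> lies in
  \<open>R\<close>, since there the composition is the action of an operator. Both sides of each
  equation are linear in \<open>y\<close>, so equality spreads to all of \<open>P\<close>.\<close>

lemma triple_PPR_linear1: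
  assumes "y \<in> P" "z \<in> carrier R"
  shows "endo_linear (\<lambda>x. triple_PPR x y z)"
  unfolding endo_linear_def
proof (intro conjI ballI)
  note L = triple_PPR_linear2[OF _ assms(2)]
  show "triple_PPR p y z \<in> P" if "p \<in> P" for p
    using endo_linearD(1)[OF L[OF that] assms(1)] .
  show "triple_PPR (p \<oplus>\<^bsub>E\<^esub> q) y z = triple_PPR p y z \<oplus>\<^bsub>E\<^esub> triple_PPR q y z" if "p \<in> P" "q \<in> P" for p q
    using that assms
    by (intro endo_linear_eqI[OF L endo_linear_add[OF L L] _ assms(1)])
      (simp_all add: triple_PPR_eq E.act_add_vector)
  show "triple_PPR (h p) y z = h (triple_PPR p y z)" if "h \<in> endo" "p \<in> P" for h p
    using that assms
    by (intro endo_linear_eqI[OF L endo_linear_endo[OF L] _ assms(1)])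
      (simp_all add: triple_PPR_eq endo_act)
qed

text \<open>Two nested inductions reduce \<open>x\<close> and \<open>y\<close> to elements of
  \<open>R\<close>, where the map is a left operator.\<close>

lemma extendable_triple_PPR:
  assumes x: "x \<in> P" and y: "y \<in> P"
  shows "extendable (triple_PPR x y)"
  using x
proof (induction rule: P_induct)
  case (base r)
  show ?case using y
  proof (induction rule: P_induct)
    case (base s)
    then show ?case using \<open>r \<in> carrier R\<close>
      by (intro extendableI[OF endo_linear_act[of "left_op R r s"]]) (simp_all add: triple_PPR_eq op_act)
  next
    case (add p q)
    then show ?case using \<open>r \<in> carrier R\<close>
      by (intro extendable_add[OF add(3,4)]) (simp add: endo_linearD[OF triple_PPR_linear2])
  next
    case (endo f p)
    then show ?case using \<open>r \<in> carrier R\<close>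
      by (intro extendable_endo[OF endo(3,1)]) (simp add: endo_linearD[OF triple_PPR_linear2])
  qed
next
  case (add p q)
  then show ?case using y
    by (intro extendable_add[OF add(3,4)]) (simp add: endo_linearD[OF triple_PPR_linear1])
next
  case (endo f p)
  then show ?case using y
    by (intro extendable_endo[OF endo(3,1)]) (simp add: endo_linearD[OF triple_PPR_linear1])
qed

lemma triple_PPP_linear3: "\<lbrakk>x \<in> P; y \<in> P\<rbrakk> \<Longrightarrow> endo_linear (\<lambda>z. triple_PPP x y z)"
  and triple_PPP_eq: "\<lbrakk>x \<in> P; y \<in> P; z \<in> carrier R\<rbrakk> \<Longrightarrow> triple_PPP x y z = triple_PPR x y z"
  using linear_ext[OF extendable_triple_PPR[of x y]] unfolding triple_PPP_def by simp_all

lemma triple_PPP_linear1: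
  assumes "y \<in> P" "z \<in> P"
  shows "endo_linear (\<lambda>x. triple_PPP x y z)"
  unfolding endo_linear_def
proof (intro conjI ballI)
  note L = triple_PPP_linear3[OF _ assms(1)] and D = endo_linearD[OF triple_PPR_linear1[OF assms(1)]]
  show "triple_PPP p y z \<in> P" if "p \<in> P" for p
    using endo_linearD(1)[OF L[OF that] assms(2)] .
  show "triple_PPP (p \<oplus>\<^bsub>E\<^esub> q) y z = triple_PPP p y z \<oplus>\<^bsub>E\<^esub> triple_PPP q y z" if "p \<in> P" "q \<in> P" for p q
    using that assms
    by (intro endo_linear_eqI[OF L endo_linear_add[OF L L] _ assms(2)]) (simp_all add: triple_PPP_eq D)
  show "triple_PPP (h p) y z = h (triple_PPP p y z)" if "h \<in> endo" "p \<in> P" for h p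
    using that assms
    by (intro endo_linear_eqI[OF L endo_linear_endo[OF L] _ assms(2)]) (simp_all add: triple_PPP_eq D)
qed

lemma triple_PPP_linear2:
  assumes "x \<in> P" "z \<in> P"
  shows "endo_linear (\<lambda>y. triple_PPP x y z)"
  unfolding endo_linear_def
proof (intro conjI ballI)
  note L = triple_PPP_linear3[OF assms(1)] and D = endo_linearD[OF triple_PPR_linear2[OF assms(1)]]
  show "triple_PPP x p z \<in> P" if "p \<in> P" for p
    using endo_linearD(1)[OF L[OF that] assms(2)] .
  show "triple_PPP x (p \<oplus>\<^bsub>E\<^esub> q) z = triple_PPP x p z \<oplus>\<^bsub>E\<^esub> triple_PPP x q z" if "p \<in> P" "q \<in> P" for p q
    using that assms
    by (intro endo_linear_eqI[OF L endo_linear_add[OF L L] _ assms(2)]) (simp_all add: triple_PPP_eq D)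
  show "triple_PPP x (h p) z = h (triple_PPP x p z)" if "h \<in> endo" "p \<in> P" for h p
    using that assms
    by (intro endo_linear_eqI[OF L endo_linear_endo[OF L] _ assms(2)]) (simp_all add: triple_PPP_eq D)
qed

lemma triple_PPP_R:
  assumes "x \<in> carrier R" "y \<in> carrier R" "z \<in> carrier R"
  shows "triple_PPP x y z = triple R x y z"
  using assms by (simp add: triple_PPP_eq triple_PPR_eq op_act)

section \<open>CM(R) and uniqueness of the composition\<close>

lemma CM_simps:
  "a \<otimes>\<^bsub>CM K R E\<^esub> b = compose P a b" "\<zero>\<^bsub>CM K R E\<^esub> = (\<lambda>x\<in>P. \<zero>\<^bsub>E\<^esub>)"
  by (simp_all add: CM_def operator_ring_def Let_def)

text \<open>Injectivity of the hull extends an endomorphism of \<open>P\<close> to \<open>E\<close>;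
  conversely every endomorphism of \<open>E\<close> maps \<open>P\<close> into itself. So linearity
  over \<open>CM\<close> can be tested with \<open>endo\<close>.\<close>

lemma CM_iff: "k \<in> carrier (CM K R E) \<longleftrightarrow> (\<exists>h\<in>endo. k = restrict h P)"
proof
  have *: "carrier (CM K R E) = module_hom mring (E\<lparr>carrier := P\<rparr>) (E\<lparr>carrier := P\<rparr>)"
    by (simp add: CM_def operator_ring_def Let_def)
  assume "k \<in> carrier (CM K R E)"
  then have k: "k \<in> P \<rightarrow>\<^sub>E P" "\<And>x y. \<lbrakk>x \<in> P; y \<in> P\<rbrakk> \<Longrightarrow> k (x \<oplus>\<^bsub>E\<^esub> y) = k x \<oplus>\<^bsub>E\<^esub> k y"
    "\<And>x a. \<lbrakk>x \<in> P; a \<in> carrier mring\<rbrakk> \<Longrightarrow> k (a \<odot>\<^bsub>E\<^esub> x) = a \<odot>\<^bsub>E\<^esub> k x"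
    unfolding * module_hom_def by auto
  obtain h where "h \<in> endo" "\<And>x. x \<in> P \<Longrightarrow> h x = k x"
  proof (rule extend_hom[OF submodule_P, of k])
    show "k x \<in> carrier E" if "x \<in> P" for x using PiE_mem[OF k(1) that] by simp
  qed (use k that in auto)
  moreover from this have "k = restrict h P"
    using k(1) by (intro ext) (auto simp: PiE_iff extensional_def)
  ultimately show "\<exists>h\<in>endo. k = restrict h P" by blast
next
  assume "\<exists>h\<in>endo. k = restrict h P"
  then show "k \<in> carrier (CM K R E)"
    by (auto simp: CM_def operator_ring_def Let_def module_hom_def[of _ "E\<lparr>carrier := P\<rparr>"] endo_add endo_act)
qed

lemma P_module_simps [simp]:
  "carrier (P_module K R E) = P" "x \<oplus>\<^bsub>P_module K R E\<^esub> y = x \<oplus>\<^bsub>E\<^esub> y" "k \<odot>\<^bsub>P_module K R E\<^esub> x = k x"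
  by (simp_all add: P_module_def)

lemma trilinear_P_iff:
  "trilinear (CM K R E) (P_module K R E) t \<longleftrightarrow>
    (\<forall>x\<in>P. \<forall>y\<in>P. endo_linear (\<lambda>z. t z x y) \<and> endo_linear (\<lambda>z. t x z y) \<and> endo_linear (\<lambda>z. t x y z))"
  (is "_ \<longleftrightarrow> ?lin")
proof
  assume t: "trilinear (CM K R E) (P_module K R E) t"
  have "k x = h x" if "k = restrict h P" "x \<in> P" for h k x using that by simp
  have "t (h x) y z = h (t x y z) \<and> t x (h y) z = h (t x y z) \<and> t x y (h z) = h (t x y z)"
    if h: "h \<in> endo" and xyz: "x \<in> P" "y \<in> P" "z \<in> P" for h x y z
  proof -
    have "restrict h P \<in> carrier (CM K R E)" unfolding CM_iff using h by blast
    moreover have "\<forall>k\<in>carrier (CM K R E). \<forall>x\<in>P. \<forall>y\<in>P. \<forall>z\<in>P.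
        t (k x) y z = k (t x y z) \<and> t x (k y) z = k (t x y z) \<and> t x y (k z) = k (t x y z)"
      "\<forall>x\<in>P. \<forall>y\<in>P. \<forall>z\<in>P. t x y z \<in> P"
      using t unfolding trilinear_def by simp_all
    ultimately have "t (restrict h P x) y z = restrict h P (t x y z) \<and>
        t x (restrict h P y) z = restrict h P (t x y z) \<and> t x y (restrict h P z) = restrict h P (t x y z)"
      and "t x y z \<in> P"
      using xyz by blast+
    then show ?thesis using xyz by simp
  qed
  then show ?lin
    using t unfolding trilinear_def endo_linear_def by simp
next
  assume lin: ?lin
  show "trilinear (CM K R E) (P_module K R E) t"
    unfolding trilinear_def
  proof (intro conjI ballI)
    fix k x y z assume k: "k \<in> carrier (CM K R E)" and "x \<in> carrier (P_module K R E)"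
      "y \<in> carrier (P_module K R E)" "z \<in> carrier (P_module K R E)"
    then have xyz: "x \<in> P" "y \<in> P" "z \<in> P" by simp_all
    obtain h where h: "h \<in> endo" "k = restrict h P" using k CM_iff by blast
    have L: "endo_linear (\<lambda>u. t u y z)" "endo_linear (\<lambda>u. t x u z)" "endo_linear (\<lambda>u. t x y u)"
      using lin xyz by blast+
    show "t (k \<odot>\<^bsub>P_module K R E\<^esub> x) y z = k \<odot>\<^bsub>P_module K R E\<^esub> t x y z"
      "t x (k \<odot>\<^bsub>P_module K R E\<^esub> y) z = k \<odot>\<^bsub>P_module K R E\<^esub> t x y z"
      "t x y (k \<odot>\<^bsub>P_module K R E\<^esub> z) = k \<odot>\<^bsub>P_module K R E\<^esub> t x y z"
      using endo_linearD[OF L(1)] endo_linearD[OF L(2)] endo_linearD[OF L(3)] h xyz by simp_all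
  qed (use lin in \<open>auto simp: endo_linear_def\<close>)
qed

lemma trilinear_triple_PPP:
  "trilinear (CM K R E) (P_module K R E)
    (\<lambda>x y z. if x \<in> P \<and> y \<in> P \<and> z \<in> P then triple_PPP x y z else undefined)"
proof -
  have cong: "endo_linear f \<Longrightarrow> (\<And>p. p \<in> P \<Longrightarrow> g p = f p) \<Longrightarrow> endo_linear g" for f g
    unfolding endo_linear_def by auto
  show ?thesis
    unfolding trilinear_P_iff
    by (intro ballI conjI; rule cong, rule triple_PPP_linear1 triple_PPP_linear2 triple_PPP_linear3) auto
qed

text \<open>This evaluates the definite description in \<open>P_triple\<close>. For uniqueness,
  agreement on \<open>R\<close> is extended by linearity, each of the three passes freeing one more
  argument from \<open>R\<close> to \<open>P\<close>.\<close>

lemma P_triple_eq: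
  "P_triple K R E = (\<lambda>x y z. if x \<in> P \<and> y \<in> P \<and> z \<in> P then triple_PPP x y z else undefined)"
  (is "_ = ?t")
  unfolding P_triple_def
proof (rule the_equality)
  show "trilinear (CM K R E) (P_module K R E) ?t \<and>
     (\<forall>x\<in>carrier R. \<forall>y\<in>carrier R. \<forall>z\<in>carrier R. ?t x y z = triple R x y z) \<and>
     (\<forall>x y z. \<not> (x \<in> P \<and> y \<in> P \<and> z \<in> P) \<longrightarrow> ?t x y z = undefined)"
    using trilinear_triple_PPP by (auto simp: triple_PPP_R)
  fix t
  assume t: "trilinear (CM K R E) (P_module K R E) t \<and>
     (\<forall>x\<in>carrier R. \<forall>y\<in>carrier R. \<forall>z\<in>carrier R. t x y z = triple R x y z) \<and>
     (\<forall>x y z. \<not> (x \<in> P \<and> y \<in> P \<and> z \<in> P) \<longrightarrow> t x y z = undefined)"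
  then have L: "endo_linear (\<lambda>z. t z x y)" "endo_linear (\<lambda>z. t x z y)" "endo_linear (\<lambda>z. t x y z)"
    if "x \<in> P" "y \<in> P" for x y
    using that unfolding trilinear_P_iff by blast+
  note L' = triple_PPP_linear1 triple_PPP_linear2 triple_PPP_linear3
  have eq1: "t x y z = triple_PPP x y z" if "x \<in> P" "y \<in> carrier R" "z \<in> carrier R" for x y z
    using that t by (intro endo_linear_eqI[OF L(1) L'(1) _ that(1)]) (auto simp: triple_PPP_R)
  have eq2: "t x y z = triple_PPP x y z" if "x \<in> P" "y \<in> P" "z \<in> carrier R" for x y z
    using that eq1 by (intro endo_linear_eqI[OF L(2) L'(2) _ that(2)]) auto
  have eq3: "t x y z = triple_PPP x y z" if "x \<in> P" "y \<in> P" "z \<in> P" for x y z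
    using that eq2 by (intro endo_linear_eqI[OF L(3) L'(3) _ that(3)]) auto
  show "t = ?t"
    using t eq3 by (intro ext) auto
qed

abbreviation tp :: "'a \<Rightarrow> 'a \<Rightarrow> 'a \<Rightarrow> 'a" where "tp \<equiv> P_triple K R E"

lemma tp_linear:
  assumes "x \<in> P" "y \<in> P"
  shows "endo_linear (\<lambda>z. tp z x y)" "endo_linear (\<lambda>z. tp x z y)" "endo_linear (\<lambda>z. tp x y z)"
  using trilinear_triple_PPP assms unfolding trilinear_P_iff P_triple_eq[symmetric] by blast+

lemma tp_R: "\<lbrakk>x \<in> carrier R; y \<in> carrier R; z \<in> carrier R\<rbrakk> \<Longrightarrow> tp x y z = triple R x y z"
  by (simp add: P_triple_eq triple_PPP_R)

lemma tp_closed [simp, intro]: "\<lbrakk>x \<in> P; y \<in> P; z \<in> P\<rbrakk> \<Longrightarrow> tp x y z \<in> P"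
  using endo_linearD(1)[OF tp_linear(1)] by blast

lemma tp_act:
  assumes "x \<in> carrier R" "y \<in> carrier R" "p \<in> P"
  shows "tp x y p = left_op R x y \<odot>\<^bsub>E\<^esub> p" "tp x p y = middle_op R x y \<odot>\<^bsub>E\<^esub> p" "tp p x y = right_op R x y \<odot>\<^bsub>E\<^esub> p"
proof -
  show "tp x y p = left_op R x y \<odot>\<^bsub>E\<^esub> p"
    using assms by (intro endo_linear_eqI[OF tp_linear(3) endo_linear_act _ assms(3)]) (auto simp: tp_R op_act)
  show "tp x p y = middle_op R x y \<odot>\<^bsub>E\<^esub> p"
    using assms by (intro endo_linear_eqI[OF tp_linear(2) endo_linear_act _ assms(3)]) (auto simp: tp_R op_act)
  show "tp p x y = right_op R x y \<odot>\<^bsub>E\<^esub> p"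
    using assms by (intro endo_linear_eqI[OF tp_linear(1) endo_linear_act _ assms(3)]) (auto simp: tp_R op_act)
qed

section \<open>Jordan identities of P(R)\<close>

lemma tp_commute:
  assumes "x \<in> P" "y \<in> P" "z \<in> P" shows "tp x y z = tp z y x"
proof -
  have 1: "tp x y z = tp z y x" if "x \<in> P" "y \<in> carrier R" "z \<in> carrier R" for x y z
  proof (intro endo_linear_eqI[OF tp_linear(1) tp_linear(3) _ that(1)])
    show "tp r y z = tp z y r" if "r \<in> carrier R" for r
      using triple_commute[of r y z] that \<open>y \<in> carrier R\<close> \<open>z \<in> carrier R\<close> by (simp add: tp_R)
  qed (use that in auto)
  have 2: "tp x y z = tp z y x" if "x \<in> P" "y \<in> P" "z \<in> carrier R" for x y z
    using that 1 by (intro endo_linear_eqI[OF tp_linear(2) tp_linear(2) _ that(2)]) auto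
  show ?thesis
    using assms 2 by (intro endo_linear_eqI[OF tp_linear(3) tp_linear(1) _ assms(3)]) auto
qed

lemma tp_compose:
  assumes "endo_linear f" "x \<in> P" "y \<in> P"
  shows "endo_linear (\<lambda>z. tp (f z) x y)" "endo_linear (\<lambda>z. tp x (f z) y)" "endo_linear (\<lambda>z. tp x y (f z))"
  using assms by (auto intro: endo_linear_compose[OF tp_linear(1)] endo_linear_compose[OF tp_linear(2)]
      endo_linear_compose[OF tp_linear(3)])

text \<open>Both sides are linear in each of the five variables, so the identity passes from
  \<open>R\<close> to \<open>P\<close> one variable at a time.\<close>

lemma tp_derivation:
  assumes "x \<in> P" "y \<in> P" "a \<in> P" "b \<in> P" "c \<in> P"
  shows "tp x y (tp a b c) =
    tp a b (tp x y c) \<oplus>\<^bsub>E\<^esub> (tp (tp x y a) b c \<oplus>\<^bsub>E\<^esub> \<ominus>\<^bsub>E\<^esub> tp a (tp y x b) c)"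
proof -
  have minus: "\<ominus>\<^bsub>R\<^esub> r = \<ominus>\<^bsub>E\<^esub> r" if "r \<in> carrier R" for r
    using that R_add[of r "\<ominus>\<^bsub>R\<^esub> r"] by (intro E.V.minus_equality[symmetric]) (auto simp: R_add M.l_neg R_zero)
  let ?J = "\<lambda>x y a b c. tp x y (tp a b c) =
    tp a b (tp x y c) \<oplus>\<^bsub>E\<^esub> (tp (tp x y a) b c \<oplus>\<^bsub>E\<^esub> \<ominus>\<^bsub>E\<^esub> tp a (tp y x b) c)"
  note lin = endo_linear_add endo_linear_minus tp_compose endo_linear_id
  have 0: "?J x y a b c"
    if "x \<in> carrier R" "y \<in> carrier R" "a \<in> carrier R" "b \<in> carrier R" "c \<in> carrier R" for x y a b c
    using that triple_derivation[OF that] by (simp add: tp_R R_add M.minus_eq minus[symmetric])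
  have 1: "?J x y a b c"
    if "x \<in> P" "y \<in> carrier R" "a \<in> carrier R" "b \<in> carrier R" "c \<in> carrier R" for x y a b c
    by (rule endo_linear_eqI[OF _ _ 0 that(1)]) (use that in \<open>(intro lin)?; simp\<close>)+
  have 2: "?J x y a b c"
    if "x \<in> P" "y \<in> P" "a \<in> carrier R" "b \<in> carrier R" "c \<in> carrier R" for x y a b c
    by (rule endo_linear_eqI[OF _ _ 1 that(2)]) (use that in \<open>(intro lin)?; simp\<close>)+
  have 3: "?J x y a b c"
    if "x \<in> P" "y \<in> P" "a \<in> P" "b \<in> carrier R" "c \<in> carrier R" for x y a b c
    by (rule endo_linear_eqI[OF _ _ 2 that(3)]) (use that in \<open>(intro lin)?; simp\<close>)+
  have 4: "?J x y a b c"
    if "x \<in> P" "y \<in> P" "a \<in> P" "b \<in> P" "c \<in> carrier R" for x y a b c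
    by (rule endo_linear_eqI[OF _ _ 3 that(4)]) (use that in \<open>(intro lin)?; simp\<close>)+
  show ?thesis
    by (rule endo_linear_eqI[OF _ _ 4 assms(5)]) (use assms in \<open>(intro lin)?; simp\<close>)+
qed

section \<open>P(R) as a system of quotients of R\<close>

abbreviation P\<^sub>K :: "('k, 'a) triple_system" where "P\<^sub>K \<equiv> P_over_base K R E"

lemma P_over_base_simps [simp]:
  "carrier P\<^sub>K = P" "\<zero>\<^bsub>P\<^sub>K\<^esub> = \<zero>\<^bsub>E\<^esub>" "x \<oplus>\<^bsub>P\<^sub>K\<^esub> y = x \<oplus>\<^bsub>E\<^esub> y"
  "k \<odot>\<^bsub>P\<^sub>K\<^esub> x = scalar_operator R k \<odot>\<^bsub>E\<^esub> x" "triple P\<^sub>K = tp"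
  by (simp_all add: P_over_base_def with_triple_def scalar_module_def)

lemma module_P: "module K P\<^sub>K"
proof (rule module_restrict[OF V.module_axioms submodule_scalar[OF submodule_P]])
qed (simp_all add: P_over_base_def with_triple_def scalar_module_def)

lemma jordan_P: "linear_triple_jordan K P\<^sub>K"
proof -
  interpret PK: module K P\<^sub>K by (rule module_P)
  have minus: "\<ominus>\<^bsub>P\<^sub>K\<^esub> x = \<ominus>\<^bsub>E\<^esub> x" if "x \<in> P" for x
    using that by (intro PK.M.minus_equality) (auto simp: E.V.l_neg)
  have "linear_triple_system K P\<^sub>K"
  proof (unfold_locales, unfold trilinear_def, intro conjI ballI)
    fix k x y z assume k: "k \<in> carrier K" and "x \<in> carrier P\<^sub>K" "y \<in> carrier P\<^sub>K" "z \<in> carrier P\<^sub>K"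
    then have xyz: "x \<in> P" "y \<in> P" "z \<in> P" by simp_all
    then show "triple P\<^sub>K (k \<odot>\<^bsub>P\<^sub>K\<^esub> x) y z = k \<odot>\<^bsub>P\<^sub>K\<^esub> triple P\<^sub>K x y z"
      "triple P\<^sub>K x (k \<odot>\<^bsub>P\<^sub>K\<^esub> y) z = k \<odot>\<^bsub>P\<^sub>K\<^esub> triple P\<^sub>K x y z"
      "triple P\<^sub>K x y (k \<odot>\<^bsub>P\<^sub>K\<^esub> z) = k \<odot>\<^bsub>P\<^sub>K\<^esub> triple P\<^sub>K x y z"
      using endo_linearD(3)[OF tp_linear(1) endo_scalar[OF k], of y z x]
        endo_linearD(3)[OF tp_linear(2) endo_scalar[OF k], of x z y]
        endo_linearD(3)[OF tp_linear(3) endo_scalar[OF k], of x y z] by simp_all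
  qed (simp_all add: endo_linearD[OF tp_linear(1)] endo_linearD[OF tp_linear(2)] endo_linearD[OF tp_linear(3)])
  then show ?thesis
  proof (rule linear_triple_jordanI)
    fix x y z assume "x \<in> carrier P\<^sub>K" "y \<in> carrier P\<^sub>K" "z \<in> carrier P\<^sub>K"
    then show "triple P\<^sub>K x y z = triple P\<^sub>K z y x" using tp_commute[of x y z] by simp
  next
    fix x y a b c assume "x \<in> carrier P\<^sub>K" "y \<in> carrier P\<^sub>K" "a \<in> carrier P\<^sub>K" "b \<in> carrier P\<^sub>K" "c \<in> carrier P\<^sub>K"
    then show "triple P\<^sub>K x y (triple P\<^sub>K a b c) = triple P\<^sub>K a b (triple P\<^sub>K x y c) \<oplus>\<^bsub>P\<^sub>K\<^esub>
       (triple P\<^sub>K (triple P\<^sub>K x y a) b c \<ominus>\<^bsub>P\<^sub>K\<^esub> triple P\<^sub>K a (triple P\<^sub>K y x b) c)"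
      using tp_derivation[of x y a b c] by (simp add: PK.M.minus_eq minus)
  qed
qed

lemma submodule_of_hull_P: "submodule_of_hull K R E P\<^sub>K"
  unfolding submodule_of_hull_def using submodule_P by (simp add: tp_act)

lemma triple_embedding_P: "triple_embedding K R P\<^sub>K (\<lambda>x. x)"
  unfolding triple_embedding_def by (auto simp: R_add R_smult tp_R)

text \<open>For a sum the two ideals are intersected. For h(q) the endomorphism is moved from q to
  the element of the ideal, {h(q),s,i} = {q,s,h(i)}, so the elements of \<open>L\<close> that
  \<open>h\<close> maps into \<open>L\<close> are absorbed.\<close>

lemma absorbing_ideal:
  assumes "q \<in> P"
  shows "\<exists>L. essential_ideal L \<and> absorbs P\<^sub>K (carrier R) L q"
  using assms
proof (induction rule: P_induct)
  case (base r)
  then show ?case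
    using essential_ideal_carrier
    by (intro exI[of _ "carrier R"]) (auto simp: absorbs_def tp_R)
next
  case (add p q)
  then obtain L M where L: "essential_ideal L" "absorbs P\<^sub>K (carrier R) L p"
    "essential_ideal M" "absorbs P\<^sub>K (carrier R) M q" by blast
  have sub: "x \<in> carrier R" if "x \<in> L" for x using L(1) that unfolding essential_ideal_def by auto
  have "absorbs P\<^sub>K (carrier R) (L \<inter> M) (p \<oplus>\<^bsub>E\<^esub> q)"
    using L(2,4) add(1,2) submodule_mringD(3)[OF submodule_E] unfolding absorbs_def
    by (simp add: endo_linearD[OF tp_linear(1)] endo_linearD[OF tp_linear(2)] sub)
  then show ?case using essential_ideal_Int L(1,3) by blast
next
  case (endo h q)
  then obtain L where L: "essential_ideal L" "absorbs P\<^sub>K (carrier R) L q" by blast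
  have sub: "x \<in> carrier R" if "x \<in> L" for x using L(1) that unfolding essential_ideal_def by auto
  have "absorbs P\<^sub>K (carrier R) {x \<in> L. h x \<in> L} (h q)"
    unfolding absorbs_def
  proof (intro ballI)
    fix i s assume i: "i \<in> {x \<in> L. h x \<in> L}" and s: "s \<in> carrier R"
    have "tp (h q) s i = tp q s (h i)" "tp (h q) i s = tp q (h i) s" "tp i (h q) s = tp (h i) q s"
      using i s sub endo(1,2)
      by (simp_all add: endo_linearD(3)[OF tp_linear(1)] endo_linearD(3)[OF tp_linear(2)] endo_linearD(3)[OF tp_linear(3)])
    then show "triple P\<^sub>K (h q) s i \<in> carrier R \<and> triple P\<^sub>K (h q) i s \<in> carrier R \<and> triple P\<^sub>K i (h q) s \<in> carrier R"
      using L(2) i s unfolding absorbs_def by simp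
  qed
  then show ?case using essential_ideal_preimage[OF L(1,1) endo(1)] by blast
qed

lemma M_quotients_P: "M_quotients K R (\<lambda>x. x) P\<^sub>K"
proof (rule M_quotientsI[OF jordan_P linear_triple_system_axioms triple_embedding_P])
  fix q assume q: "q \<in> carrier P\<^sub>K" "q \<noteq> \<zero>\<^bsub>P\<^sub>K\<^esub>"
  obtain L where L: "essential_ideal L" "absorbs P\<^sub>K (carrier R) L q"
    using absorbing_ideal q by auto
  have Ls: "submodule L mring E" "L \<subseteq> carrier R" using L(1) unfolding essential_ideal_def by auto
  have id: "ideal_of R (carrier R) L" using submodule_ideal_of[OF Ls] .
  have "submodule L K R" using submodule_base[OF Ls] .
  moreover have ann: "x = \<zero>\<^bsub>R\<^esub>" if "x \<in> carrier R" "annihilates R (carrier R) L x" for x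
    using essential_ideal_annihilator[OF L(1) that] R_zero by simp
  moreover have "\<not> annihilates P\<^sub>K (carrier R) L q"
    using annihilator_zero[OF jordan_P submodule_of_hull_P triple_embedding_P id ann q(1)] q(2) by auto
  ultimately show "\<exists>I. submodule I K R \<and> ideal_of R (carrier R) I \<and>
      (\<forall>x\<in>carrier R. annihilates R (carrier R) I x \<longrightarrow> x = \<zero>\<^bsub>R\<^esub>) \<and>
      \<not> annihilates P\<^sub>K ((\<lambda>x. x) ` carrier R) ((\<lambda>x. x) ` I) q \<and>
      absorbs P\<^sub>K ((\<lambda>x. x) ` carrier R) ((\<lambda>x. x) ` I) q"
    using id L(2) by (intro exI[of _ L]) simp
qed

text \<open>The idempotent is the support of a nonzero multiple of \<open>p\<close> in
  \<open>R\<close>. It may be smaller than the support of \<open>p\<close>, but it is nonzero, and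
  every idempotent that kills \<open>p\<close> kills the multiple and is orthogonal to it.\<close>

lemma support_P:
  assumes p: "p \<in> P" "p \<noteq> \<zero>\<^bsub>E\<^esub>"
  shows "\<exists>\<beta>\<in>idempotents (CM K R E). \<beta> \<noteq> \<zero>\<^bsub>CM K R E\<^esub> \<and>
    (\<forall>\<gamma>\<in>idempotents (CM K R E). \<gamma> p = \<zero>\<^bsub>E\<^esub> \<longrightarrow> \<gamma> \<otimes>\<^bsub>CM K R E\<^esub> \<beta> = \<zero>\<^bsub>CM K R E\<^esub>)"
proof -
  obtain a where a: "a \<in> carrier mring" "a \<odot>\<^bsub>E\<^esub> p \<in> carrier R" "a \<odot>\<^bsub>E\<^esub> p \<noteq> \<zero>\<^bsub>E\<^esub>"
    using essential[of p] p by auto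
  obtain g where g: "g \<in> endo" "g (a \<odot>\<^bsub>E\<^esub> p) = a \<odot>\<^bsub>E\<^esub> p" "\<And>p. p \<in> P \<Longrightarrow> g (g p) = g p"
    "\<And>h q. \<lbrakk>h \<in> endo; h (a \<odot>\<^bsub>E\<^esub> p) = \<zero>\<^bsub>E\<^esub>; q \<in> P\<rbrakk> \<Longrightarrow> h (g q) = \<zero>\<^bsub>E\<^esub>"
    using support_R[OF a(2,3)] by metis
  define \<beta> where "\<beta> = restrict g P"
  show ?thesis
  proof (intro bexI[of _ \<beta>] conjI ballI impI)
    show "\<beta> \<in> idempotents (CM K R E)"
      unfolding idempotents_def CM_simps using g CM_iff by (auto simp: \<beta>_def compose_def intro!: ext)
    have "\<beta> (a \<odot>\<^bsub>E\<^esub> p) \<noteq> (\<lambda>x\<in>P. \<zero>\<^bsub>E\<^esub>) (a \<odot>\<^bsub>E\<^esub> p)"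
      using g(2) a p by (simp add: \<beta>_def)
    then show "\<beta> \<noteq> \<zero>\<^bsub>CM K R E\<^esub>" unfolding CM_simps by metis
    fix \<gamma> assume \<gamma>: "\<gamma> \<in> idempotents (CM K R E)" "\<gamma> p = \<zero>\<^bsub>E\<^esub>"
    then obtain h where h: "h \<in> endo" "\<gamma> = restrict h P" unfolding idempotents_def using CM_iff by blast
    then have "h p = \<zero>\<^bsub>E\<^esub>" using \<gamma>(2) p by simp
    then have "h (a \<odot>\<^bsub>E\<^esub> p) = \<zero>\<^bsub>E\<^esub>" using h a p by (simp add: endo_act)
    then show "\<gamma> \<otimes>\<^bsub>CM K R E\<^esub> \<beta> = \<zero>\<^bsub>CM K R E\<^esub>"
      unfolding CM_simps using h g(1,4) by (auto simp: \<beta>_def compose_def intro!: ext)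
  qed
qed

end


section \<open>Glueing along dense families of idempotents\<close>

declare scalar_module_simps [simp del]

text \<open>The assumption stands in for the explicit description of \<open>CM\<close>. It asks for
  a nonzero \<beta> below the support of \<open>p\<close>, which does not have to be the support
  itself.\<close>

locale supported_hull = hulled_system C P E
  for C :: "('k, 'n) ring_scheme" (structure)
    and P :: "('k, 'a, 'm) triple_system_scheme" (structure)
    and E :: "('a \<Rightarrow> 'a, 'a) module" +
  assumes support: "\<lbrakk>p \<in> carrier P; p \<noteq> \<zero>\<^bsub>P\<^esub>\<rbrakk> \<Longrightarrow> \<exists>\<beta>\<in>idempotents C. \<beta> \<noteq> \<zero>\<^bsub>C\<^esub> \<and>
    (\<forall>\<gamma>\<in>idempotents C. \<gamma> \<odot>\<^bsub>P\<^esub> p = \<zero>\<^bsub>P\<^esub> \<longrightarrow> \<gamma> \<otimes>\<^bsub>C\<^esub> \<beta> = \<zero>\<^bsub>C\<^esub>)"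
begin

abbreviation V :: "('k, 'a) module" where "V \<equiv> scalar_module P E"
abbreviation B :: "'k set" where "B \<equiv> idempotents C"

lemma carrier_V [simp]: "carrier V = carrier E"
  by (simp add: scalar_module_simps)

lemma B_carrier [simp, intro]: "\<alpha> \<in> B \<Longrightarrow> \<alpha> \<in> carrier C"
  unfolding idempotents_def by simp

lemma B_mult [simp]: "\<alpha> \<in> B \<Longrightarrow> \<alpha> \<otimes> \<alpha> = \<alpha>"
  unfolding idempotents_def by simp

lemma B_closed [simp, intro]: "\<lbrakk>\<alpha> \<in> B; \<beta> \<in> B\<rbrakk> \<Longrightarrow> \<alpha> \<otimes> \<beta> \<in> B"
proof -
  assume ab: "\<alpha> \<in> B" "\<beta> \<in> B"
  then have c: "\<alpha> \<in> carrier C" "\<beta> \<in> carrier C" by auto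
  have "(\<alpha> \<otimes> \<beta>) \<otimes> (\<alpha> \<otimes> \<beta>) = \<alpha> \<otimes> (\<beta> \<otimes> (\<alpha> \<otimes> \<beta>))"
    using c by (intro R.m_assoc) simp_all
  also have "\<beta> \<otimes> (\<alpha> \<otimes> \<beta>) = \<alpha> \<otimes> (\<beta> \<otimes> \<beta>)" using c by (intro R.m_lcomm)
  also have "\<alpha> \<otimes> (\<alpha> \<otimes> (\<beta> \<otimes> \<beta>)) = (\<alpha> \<otimes> \<alpha>) \<otimes> (\<beta> \<otimes> \<beta>)" using c by (simp only: R.m_assoc R.m_closed)
  also have "\<dots> = \<alpha> \<otimes> \<beta>" using ab by simp
  finally show ?thesis unfolding idempotents_def using c by simp
qed

lemma one_B [simp, intro]: "\<one> \<in> B" and zero_B [simp, intro]: "\<zero> \<in> B"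
  unfolding idempotents_def by simp_all

lemma V_closed [simp, intro]: "\<lbrakk>k \<in> carrier C; x \<in> carrier E\<rbrakk> \<Longrightarrow> k \<odot>\<^bsub>V\<^esub> x \<in> carrier E"
  using V.smult_closed by simp

lemma V_group_closed [simp, intro]:
  "\<zero>\<^bsub>V\<^esub> \<in> carrier E" "x \<in> carrier E \<Longrightarrow> \<ominus>\<^bsub>V\<^esub> x \<in> carrier E"
  "\<lbrakk>x \<in> carrier E; y \<in> carrier E\<rbrakk> \<Longrightarrow> x \<oplus>\<^bsub>V\<^esub> y \<in> carrier E"
  using V.M.zero_closed V.M.a_inv_closed V.M.a_closed by simp_all

lemma V_smult_smult: "\<lbrakk>k \<in> carrier C; l \<in> carrier C; x \<in> carrier E\<rbrakk> \<Longrightarrow> (k \<otimes> l) \<odot>\<^bsub>V\<^esub> x = k \<odot>\<^bsub>V\<^esub> (l \<odot>\<^bsub>V\<^esub> x)"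
  using V.smult_assoc1 by simp

lemma V_lcomm: "\<lbrakk>k \<in> carrier C; l \<in> carrier C; x \<in> carrier E\<rbrakk> \<Longrightarrow> k \<odot>\<^bsub>V\<^esub> (l \<odot>\<^bsub>V\<^esub> x) = l \<odot>\<^bsub>V\<^esub> (k \<odot>\<^bsub>V\<^esub> x)"
  by (simp add: R.m_comm flip: V_smult_smult)

lemma V_idem [simp]: "\<lbrakk>\<alpha> \<in> B; x \<in> carrier E\<rbrakk> \<Longrightarrow> \<alpha> \<odot>\<^bsub>V\<^esub> (\<alpha> \<odot>\<^bsub>V\<^esub> x) = \<alpha> \<odot>\<^bsub>V\<^esub> x"
  by (simp flip: V_smult_smult)

lemma V_act: "\<lbrakk>k \<in> carrier C; a \<in> carrier mring; x \<in> carrier E\<rbrakk> \<Longrightarrow> k \<odot>\<^bsub>V\<^esub> (a \<odot>\<^bsub>E\<^esub> x) = a \<odot>\<^bsub>E\<^esub> (k \<odot>\<^bsub>V\<^esub> x)"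
  by (simp add: scalar_module_simps scalar_act_commute)

lemma V_zero: "\<zero>\<^bsub>V\<^esub> = \<zero>\<^bsub>P\<^esub>" "\<zero>\<^bsub>V\<^esub> = \<zero>\<^bsub>E\<^esub>"
  by (simp_all add: scalar_module_simps R_zero)

lemma P_smult: "\<lbrakk>k \<in> carrier C; x \<in> carrier P\<rbrakk> \<Longrightarrow> k \<odot>\<^bsub>V\<^esub> x = k \<odot>\<^bsub>P\<^esub> x"
  by (simp add: scalar_module_simps R_smult)

section \<open>Dense sets of idempotents and separation\<close>

definition dense :: "'k set \<Rightarrow> bool" where
  "dense D \<longleftrightarrow> D \<subseteq> B \<and> (\<forall>\<beta>\<in>B. (\<forall>\<delta>\<in>D. \<beta> \<otimes> \<delta> = \<zero>) \<longrightarrow> \<beta> = \<zero>)"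

lemma denseD: "\<lbrakk>dense D; \<beta> \<in> B; \<And>\<delta>. \<delta> \<in> D \<Longrightarrow> \<beta> \<otimes> \<delta> = \<zero>\<rbrakk> \<Longrightarrow> \<beta> = \<zero>"
  unfolding dense_def by blast

lemma dense_mono: "\<lbrakk>dense D; D \<subseteq> D'; D' \<subseteq> B\<rbrakk> \<Longrightarrow> dense D'"
  unfolding dense_def by blast

lemma dense_orthogonal_iff:
  "dense_orthogonal C \<Xi> \<longleftrightarrow> dense \<Xi> \<and> (\<forall>\<xi>\<in>\<Xi>. \<forall>\<eta>\<in>\<Xi>. \<xi> \<noteq> \<eta> \<longrightarrow> \<xi> \<otimes> \<eta> = \<zero>)"
proof -
  have "{\<alpha> \<in> B. \<forall>\<xi>\<in>\<Xi>. \<alpha> \<otimes> \<xi> = \<zero>} = {\<zero>} \<longleftrightarrow> (\<forall>\<beta>\<in>B. (\<forall>\<delta>\<in>\<Xi>. \<beta> \<otimes> \<delta> = \<zero>) \<longrightarrow> \<beta> = \<zero>)" if "\<Xi> \<subseteq> B"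
    using that by auto
  then show ?thesis unfolding dense_orthogonal_def dense_def by blast
qed

text \<open>Essentiality gives a nonzero multiple of \<open>w\<close> in \<open>P\<close>. Scalars
  commute with operators, so an idempotent that kills \<open>w\<close> also kills this multiple, and
  a \<beta> for the multiple serves for \<open>w\<close>.\<close>

lemma support_hull:
  assumes w: "w \<in> carrier E" "w \<noteq> \<zero>\<^bsub>V\<^esub>"
  shows "\<exists>\<beta>\<in>B. \<beta> \<noteq> \<zero> \<and> (\<forall>\<gamma>\<in>B. \<gamma> \<odot>\<^bsub>V\<^esub> w = \<zero>\<^bsub>V\<^esub> \<longrightarrow> \<gamma> \<otimes> \<beta> = \<zero>)"
proof -
  obtain a where a: "a \<in> carrier mring" "a \<odot>\<^bsub>E\<^esub> w \<in> carrier P" "a \<odot>\<^bsub>E\<^esub> w \<noteq> \<zero>\<^bsub>P\<^esub>"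
    using essential[of w] w unfolding V_zero R_zero by blast
  then obtain \<beta> where \<beta>: "\<beta> \<in> B" "\<beta> \<noteq> \<zero>"
    "\<And>\<gamma>. \<lbrakk>\<gamma> \<in> B; \<gamma> \<odot>\<^bsub>P\<^esub> (a \<odot>\<^bsub>E\<^esub> w) = \<zero>\<^bsub>P\<^esub>\<rbrakk> \<Longrightarrow> \<gamma> \<otimes> \<beta> = \<zero>"
    using support[OF a(2,3)] by blast
  have "\<gamma> \<otimes> \<beta> = \<zero>" if \<gamma>: "\<gamma> \<in> B" "\<gamma> \<odot>\<^bsub>V\<^esub> w = \<zero>\<^bsub>V\<^esub>" for \<gamma>
  proof (rule \<beta>(3)[OF \<gamma>(1)])
    have "\<gamma> \<odot>\<^bsub>P\<^esub> (a \<odot>\<^bsub>E\<^esub> w) = a \<odot>\<^bsub>E\<^esub> (\<gamma> \<odot>\<^bsub>V\<^esub> w)"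
      using \<gamma>(1) a w by (simp add: V_act flip: P_smult)
    also have "\<dots> = \<zero>\<^bsub>E\<^esub>" using \<gamma>(2) a(1) unfolding V_zero(2) by simp
    finally show "\<gamma> \<odot>\<^bsub>P\<^esub> (a \<odot>\<^bsub>E\<^esub> w) = \<zero>\<^bsub>P\<^esub>" unfolding R_zero .
  qed
  then show ?thesis using \<beta>(1,2) by blast
qed

text \<open>A nonzero \<open>w\<close> would yield a nonzero \<beta> orthogonal to every idempotent
  that kills \<open>w\<close>, in particular to all of \<open>D\<close>, against density.\<close>

lemma separated:
  assumes "dense D" "w \<in> carrier E" "\<And>\<delta>. \<delta> \<in> D \<Longrightarrow> \<delta> \<odot>\<^bsub>V\<^esub> w = \<zero>\<^bsub>V\<^esub>"
  shows "w = \<zero>\<^bsub>V\<^esub>"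
proof (rule ccontr)
  assume "w \<noteq> \<zero>\<^bsub>V\<^esub>"
  then obtain \<beta> where \<beta>: "\<beta> \<in> B" "\<beta> \<noteq> \<zero>" "\<And>\<gamma>. \<lbrakk>\<gamma> \<in> B; \<gamma> \<odot>\<^bsub>V\<^esub> w = \<zero>\<^bsub>V\<^esub>\<rbrakk> \<Longrightarrow> \<gamma> \<otimes> \<beta> = \<zero>"
    using support_hull[OF assms(2)] by blast
  have DB: "D \<subseteq> B" using assms(1) unfolding dense_def by simp
  have "\<beta> = \<zero>"
  proof (rule denseD[OF assms(1) \<beta>(1)])
    fix \<delta> assume "\<delta> \<in> D"
    then show "\<beta> \<otimes> \<delta> = \<zero>" using \<beta>(3)[of \<delta>] assms(3) DB \<beta>(1) R.m_comm[of \<beta> \<delta>] by auto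
  qed
  then show False using \<beta>(2) by simp
qed

lemma separated_eq:
  assumes D: "dense D" and xy: "x \<in> carrier E" "y \<in> carrier E" and eq: "\<And>\<delta>. \<delta> \<in> D \<Longrightarrow> \<delta> \<odot>\<^bsub>V\<^esub> x = \<delta> \<odot>\<^bsub>V\<^esub> y"
  shows "x = y"
proof -
  have DB: "D \<subseteq> B" using D unfolding dense_def by simp
  have "x \<ominus>\<^bsub>V\<^esub> y = \<zero>\<^bsub>V\<^esub>"
  proof (rule separated[OF D])
    show "x \<ominus>\<^bsub>V\<^esub> y \<in> carrier E" using xy V.M.minus_closed[of x y] by simp
    fix \<delta> assume "\<delta> \<in> D"
    then show "\<delta> \<odot>\<^bsub>V\<^esub> (x \<ominus>\<^bsub>V\<^esub> y) = \<zero>\<^bsub>V\<^esub>"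
      using DB xy eq[of \<delta>] by (auto simp: V.M.minus_eq V.smult_r_distr V.smult_r_minus V.M.r_neg subset_iff)
  qed
  then show ?thesis
    using xy V.M.minus_equality[of x "\<ominus>\<^bsub>V\<^esub> y"] by (auto simp: V.M.minus_eq)
qed

text \<open>
  Baer's criterion is applied to the right ideal of those operators \<open>a\<close> for which the family
  \<open>\<alpha> u\<^sub>\<alpha> a\<close> is glued by an element; it contains all \<open>\<alpha> \<in> D\<close>.
\<close>

lemma glue:
  assumes D: "dense D" and u: "\<And>\<alpha>. \<alpha> \<in> D \<Longrightarrow> u \<alpha> \<in> carrier E"
    and compat: "\<And>\<alpha> \<beta>. \<lbrakk>\<alpha> \<in> D; \<beta> \<in> D\<rbrakk> \<Longrightarrow> \<alpha> \<odot>\<^bsub>V\<^esub> u \<beta> = \<beta> \<odot>\<^bsub>V\<^esub> u \<alpha>"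
  obtains x where "x \<in> carrier E" "\<And>\<alpha>. \<alpha> \<in> D \<Longrightarrow> \<alpha> \<odot>\<^bsub>V\<^esub> x = \<alpha> \<odot>\<^bsub>V\<^esub> u \<alpha>"
proof -
  have DB: "\<alpha> \<in> B" if "\<alpha> \<in> D" for \<alpha> using D that unfolding dense_def by auto
  define rel where "rel a w \<longleftrightarrow> w \<in> carrier E \<and> (\<forall>\<alpha>\<in>D. \<alpha> \<odot>\<^bsub>V\<^esub> w = a \<odot>\<^bsub>E\<^esub> (\<alpha> \<odot>\<^bsub>V\<^esub> u \<alpha>))" for a w
  define J where "J = {a \<in> carrier mring. \<exists>w. rel a w}"
  define f where "f a = (THE w. rel a w)" for a
  have uniq: "w = w'" if "rel a w" "rel a w'" for a w w'
  proof (rule separated_eq[OF D])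
    show "w \<in> carrier E" "w' \<in> carrier E" using that unfolding rel_def by simp_all
    show "\<delta> \<odot>\<^bsub>V\<^esub> w = \<delta> \<odot>\<^bsub>V\<^esub> w'" if "\<delta> \<in> D" for \<delta>
      using that \<open>rel a w\<close> \<open>rel a w'\<close> unfolding rel_def by simp
  qed
  have f: "f a = w" if "rel a w" for a w
    unfolding f_def using that uniq by (intro the_equality) auto
  have fr: "rel a (f a)" if "a \<in> J" for a using that f unfolding J_def by auto
  have cl: "\<alpha> \<odot>\<^bsub>V\<^esub> u \<alpha> \<in> carrier E" if "\<alpha> \<in> D" for \<alpha> using that DB u by simp
  have zero: "rel \<zero>\<^bsub>mring\<^esub> \<zero>\<^bsub>V\<^esub>"
    unfolding rel_def using cl DB by (auto simp: V_zero(2)) (auto simp flip: V_zero(2))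
  have add: "rel (a \<oplus>\<^bsub>mring\<^esub> b) (f a \<oplus>\<^bsub>E\<^esub> f b)" if "a \<in> J" "b \<in> J" for a b
  proof -
    have "\<alpha> \<odot>\<^bsub>V\<^esub> (f a \<oplus>\<^bsub>E\<^esub> f b) = \<alpha> \<odot>\<^bsub>V\<^esub> f a \<oplus>\<^bsub>E\<^esub> \<alpha> \<odot>\<^bsub>V\<^esub> f b" if "\<alpha> \<in> D" for \<alpha>
      using V.smult_r_distr[of \<alpha> "f a" "f b"] DB[OF that] fr[OF \<open>a \<in> J\<close>] fr[OF \<open>b \<in> J\<close>]
      by (simp add: rel_def) (simp add: scalar_module_simps)
    then show ?thesis
      using that fr[OF that(1)] fr[OF that(2)] cl unfolding rel_def J_def by (simp add: E.act_add_scalar)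
  qed
  have mult: "rel (b \<otimes>\<^bsub>mring\<^esub> a) (a \<odot>\<^bsub>E\<^esub> f b)" if "b \<in> J" "a \<in> carrier mring" for a b
    using that fr[OF that(1)] cl DB unfolding rel_def J_def by (simp add: V_act E.act_mult E.act_closed)
  \<comment> \<open>The scalar operators of \<open>D\<close> lie in \<open>J\<close>: by
    compatibility the family multiplied by \<beta> is glued by \<beta>u(\<beta>). Thus
    \<open>f\<close> is known on them, and the element supplied by Baer's criterion has the
    prescribed pieces.\<close>
  have sc: "rel (scalar_operator P \<beta>) (\<beta> \<odot>\<^bsub>V\<^esub> u \<beta>)" if \<beta>: "\<beta> \<in> D" for \<beta>
    unfolding rel_def
  proof (intro conjI ballI cl[OF \<beta>])
    fix \<alpha> assume \<alpha>: "\<alpha> \<in> D"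
    have "\<alpha> \<odot>\<^bsub>V\<^esub> (\<beta> \<odot>\<^bsub>V\<^esub> u \<beta>) = \<beta> \<odot>\<^bsub>V\<^esub> (\<beta> \<odot>\<^bsub>V\<^esub> u \<alpha>)"
      using \<alpha> \<beta> DB u compat[of \<alpha> \<beta>] by (simp add: V_lcomm[of \<alpha> \<beta>])
    also have "\<dots> = \<beta> \<odot>\<^bsub>V\<^esub> u \<alpha>" using \<alpha> \<beta> DB u by simp
    also have "\<dots> = \<alpha> \<odot>\<^bsub>V\<^esub> (\<alpha> \<odot>\<^bsub>V\<^esub> u \<beta>)" using \<alpha> \<beta> DB u compat[OF \<beta> \<alpha>] by simp
    also have "\<dots> = \<beta> \<odot>\<^bsub>V\<^esub> (\<alpha> \<odot>\<^bsub>V\<^esub> u \<alpha>)"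
      using \<alpha> \<beta> DB u compat[of \<alpha> \<beta>] by (simp add: V_lcomm[of \<beta> \<alpha>])
    finally show "\<alpha> \<odot>\<^bsub>V\<^esub> (\<beta> \<odot>\<^bsub>V\<^esub> u \<beta>) = scalar_operator P \<beta> \<odot>\<^bsub>E\<^esub> (\<alpha> \<odot>\<^bsub>V\<^esub> u \<alpha>)"
      by (simp add: scalar_module_simps)
  qed
  obtain w where w: "w \<in> carrier E" "\<And>x. x \<in> J \<Longrightarrow> x \<odot>\<^bsub>E\<^esub> w = f x"
  proof (rule baer[of J f])
    show "J \<subseteq> carrier mring" unfolding J_def by blast
    show "\<zero>\<^bsub>mring\<^esub> \<in> J" unfolding J_def using zero by auto
    show "x \<oplus>\<^bsub>mring\<^esub> y \<in> J" if "x \<in> J" "y \<in> J" for x y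
      using add[OF that] that unfolding J_def by auto
    show "x \<otimes>\<^bsub>mring\<^esub> a \<in> J" if "x \<in> J" "a \<in> carrier mring" for x a
      using mult[OF that] that unfolding J_def by auto
    show "f x \<in> carrier E" if "x \<in> J" for x using fr[OF that] unfolding rel_def by simp
    show "f (x \<oplus>\<^bsub>mring\<^esub> y) = f x \<oplus>\<^bsub>E\<^esub> f y" if "x \<in> J" "y \<in> J" for x y
      using f[OF add[OF that]] .
    show "f (x \<otimes>\<^bsub>mring\<^esub> a) = a \<odot>\<^bsub>E\<^esub> f x" if "x \<in> J" "a \<in> carrier mring" for x a
      using f[OF mult[OF that]] .
  qed (use that in blast)
  have "\<alpha> \<odot>\<^bsub>V\<^esub> w = \<alpha> \<odot>\<^bsub>V\<^esub> u \<alpha>" if "\<alpha> \<in> D" for \<alpha>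
    using w(2)[of "scalar_operator P \<alpha>"] sc[OF that] f[OF sc[OF that]] that DB
    unfolding J_def by (auto simp: scalar_module_simps)
  then show ?thesis using that w(1) by blast
qed

section \<open>Intersections and orthogonal refinements of dense sets\<close>

definition idempotent_ideal :: "'k set \<Rightarrow> bool" where
  "idempotent_ideal D \<longleftrightarrow> D \<subseteq> B \<and> (\<forall>\<delta>\<in>D. \<forall>\<beta>\<in>B. \<beta> \<otimes> \<delta> \<in> D)"

text \<open>Dense sets in general may have empty intersection; for ideals, products of members of
  \<open>D\<close> and \<open>D'\<close> lie in both. If \<beta> is orthogonal to the intersection,
  then \<beta>\<delta> is orthogonal to \<open>D'\<close> for every \<delta> in
  \<open>D\<close>.\<close>

lemma dense_Int:
  assumes D: "dense D" "idempotent_ideal D" and D': "dense D'" "idempotent_ideal D'"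
  shows "dense (D \<inter> D')" "idempotent_ideal (D \<inter> D')"
proof -
  have B: "\<delta> \<in> D \<Longrightarrow> \<delta> \<in> B" "\<delta> \<in> D' \<Longrightarrow> \<delta> \<in> B" for \<delta> using D(1) D'(1) unfolding dense_def by auto
  show "idempotent_ideal (D \<inter> D')" using D D' unfolding idempotent_ideal_def by blast
  show "dense (D \<inter> D')"
    unfolding dense_def
  proof (intro conjI ballI impI)
    show "D \<inter> D' \<subseteq> B" using B by blast
    fix \<beta> assume \<beta>: "\<beta> \<in> B" and z: "\<forall>\<delta>\<in>D \<inter> D'. \<beta> \<otimes> \<delta> = \<zero>"
    show "\<beta> = \<zero>"
    proof (rule denseD[OF D(1) \<beta>])
      fix \<delta> assume \<delta>: "\<delta> \<in> D"
      show "\<beta> \<otimes> \<delta> = \<zero>"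
      proof (rule denseD[OF D'(1)])
        show "\<beta> \<otimes> \<delta> \<in> B" using \<beta> \<delta> B by simp
        fix \<delta>' assume \<delta>': "\<delta>' \<in> D'"
        have "\<delta> \<otimes> \<delta>' \<in> D'" "\<delta>' \<otimes> \<delta> \<in> D" using \<delta> \<delta>' D(2) D'(2) B unfolding idempotent_ideal_def by auto
        then have "\<delta> \<otimes> \<delta>' \<in> D \<inter> D'" using R.m_comm[of \<delta> \<delta>'] \<delta> \<delta>' B by auto
        then show "\<beta> \<otimes> \<delta> \<otimes> \<delta>' = \<zero>" using z \<beta> \<delta> \<delta>' B by (simp add: R.m_assoc)
      qed
    qed
  qed
qed

text \<open>By Zorn's lemma there is a maximal orthogonal subset \<open>M\<close> of
  \<open>D\<close>. If \<beta> is orthogonal to \<open>M\<close>, then each \<beta>\<delta> with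
  \<delta> in \<open>D\<close> can be adjoined; by maximality it already lies in \<open>M\<close>,
  is orthogonal to \<beta>, and so is zero.\<close>

lemma dense_orthogonal_subset:
  assumes D: "dense D" "idempotent_ideal D"
  shows "\<exists>\<Xi>\<subseteq>D. dense_orthogonal C \<Xi>"
proof -
  define orth where "orth X \<longleftrightarrow> (\<forall>\<xi>\<in>X. \<forall>\<eta>\<in>X. \<xi> \<noteq> \<eta> \<longrightarrow> \<xi> \<otimes> \<eta> = \<zero>)" for X
  let ?A = "{X. X \<subseteq> D \<and> orth X}"
  have "\<exists>M\<in>?A. \<forall>X\<in>?A. M \<subseteq> X \<longrightarrow> X = M"
  proof (rule subset_Zorn')
    fix c assume c: "subset.chain ?A c"
    have "\<xi> \<otimes> \<eta> = \<zero>" if "\<xi> \<in> X" "X \<in> c" "\<eta> \<in> Y" "Y \<in> c" "\<xi> \<noteq> \<eta>" for \<xi> \<eta> X Y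
    proof -
      have "X \<subseteq> Y \<or> Y \<subseteq> X" "X \<in> ?A" "Y \<in> ?A"
        using c that unfolding subset_chain_def by auto
      then show ?thesis using that unfolding orth_def by blast
    qed
    moreover have "\<Union>c \<subseteq> D" using c unfolding subset_chain_def by auto
    ultimately show "\<Union>c \<in> ?A" unfolding orth_def by blast
  qed
  then obtain M where "M \<in> ?A" "\<forall>X\<in>?A. M \<subseteq> X \<longrightarrow> X = M" ..
  then have M: "M \<subseteq> D" "orth M" "\<And>X. \<lbrakk>X \<subseteq> D; orth X; M \<subseteq> X\<rbrakk> \<Longrightarrow> X = M" by simp_all
  have DB: "\<delta> \<in> B" if "\<delta> \<in> D" for \<delta> using D(1) that unfolding dense_def by auto
  have "dense M"
    unfolding dense_def
  proof (intro conjI ballI impI)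
    show "M \<subseteq> B" using M(1) DB by blast
    fix \<beta> assume \<beta>: "\<beta> \<in> B" and z: "\<forall>\<delta>\<in>M. \<beta> \<otimes> \<delta> = \<zero>"
    show "\<beta> = \<zero>"
    proof (rule denseD[OF D(1) \<beta>])
      fix \<delta> assume \<delta>: "\<delta> \<in> D"
      have bd: "\<beta> \<otimes> \<delta> \<in> D" using D(2) \<delta> \<beta> unfolding idempotent_ideal_def by blast
      have perp: "(\<beta> \<otimes> \<delta>) \<otimes> \<eta> = \<zero>" if "\<eta> \<in> M" for \<eta>
      proof -
        have "\<eta> \<in> B" using that M(1) DB by blast
        then have "(\<beta> \<otimes> \<delta>) \<otimes> \<eta> = \<delta> \<otimes> (\<beta> \<otimes> \<eta>)"
          using \<beta> DB[OF \<delta>] by (simp add: R.m_ac)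
        then show ?thesis using z that DB[OF \<delta>] by simp
      qed
      have "orth (insert (\<beta> \<otimes> \<delta>) M)"
        unfolding orth_def
      proof (intro ballI impI)
        fix \<xi> \<eta> assume *: "\<xi> \<in> insert (\<beta> \<otimes> \<delta>) M" "\<eta> \<in> insert (\<beta> \<otimes> \<delta>) M" "\<xi> \<noteq> \<eta>"
        have c: "\<xi> \<in> carrier C" "\<eta> \<in> carrier C" using * M(1) DB bd by auto
        consider "\<xi> = \<beta> \<otimes> \<delta>" "\<eta> \<in> M" | "\<eta> = \<beta> \<otimes> \<delta>" "\<xi> \<in> M" | "\<xi> \<in> M" "\<eta> \<in> M" using * by blast
        then show "\<xi> \<otimes> \<eta> = \<zero>"
          using perp M(2) *(3) c R.m_comm[of \<xi> \<eta>] unfolding orth_def by cases auto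
      qed
      then have "insert (\<beta> \<otimes> \<delta>) M = M" using M(1,3) bd by blast
      then have "\<beta> \<otimes> \<delta> \<in> M" by blast
      then have "\<beta> \<otimes> (\<beta> \<otimes> \<delta>) = \<zero>" using z by blast
      then show "\<beta> \<otimes> \<delta> = \<zero>" using \<beta> DB[OF \<delta>] by (simp flip: R.m_assoc)
    qed
  qed
  then have "dense_orthogonal C M" using M(2) unfolding orth_def dense_orthogonal_iff by simp
  then show ?thesis using M(1) by blast
qed

section \<open>Explicit form of the orthogonal completion\<close>

definition idempotent_domain :: "'a set \<Rightarrow> 'a \<Rightarrow> 'k set" where
  "idempotent_domain S x = {\<alpha> \<in> B. \<alpha> \<odot>\<^bsub>V\<^esub> x \<in> S}"

text \<open>The full set of idempotents moving \<open>x\<close> into \<open>S\<close> is used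
  instead of an orthogonal family: it involves no choice, and when \<open>S\<close> is a submodule
  the sets of several elements can be intersected.\<close>

definition completion :: "'a set \<Rightarrow> 'a set" where
  "completion S = {x \<in> carrier E. dense (idempotent_domain S x)}"

lemma completion_carrier: "x \<in> completion S \<Longrightarrow> x \<in> carrier E"
  unfolding completion_def by simp

lemma idempotent_domain_ideal:
  assumes S: "submodule S C V" and x: "x \<in> carrier E"
  shows "idempotent_ideal (idempotent_domain S x)"
  using V.submoduleE(4)[OF S] x
  unfolding idempotent_ideal_def idempotent_domain_def by (auto simp: V_smult_smult)

lemma completion_domain:
  assumes "submodule S C V" "x \<in> completion S"
  shows "dense (idempotent_domain S x)" "idempotent_ideal (idempotent_domain S x)"
  using assms idempotent_domain_ideal unfolding completion_def by auto

lemma subset_completion: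
  assumes "submodule S C V" shows "S \<subseteq> completion S"
proof
  fix x assume x: "x \<in> S"
  then have xE: "x \<in> carrier E" using V.submoduleE(1)[OF assms] by auto
  have "\<one> \<in> idempotent_domain S x" using x xE V.smult_one[of x] unfolding idempotent_domain_def by simp
  then have "dense (idempotent_domain S x)"
    unfolding dense_def idempotent_domain_def by (auto dest!: bspec[of _ _ \<one>])
  then show "x \<in> completion S" using xE unfolding completion_def by simp
qed

lemma completion_mono:
  assumes "S \<subseteq> T" shows "completion S \<subseteq> completion T"
proof
  fix x assume "x \<in> completion S"
  then show "x \<in> completion T"
    using assms dense_mono[of "idempotent_domain S x" "idempotent_domain T x"]
    unfolding completion_def idempotent_domain_def by auto
qed

lemma submodule_completion:
  assumes S: "submodule S C V" shows "submodule (completion S) C V"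
proof (rule V.submoduleI)
  note SE = V.submoduleE[OF S]
  show "completion S \<subseteq> carrier V" unfolding completion_def by auto
  have zS: "\<zero>\<^bsub>V\<^esub> \<in> S" using subgroup.one_closed[OF submodule.axioms(1)[OF S]] by simp
  then show "\<zero>\<^bsub>V\<^esub> \<in> completion S" using subset_completion[OF S] by blast
  have sm: "k \<odot>\<^bsub>V\<^esub> x \<in> completion S" if k: "k \<in> carrier C" and x: "x \<in> completion S" for k x
  proof -
    have xE: "x \<in> carrier E" using completion_carrier[OF x] .
    have "idempotent_domain S x \<subseteq> idempotent_domain S (k \<odot>\<^bsub>V\<^esub> x)"
      using SE(4) k xE unfolding idempotent_domain_def by (auto simp: V_lcomm[of _ k])
    then show ?thesis
      using dense_mono[OF completion_domain(1)[OF S x]] xE k unfolding completion_def idempotent_domain_def by auto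
  qed
  then show "\<And>k x. \<lbrakk>k \<in> carrier C; x \<in> completion S\<rbrakk> \<Longrightarrow> k \<odot>\<^bsub>V\<^esub> x \<in> completion S" .
  show "\<ominus>\<^bsub>V\<^esub> x \<in> completion S" if "x \<in> completion S" for x
  proof -
    have "\<ominus>\<^bsub>V\<^esub> x = (\<ominus> \<one>) \<odot>\<^bsub>V\<^esub> x" using completion_carrier[OF that] by (simp add: V.smult_l_minus)
    then show ?thesis using sm that by simp
  qed
  fix x y assume xy: "x \<in> completion S" "y \<in> completion S"
  note c = completion_carrier[OF xy(1)] completion_carrier[OF xy(2)]
  have "idempotent_domain S x \<inter> idempotent_domain S y \<subseteq> idempotent_domain S (x \<oplus>\<^bsub>V\<^esub> y)"
    using SE(5) c unfolding idempotent_domain_def by (auto simp: V.smult_r_distr)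
  moreover have "dense (idempotent_domain S x \<inter> idempotent_domain S y)"
    using completion_domain[OF S] xy by (intro dense_Int) auto
  moreover have "idempotent_domain S (x \<oplus>\<^bsub>V\<^esub> y) \<subseteq> B" unfolding idempotent_domain_def by auto
  ultimately have "dense (idempotent_domain S (x \<oplus>\<^bsub>V\<^esub> y))"
    using dense_mono by blast
  then show "x \<oplus>\<^bsub>V\<^esub> y \<in> completion S"
    using c V.M.a_closed[of x y] unfolding completion_def by simp
qed

lemma orthogonal_sum_exists:
  assumes S: "submodule S C V" and x: "x \<in> completion S"
  shows "\<exists>\<Xi> u. orthogonal_sum C V S \<Xi> u x"
proof -
  obtain \<Xi> where \<Xi>: "\<Xi> \<subseteq> idempotent_domain S x" "dense_orthogonal C \<Xi>"
    using dense_orthogonal_subset[OF completion_domain[OF S x]] by blast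
  have "orthogonal_sum C V S \<Xi> (\<lambda>\<xi>. \<xi> \<odot>\<^bsub>V\<^esub> x) x"
    using \<Xi> completion_carrier[OF x] unfolding orthogonal_sum_def idempotent_domain_def by auto
  then show ?thesis by blast
qed

text \<open>Multiplied by their own \<xi>, the pieces become compatible, because products of
  distinct \<xi> vanish, and can be glued. The domain of the result contains each \<xi>\<delta> with
  \<delta> in the domain of the piece at \<xi>; these products are dense.\<close>

lemma orthogonally_complete_completion:
  assumes S: "submodule S C V"
  shows "orthogonally_complete C V (completion S)"
  unfolding orthogonally_complete_def
proof (intro conjI allI impI)
  note SE = V.submoduleE[OF S]
  show "completion S \<subseteq> carrier V" unfolding completion_def by auto
  fix \<Xi> u assume *: "dense_orthogonal C \<Xi> \<and> u \<in> \<Xi> \<rightarrow> completion S"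
  then have \<Xi>: "dense \<Xi>" and orth: "\<And>\<xi> \<eta>. \<lbrakk>\<xi> \<in> \<Xi>; \<eta> \<in> \<Xi>; \<xi> \<noteq> \<eta>\<rbrakk> \<Longrightarrow> \<xi> \<otimes> \<eta> = \<zero>"
    and u: "\<And>\<xi>. \<xi> \<in> \<Xi> \<Longrightarrow> u \<xi> \<in> completion S"
    unfolding dense_orthogonal_iff by auto
  have B: "\<xi> \<in> B" if "\<xi> \<in> \<Xi>" for \<xi> using \<Xi> that unfolding dense_def by auto
  have uE: "u \<xi> \<in> carrier E" if "\<xi> \<in> \<Xi>" for \<xi> using completion_carrier[OF u[OF that]] .
  obtain x where x: "x \<in> carrier E" "\<And>\<alpha>. \<alpha> \<in> \<Xi> \<Longrightarrow> \<alpha> \<odot>\<^bsub>V\<^esub> x = \<alpha> \<odot>\<^bsub>V\<^esub> (\<alpha> \<odot>\<^bsub>V\<^esub> u \<alpha>)"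
  proof (rule glue[OF \<Xi>, of "\<lambda>\<xi>. \<xi> \<odot>\<^bsub>V\<^esub> u \<xi>"])
    show "\<alpha> \<odot>\<^bsub>V\<^esub> u \<alpha> \<in> carrier E" if "\<alpha> \<in> \<Xi>" for \<alpha> using that B uE by simp
    show "\<alpha> \<odot>\<^bsub>V\<^esub> (\<beta> \<odot>\<^bsub>V\<^esub> u \<beta>) = \<beta> \<odot>\<^bsub>V\<^esub> (\<alpha> \<odot>\<^bsub>V\<^esub> u \<alpha>)" if "\<alpha> \<in> \<Xi>" "\<beta> \<in> \<Xi>" for \<alpha> \<beta>
    proof (cases "\<alpha> = \<beta>")
      case False
      then show ?thesis
        using orth[OF that] orth[OF that(2,1)] that B uE V.smult_l_null by (simp flip: V_smult_smult)
    qed simp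
  qed (use that in blast)
  have x': "\<xi> \<odot>\<^bsub>V\<^esub> x = \<xi> \<odot>\<^bsub>V\<^esub> u \<xi>" if "\<xi> \<in> \<Xi>" for \<xi> using x(2)[OF that] that B uE by simp
  have "dense (idempotent_domain S x)"
    unfolding dense_def
  proof (intro conjI ballI impI)
    show "idempotent_domain S x \<subseteq> B" unfolding idempotent_domain_def by auto
    fix \<beta> assume \<beta>: "\<beta> \<in> B" and z: "\<forall>\<delta>\<in>idempotent_domain S x. \<beta> \<otimes> \<delta> = \<zero>"
    show "\<beta> = \<zero>"
    proof (rule denseD[OF \<Xi> \<beta>])
      fix \<xi> assume \<xi>: "\<xi> \<in> \<Xi>"
      show "\<beta> \<otimes> \<xi> = \<zero>"
      proof (rule denseD[OF completion_domain(1)[OF S u[OF \<xi>]]])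
        show "\<beta> \<otimes> \<xi> \<in> B" using \<beta> B[OF \<xi>] by simp
        fix \<delta> assume \<delta>: "\<delta> \<in> idempotent_domain S (u \<xi>)"
        then have \<delta>': "\<delta> \<in> B" "\<delta> \<odot>\<^bsub>V\<^esub> u \<xi> \<in> S" unfolding idempotent_domain_def by auto
        have "(\<xi> \<otimes> \<delta>) \<odot>\<^bsub>V\<^esub> x = \<xi> \<odot>\<^bsub>V\<^esub> (\<delta> \<odot>\<^bsub>V\<^esub> u \<xi>)"
          using \<delta>' B[OF \<xi>] x(1) uE[OF \<xi>] x'[OF \<xi>]
          by (simp add: V_smult_smult V_lcomm[of \<xi> \<delta>])
        also have "\<dots> \<in> S" using SE(4) \<delta>'(2) B[OF \<xi>] by blast
        finally have "\<xi> \<otimes> \<delta> \<in> idempotent_domain S x"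
          using \<delta>' B[OF \<xi>] unfolding idempotent_domain_def by simp
        then show "\<beta> \<otimes> \<xi> \<otimes> \<delta> = \<zero>" using z \<beta> B[OF \<xi>] \<delta>' by (simp add: R.m_assoc)
      qed
    qed
  qed
  then have "x \<in> completion S" using x(1) unfolding completion_def by simp
  then show "\<exists>x\<in>completion S. orthogonal_sum C V (completion S) \<Xi> u x"
    using * x' unfolding orthogonal_sum_def by blast
qed

text \<open>An orthogonally complete set containing \<open>S\<close> has some sum of the pieces of
  \<open>x\<close>; by separation that sum is \<open>x\<close> itself.\<close>

lemma orthogonal_closure_eq:
  assumes S: "submodule S C V"
  shows "orthogonal_closure C V S = completion S"
proof
  show "orthogonal_closure C V S \<subseteq> completion S"
    unfolding orthogonal_closure_def
    using orthogonally_complete_completion[OF S] subset_completion[OF S] by blast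
  show "completion S \<subseteq> orthogonal_closure C V S"
  proof
    fix x assume x: "x \<in> completion S"
    obtain \<Xi> u where \<Xi>: "orthogonal_sum C V S \<Xi> u x" using orthogonal_sum_exists[OF S x] by blast
    then have \<Xi>': "dense_orthogonal C \<Xi>" "u \<in> \<Xi> \<rightarrow> S" "\<And>\<xi>. \<xi> \<in> \<Xi> \<Longrightarrow> \<xi> \<odot>\<^bsub>V\<^esub> x = \<xi> \<odot>\<^bsub>V\<^esub> u \<xi>"
      unfolding orthogonal_sum_def by auto
    have "x \<in> T" if T: "orthogonally_complete C V T" "S \<subseteq> T" for T
    proof -
      have "u \<in> \<Xi> \<rightarrow> T" using \<Xi>'(2) T(2) by auto
      then obtain y where y: "y \<in> T" "orthogonal_sum C V T \<Xi> u y"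
        using T(1) \<Xi>'(1) unfolding orthogonally_complete_def by blast
      have "y = x"
      proof (rule separated_eq[of \<Xi>])
        show "dense \<Xi>" using \<Xi>'(1) unfolding dense_orthogonal_iff by simp
        show "y \<in> carrier E" using y(1) T(1) unfolding orthogonally_complete_def by auto
        show "\<delta> \<odot>\<^bsub>V\<^esub> y = \<delta> \<odot>\<^bsub>V\<^esub> x" if "\<delta> \<in> \<Xi>" for \<delta>
          using that y(2) \<Xi>'(3) unfolding orthogonal_sum_def by simp
      qed (rule completion_carrier[OF x])
      then show ?thesis using y(1) by simp
    qed
    then show "x \<in> orthogonal_closure C V S" unfolding orthogonal_closure_def by blast
  qed
qed

end


section \<open>Orthogonal completeness of the maximal system of quotients\<close>

text \<open>Maximality is stated for competitors with elements in \<open>'a list set\<close>. A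
  competitor with elements in \<open>'a\<close> is recoded along the injection of x to the singleton
  of the one-element list of x.\<close>

lemma M_quotients_lift:
  fixes R :: "('k, 'a, 'm) triple_system_scheme" and Q :: "('k, 'a, 'l) triple_system_scheme"
  assumes Q: "M_quotients K R (\<lambda>x. x) Q" and Z: "maximal_M_quotients K R \<kappa> Z"
  shows "\<exists>\<phi>. triple_embedding K Q Z \<phi> \<and> (\<forall>x\<in>carrier R. \<phi> x = \<kappa> x)"
proof -
  define f :: "'a \<Rightarrow> 'a list set" where "f x = {[x]}" for x
  define g :: "'a list set \<Rightarrow> 'a" where "g X = hd (the_elem X)" for X
  have gf [simp]: "g (f x) = x" for x by (simp add: f_def g_def)
  have finj [simp]: "f x = f y \<longleftrightarrow> x = y" for x y by (metis gf)
  define T :: "('k, 'a list set) triple_system" where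
    "T = \<lparr>carrier = f ` carrier Q, mult = undefined, one = undefined, zero = f \<zero>\<^bsub>Q\<^esub>,
      add = (\<lambda>X Y. f (g X \<oplus>\<^bsub>Q\<^esub> g Y)), smult = (\<lambda>k X. f (k \<odot>\<^bsub>Q\<^esub> g X)),
      triple = (\<lambda>X Y Z. f (triple Q (g X) (g Y) (g Z)))\<rparr>"
  have T [simp]: "carrier T = f ` carrier Q" "\<zero>\<^bsub>T\<^esub> = f \<zero>\<^bsub>Q\<^esub>" "f x \<oplus>\<^bsub>T\<^esub> f y = f (x \<oplus>\<^bsub>Q\<^esub> y)"
    "k \<odot>\<^bsub>T\<^esub> f x = f (k \<odot>\<^bsub>Q\<^esub> x)" "triple T (f x) (f y) (f z) = f (triple Q x y z)" for x y z k
    by (simp_all add: T_def)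
  have jQ: "linear_triple_jordan K Q" and lR: "linear_triple_system K R" and emb: "triple_embedding K R Q (\<lambda>x. x)"
    using Q unfolding M_quotients_def by auto
  interpret Q: linear_triple_jordan K Q by fact
  have "M_quotients K R f T"
  proof (rule M_quotientsI[OF _ lR])
    show "linear_triple_jordan K T"
      using triple_homomorphic_image(2)[OF Q.linear_triple_system_axioms, of T f] jQ by simp
    show "triple_embedding K R T f"
      using emb unfolding triple_embedding_def by (auto simp: inj_on_def)
    fix q assume "q \<in> carrier T" "q \<noteq> \<zero>\<^bsub>T\<^esub>"
    then obtain p where p: "q = f p" "p \<in> carrier Q" "p \<noteq> \<zero>\<^bsub>Q\<^esub>" by auto
    obtain I where I: "submodule I K R" "ideal_of R (carrier R) I"
      "\<And>x. \<lbrakk>x \<in> carrier R; annihilates R (carrier R) I x\<rbrakk> \<Longrightarrow> x = \<zero>\<^bsub>R\<^esub>"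
      "\<not> annihilates Q ((\<lambda>x. x) ` carrier R) ((\<lambda>x. x) ` I) p" "absorbs Q ((\<lambda>x. x) ` carrier R) ((\<lambda>x. x) ` I) p"
      using M_quotientsE[OF Q p(2,3)] by blast
    have "\<not> annihilates T (f ` carrier R) (f ` I) q" "absorbs T (f ` carrier R) (f ` I) q"
      using I(4,5) unfolding annihilates_def absorbs_def p(1) by auto
    then show "\<exists>I. submodule I K R \<and> ideal_of R (carrier R) I \<and>
      (\<forall>x\<in>carrier R. annihilates R (carrier R) I x \<longrightarrow> x = \<zero>\<^bsub>R\<^esub>) \<and>
      \<not> annihilates T (f ` carrier R) (f ` I) q \<and> absorbs T (f ` carrier R) (f ` I) q"
      using I(1-3) by blast
  qed
  then obtain \<psi> where \<psi>: "triple_embedding K T Z \<psi>" "\<And>x. x \<in> carrier R \<Longrightarrow> \<psi> (f x) = \<kappa> x"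
    using Z unfolding maximal_M_quotients_def by blast
  have "triple_embedding K Q Z (\<lambda>x. \<psi> (f x))"
    using \<psi>(1) unfolding triple_embedding_def
    by (auto simp: inj_on_def simp flip: T(3-5))
  then show ?thesis using \<psi>(2) by blast
qed

locale quotient_setting = supported_hull C P E
  for C :: "('k, 'n) ring_scheme" (structure)
    and P :: "('k, 'a, 'm) triple_system_scheme" (structure)
    and E :: "('a \<Rightarrow> 'a, 'a) module" +
  fixes Q :: "('k, 'a) triple_system"
  assumes maximal: "maximal_M_quotients C P (\<lambda>x. x) Q"
    and sub_hull: "submodule_of_hull C P E Q"
begin

lemma quotients: "M_quotients C P (\<lambda>x. x) Q"
  using maximal unfolding maximal_M_quotients_def by simp

sublocale Q: linear_triple_jordan C Q
  using quotients unfolding M_quotients_def by simp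

lemma embedding_Q: "triple_embedding C P Q (\<lambda>x. x)"
  using quotients unfolding M_quotients_def by simp

lemma P_Q [simp, intro]: "x \<in> carrier P \<Longrightarrow> x \<in> carrier Q"
  and triple_P: "\<lbrakk>x \<in> carrier P; y \<in> carrier P; z \<in> carrier P\<rbrakk> \<Longrightarrow> triple Q x y z = triple P x y z"
  using embedding_Q unfolding triple_embedding_def by auto

lemma Q_E [simp, intro]: "q \<in> carrier Q \<Longrightarrow> q \<in> carrier E"
  using sub_hull submodule_mringD(1) unfolding submodule_of_hull_def by auto

lemma Q_add: "\<lbrakk>p \<in> carrier Q; q \<in> carrier Q\<rbrakk> \<Longrightarrow> p \<oplus>\<^bsub>Q\<^esub> q = p \<oplus>\<^bsub>V\<^esub> q"
  and Q_smult: "\<lbrakk>k \<in> carrier C; q \<in> carrier Q\<rbrakk> \<Longrightarrow> k \<odot>\<^bsub>Q\<^esub> q = k \<odot>\<^bsub>V\<^esub> q"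
  using sub_hull unfolding submodule_of_hull_def by (simp_all add: scalar_module_simps)

lemma Q_zero: "\<zero>\<^bsub>Q\<^esub> = \<zero>\<^bsub>V\<^esub>"
  using submodule_of_hull_zero[OF sub_hull Q.M.abelian_group_axioms] V_zero by simp

lemma Q_ops:
  assumes "x \<in> carrier P" "y \<in> carrier P" "q \<in> carrier Q"
  shows "left_op P x y \<odot>\<^bsub>E\<^esub> q = triple Q x y q" "middle_op P x y \<odot>\<^bsub>E\<^esub> q = triple Q x q y"
    "right_op P x y \<odot>\<^bsub>E\<^esub> q = triple Q q x y"
  using sub_hull assms unfolding submodule_of_hull_def by simp_all

lemma submodule_Q: "submodule (carrier Q) C V" and submodule_P: "submodule (carrier P) C V"
  using sub_hull submodule_scalar submodule_E unfolding submodule_of_hull_def by auto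

lemma Q_V_closed [simp]: "\<lbrakk>k \<in> carrier C; q \<in> carrier Q\<rbrakk> \<Longrightarrow> k \<odot>\<^bsub>V\<^esub> q \<in> carrier Q"
  "\<lbrakk>p \<in> carrier Q; q \<in> carrier Q\<rbrakk> \<Longrightarrow> p \<oplus>\<^bsub>V\<^esub> q \<in> carrier Q"
  using Q.smult_closed[of k q] Q.M.a_closed[of p q] by (simp_all add: Q_smult Q_add)

lemma P_V_closed [simp]: "\<lbrakk>k \<in> carrier C; q \<in> carrier P\<rbrakk> \<Longrightarrow> k \<odot>\<^bsub>V\<^esub> q \<in> carrier P"
  "\<lbrakk>p \<in> carrier P; q \<in> carrier P\<rbrakk> \<Longrightarrow> p \<oplus>\<^bsub>V\<^esub> q \<in> carrier P"
  using V.submoduleE[OF submodule_P] by simp_all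

lemma Q_triple_smult:
  assumes "k \<in> carrier C" "x \<in> carrier Q" "y \<in> carrier Q" "z \<in> carrier Q"
  shows "triple Q (k \<odot>\<^bsub>V\<^esub> x) y z = k \<odot>\<^bsub>V\<^esub> triple Q x y z"
    "triple Q x (k \<odot>\<^bsub>V\<^esub> y) z = k \<odot>\<^bsub>V\<^esub> triple Q x y z"
    "triple Q x y (k \<odot>\<^bsub>V\<^esub> z) = k \<odot>\<^bsub>V\<^esub> triple Q x y z"
  using Q.triple_smult[OF assms] assms by (simp_all add: Q_smult)

lemma Q_triple_add:
  assumes "x \<in> carrier Q" "x' \<in> carrier Q" "y \<in> carrier Q" "z \<in> carrier Q"
  shows "triple Q (x \<oplus>\<^bsub>V\<^esub> x') y z = triple Q x y z \<oplus>\<^bsub>V\<^esub> triple Q x' y z"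
    "triple Q y (x \<oplus>\<^bsub>V\<^esub> x') z = triple Q y x z \<oplus>\<^bsub>V\<^esub> triple Q y x' z"
    "triple Q y z (x \<oplus>\<^bsub>V\<^esub> x') = triple Q y z x \<oplus>\<^bsub>V\<^esub> triple Q y z x'"
  using Q.triple_add[OF assms] assms by (simp_all add: Q_add)

text \<open>An idempotent equals its own cube, so a factor \<beta> can be distributed over all three
  arguments; this is what allows the composition to be computed locally.\<close>

lemma idempotent_triple:
  assumes "\<beta> \<in> B" "x \<in> carrier Q" "y \<in> carrier Q" "z \<in> carrier Q"
  shows "triple Q (\<beta> \<odot>\<^bsub>V\<^esub> x) (\<beta> \<odot>\<^bsub>V\<^esub> y) (\<beta> \<odot>\<^bsub>V\<^esub> z) = \<beta> \<odot>\<^bsub>V\<^esub> triple Q x y z"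
  using assms by (simp add: Q_triple_smult)

section \<open>The composition on the completion of Q\<close>

abbreviation hat :: "'a set" where "hat \<equiv> completion (carrier Q)"

lemma Q_hat [simp, intro]: "q \<in> carrier Q \<Longrightarrow> q \<in> hat"
  using subset_completion[OF submodule_Q] by auto

lemma hat_E [simp, intro]: "x \<in> hat \<Longrightarrow> x \<in> carrier E"
  by (rule completion_carrier)

lemma hat_closed [simp, intro]:
  "\<lbrakk>k \<in> carrier C; x \<in> hat\<rbrakk> \<Longrightarrow> k \<odot>\<^bsub>V\<^esub> x \<in> hat" "\<lbrakk>x \<in> hat; y \<in> hat\<rbrakk> \<Longrightarrow> x \<oplus>\<^bsub>V\<^esub> y \<in> hat"
  "x \<in> hat \<Longrightarrow> \<ominus>\<^bsub>V\<^esub> x \<in> hat" "\<zero>\<^bsub>V\<^esub> \<in> hat"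
proof -
  note H = submodule_completion[OF submodule_Q]
  show "\<lbrakk>k \<in> carrier C; x \<in> hat\<rbrakk> \<Longrightarrow> k \<odot>\<^bsub>V\<^esub> x \<in> hat" by (rule V.submoduleE(4)[OF H])
  show "\<lbrakk>x \<in> hat; y \<in> hat\<rbrakk> \<Longrightarrow> x \<oplus>\<^bsub>V\<^esub> y \<in> hat" by (rule V.submoduleE(5)[OF H])
  show "x \<in> hat \<Longrightarrow> \<ominus>\<^bsub>V\<^esub> x \<in> hat" by (rule V.submoduleE(3)[OF H])
  show "\<zero>\<^bsub>V\<^esub> \<in> hat" using subgroup.one_closed[OF submodule.axioms(1)[OF H]] by simp
qed

definition common_domain :: "'a set \<Rightarrow> 'k set" where
  "common_domain X = {\<alpha> \<in> B. \<forall>x\<in>X. \<alpha> \<odot>\<^bsub>V\<^esub> x \<in> carrier Q}"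

lemma common_domain:
  assumes "finite X" "X \<subseteq> hat"
  shows "dense (common_domain X) \<and> idempotent_ideal (common_domain X)"
  using assms
proof (induction X)
  case empty
  have "dense B" unfolding dense_def by (auto dest!: bspec[of _ _ \<one>])
  then show ?case unfolding common_domain_def idempotent_ideal_def by simp
next
  case (insert x X)
  have "common_domain (insert x X) = idempotent_domain (carrier Q) x \<inter> common_domain X"
    unfolding common_domain_def idempotent_domain_def by auto
  then show ?case
    using insert dense_Int[OF completion_domain[OF submodule_Q, of x]] by simp
qed

text \<open>An equation in the completion is checked after multiplication by idempotents that carry
  all the finitely many elements of \<open>X\<close> into \<open>Q\<close>; such idempotents are
  dense.\<close>

lemma hat_eqI:
  assumes "finite X" "X \<subseteq> hat" "u \<in> carrier E" "v \<in> carrier E"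
    and eq: "\<And>\<alpha>. \<lbrakk>\<alpha> \<in> B; \<forall>x\<in>X. \<alpha> \<odot>\<^bsub>V\<^esub> x \<in> carrier Q\<rbrakk> \<Longrightarrow> \<alpha> \<odot>\<^bsub>V\<^esub> u = \<alpha> \<odot>\<^bsub>V\<^esub> v"
  shows "u = v"
proof (rule separated_eq[of "common_domain X"])
  show "dense (common_domain X)" using common_domain[OF assms(1,2)] by simp
  show "\<delta> \<odot>\<^bsub>V\<^esub> u = \<delta> \<odot>\<^bsub>V\<^esub> v" if "\<delta> \<in> common_domain X" for \<delta>
    using that by (intro eq) (simp_all add: common_domain_def)
qed fact+

definition hat_triple :: "'a \<Rightarrow> 'a \<Rightarrow> 'a \<Rightarrow> 'a" where
  "hat_triple x y z = (THE s. s \<in> carrier E \<and>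
    (\<forall>\<alpha>\<in>common_domain {x, y, z}. \<alpha> \<odot>\<^bsub>V\<^esub> s = triple Q (\<alpha> \<odot>\<^bsub>V\<^esub> x) (\<alpha> \<odot>\<^bsub>V\<^esub> y) (\<alpha> \<odot>\<^bsub>V\<^esub> z)))"

text \<open>The local products are compatible, since multiplication by a second idempotent can be
  carried into all arguments and idempotents commute. Hence they glue, and separation makes the
  result unique.\<close>

lemma hat_triple:
  assumes "x \<in> hat" "y \<in> hat" "z \<in> hat"
  shows "hat_triple x y z \<in> carrier E"
    and "\<lbrakk>\<alpha> \<in> B; \<alpha> \<odot>\<^bsub>V\<^esub> x \<in> carrier Q; \<alpha> \<odot>\<^bsub>V\<^esub> y \<in> carrier Q; \<alpha> \<odot>\<^bsub>V\<^esub> z \<in> carrier Q\<rbrakk> \<Longrightarrow>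
      \<alpha> \<odot>\<^bsub>V\<^esub> hat_triple x y z = triple Q (\<alpha> \<odot>\<^bsub>V\<^esub> x) (\<alpha> \<odot>\<^bsub>V\<^esub> y) (\<alpha> \<odot>\<^bsub>V\<^esub> z)"
proof -
  let ?D = "common_domain {x, y, z}"
  let ?u = "\<lambda>\<alpha>. triple Q (\<alpha> \<odot>\<^bsub>V\<^esub> x) (\<alpha> \<odot>\<^bsub>V\<^esub> y) (\<alpha> \<odot>\<^bsub>V\<^esub> z)"
  let ?\<Phi> = "\<lambda>s. s \<in> carrier E \<and> (\<forall>\<alpha>\<in>?D. \<alpha> \<odot>\<^bsub>V\<^esub> s = ?u \<alpha>)"
  note c = assms[THEN hat_E]
  have D: "dense ?D" using common_domain[of "{x, y, z}"] assms by simp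
  have Dd: "\<alpha> \<in> B" "\<alpha> \<odot>\<^bsub>V\<^esub> x \<in> carrier Q" "\<alpha> \<odot>\<^bsub>V\<^esub> y \<in> carrier Q" "\<alpha> \<odot>\<^bsub>V\<^esub> z \<in> carrier Q"
    if "\<alpha> \<in> ?D" for \<alpha> using that unfolding common_domain_def by auto
  have twist: "\<beta> \<odot>\<^bsub>V\<^esub> ?u \<alpha> = triple Q (\<beta> \<odot>\<^bsub>V\<^esub> (\<alpha> \<odot>\<^bsub>V\<^esub> x)) (\<beta> \<odot>\<^bsub>V\<^esub> (\<alpha> \<odot>\<^bsub>V\<^esub> y)) (\<beta> \<odot>\<^bsub>V\<^esub> (\<alpha> \<odot>\<^bsub>V\<^esub> z))"
    if "\<alpha> \<in> ?D" "\<beta> \<in> B" for \<alpha> \<beta>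
    using idempotent_triple[OF that(2) Dd(2-4)[OF that(1)]] by simp
  obtain s where s: "s \<in> carrier E" "\<And>\<alpha>. \<alpha> \<in> ?D \<Longrightarrow> \<alpha> \<odot>\<^bsub>V\<^esub> s = \<alpha> \<odot>\<^bsub>V\<^esub> ?u \<alpha>"
  proof (rule glue[OF D, of ?u])
    show "?u \<alpha> \<in> carrier E" if "\<alpha> \<in> ?D" for \<alpha> using Dd[OF that] by simp
    show "\<alpha> \<odot>\<^bsub>V\<^esub> ?u \<beta> = \<beta> \<odot>\<^bsub>V\<^esub> ?u \<alpha>" if "\<alpha> \<in> ?D" "\<beta> \<in> ?D" for \<alpha> \<beta>
      unfolding twist[OF that(1) Dd(1)[OF that(2)]] twist[OF that(2) Dd(1)[OF that(1)]]
      using Dd(1)[OF that(1)] Dd(1)[OF that(2)] c by (simp add: V_lcomm[of \<alpha> \<beta>])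
  qed (use that in blast)
  have s': "?\<Phi> s"
  proof (intro conjI ballI s(1))
    fix \<alpha> assume \<alpha>: "\<alpha> \<in> ?D"
    show "\<alpha> \<odot>\<^bsub>V\<^esub> s = ?u \<alpha>"
      unfolding s(2)[OF \<alpha>] twist[OF \<alpha> Dd(1)[OF \<alpha>]] using Dd(1)[OF \<alpha>] c by simp
  qed
  have "?\<Phi> (hat_triple x y z)"
    unfolding hat_triple_def
  proof (rule theI2[of ?\<Phi>, OF s'])
    show "v = s" if v: "?\<Phi> v" for v
    proof (rule separated_eq[OF D])
      show "\<delta> \<odot>\<^bsub>V\<^esub> v = \<delta> \<odot>\<^bsub>V\<^esub> s" if "\<delta> \<in> ?D" for \<delta> using v s' that by simp
    qed (use v s' in blast)+
  qed
  then show "hat_triple x y z \<in> carrier E"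
    and "\<lbrakk>\<alpha> \<in> B; \<alpha> \<odot>\<^bsub>V\<^esub> x \<in> carrier Q; \<alpha> \<odot>\<^bsub>V\<^esub> y \<in> carrier Q; \<alpha> \<odot>\<^bsub>V\<^esub> z \<in> carrier Q\<rbrakk> \<Longrightarrow>
      \<alpha> \<odot>\<^bsub>V\<^esub> hat_triple x y z = triple Q (\<alpha> \<odot>\<^bsub>V\<^esub> x) (\<alpha> \<odot>\<^bsub>V\<^esub> y) (\<alpha> \<odot>\<^bsub>V\<^esub> z)"
    unfolding common_domain_def by auto
qed

lemma hat_triple_closed [simp, intro]:
  assumes "x \<in> hat" "y \<in> hat" "z \<in> hat"
  shows "hat_triple x y z \<in> hat"
proof -
  have "common_domain {x, y, z} \<subseteq> idempotent_domain (carrier Q) (hat_triple x y z)"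
    using hat_triple(2)[OF assms] unfolding common_domain_def idempotent_domain_def by auto
  moreover have "dense (common_domain {x, y, z})" using common_domain[of "{x, y, z}"] assms by simp
  moreover have "idempotent_domain (carrier Q) (hat_triple x y z) \<subseteq> B" unfolding idempotent_domain_def by auto
  ultimately have "dense (idempotent_domain (carrier Q) (hat_triple x y z))"
    using dense_mono by blast
  then show ?thesis using hat_triple(1)[OF assms] unfolding completion_def by simp
qed

lemma hat_triple_Q: "\<lbrakk>x \<in> carrier Q; y \<in> carrier Q; z \<in> carrier Q\<rbrakk> \<Longrightarrow> hat_triple x y z = triple Q x y z"
  using hat_triple(2)[of x y z \<one>] hat_triple(1)[of x y z] V.smult_one by simp

abbreviation T :: "('k, 'a) triple_system" where "T \<equiv> with_triple V hat hat_triple"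

lemma T_simps [simp]:
  "carrier T = hat" "\<zero>\<^bsub>T\<^esub> = \<zero>\<^bsub>V\<^esub>" "add T = add V" "smult T = smult V" "triple T = hat_triple"
  by (simp_all add: with_triple_def)

text \<open>Multiplied by a suitable \<alpha>, each axiom turns into the same axiom of
  \<open>Q\<close> for the pieces of its arguments.\<close>

sublocale T: linear_triple_jordan C T
proof -
  have "module C T"
    by (rule module_restrict[OF V.module_axioms submodule_completion[OF submodule_Q]]) simp_all
  then interpret T: module C T .
  have T: "linear_triple_system C T"
  proof (unfold_locales, unfold trilinear_def T_simps, intro conjI ballI)
    fix x x' y z assume c: "x \<in> hat" "x' \<in> hat" "y \<in> hat" "z \<in> hat"
    show "hat_triple (x \<oplus>\<^bsub>V\<^esub> x') y z = hat_triple x y z \<oplus>\<^bsub>V\<^esub> hat_triple x' y z"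
    proof (rule hat_eqI[of "{x, x', y, z}"])
      fix \<alpha> assume "\<alpha> \<in> B" "\<forall>u\<in>{x, x', y, z}. \<alpha> \<odot>\<^bsub>V\<^esub> u \<in> carrier Q"
      then show "\<alpha> \<odot>\<^bsub>V\<^esub> hat_triple (x \<oplus>\<^bsub>V\<^esub> x') y z = \<alpha> \<odot>\<^bsub>V\<^esub> (hat_triple x y z \<oplus>\<^bsub>V\<^esub> hat_triple x' y z)"
        using c by (simp add: hat_triple(2) V.smult_r_distr Q_triple_add)
    qed (use c in simp_all)
    show "hat_triple y (x \<oplus>\<^bsub>V\<^esub> x') z = hat_triple y x z \<oplus>\<^bsub>V\<^esub> hat_triple y x' z"
    proof (rule hat_eqI[of "{x, x', y, z}"])
      fix \<alpha> assume "\<alpha> \<in> B" "\<forall>u\<in>{x, x', y, z}. \<alpha> \<odot>\<^bsub>V\<^esub> u \<in> carrier Q"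
      then show "\<alpha> \<odot>\<^bsub>V\<^esub> hat_triple y (x \<oplus>\<^bsub>V\<^esub> x') z = \<alpha> \<odot>\<^bsub>V\<^esub> (hat_triple y x z \<oplus>\<^bsub>V\<^esub> hat_triple y x' z)"
        using c by (simp add: hat_triple(2) V.smult_r_distr Q_triple_add)
    qed (use c in simp_all)
    show "hat_triple y z (x \<oplus>\<^bsub>V\<^esub> x') = hat_triple y z x \<oplus>\<^bsub>V\<^esub> hat_triple y z x'"
    proof (rule hat_eqI[of "{x, x', y, z}"])
      fix \<alpha> assume "\<alpha> \<in> B" "\<forall>u\<in>{x, x', y, z}. \<alpha> \<odot>\<^bsub>V\<^esub> u \<in> carrier Q"
      then show "\<alpha> \<odot>\<^bsub>V\<^esub> hat_triple y z (x \<oplus>\<^bsub>V\<^esub> x') = \<alpha> \<odot>\<^bsub>V\<^esub> (hat_triple y z x \<oplus>\<^bsub>V\<^esub> hat_triple y z x')"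
        using c by (simp add: hat_triple(2) V.smult_r_distr Q_triple_add)
    qed (use c in simp_all)
  next
    fix k x y z assume k: "k \<in> carrier C" and c: "x \<in> hat" "y \<in> hat" "z \<in> hat"
    show "hat_triple (k \<odot>\<^bsub>V\<^esub> x) y z = k \<odot>\<^bsub>V\<^esub> hat_triple x y z"
    proof (rule hat_eqI[of "{x, y, z}"])
      fix \<alpha> assume "\<alpha> \<in> B" "\<forall>u\<in>{x, y, z}. \<alpha> \<odot>\<^bsub>V\<^esub> u \<in> carrier Q"
      then show "\<alpha> \<odot>\<^bsub>V\<^esub> hat_triple (k \<odot>\<^bsub>V\<^esub> x) y z = \<alpha> \<odot>\<^bsub>V\<^esub> (k \<odot>\<^bsub>V\<^esub> hat_triple x y z)"
        using c k by (simp add: hat_triple(2) Q_triple_smult V_lcomm[of _ k])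
    qed (use c k in simp_all)
    show "hat_triple x (k \<odot>\<^bsub>V\<^esub> y) z = k \<odot>\<^bsub>V\<^esub> hat_triple x y z"
    proof (rule hat_eqI[of "{x, y, z}"])
      fix \<alpha> assume "\<alpha> \<in> B" "\<forall>u\<in>{x, y, z}. \<alpha> \<odot>\<^bsub>V\<^esub> u \<in> carrier Q"
      then show "\<alpha> \<odot>\<^bsub>V\<^esub> hat_triple x (k \<odot>\<^bsub>V\<^esub> y) z = \<alpha> \<odot>\<^bsub>V\<^esub> (k \<odot>\<^bsub>V\<^esub> hat_triple x y z)"
        using c k by (simp add: hat_triple(2) Q_triple_smult V_lcomm[of _ k])
    qed (use c k in simp_all)
    show "hat_triple x y (k \<odot>\<^bsub>V\<^esub> z) = k \<odot>\<^bsub>V\<^esub> hat_triple x y z"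
    proof (rule hat_eqI[of "{x, y, z}"])
      fix \<alpha> assume "\<alpha> \<in> B" "\<forall>u\<in>{x, y, z}. \<alpha> \<odot>\<^bsub>V\<^esub> u \<in> carrier Q"
      then show "\<alpha> \<odot>\<^bsub>V\<^esub> hat_triple x y (k \<odot>\<^bsub>V\<^esub> z) = \<alpha> \<odot>\<^bsub>V\<^esub> (k \<odot>\<^bsub>V\<^esub> hat_triple x y z)"
        using c k by (simp add: hat_triple(2) Q_triple_smult V_lcomm[of _ k])
    qed (use c k in simp_all)
  qed auto
  have minus: "\<ominus>\<^bsub>T\<^esub> x = \<ominus>\<^bsub>V\<^esub> x" if "x \<in> hat" for x
    using that by (intro T.M.minus_equality) (auto simp: V.M.l_neg)
  have minus_Q: "\<ominus>\<^bsub>Q\<^esub> x = \<ominus>\<^bsub>V\<^esub> x" if "x \<in> carrier Q" for x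
    using that Q_add[of "\<ominus>\<^bsub>Q\<^esub> x" x] by (intro V.M.minus_equality[symmetric]) (auto simp: Q.M.l_neg Q_zero)
  show "linear_triple_jordan C T"
  proof (rule linear_triple_jordanI[OF T]; unfold T_simps)
    fix x y z assume c: "x \<in> hat" "y \<in> hat" "z \<in> hat"
    show "hat_triple x y z = hat_triple z y x"
    proof (rule hat_eqI[of "{x, y, z}"])
      fix \<alpha> assume "\<alpha> \<in> B" "\<forall>u\<in>{x, y, z}. \<alpha> \<odot>\<^bsub>V\<^esub> u \<in> carrier Q"
      then show "\<alpha> \<odot>\<^bsub>V\<^esub> hat_triple x y z = \<alpha> \<odot>\<^bsub>V\<^esub> hat_triple z y x"
        using c Q.triple_commute[of "\<alpha> \<odot>\<^bsub>V\<^esub> x" "\<alpha> \<odot>\<^bsub>V\<^esub> y" "\<alpha> \<odot>\<^bsub>V\<^esub> z"] by (simp add: hat_triple(2))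
    qed (use c in auto)
  next
    fix x y a b c assume h: "x \<in> hat" "y \<in> hat" "a \<in> hat" "b \<in> hat" "c \<in> hat"
    have "hat_triple x y (hat_triple a b c) = hat_triple a b (hat_triple x y c) \<oplus>\<^bsub>V\<^esub>
      (hat_triple (hat_triple x y a) b c \<oplus>\<^bsub>V\<^esub> \<ominus>\<^bsub>V\<^esub> hat_triple a (hat_triple y x b) c)"
    proof (rule hat_eqI[of "{x, y, a, b, c}"])
      fix \<alpha> assume \<alpha>: "\<alpha> \<in> B" "\<forall>u\<in>{x, y, a, b, c}. \<alpha> \<odot>\<^bsub>V\<^esub> u \<in> carrier Q"
      then show "\<alpha> \<odot>\<^bsub>V\<^esub> hat_triple x y (hat_triple a b c) = \<alpha> \<odot>\<^bsub>V\<^esub> (hat_triple a b (hat_triple x y c) \<oplus>\<^bsub>V\<^esub>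
        (hat_triple (hat_triple x y a) b c \<oplus>\<^bsub>V\<^esub> \<ominus>\<^bsub>V\<^esub> hat_triple a (hat_triple y x b) c))"
        using h Q.triple_derivation[of "\<alpha> \<odot>\<^bsub>V\<^esub> x" "\<alpha> \<odot>\<^bsub>V\<^esub> y" "\<alpha> \<odot>\<^bsub>V\<^esub> a" "\<alpha> \<odot>\<^bsub>V\<^esub> b" "\<alpha> \<odot>\<^bsub>V\<^esub> c"]
        by (simp add: hat_triple(2) V.smult_r_distr V.smult_r_minus Q.M.minus_eq minus_Q[symmetric] Q_add)
    qed (use h in auto)
    then show "hat_triple x y (hat_triple a b c) = hat_triple a b (hat_triple x y c) \<oplus>\<^bsub>V\<^esub>
      (hat_triple (hat_triple x y a) b c \<ominus>\<^bsub>T\<^esub> hat_triple a (hat_triple y x b) c)"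
      using h by (simp add: T.M.minus_eq minus)
  qed
qed

lemma hat_triple_smult:
  assumes "k \<in> carrier C" "x \<in> hat" "y \<in> hat" "z \<in> hat"
  shows "hat_triple (k \<odot>\<^bsub>V\<^esub> x) y z = k \<odot>\<^bsub>V\<^esub> hat_triple x y z"
    "hat_triple x (k \<odot>\<^bsub>V\<^esub> y) z = k \<odot>\<^bsub>V\<^esub> hat_triple x y z"
    "hat_triple x y (k \<odot>\<^bsub>V\<^esub> z) = k \<odot>\<^bsub>V\<^esub> hat_triple x y z"
  using T.triple_smult[of k x y z] assms by simp_all

lemma hat_triple_add:
  assumes "x \<in> hat" "x' \<in> hat" "y \<in> hat" "z \<in> hat"
  shows "hat_triple (x \<oplus>\<^bsub>V\<^esub> x') y z = hat_triple x y z \<oplus>\<^bsub>V\<^esub> hat_triple x' y z"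
    "hat_triple y (x \<oplus>\<^bsub>V\<^esub> x') z = hat_triple y x z \<oplus>\<^bsub>V\<^esub> hat_triple y x' z"
    "hat_triple y z (x \<oplus>\<^bsub>V\<^esub> x') = hat_triple y z x \<oplus>\<^bsub>V\<^esub> hat_triple y z x'"
  using T.triple_add[of x x' y z] assms by simp_all

text \<open>The new composition has to agree with the action of the operators on the hull; only then
  does \<open>annihilator_zero\<close> apply to \<open>T\<close>.\<close>

lemma hat_ops:
  assumes "x \<in> carrier P" "y \<in> carrier P" "q \<in> hat"
  shows "left_op P x y \<odot>\<^bsub>E\<^esub> q = hat_triple x y q" "middle_op P x y \<odot>\<^bsub>E\<^esub> q = hat_triple x q y"
    "right_op P x y \<odot>\<^bsub>E\<^esub> q = hat_triple q x y"
proof -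
  have eq: "\<alpha> \<odot>\<^bsub>V\<^esub> (left_op P x y \<odot>\<^bsub>E\<^esub> q) = \<alpha> \<odot>\<^bsub>V\<^esub> hat_triple x y q"
    "\<alpha> \<odot>\<^bsub>V\<^esub> (middle_op P x y \<odot>\<^bsub>E\<^esub> q) = \<alpha> \<odot>\<^bsub>V\<^esub> hat_triple x q y"
    "\<alpha> \<odot>\<^bsub>V\<^esub> (right_op P x y \<odot>\<^bsub>E\<^esub> q) = \<alpha> \<odot>\<^bsub>V\<^esub> hat_triple q x y"
    if "\<alpha> \<in> B" "\<forall>u\<in>{q}. \<alpha> \<odot>\<^bsub>V\<^esub> u \<in> carrier Q" for \<alpha>
  proof -
    have "\<alpha> \<odot>\<^bsub>V\<^esub> (\<alpha> \<odot>\<^bsub>V\<^esub> q) = \<alpha> \<odot>\<^bsub>V\<^esub> q" using that assms by simp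
    then show "\<alpha> \<odot>\<^bsub>V\<^esub> (left_op P x y \<odot>\<^bsub>E\<^esub> q) = \<alpha> \<odot>\<^bsub>V\<^esub> hat_triple x y q"
      "\<alpha> \<odot>\<^bsub>V\<^esub> (middle_op P x y \<odot>\<^bsub>E\<^esub> q) = \<alpha> \<odot>\<^bsub>V\<^esub> hat_triple x q y"
      "\<alpha> \<odot>\<^bsub>V\<^esub> (right_op P x y \<odot>\<^bsub>E\<^esub> q) = \<alpha> \<odot>\<^bsub>V\<^esub> hat_triple q x y"
      using assms that Q_triple_smult(3)[of \<alpha> x y "\<alpha> \<odot>\<^bsub>V\<^esub> q"] Q_triple_smult(2)[of \<alpha> x "\<alpha> \<odot>\<^bsub>V\<^esub> q" y]
        Q_triple_smult(1)[of \<alpha> "\<alpha> \<odot>\<^bsub>V\<^esub> q" x y]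
      by (simp_all add: V_act Q_ops hat_triple(2) Q_triple_smult)
  qed
  show "left_op P x y \<odot>\<^bsub>E\<^esub> q = hat_triple x y q"
    by (rule hat_eqI[of "{q}", OF _ _ _ _ eq(1)]) (use assms in \<open>simp_all add: E.act_closed\<close>)
  show "middle_op P x y \<odot>\<^bsub>E\<^esub> q = hat_triple x q y"
    by (rule hat_eqI[of "{q}", OF _ _ _ _ eq(2)]) (use assms in \<open>simp_all add: E.act_closed\<close>)
  show "right_op P x y \<odot>\<^bsub>E\<^esub> q = hat_triple q x y"
    by (rule hat_eqI[of "{q}", OF _ _ _ _ eq(3)]) (use assms in \<open>simp_all add: E.act_closed\<close>)
qed

lemma submodule_of_hull_T: "submodule_of_hull C P E T"
  unfolding submodule_of_hull_def T_simps
proof (intro conjI ballI)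
  show "submodule hat mring E"
  proof (rule submodule_mringI)
    show "hat \<subseteq> carrier E" by auto
    show "\<zero>\<^bsub>E\<^esub> \<in> hat" using hat_closed(4) V_zero by simp
    show "v \<oplus>\<^bsub>E\<^esub> w \<in> hat" if "v \<in> hat" "w \<in> hat" for v w
      using hat_closed(2)[OF that] by (simp add: scalar_module_simps)
    show "scalar_operator P k \<odot>\<^bsub>E\<^esub> w \<in> hat" if "k \<in> carrier C" "w \<in> hat" for k w
      using hat_closed(1)[OF that] by (simp add: scalar_module_simps)
  qed (auto simp: hat_ops)
qed (auto simp: hat_ops scalar_module_simps)

lemma embedding_T: "triple_embedding C P T (\<lambda>x. x)"
  using embedding_Q unfolding triple_embedding_def
  by (auto simp: Q_add Q_smult hat_triple_Q)

section \<open>The completion of Q as a system of quotients\<close>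

lemma submodule_absorbing:
  assumes x: "x \<in> hat"
  defines "I \<equiv> {p \<in> carrier P. \<forall>a\<in>carrier mring. \<forall>s\<in>carrier P.
    hat_triple x s (a \<odot>\<^bsub>E\<^esub> p) \<in> carrier P \<and> hat_triple x (a \<odot>\<^bsub>E\<^esub> p) s \<in> carrier P \<and>
    hat_triple (a \<odot>\<^bsub>E\<^esub> p) x s \<in> carrier P}"
  shows "submodule I mring E" "absorbs T (carrier P) I x"
proof -
  have Pm: "a \<odot>\<^bsub>E\<^esub> p \<in> carrier P" if "a \<in> carrier mring" "p \<in> carrier P" for a p
    using submodule_mringD(4)[OF submodule_E that] .
  have zP: "\<zero>\<^bsub>V\<^esub> \<in> carrier P" using V_zero by simp
  have hz: "hat_triple u v \<zero>\<^bsub>V\<^esub> = \<zero>\<^bsub>V\<^esub>" "hat_triple u \<zero>\<^bsub>V\<^esub> v = \<zero>\<^bsub>V\<^esub>" "hat_triple \<zero>\<^bsub>V\<^esub> u v = \<zero>\<^bsub>V\<^esub>" if "u \<in> hat" "v \<in> hat" for u v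
    using T.triple_zero[of u v] that by simp_all
  \<comment> \<open>Quantifying over all operators in \<open>I\<close> makes it stable: two
    successive operators are again one operator. Absorption itself is the case of the identity
    operator.\<close>
  have act: "b \<odot>\<^bsub>E\<^esub> p \<in> I" if "b \<in> carrier mring" "p \<in> I" for b p
  proof -
    have p: "p \<in> carrier P" using that(2) unfolding I_def by simp
    have "a \<odot>\<^bsub>E\<^esub> (b \<odot>\<^bsub>E\<^esub> p) = (b \<otimes>\<^bsub>mring\<^esub> a) \<odot>\<^bsub>E\<^esub> p" if "a \<in> carrier mring" for a
      using E.act_mult[of b a p] that \<open>b \<in> carrier mring\<close> p by simp
    then show ?thesis using that p Pm unfolding I_def by auto
  qed
  show "submodule I mring E"
  proof (rule submodule_mringI)
    show "I \<subseteq> carrier E" unfolding I_def by auto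
    show "\<zero>\<^bsub>E\<^esub> \<in> I"
    proof -
      have "a \<odot>\<^bsub>E\<^esub> \<zero>\<^bsub>V\<^esub> = \<zero>\<^bsub>V\<^esub>" if "a \<in> carrier mring" for a using that unfolding V_zero(2) by simp
      then show ?thesis using zP hz x unfolding I_def V_zero(2)[symmetric] by simp
    qed
    fix v w assume vw: "v \<in> I" "w \<in> I"
    have "a \<odot>\<^bsub>E\<^esub> (v \<oplus>\<^bsub>E\<^esub> w) = a \<odot>\<^bsub>E\<^esub> v \<oplus>\<^bsub>V\<^esub> a \<odot>\<^bsub>E\<^esub> w" if "a \<in> carrier mring" for a
      using that vw unfolding I_def by (auto simp: E.act_add_vector scalar_module_simps)
    moreover have "v \<oplus>\<^bsub>E\<^esub> w \<in> carrier P"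
      using vw submodule_mringD(3)[OF submodule_E] unfolding I_def by auto
    ultimately show "v \<oplus>\<^bsub>E\<^esub> w \<in> I"
      using vw x Pm unfolding I_def by (auto simp: hat_triple_add)
  qed (auto intro!: act)
  show "absorbs T (carrier P) I x"
    unfolding absorbs_def T_simps
  proof (intro ballI)
    fix i s assume "i \<in> I" "s \<in> carrier P"
    then show "hat_triple x s i \<in> carrier P \<and> hat_triple x i s \<in> carrier P \<and> hat_triple i x s \<in> carrier P"
      using E.act_one[of i] E.A.one_closed unfolding I_def by fastforce
  qed
qed

lemma quotients_T: "M_quotients C P (\<lambda>x. x) T"
proof (rule M_quotientsI[OF T.linear_triple_jordan_axioms linear_triple_system_axioms embedding_T])
  fix x assume "x \<in> carrier T" "x \<noteq> \<zero>\<^bsub>T\<^esub>"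
  then have x: "x \<in> hat" "x \<noteq> \<zero>\<^bsub>V\<^esub>" by simp_all
  define D where "D = idempotent_domain (carrier Q) x"
  have D: "dense D" "\<And>\<alpha>. \<alpha> \<in> D \<Longrightarrow> \<alpha> \<in> B" "\<And>\<alpha>. \<alpha> \<in> D \<Longrightarrow> \<alpha> \<odot>\<^bsub>V\<^esub> x \<in> carrier Q"
    using completion_domain[OF submodule_Q x(1)] unfolding D_def idempotent_domain_def by auto
  obtain \<alpha>\<^sub>0 where \<alpha>\<^sub>0: "\<alpha>\<^sub>0 \<in> D" "\<alpha>\<^sub>0 \<odot>\<^bsub>V\<^esub> x \<noteq> \<zero>\<^bsub>V\<^esub>"
    using separated[OF D(1) hat_E[OF x(1)]] x(2) by blast
  have ideals: "\<exists>J. submodule J mring E \<and> J \<subseteq> carrier P \<and>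
      (\<forall>y\<in>carrier P. annihilates P (carrier P) J y \<longrightarrow> y = \<zero>\<^bsub>P\<^esub>) \<and> absorbs Q (carrier P) J q \<and>
      (q \<noteq> \<zero>\<^bsub>V\<^esub> \<longrightarrow> \<not> annihilates Q (carrier P) J q)" if q: "q \<in> carrier Q" for q
  proof -
    have *: "\<exists>J. submodule J mring E \<and> J \<subseteq> carrier P \<and>
      (\<forall>y\<in>carrier P. annihilates P (carrier P) J y \<longrightarrow> y = \<zero>\<^bsub>P\<^esub>) \<and> absorbs Q (carrier P) J q \<and>
      \<not> annihilates Q (carrier P) J q" if q: "q \<in> carrier Q" "q \<noteq> \<zero>\<^bsub>V\<^esub>" for q
    proof -
      obtain J where "submodule J C P" "ideal_of P (carrier P) J"
        "\<And>y. \<lbrakk>y \<in> carrier P; annihilates P (carrier P) J y\<rbrakk> \<Longrightarrow> y = \<zero>\<^bsub>P\<^esub>"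
        "\<not> annihilates Q ((\<lambda>x. x) ` carrier P) ((\<lambda>x. x) ` J) q" "absorbs Q ((\<lambda>x. x) ` carrier P) ((\<lambda>x. x) ` J) q"
        using M_quotientsE[OF quotients q(1)] q(2) Q_zero by metis
      moreover from this have "submodule J mring E" "J \<subseteq> carrier P"
        using ideal_submodule unfolding ideal_of_def by auto
      ultimately show ?thesis by (intro exI[of _ J]) simp
    qed
    show ?thesis
    proof (cases "q = \<zero>\<^bsub>V\<^esub>")
      case True
      obtain J where J: "submodule J mring E" "J \<subseteq> carrier P"
        "\<forall>y\<in>carrier P. annihilates P (carrier P) J y \<longrightarrow> y = \<zero>\<^bsub>P\<^esub>"
        using *[OF D(3)[OF \<alpha>\<^sub>0(1)] \<alpha>\<^sub>0(2)] by blast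
      moreover have "absorbs Q (carrier P) J q"
        unfolding absorbs_def True Q_zero[symmetric]
      proof (intro ballI)
        fix i s assume "i \<in> J" "s \<in> carrier P"
        moreover have "\<zero>\<^bsub>Q\<^esub> \<in> carrier P" using Q_zero V_zero(1) by simp
        ultimately show "triple Q \<zero>\<^bsub>Q\<^esub> s i \<in> carrier P \<and> triple Q \<zero>\<^bsub>Q\<^esub> i s \<in> carrier P \<and> triple Q i \<zero>\<^bsub>Q\<^esub> s \<in> carrier P"
          using J(2) by (simp add: subset_iff)
      qed
      ultimately show ?thesis using True by blast
    qed (use *[OF q] in blast)
  qed
  let ?I = "{p \<in> carrier P. \<forall>a\<in>carrier mring. \<forall>s\<in>carrier P.
    hat_triple x s (a \<odot>\<^bsub>E\<^esub> p) \<in> carrier P \<and> hat_triple x (a \<odot>\<^bsub>E\<^esub> p) s \<in> carrier P \<and>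
    hat_triple (a \<odot>\<^bsub>E\<^esub> p) x s \<in> carrier P}"
  note I = submodule_absorbing[OF x(1)]
  \<comment> \<open>The idempotent is shifted from the element of \<open>J\<close> to
    \<open>x\<close>: {x,s,\<alpha>j} = {\<alpha>x,s,j}, and \<alpha>x absorbs
    \<open>J\<close>.\<close>
  have into: "\<alpha> \<odot>\<^bsub>V\<^esub> j \<in> ?I" if \<alpha>: "\<alpha> \<in> D" and J: "submodule J mring E" "J \<subseteq> carrier P"
    "absorbs Q (carrier P) J (\<alpha> \<odot>\<^bsub>V\<^esub> x)" and j: "j \<in> J" for \<alpha> J j
  proof -
    have jP: "j \<in> carrier P" using J(2) j by auto
    have "hat_triple x s (a \<odot>\<^bsub>E\<^esub> (\<alpha> \<odot>\<^bsub>V\<^esub> j)) \<in> carrier P \<and> hat_triple x (a \<odot>\<^bsub>E\<^esub> (\<alpha> \<odot>\<^bsub>V\<^esub> j)) s \<in> carrier P \<and>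
      hat_triple (a \<odot>\<^bsub>E\<^esub> (\<alpha> \<odot>\<^bsub>V\<^esub> j)) x s \<in> carrier P" if a: "a \<in> carrier mring" and s: "s \<in> carrier P" for a s
    proof -
      have i: "a \<odot>\<^bsub>E\<^esub> j \<in> J" using submodule_mringD(4)[OF J(1) a j] .
      then have iP: "a \<odot>\<^bsub>E\<^esub> j \<in> carrier P" using J(2) by auto
      have eq: "a \<odot>\<^bsub>E\<^esub> (\<alpha> \<odot>\<^bsub>V\<^esub> j) = \<alpha> \<odot>\<^bsub>V\<^esub> (a \<odot>\<^bsub>E\<^esub> j)" using a D(2)[OF \<alpha>] jP by (simp add: V_act)
      have "hat_triple x s (\<alpha> \<odot>\<^bsub>V\<^esub> (a \<odot>\<^bsub>E\<^esub> j)) = triple Q (\<alpha> \<odot>\<^bsub>V\<^esub> x) s (a \<odot>\<^bsub>E\<^esub> j)"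
        "hat_triple x (\<alpha> \<odot>\<^bsub>V\<^esub> (a \<odot>\<^bsub>E\<^esub> j)) s = triple Q (\<alpha> \<odot>\<^bsub>V\<^esub> x) (a \<odot>\<^bsub>E\<^esub> j) s"
        "hat_triple (\<alpha> \<odot>\<^bsub>V\<^esub> (a \<odot>\<^bsub>E\<^esub> j)) x s = triple Q (a \<odot>\<^bsub>E\<^esub> j) (\<alpha> \<odot>\<^bsub>V\<^esub> x) s"
        using iP s x(1) D(2,3)[OF \<alpha>] by (simp_all add: hat_triple_smult flip: hat_triple_Q)
      then show ?thesis using J(3) i s unfolding eq absorbs_def by simp
    qed
    then show ?thesis using jP D(2)[OF \<alpha>] by simp
  qed
  have "y = \<zero>\<^bsub>P\<^esub>" if y: "y \<in> carrier P" "annihilates P (carrier P) ?I y" for y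
  proof -
    have "y = \<zero>\<^bsub>V\<^esub>"
    proof (rule separated[OF D(1)])
      fix \<alpha> assume \<alpha>: "\<alpha> \<in> D"
      obtain J where J: "submodule J mring E" "J \<subseteq> carrier P"
        "\<forall>y\<in>carrier P. annihilates P (carrier P) J y \<longrightarrow> y = \<zero>\<^bsub>P\<^esub>" "absorbs Q (carrier P) J (\<alpha> \<odot>\<^bsub>V\<^esub> x)"
        using ideals[OF D(3)[OF \<alpha>]] by blast
      \<comment> \<open>Shifting \<alpha> from \<alpha>i to \<open>y\<close> shows that \<alpha>y
        annihilates the ideal belonging to \<alpha>x. So \<alpha>y = 0 for all \<alpha> in the dense
        set \<open>D\<close>.\<close>
      have "annihilates P (carrier P) J (\<alpha> \<odot>\<^bsub>P\<^esub> y)"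
        unfolding annihilates_def
      proof (intro ballI)
        fix i s assume i: "i \<in> J" and s: "s \<in> carrier P"
        have iP: "i \<in> carrier P" using J(2) i by auto
        have "\<alpha> \<odot>\<^bsub>P\<^esub> i \<in> ?I" using into[OF \<alpha> J(1,2,4) i] D(2)[OF \<alpha>] iP by (simp add: P_smult)
        then have "triple P y s (\<alpha> \<odot>\<^bsub>P\<^esub> i) = \<zero>\<^bsub>P\<^esub>" "triple P y (\<alpha> \<odot>\<^bsub>P\<^esub> i) s = \<zero>\<^bsub>P\<^esub>" "triple P (\<alpha> \<odot>\<^bsub>P\<^esub> i) y s = \<zero>\<^bsub>P\<^esub>"
          using y(2) s unfolding annihilates_def by blast+
        then show "triple P (\<alpha> \<odot>\<^bsub>P\<^esub> y) s i = \<zero>\<^bsub>P\<^esub> \<and> triple P (\<alpha> \<odot>\<^bsub>P\<^esub> y) i s = \<zero>\<^bsub>P\<^esub> \<and> triple P i (\<alpha> \<odot>\<^bsub>P\<^esub> y) s = \<zero>\<^bsub>P\<^esub>"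
          using iP s y(1) D(2)[OF \<alpha>] by (simp add: triple_smult)
      qed
      then have "\<alpha> \<odot>\<^bsub>P\<^esub> y = \<zero>\<^bsub>P\<^esub>" using J(3) y(1) D(2)[OF \<alpha>] by simp
      then show "\<alpha> \<odot>\<^bsub>V\<^esub> y = \<zero>\<^bsub>V\<^esub>" using P_smult D(2)[OF \<alpha>] y(1) V_zero by simp
    qed (use y in auto)
    then show ?thesis using V_zero by simp
  qed
  moreover have "\<not> annihilates T (carrier P) ?I x"
  proof
    assume ann: "annihilates T (carrier P) ?I x"
    obtain J where J: "submodule J mring E" "J \<subseteq> carrier P" "absorbs Q (carrier P) J (\<alpha>\<^sub>0 \<odot>\<^bsub>V\<^esub> x)"
      "\<not> annihilates Q (carrier P) J (\<alpha>\<^sub>0 \<odot>\<^bsub>V\<^esub> x)"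
      using ideals[OF D(3)[OF \<alpha>\<^sub>0(1)]] \<alpha>\<^sub>0(2) by blast
    \<comment> \<open>If \<open>x\<close> annihilated \<open>?I\<close>, its nonzero piece at
      \<open>\<alpha>\<^sub>0\<close> would annihilate the very ideal that was chosen to detect
      it.\<close>
    have "annihilates Q (carrier P) J (\<alpha>\<^sub>0 \<odot>\<^bsub>V\<^esub> x)"
      unfolding annihilates_def
    proof (intro ballI)
      fix i s assume i: "i \<in> J" and s: "s \<in> carrier P"
      have iP: "i \<in> carrier P" using J(2) i by auto
      have "\<alpha>\<^sub>0 \<odot>\<^bsub>V\<^esub> i \<in> ?I" using into[OF \<alpha>\<^sub>0(1) J(1,2,3) i] .
      then have "hat_triple x s (\<alpha>\<^sub>0 \<odot>\<^bsub>V\<^esub> i) = \<zero>\<^bsub>V\<^esub> \<and> hat_triple x (\<alpha>\<^sub>0 \<odot>\<^bsub>V\<^esub> i) s = \<zero>\<^bsub>V\<^esub> \<and> hat_triple (\<alpha>\<^sub>0 \<odot>\<^bsub>V\<^esub> i) x s = \<zero>\<^bsub>V\<^esub>"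
        using ann s unfolding annihilates_def T_simps by blast
      then show "triple Q (\<alpha>\<^sub>0 \<odot>\<^bsub>V\<^esub> x) s i = \<zero>\<^bsub>Q\<^esub> \<and> triple Q (\<alpha>\<^sub>0 \<odot>\<^bsub>V\<^esub> x) i s = \<zero>\<^bsub>Q\<^esub> \<and> triple Q i (\<alpha>\<^sub>0 \<odot>\<^bsub>V\<^esub> x) s = \<zero>\<^bsub>Q\<^esub>"
        using iP s x(1) D(2,3)[OF \<alpha>\<^sub>0(1)] by (simp add: hat_triple_smult Q_zero flip: hat_triple_Q)
    qed
    then show False using J(4) by simp
  qed
  moreover have IP: "?I \<subseteq> carrier P" by blast
  ultimately show "\<exists>I. submodule I C P \<and> ideal_of P (carrier P) I \<and>
      (\<forall>x\<in>carrier P. annihilates P (carrier P) I x \<longrightarrow> x = \<zero>\<^bsub>P\<^esub>) \<and>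
      \<not> annihilates T ((\<lambda>x. x) ` carrier P) ((\<lambda>x. x) ` I) x \<and> absorbs T ((\<lambda>x. x) ` carrier P) ((\<lambda>x. x) ` I) x"
    using I(2) submodule_base[OF I(1) IP] submodule_ideal_of[OF I(1) IP]
    by (intro exI[of _ ?I]) simp
qed

text \<open>
  Maximality embeds the completion into \<open>Q\<close>; the embedding is the identity, because its
  difference with the identity annihilates an ideal of \<open>P\<close> without annihilator.
\<close>

lemma completion_Q: "hat = carrier Q"
proof
  obtain \<phi> where \<phi>: "triple_embedding C T Q \<phi>" "\<And>p. p \<in> carrier P \<Longrightarrow> \<phi> p = p"
    using M_quotients_lift[OF quotients_T maximal] by blast
  have \<phi>Q: "\<phi> x \<in> carrier Q" if "x \<in> hat" for x using \<phi>(1) that unfolding triple_embedding_def by auto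
  have \<phi>t: "\<phi> (hat_triple x y z) = triple Q (\<phi> x) (\<phi> y) (\<phi> z)" if "x \<in> hat" "y \<in> hat" "z \<in> hat" for x y z
    using \<phi>(1) that unfolding triple_embedding_def by simp
  show "hat \<subseteq> carrier Q"
  proof
    fix x assume x: "x \<in> hat"
    show "x \<in> carrier Q"
    proof (cases "x = \<zero>\<^bsub>V\<^esub>")
      case True
      then show ?thesis using Q_zero Q.M.zero_closed by simp
    next
      case False
      obtain I where I: "submodule I C P" "ideal_of P (carrier P) I"
        "\<And>y. \<lbrakk>y \<in> carrier P; annihilates P (carrier P) I y\<rbrakk> \<Longrightarrow> y = \<zero>\<^bsub>P\<^esub>"
        "absorbs T ((\<lambda>x. x) ` carrier P) ((\<lambda>x. x) ` I) x"
        using M_quotientsE[OF quotients_T, of x] x False by (metis T_simps(1,2))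
      define d where "d = \<phi> x \<oplus>\<^bsub>V\<^esub> \<ominus>\<^bsub>V\<^esub> x"
      have d: "d \<in> hat" unfolding d_def using x \<phi>Q by simp
      have "annihilates T (carrier P) I d"
        unfolding annihilates_def T_simps
      proof (intro ballI)
        fix i s assume i: "i \<in> I" and s: "s \<in> carrier P"
        have iP: "i \<in> carrier P" using I(2) i unfolding ideal_of_def by auto
        have in_P: "hat_triple x s i \<in> carrier P" "hat_triple x i s \<in> carrier P" "hat_triple i x s \<in> carrier P"
          using I(4) i s unfolding absorbs_def by simp_all
        \<comment> \<open>The product {x,s,i} lies in \<open>P\<close>, where \<phi> is the
          identity; evaluating \<phi> on it replaces \<open>x\<close> by \<phi>(x) and changes
          nothing else.\<close>
        have fix_\<phi>: "hat_triple (\<phi> x) s i = hat_triple x s i" "hat_triple (\<phi> x) i s = hat_triple x i s"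
          "hat_triple i (\<phi> x) s = hat_triple i x s"
          using \<phi>(2)[OF in_P(1)] \<phi>(2)[OF in_P(2)] \<phi>(2)[OF in_P(3)] \<phi>(2)[OF s] \<phi>(2)[OF iP] x s iP \<phi>Q[OF x]
          by (simp_all add: \<phi>t hat_triple_Q)
        have minus: "\<ominus>\<^bsub>V\<^esub> x = (\<ominus> \<one>) \<odot>\<^bsub>V\<^esub> x" using x by (simp add: V.smult_l_minus)
        have cancel: "u \<oplus>\<^bsub>V\<^esub> (\<ominus> \<one>) \<odot>\<^bsub>V\<^esub> u = \<zero>\<^bsub>V\<^esub>" if "u \<in> hat" for u
          using that by (simp add: V.smult_l_minus V.M.r_neg)
        show "hat_triple d s i = \<zero>\<^bsub>V\<^esub> \<and> hat_triple d i s = \<zero>\<^bsub>V\<^esub> \<and> hat_triple i d s = \<zero>\<^bsub>V\<^esub>"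
          unfolding d_def minus using x \<phi>Q[OF x] s iP
          by (simp add: hat_triple_add hat_triple_smult fix_\<phi> cancel)
      qed
      then have "d = \<zero>\<^bsub>V\<^esub>"
        using annihilator_zero[OF T.linear_triple_jordan_axioms submodule_of_hull_T embedding_T I(2,3), of d] d V_zero
        by simp
      then have "\<phi> x = x"
        using x \<phi>Q[OF x] V.M.minus_equality[of "\<phi> x" "\<ominus>\<^bsub>V\<^esub> x"] unfolding d_def by simp
      then show ?thesis using \<phi>Q[OF x] by simp
    qed
  qed
qed auto

end


section \<open>Localisation at an ultrafilter\<close>

locale localised_system = linear_triple_system K R
  for K :: "('k, 'n) ring_scheme" (structure)
    and R :: "('k, 'a, 'm) triple_system_scheme" (structure) +
  fixes U :: "'k set"
  assumes ultrafilter: "is_ultrafilter K U"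
begin

abbreviation cls :: "'a \<Rightarrow> 'a set" where "cls x \<equiv> local_kernel K U R +>\<^bsub>R\<^esub> x"

lemma U_idempotent: "\<alpha> \<in> U \<Longrightarrow> \<alpha> \<in> carrier K" "\<alpha> \<in> U \<Longrightarrow> \<alpha> \<otimes> \<alpha> = \<alpha>" "\<zero> \<notin> U"
  and U_mult: "\<lbrakk>\<alpha> \<in> U; \<beta> \<in> U\<rbrakk> \<Longrightarrow> \<alpha> \<otimes> \<beta> \<in> U"
  using ultrafilter unfolding is_ultrafilter_def idempotents_def by auto

lemma U_complement:
  assumes "\<alpha> \<in> idempotents K"
  shows "\<alpha> \<in> U \<longleftrightarrow> \<one> \<ominus> \<alpha> \<notin> U"
proof -
  have a: "\<alpha> \<in> carrier K" "\<alpha> \<otimes> \<alpha> = \<alpha>" using assms unfolding idempotents_def by auto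
  then have "\<alpha> \<otimes> (\<one> \<ominus> \<alpha>) = \<zero>" by (simp add: R.minus_eq R.r_distr R.r_minus R.r_neg)
  then have "\<not> (\<alpha> \<in> U \<and> \<one> \<ominus> \<alpha> \<in> U)" using U_mult[of \<alpha> "\<one> \<ominus> \<alpha>"] U_idempotent(3) by auto
  then show ?thesis using ultrafilter assms unfolding is_ultrafilter_def by blast
qed

lemma complement_idempotent: "\<alpha> \<in> idempotents K \<Longrightarrow> \<one> \<ominus> \<alpha> \<in> idempotents K"
  unfolding idempotents_def
  by (auto simp: R.minus_eq R.r_distr R.l_distr R.r_minus R.l_minus R.r_neg R.minus_add)

lemma one_U: "\<one> \<in> U"
proof -
  have "\<one> \<ominus> \<one> \<notin> U" using U_idempotent(3) by (simp add: R.minus_eq R.r_neg)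
  then show ?thesis using U_complement[of \<one>] unfolding idempotents_def by simp
qed

text \<open>An element \<alpha>y with \<alpha> outside \<open>U\<close> is killed by 1 - \<alpha>,
  which belongs to \<open>U\<close>; conversely \<alpha>x = 0 gives x = (1 - \<alpha>)x. Elements
  thus have the same class exactly when some member of \<open>U\<close> makes them equal.\<close>

lemma local_kernel_iff: "x \<in> local_kernel K U R \<longleftrightarrow> x \<in> carrier R \<and> (\<exists>\<alpha>\<in>U. \<alpha> \<odot>\<^bsub>R\<^esub> x = \<zero>\<^bsub>R\<^esub>)"
proof
  assume "x \<in> local_kernel K U R"
  then obtain \<alpha> y where x: "x \<in> carrier R" "x = \<alpha> \<odot>\<^bsub>R\<^esub> y" "y \<in> carrier R" "\<alpha> \<in> idempotents K" "\<alpha> \<notin> U"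
    unfolding local_kernel_def by blast
  then have a: "\<alpha> \<in> carrier K" "\<alpha> \<otimes> \<alpha> = \<alpha>" unfolding idempotents_def by auto
  then have "(\<one> \<ominus> \<alpha>) \<otimes> \<alpha> = \<zero>" by (simp add: R.minus_eq R.l_distr R.l_minus R.r_neg)
  then have "(\<one> \<ominus> \<alpha>) \<odot>\<^bsub>R\<^esub> x = \<zero>\<^bsub>R\<^esub>" using x a by (simp flip: smult_assoc1)
  moreover have "\<one> \<ominus> \<alpha> \<in> U" using U_complement[OF x(4)] x(5) by simp
  ultimately show "x \<in> carrier R \<and> (\<exists>\<alpha>\<in>U. \<alpha> \<odot>\<^bsub>R\<^esub> x = \<zero>\<^bsub>R\<^esub>)" using x(1) by blast
next
  assume "x \<in> carrier R \<and> (\<exists>\<alpha>\<in>U. \<alpha> \<odot>\<^bsub>R\<^esub> x = \<zero>\<^bsub>R\<^esub>)"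
  then obtain \<alpha> where x: "x \<in> carrier R" "\<alpha> \<in> U" "\<alpha> \<odot>\<^bsub>R\<^esub> x = \<zero>\<^bsub>R\<^esub>" by blast
  then have a: "\<alpha> \<in> idempotents K" "\<alpha> \<in> carrier K" using U_idempotent unfolding idempotents_def by auto
  have "x = (\<one> \<ominus> \<alpha>) \<odot>\<^bsub>R\<^esub> x"
    using x a(2) by (simp add: R.minus_eq smult_l_distr smult_l_minus)
  moreover have "\<one> \<ominus> \<alpha> \<notin> U" using U_complement[OF a(1)] x(2) by simp
  ultimately show "x \<in> local_kernel K U R"
    using x(1) complement_idempotent[OF a(1)] unfolding local_kernel_def by blast
qed

lemma cls_eq:
  assumes x: "x \<in> carrier R"
  shows "cls x = {y \<in> carrier R. \<exists>\<alpha>\<in>U. \<alpha> \<odot>\<^bsub>R\<^esub> y = \<alpha> \<odot>\<^bsub>R\<^esub> x}"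
proof (intro equalityI subsetI)
  fix y assume "y \<in> cls x"
  then obtain n where n: "n \<in> local_kernel K U R" "y = n \<oplus>\<^bsub>R\<^esub> x" unfolding a_r_coset_def' by auto
  then obtain \<alpha> where "\<alpha> \<in> U" "\<alpha> \<odot>\<^bsub>R\<^esub> n = \<zero>\<^bsub>R\<^esub>" "n \<in> carrier R" unfolding local_kernel_iff by blast
  then show "y \<in> {y \<in> carrier R. \<exists>\<alpha>\<in>U. \<alpha> \<odot>\<^bsub>R\<^esub> y = \<alpha> \<odot>\<^bsub>R\<^esub> x}"
    using n(2) x U_idempotent(1) by (auto simp: smult_r_distr intro!: bexI[of _ \<alpha>])
next
  fix y assume "y \<in> {y \<in> carrier R. \<exists>\<alpha>\<in>U. \<alpha> \<odot>\<^bsub>R\<^esub> y = \<alpha> \<odot>\<^bsub>R\<^esub> x}"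
  then obtain \<alpha> where y: "y \<in> carrier R" "\<alpha> \<in> U" "\<alpha> \<odot>\<^bsub>R\<^esub> y = \<alpha> \<odot>\<^bsub>R\<^esub> x" by blast
  then have "\<alpha> \<odot>\<^bsub>R\<^esub> (y \<oplus>\<^bsub>R\<^esub> \<ominus>\<^bsub>R\<^esub> x) = \<zero>\<^bsub>R\<^esub>"
    using x U_idempotent(1) by (simp add: smult_r_distr smult_r_minus M.r_neg)
  then have "y \<oplus>\<^bsub>R\<^esub> \<ominus>\<^bsub>R\<^esub> x \<in> local_kernel K U R" using y x unfolding local_kernel_iff by auto
  moreover have "y = (y \<oplus>\<^bsub>R\<^esub> \<ominus>\<^bsub>R\<^esub> x) \<oplus>\<^bsub>R\<^esub> x" using x y by (simp add: M.a_assoc M.l_neg)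
  ultimately show "y \<in> cls x" unfolding a_r_coset_def' by blast
qed

lemma cls_eq_iff:
  assumes "x \<in> carrier R" "y \<in> carrier R"
  shows "cls x = cls y \<longleftrightarrow> (\<exists>\<alpha>\<in>U. \<alpha> \<odot>\<^bsub>R\<^esub> x = \<alpha> \<odot>\<^bsub>R\<^esub> y)"
proof
  assume "cls x = cls y"
  moreover have "x \<in> cls x" using assms(1) one_U unfolding cls_eq[OF assms(1)] by blast
  ultimately have "x \<in> cls y" by simp
  then show "\<exists>\<alpha>\<in>U. \<alpha> \<odot>\<^bsub>R\<^esub> x = \<alpha> \<odot>\<^bsub>R\<^esub> y" unfolding cls_eq[OF assms(2)] by simp
next
  assume "\<exists>\<alpha>\<in>U. \<alpha> \<odot>\<^bsub>R\<^esub> x = \<alpha> \<odot>\<^bsub>R\<^esub> y"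
  then obtain \<alpha> where a: "\<alpha> \<in> U" "\<alpha> \<odot>\<^bsub>R\<^esub> x = \<alpha> \<odot>\<^bsub>R\<^esub> y" by blast
  have sub: "{u \<in> carrier R. \<exists>\<alpha>\<in>U. \<alpha> \<odot>\<^bsub>R\<^esub> u = \<alpha> \<odot>\<^bsub>R\<^esub> x} \<subseteq> {u \<in> carrier R. \<exists>\<alpha>\<in>U. \<alpha> \<odot>\<^bsub>R\<^esub> u = \<alpha> \<odot>\<^bsub>R\<^esub> y}"
    if "x \<in> carrier R" "y \<in> carrier R" "\<alpha> \<odot>\<^bsub>R\<^esub> x = \<alpha> \<odot>\<^bsub>R\<^esub> y" for x y
  proof
    fix u assume "u \<in> {u \<in> carrier R. \<exists>\<alpha>\<in>U. \<alpha> \<odot>\<^bsub>R\<^esub> u = \<alpha> \<odot>\<^bsub>R\<^esub> x}"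
    then obtain \<beta> where u: "u \<in> carrier R" "\<beta> \<in> U" "\<beta> \<odot>\<^bsub>R\<^esub> u = \<beta> \<odot>\<^bsub>R\<^esub> x" by blast
    note c = U_idempotent(1)[OF a(1)] U_idempotent(1)[OF u(2)]
    have "(\<alpha> \<otimes> \<beta>) \<odot>\<^bsub>R\<^esub> u = \<alpha> \<odot>\<^bsub>R\<^esub> (\<beta> \<odot>\<^bsub>R\<^esub> x)" using c u by (simp add: smult_assoc1)
    also have "\<dots> = \<beta> \<odot>\<^bsub>R\<^esub> (\<alpha> \<odot>\<^bsub>R\<^esub> x)" using c that(1,2) by (simp add: R.m_comm flip: smult_assoc1)
    also have "\<dots> = \<beta> \<odot>\<^bsub>R\<^esub> (\<alpha> \<odot>\<^bsub>R\<^esub> y)" unfolding that(3) ..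
    also have "\<dots> = (\<alpha> \<otimes> \<beta>) \<odot>\<^bsub>R\<^esub> y" using c that(1,2) by (simp add: R.m_comm flip: smult_assoc1)
    finally show "u \<in> {u \<in> carrier R. \<exists>\<alpha>\<in>U. \<alpha> \<odot>\<^bsub>R\<^esub> u = \<alpha> \<odot>\<^bsub>R\<^esub> y}"
      using u(1) U_mult[OF a(1) u(2)] by blast
  qed
  show "cls x = cls y"
    unfolding cls_eq[OF assms(1)] cls_eq[OF assms(2)]
    using sub[OF assms a(2)] sub[OF assms(2,1) a(2)[symmetric]] by blast
qed

lemma cls_zero_iff: "x \<in> carrier R \<Longrightarrow> cls x = cls \<zero>\<^bsub>R\<^esub> \<longleftrightarrow> (\<exists>\<alpha>\<in>U. \<alpha> \<odot>\<^bsub>R\<^esub> x = \<zero>\<^bsub>R\<^esub>)"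
  by (simp add: cls_eq_iff U_idempotent(1) cong: bex_cong)

lemma mem_cls_iff:
  assumes "x \<in> carrier R" shows "y \<in> cls x \<longleftrightarrow> y \<in> carrier R \<and> cls y = cls x"
proof -
  have "y \<in> cls x \<longleftrightarrow> y \<in> carrier R \<and> (\<exists>\<alpha>\<in>U. \<alpha> \<odot>\<^bsub>R\<^esub> y = \<alpha> \<odot>\<^bsub>R\<^esub> x)"
    unfolding cls_eq[OF assms] by simp
  then show ?thesis using cls_eq_iff[OF _ assms, of y] by blast
qed

lemma cls_cong_smult:
  assumes "k \<in> carrier K" "x \<in> carrier R" "x' \<in> carrier R" "cls x = cls x'"
  shows "cls (k \<odot>\<^bsub>R\<^esub> x) = cls (k \<odot>\<^bsub>R\<^esub> x')"
proof -
  obtain \<alpha> where a: "\<alpha> \<in> U" "\<alpha> \<odot>\<^bsub>R\<^esub> x = \<alpha> \<odot>\<^bsub>R\<^esub> x'" using assms cls_eq_iff by blast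
  have "\<alpha> \<odot>\<^bsub>R\<^esub> (k \<odot>\<^bsub>R\<^esub> x) = k \<odot>\<^bsub>R\<^esub> (\<alpha> \<odot>\<^bsub>R\<^esub> x)" "k \<odot>\<^bsub>R\<^esub> (\<alpha> \<odot>\<^bsub>R\<^esub> x') = \<alpha> \<odot>\<^bsub>R\<^esub> (k \<odot>\<^bsub>R\<^esub> x')"
    using assms U_idempotent(1)[OF a(1)] by (simp_all add: R.m_comm flip: smult_assoc1)
  then have "\<alpha> \<odot>\<^bsub>R\<^esub> (k \<odot>\<^bsub>R\<^esub> x) = \<alpha> \<odot>\<^bsub>R\<^esub> (k \<odot>\<^bsub>R\<^esub> x')" using a(2) by simp
  then show ?thesis using cls_eq_iff[of "k \<odot>\<^bsub>R\<^esub> x" "k \<odot>\<^bsub>R\<^esub> x'"] assms a(1) by auto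
qed

lemma smult_triple_cube:
  assumes "\<alpha> \<in> U" "x \<in> carrier R" "y \<in> carrier R" "z \<in> carrier R"
  shows "\<alpha> \<odot>\<^bsub>R\<^esub> triple R x y z = triple R (\<alpha> \<odot>\<^bsub>R\<^esub> x) (\<alpha> \<odot>\<^bsub>R\<^esub> y) (\<alpha> \<odot>\<^bsub>R\<^esub> z)"
  using assms U_idempotent by (simp add: triple_smult flip: smult_assoc1)

lemma smult_product_cong:
  assumes "\<alpha> \<in> U" "\<beta> \<in> U" "x \<in> carrier R" "x' \<in> carrier R" "\<alpha> \<odot>\<^bsub>R\<^esub> x = \<alpha> \<odot>\<^bsub>R\<^esub> x'"
  shows "(\<alpha> \<otimes> \<beta>) \<odot>\<^bsub>R\<^esub> x = (\<alpha> \<otimes> \<beta>) \<odot>\<^bsub>R\<^esub> x'" "(\<beta> \<otimes> \<alpha>) \<odot>\<^bsub>R\<^esub> x = (\<beta> \<otimes> \<alpha>) \<odot>\<^bsub>R\<^esub> x'"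
proof -
  note c = U_idempotent(1)[OF assms(1)] U_idempotent(1)[OF assms(2)]
  show "(\<beta> \<otimes> \<alpha>) \<odot>\<^bsub>R\<^esub> x = (\<beta> \<otimes> \<alpha>) \<odot>\<^bsub>R\<^esub> x'" using assms c by (simp add: smult_assoc1)
  then show "(\<alpha> \<otimes> \<beta>) \<odot>\<^bsub>R\<^esub> x = (\<alpha> \<otimes> \<beta>) \<odot>\<^bsub>R\<^esub> x'" using R.m_comm[OF c] by simp
qed

lemma cls_cong_triple:
  assumes "x \<in> carrier R" "x' \<in> carrier R" "cls x = cls x'"
    "y \<in> carrier R" "y' \<in> carrier R" "cls y = cls y'" "z \<in> carrier R" "z' \<in> carrier R" "cls z = cls z'"
  shows "cls (triple R x y z) = cls (triple R x' y' z')"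
proof -
  obtain \<alpha> where a: "\<alpha> \<in> U" "\<alpha> \<odot>\<^bsub>R\<^esub> x = \<alpha> \<odot>\<^bsub>R\<^esub> x'" using assms(3) cls_eq_iff[OF assms(1,2)] by blast
  obtain \<beta> where b: "\<beta> \<in> U" "\<beta> \<odot>\<^bsub>R\<^esub> y = \<beta> \<odot>\<^bsub>R\<^esub> y'" using assms(6) cls_eq_iff[OF assms(4,5)] by blast
  obtain \<gamma> where c: "\<gamma> \<in> U" "\<gamma> \<odot>\<^bsub>R\<^esub> z = \<gamma> \<odot>\<^bsub>R\<^esub> z'" using assms(9) cls_eq_iff[OF assms(7,8)] by blast
  \<comment> \<open>A single member of \<open>U\<close> on which all three pairs agree, available
    because \<open>U\<close> is closed under products.\<close>
  let ?\<delta> = "(\<alpha> \<otimes> \<beta>) \<otimes> \<gamma>"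
  have ab: "\<alpha> \<otimes> \<beta> \<in> U" using U_mult[OF a(1) b(1)] .
  have d: "?\<delta> \<in> U" using U_mult[OF ab c(1)] .
  have "?\<delta> \<odot>\<^bsub>R\<^esub> x = ?\<delta> \<odot>\<^bsub>R\<^esub> x'"
    using smult_product_cong(1)[OF ab c(1) assms(1,2) smult_product_cong(1)[OF a(1) b(1) assms(1,2) a(2)]] .
  moreover have "?\<delta> \<odot>\<^bsub>R\<^esub> y = ?\<delta> \<odot>\<^bsub>R\<^esub> y'"
    using smult_product_cong(1)[OF ab c(1) assms(4,5) smult_product_cong(2)[OF b(1) a(1) assms(4,5) b(2)]] .
  moreover have "?\<delta> \<odot>\<^bsub>R\<^esub> z = ?\<delta> \<odot>\<^bsub>R\<^esub> z'"
    using smult_product_cong(2)[OF c(1) ab assms(7,8) c(2)] .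
  ultimately have "?\<delta> \<odot>\<^bsub>R\<^esub> triple R x y z = ?\<delta> \<odot>\<^bsub>R\<^esub> triple R x' y' z'"
    using assms(1,2,4,5,7,8) by (simp only: smult_triple_cube[OF d])
  then show ?thesis
    using cls_eq_iff[of "triple R x y z" "triple R x' y' z'"] assms(1,2,4,5,7,8) d by blast
qed

lemma cls_self: "x \<in> carrier R \<Longrightarrow> x \<in> cls x"
  by (simp add: mem_cls_iff)

lemma cls_zero: "cls \<zero>\<^bsub>R\<^esub> = local_kernel K U R"
  unfolding cls_eq[OF M.zero_closed] set_eq_iff local_kernel_iff using U_idempotent(1) by auto

text \<open>Scalar multiplication and composition are defined as unions over representatives; by
  congruence all members of such a union coincide, leaving a single coset.\<close>

lemma localisation_simps:
  "carrier (localisation K U R) = cls ` carrier R" "\<zero>\<^bsub>localisation K U R\<^esub> = cls \<zero>\<^bsub>R\<^esub>"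
  "\<lbrakk>x \<in> carrier R; y \<in> carrier R\<rbrakk> \<Longrightarrow> cls x \<oplus>\<^bsub>localisation K U R\<^esub> cls y = cls (x \<oplus>\<^bsub>R\<^esub> y)"
  "\<lbrakk>k \<in> carrier K; x \<in> carrier R\<rbrakk> \<Longrightarrow> k \<odot>\<^bsub>localisation K U R\<^esub> cls x = cls (k \<odot>\<^bsub>R\<^esub> x)"
  "\<lbrakk>x \<in> carrier R; y \<in> carrier R; z \<in> carrier R\<rbrakk> \<Longrightarrow>
    triple (localisation K U R) (cls x) (cls y) (cls z) = cls (triple R x y z)"
proof -
  show "carrier (localisation K U R) = cls ` carrier R"
    by (auto simp: localisation_def Let_def A_RCOSETS_def RCOSETS_def a_r_coset_def)
  show "\<zero>\<^bsub>localisation K U R\<^esub> = cls \<zero>\<^bsub>R\<^esub>"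
    by (simp add: localisation_def Let_def cls_zero)
  show "cls x \<oplus>\<^bsub>localisation K U R\<^esub> cls y = cls (x \<oplus>\<^bsub>R\<^esub> y)" if x: "x \<in> carrier R" "y \<in> carrier R"
  proof -
    have "cls x <+>\<^bsub>R\<^esub> cls y = cls (x \<oplus>\<^bsub>R\<^esub> y)"
    proof (intro equalityI subsetI)
      fix w assume "w \<in> cls x <+>\<^bsub>R\<^esub> cls y"
      then obtain u v where w: "w = u \<oplus>\<^bsub>R\<^esub> v" "u \<in> cls x" "v \<in> cls y" unfolding set_add_def' by blast
      then obtain \<alpha> \<beta> where a: "u \<in> carrier R" "v \<in> carrier R" "\<alpha> \<in> U" "\<alpha> \<odot>\<^bsub>R\<^esub> u = \<alpha> \<odot>\<^bsub>R\<^esub> x"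
        "\<beta> \<in> U" "\<beta> \<odot>\<^bsub>R\<^esub> v = \<beta> \<odot>\<^bsub>R\<^esub> y"
        unfolding cls_eq[OF x(1)] cls_eq[OF x(2)] by blast
      have "(\<alpha> \<otimes> \<beta>) \<odot>\<^bsub>R\<^esub> w = (\<alpha> \<otimes> \<beta>) \<odot>\<^bsub>R\<^esub> (x \<oplus>\<^bsub>R\<^esub> y)"
        unfolding w(1) using a x smult_product_cong(1)[OF a(3,5,1) x(1) a(4)]
          smult_product_cong(2)[OF a(5,3,2) x(2) a(6)] U_idempotent(1)
        by (simp add: smult_r_distr)
      then show "w \<in> cls (x \<oplus>\<^bsub>R\<^esub> y)" using w(1) a x U_mult[OF a(3,5)] by (auto simp: cls_eq)
    next
      fix w assume "w \<in> cls (x \<oplus>\<^bsub>R\<^esub> y)"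
      then obtain \<alpha> where a: "w \<in> carrier R" "\<alpha> \<in> U" "\<alpha> \<odot>\<^bsub>R\<^esub> w = \<alpha> \<odot>\<^bsub>R\<^esub> (x \<oplus>\<^bsub>R\<^esub> y)"
        using x by (auto simp: cls_eq)
      then have "\<alpha> \<odot>\<^bsub>R\<^esub> (w \<oplus>\<^bsub>R\<^esub> \<ominus>\<^bsub>R\<^esub> y) = \<alpha> \<odot>\<^bsub>R\<^esub> x"
        using x U_idempotent(1)[OF a(2)]
        by (simp add: smult_r_distr smult_r_minus M.a_assoc M.r_neg)
      then have "w \<oplus>\<^bsub>R\<^esub> \<ominus>\<^bsub>R\<^esub> y \<in> cls x" using x a by (auto simp: cls_eq)
      moreover have "w = (w \<oplus>\<^bsub>R\<^esub> \<ominus>\<^bsub>R\<^esub> y) \<oplus>\<^bsub>R\<^esub> y" using x a by (simp add: M.a_assoc M.l_neg)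
      ultimately show "w \<in> cls x <+>\<^bsub>R\<^esub> cls y"
        using cls_self[OF x(2)] unfolding set_add_def' by blast
    qed
    then show ?thesis by (simp add: localisation_def Let_def)
  qed
  show "k \<odot>\<^bsub>localisation K U R\<^esub> cls x = cls (k \<odot>\<^bsub>R\<^esub> x)" if k: "k \<in> carrier K" and x: "x \<in> carrier R"
  proof -
    have "cls (k \<odot>\<^bsub>R\<^esub> x') = cls (k \<odot>\<^bsub>R\<^esub> x)" if "x' \<in> cls x" for x'
      using that k x mem_cls_iff[OF x] by (intro cls_cong_smult) auto
    then have "(\<Union>x'\<in>cls x. cls (k \<odot>\<^bsub>R\<^esub> x')) = cls (k \<odot>\<^bsub>R\<^esub> x)" using cls_self[OF x] by blast
    then show ?thesis by (simp add: localisation_def Let_def)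
  qed
  show "triple (localisation K U R) (cls x) (cls y) (cls z) = cls (triple R x y z)"
    if x: "x \<in> carrier R" "y \<in> carrier R" "z \<in> carrier R"
  proof -
    have "cls (triple R x' y' z') = cls (triple R x y z)" if "x' \<in> cls x" "y' \<in> cls y" "z' \<in> cls z" for x' y' z'
      using that x mem_cls_iff[OF x(1)] mem_cls_iff[OF x(2)] mem_cls_iff[OF x(3)]
      by (intro cls_cong_triple) auto
    then have "(\<Union>x'\<in>cls x. \<Union>y'\<in>cls y. \<Union>z'\<in>cls z. cls (triple R x' y' z')) = cls (triple R x y z)"
      using x[THEN cls_self] by blast
    then show ?thesis by (simp add: localisation_def Let_def)
  qed
qed

lemma linear_triple_system_localisation: "linear_triple_system K (localisation K U R)"
  and linear_triple_jordan_localisation: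
    "linear_triple_jordan K R \<Longrightarrow> linear_triple_jordan K (localisation K U R)"
  using triple_homomorphic_image[OF linear_triple_system_axioms, of "localisation K U R" cls]
  by (simp_all add: localisation_simps)

end

context quotient_setting
begin

section \<open>O(P(R)) as a subsystem of the maximal system of quotients\<close>

abbreviation OP :: "('k, 'a) triple_system" where "OP \<equiv> orthogonal_completion C V P"
abbreviation hat\<^sub>P :: "'a set" where "hat\<^sub>P \<equiv> completion (carrier P)"

lemma carrier_OP: "carrier OP = hat\<^sub>P"
  by (simp add: orthogonal_completion_def with_triple_def orthogonal_closure_eq[OF submodule_P])

text \<open>The completion is monotone, and that of \<open>Q\<close> is \<open>Q\<close>
  itself.\<close>

lemma hat_P_Q [simp, intro]: "x \<in> hat\<^sub>P \<Longrightarrow> x \<in> carrier Q"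
  using completion_mono[of "carrier P" "carrier Q"] completion_Q by auto

lemma completion_mem_iff:
  assumes "submodule S C V" "x \<in> carrier E" "dense D" "idempotent_ideal D"
    and "\<And>\<alpha>. \<alpha> \<in> D \<Longrightarrow> \<alpha> \<odot>\<^bsub>V\<^esub> x \<in> S"
  shows "x \<in> completion S"
proof -
  have "D \<subseteq> idempotent_domain S x" "idempotent_domain S x \<subseteq> B"
    using assms(3,5) unfolding dense_def idempotent_domain_def by auto
  then have "dense (idempotent_domain S x)" using dense_mono[OF assms(3)] by blast
  then show ?thesis using assms(2) unfolding completion_def by simp
qed

text \<open>An idempotent in all three domains can be carried into the arguments and brings the
  product into \<open>S\<close>. The submodules are kept separate in order to treat closure of O(P)
  and the ideal property of O(J) at once.\<close>

lemma completion_triple: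
  assumes S: "submodule S C V" "submodule S\<^sub>1 C V" "submodule S\<^sub>2 C V" "submodule S\<^sub>3 C V"
    and Q: "S\<^sub>1 \<subseteq> carrier Q" "S\<^sub>2 \<subseteq> carrier Q" "S\<^sub>3 \<subseteq> carrier Q"
    and closed: "\<And>x y z. \<lbrakk>x \<in> S\<^sub>1; y \<in> S\<^sub>2; z \<in> S\<^sub>3\<rbrakk> \<Longrightarrow> triple Q x y z \<in> S"
    and xyz: "x \<in> completion S\<^sub>1" "y \<in> completion S\<^sub>2" "z \<in> completion S\<^sub>3"
  shows "triple Q x y z \<in> completion S"
proof -
  have c: "x \<in> carrier Q" "y \<in> carrier Q" "z \<in> carrier Q"
    using xyz completion_mono Q completion_Q by blast+
  note Dx = completion_domain[OF S(2) xyz(1)] and Dy = completion_domain[OF S(3) xyz(2)]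
    and Dz = completion_domain[OF S(4) xyz(3)]
  note D = dense_Int[OF dense_Int[OF Dx Dy] Dz]
  show ?thesis
  proof (rule completion_mem_iff[OF S(1) _ D])
    show "triple Q x y z \<in> carrier E" using c by simp
    fix \<alpha>
    assume "\<alpha> \<in> idempotent_domain S\<^sub>1 x \<inter> idempotent_domain S\<^sub>2 y \<inter> idempotent_domain S\<^sub>3 z"
    then have "\<alpha> \<in> B" "\<alpha> \<odot>\<^bsub>V\<^esub> x \<in> S\<^sub>1" "\<alpha> \<odot>\<^bsub>V\<^esub> y \<in> S\<^sub>2" "\<alpha> \<odot>\<^bsub>V\<^esub> z \<in> S\<^sub>3"
      unfolding idempotent_domain_def by auto
    then show "\<alpha> \<odot>\<^bsub>V\<^esub> triple Q x y z \<in> S"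
      using closed idempotent_triple[of \<alpha> x y z] c by metis
  qed
qed

lemma hat_P_triple [simp, intro]:
  assumes "x \<in> hat\<^sub>P" "y \<in> hat\<^sub>P" "z \<in> hat\<^sub>P"
  shows "triple Q x y z \<in> hat\<^sub>P"
  using assms
  by (intro completion_triple[OF submodule_P submodule_P submodule_P submodule_P]) (auto simp: triple_P)

text \<open>The product formed in \<open>Q\<close> satisfies the componentwise formula for every
  choice of orthogonal sums. The products \<xi>\<chi>\<eta> are dense, so separation leaves no other
  element satisfying it.\<close>

lemma triple_OP:
  assumes x: "x \<in> hat\<^sub>P" "y \<in> hat\<^sub>P" "z \<in> hat\<^sub>P"
  shows "triple OP x y z = triple Q x y z"
proof -
  let ?sum = "orthogonal_sum C V (carrier P)"
  let ?glued = "\<lambda>s \<Xi> u X v H w. \<forall>\<xi>\<in>\<Xi>. \<forall>\<chi>\<in>X. \<forall>\<eta>\<in>H.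
    (\<xi> \<otimes> \<chi> \<otimes> \<eta>) \<odot>\<^bsub>V\<^esub> s = (\<xi> \<otimes> \<chi> \<otimes> \<eta>) \<odot>\<^bsub>V\<^esub> triple P (u \<xi>) (v \<chi>) (w \<eta>)"
  have glued: "?glued (triple Q x y z) \<Xi> u X v H w"
    if "?sum \<Xi> u x" "?sum X v y" "?sum H w z" for \<Xi> u X v H w
  proof (intro ballI)
    fix \<xi> \<chi> \<eta> assume i: "\<xi> \<in> \<Xi>" "\<chi> \<in> X" "\<eta> \<in> H"
    then have B: "\<xi> \<in> B" "\<chi> \<in> B" "\<eta> \<in> B" and p: "u \<xi> \<in> carrier P" "v \<chi> \<in> carrier P" "w \<eta> \<in> carrier P"
      and eq: "\<xi> \<odot>\<^bsub>V\<^esub> x = \<xi> \<odot>\<^bsub>V\<^esub> u \<xi>" "\<chi> \<odot>\<^bsub>V\<^esub> y = \<chi> \<odot>\<^bsub>V\<^esub> v \<chi>" "\<eta> \<odot>\<^bsub>V\<^esub> z = \<eta> \<odot>\<^bsub>V\<^esub> w \<eta>"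
      using that unfolding orthogonal_sum_def dense_orthogonal_def by auto
    have *: "(\<xi> \<otimes> \<chi> \<otimes> \<eta>) \<odot>\<^bsub>V\<^esub> triple Q a b c = triple Q (\<xi> \<odot>\<^bsub>V\<^esub> a) (\<chi> \<odot>\<^bsub>V\<^esub> b) (\<eta> \<odot>\<^bsub>V\<^esub> c)"
      if "a \<in> carrier Q" "b \<in> carrier Q" "c \<in> carrier Q" for a b c
      using that B by (simp add: Q_triple_smult V_smult_smult V_lcomm)
    show "(\<xi> \<otimes> \<chi> \<otimes> \<eta>) \<odot>\<^bsub>V\<^esub> triple Q x y z = (\<xi> \<otimes> \<chi> \<otimes> \<eta>) \<odot>\<^bsub>V\<^esub> triple P (u \<xi>) (v \<chi>) (w \<eta>)"
      using *[of x y z] *[of "u \<xi>" "v \<chi>" "w \<eta>"] x p eq by (simp add: triple_P)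
  qed
  have "componentwise_triple C V P x y z = triple Q x y z"
    unfolding componentwise_triple_def orthogonal_closure_eq[OF submodule_P]
  proof (rule the_equality)
    obtain \<Xi> u X v H w where "?sum \<Xi> u x" "?sum X v y" "?sum H w z"
      using orthogonal_sum_exists[OF submodule_P] x by metis
    then show "triple Q x y z \<in> hat\<^sub>P \<and> (\<exists>\<Xi> u X v H w. ?sum \<Xi> u x \<and> ?sum X v y \<and> ?sum H w z \<and>
        ?glued (triple Q x y z) \<Xi> u X v H w)"
      using glued x hat_P_triple by blast
    fix s assume "s \<in> hat\<^sub>P \<and> (\<exists>\<Xi> u X v H w. ?sum \<Xi> u x \<and> ?sum X v y \<and> ?sum H w z \<and>
        ?glued s \<Xi> u X v H w)"
    then obtain \<Xi> u X v H w where s: "s \<in> hat\<^sub>P" "?sum \<Xi> u x" "?sum X v y" "?sum H w z" "?glued s \<Xi> u X v H w"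
      by blast
    then have d: "dense \<Xi>" "dense X" "dense H"
      unfolding orthogonal_sum_def dense_orthogonal_iff by auto
    have B: "\<xi> \<in> B" "\<chi> \<in> B" "\<eta> \<in> B" if "\<xi> \<in> \<Xi>" "\<chi> \<in> X" "\<eta> \<in> H" for \<xi> \<chi> \<eta>
      using d that unfolding dense_def by auto
    let ?D = "{\<xi> \<otimes> \<chi> \<otimes> \<eta> | \<xi> \<chi> \<eta>. \<xi> \<in> \<Xi> \<and> \<chi> \<in> X \<and> \<eta> \<in> H}"
    have "dense ?D"
      unfolding dense_def
    proof (intro conjI ballI impI)
      show "?D \<subseteq> B"
      proof
        fix \<delta> assume "\<delta> \<in> ?D"
        then obtain \<xi> \<chi> \<eta> where "\<delta> = \<xi> \<otimes> \<chi> \<otimes> \<eta>" "\<xi> \<in> \<Xi>" "\<chi> \<in> X" "\<eta> \<in> H" by blast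
        then show "\<delta> \<in> B" using B[of \<xi> \<chi> \<eta>] by simp
      qed
      fix \<beta> assume \<beta>: "\<beta> \<in> B" and z: "\<forall>\<delta>\<in>?D. \<beta> \<otimes> \<delta> = \<zero>"
      show "\<beta> = \<zero>"
      proof (rule denseD[OF d(1) \<beta>])
        fix \<xi> assume \<xi>: "\<xi> \<in> \<Xi>"
        then have \<xi>B: "\<xi> \<in> B" using d(1) unfolding dense_def by auto
        show "\<beta> \<otimes> \<xi> = \<zero>"
        proof (rule denseD[OF d(2)])
          show "\<beta> \<otimes> \<xi> \<in> B" using \<beta> \<xi>B by simp
          fix \<chi> assume \<chi>: "\<chi> \<in> X"
          then have \<chi>B: "\<chi> \<in> B" using d(2) unfolding dense_def by auto
          show "\<beta> \<otimes> \<xi> \<otimes> \<chi> = \<zero>"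
          proof (rule denseD[OF d(3)])
            show "\<beta> \<otimes> \<xi> \<otimes> \<chi> \<in> B" using \<beta> \<xi>B \<chi>B by simp
            fix \<eta> assume \<eta>: "\<eta> \<in> H"
            then have "\<eta> \<in> B" using d(3) unfolding dense_def by auto
            moreover have "\<beta> \<otimes> (\<xi> \<otimes> \<chi> \<otimes> \<eta>) = \<zero>" using z \<xi> \<chi> \<eta> by blast
            ultimately show "\<beta> \<otimes> \<xi> \<otimes> \<chi> \<otimes> \<eta> = \<zero>" using \<beta> \<xi>B \<chi>B by (simp add: R.m_assoc)
          qed
        qed
      qed
    qed
    then show "s = triple Q x y z"
    proof (rule separated_eq)
      show "s \<in> carrier E" "triple Q x y z \<in> carrier E" using s(1) x by auto
      show "\<delta> \<odot>\<^bsub>V\<^esub> s = \<delta> \<odot>\<^bsub>V\<^esub> triple Q x y z" if "\<delta> \<in> ?D" for \<delta>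
        using that s(5) glued[OF s(2-4)] by auto
    qed
  qed
  then show ?thesis by (simp add: orthogonal_completion_def with_triple_def)
qed

lemma OP_simps [simp]:
  "carrier OP = hat\<^sub>P" "add OP = add V" "\<zero>\<^bsub>OP\<^esub> = \<zero>\<^bsub>V\<^esub>" "smult OP = smult V"
  using carrier_OP by (simp_all add: orthogonal_completion_def with_triple_def)

lemma hat_P_closed [simp, intro]:
  "\<lbrakk>k \<in> carrier C; x \<in> hat\<^sub>P\<rbrakk> \<Longrightarrow> k \<odot>\<^bsub>V\<^esub> x \<in> hat\<^sub>P" "\<lbrakk>x \<in> hat\<^sub>P; y \<in> hat\<^sub>P\<rbrakk> \<Longrightarrow> x \<oplus>\<^bsub>V\<^esub> y \<in> hat\<^sub>P"
  using V.submoduleE(4,5)[OF submodule_completion[OF submodule_P]] by blast+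

lemma subsystem_OP: "triple_subsystem C OP Q"
proof
  have "module C OP"
    by (rule module_restrict[OF V.module_axioms submodule_completion[OF submodule_P]]) simp_all
  then interpret OP: module C OP .
  show "linear_triple_system C OP"
  proof (unfold_locales, unfold trilinear_def OP_simps, intro conjI ballI)
  qed (simp_all add: triple_OP Q_triple_smult Q_triple_add)
  show "triple_embedding C OP Q (\<lambda>x. x)"
    unfolding triple_embedding_def by (auto simp: Q_add Q_smult triple_OP)
qed

context
  fixes U :: "'k set"
  assumes U: "is_ultrafilter C U"
begin

section \<open>The localisations at an ultrafilter\<close>

interpretation LQ: localised_system C Q U
  using U by unfold_locales

interpretation LP: localised_system C OP U
  by (intro localised_system.intro localised_system_axioms.intro U conjunct1[OF subsystem_OP])

abbreviation LQ :: "('k, 'a set) triple_system" where "LQ \<equiv> localisation C U Q"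
abbreviation LP :: "('k, 'a set) triple_system" where "LP \<equiv> localisation C U OP"
abbreviation incl :: "'a set \<Rightarrow> 'a set" where "incl \<equiv> localised_inclusion C U Q"

lemma U_B: "\<alpha> \<in> U \<Longrightarrow> \<alpha> \<in> B" and U_C: "\<alpha> \<in> U \<Longrightarrow> \<alpha> \<in> carrier C"
  using U unfolding is_ultrafilter_def by auto

text \<open>Equality of classes means equality after multiplication by a member of \<open>U\<close>,
  a condition computed in the hull and independent of the system. This gives injectivity of the
  induced map.\<close>

lemma cls_P_iff:
  assumes "x \<in> hat\<^sub>P" "y \<in> hat\<^sub>P"
  shows "LP.cls x = LP.cls y \<longleftrightarrow> LQ.cls x = LQ.cls y"
proof -
  have "LP.cls x = LP.cls y \<longleftrightarrow> (\<exists>\<alpha>\<in>U. \<alpha> \<odot>\<^bsub>V\<^esub> x = \<alpha> \<odot>\<^bsub>V\<^esub> y)"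
    using LP.cls_eq_iff[of x y] assms unfolding OP_simps by blast
  also have "\<dots> \<longleftrightarrow> (\<exists>\<alpha>\<in>U. \<alpha> \<odot>\<^bsub>Q\<^esub> x = \<alpha> \<odot>\<^bsub>Q\<^esub> y)"
    using assms U_C by (intro bex_cong refl) (simp add: Q_smult)
  also have "\<dots> \<longleftrightarrow> LQ.cls x = LQ.cls y"
    using LQ.cls_eq_iff[of x y] assms by simp
  finally show ?thesis .
qed

lemma incl_cls:
  assumes x: "x \<in> hat\<^sub>P"
  shows "incl (LP.cls x) = LQ.cls x"
proof -
  have "LQ.cls y = LQ.cls x" if "y \<in> LP.cls x" for y
    using that LP.mem_cls_iff[of x y] cls_P_iff[of y x] x by simp
  moreover have "x \<in> LP.cls x" using LP.cls_self[of x] x by simp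
  ultimately show ?thesis unfolding localised_inclusion_def by blast
qed

lemma embedding_localisation: "triple_embedding C LP LQ incl"
  unfolding triple_embedding_def LP.localisation_simps(1) LQ.localisation_simps(1) OP_simps
proof (intro conjI ballI)
  show "incl \<in> LP.cls ` hat\<^sub>P \<rightarrow> LQ.cls ` carrier Q" using incl_cls by auto
  show "inj_on incl (LP.cls ` hat\<^sub>P)" by (rule inj_onI) (clarsimp simp: incl_cls, simp add: cls_P_iff)
  fix X assume "X \<in> LP.cls ` hat\<^sub>P"
  then obtain x where x: "X = LP.cls x" "x \<in> hat\<^sub>P" by blast
  show "incl (k \<odot>\<^bsub>LP\<^esub> X) = k \<odot>\<^bsub>LQ\<^esub> incl X" if "k \<in> carrier C" for k
    using x that LP.localisation_simps(4)[of k x] LQ.localisation_simps(4)[of k x] by (simp add: incl_cls Q_smult)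
  fix Y assume "Y \<in> LP.cls ` hat\<^sub>P"
  then obtain y where y: "Y = LP.cls y" "y \<in> hat\<^sub>P" by blast
  show "incl (X \<oplus>\<^bsub>LP\<^esub> Y) = incl X \<oplus>\<^bsub>LQ\<^esub> incl Y"
    using x y LP.localisation_simps(3)[of x y] LQ.localisation_simps(3)[of x y] by (simp add: incl_cls Q_add)
  fix Z assume "Z \<in> LP.cls ` hat\<^sub>P"
  then obtain z where z: "Z = LP.cls z" "z \<in> hat\<^sub>P" by blast
  show "incl (triple LP X Y Z) = triple LQ (incl X) (incl Y) (incl Z)"
    using x y z LP.localisation_simps(5)[of x y z] LQ.localisation_simps(5)[of x y z]
    by (simp add: incl_cls triple_OP)
qed

text \<open>
  The maps \<open>t\<close> below are \<open>(s, i) \<mapsto> {y, s, i}\<close> and its two variants.  A single pair \<open>(s, i)\<close> detects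
  all those \<open>\<xi>\<close> of an orthogonal family that are detected by some pair.
\<close>

lemma glue_detecting:
  assumes \<Xi>: "dense_orthogonal C \<Xi>" and J: "submodule J C V"
    and t: "\<And>s i. \<lbrakk>s \<in> carrier Q; i \<in> carrier Q\<rbrakk> \<Longrightarrow> t s i \<in> carrier Q"
      "\<And>\<beta> s i. \<lbrakk>\<beta> \<in> B; s \<in> carrier Q; i \<in> carrier Q\<rbrakk> \<Longrightarrow> \<beta> \<odot>\<^bsub>V\<^esub> t s i = t (\<beta> \<odot>\<^bsub>V\<^esub> s) (\<beta> \<odot>\<^bsub>V\<^esub> i)"
    and JP: "J \<subseteq> carrier P"
  obtains s i where "s \<in> hat\<^sub>P" "i \<in> completion J"
    "\<And>\<gamma> \<xi>. \<lbrakk>\<gamma> \<in> B; \<gamma> \<odot>\<^bsub>V\<^esub> t s i = \<zero>\<^bsub>V\<^esub>; \<xi> \<in> \<Xi>;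
      \<exists>s\<in>carrier P. \<exists>i\<in>J. \<forall>\<gamma>\<in>B. \<gamma> \<odot>\<^bsub>V\<^esub> t s i = \<zero>\<^bsub>V\<^esub> \<longrightarrow> \<gamma> \<otimes> \<xi> = \<zero>\<rbrakk> \<Longrightarrow> \<gamma> \<otimes> \<xi> = \<zero>"
proof -
  \<comment> \<open>The pair detects \<xi> when \<xi> lies below the support of the value of
    \<open>t\<close>. The idempotents that kill the value are used to say so, which avoids choosing
    a support.\<close>
  define det where "det \<xi> p \<longleftrightarrow> fst p \<in> carrier P \<and> snd p \<in> J \<and>
    (\<forall>\<gamma>\<in>B. \<gamma> \<odot>\<^bsub>V\<^esub> t (fst p) (snd p) = \<zero>\<^bsub>V\<^esub> \<longrightarrow> \<gamma> \<otimes> \<xi> = \<zero>)" for \<xi> p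
  \<comment> \<open>Where nothing detects \<xi>, the pair of zeros keeps the two families total, as
    glueing over all of \<Xi> requires.\<close>
  define c where "c \<xi> = (if Ex (det \<xi>) then SOME p. det \<xi> p else (\<zero>\<^bsub>V\<^esub>, \<zero>\<^bsub>V\<^esub>))" for \<xi>
  have c_det: "det \<xi> (c \<xi>)" if "Ex (det \<xi>)" for \<xi>
    using that someI_ex[OF that] unfolding c_def by simp
  have zJ: "\<zero>\<^bsub>V\<^esub> \<in> J" using subgroup.one_closed[OF submodule.axioms(1)[OF J]] by simp
  have c_mem: "fst (c \<xi>) \<in> carrier P" "snd (c \<xi>) \<in> J" for \<xi>
  proof -
    have "fst (c \<xi>) \<in> carrier P \<and> snd (c \<xi>) \<in> J"
    proof (cases "Ex (det \<xi>)")
      case True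
      then show ?thesis using c_det unfolding det_def by blast
    next
      case False
      then show ?thesis using zJ V_zero(1) by (simp add: c_def)
    qed
    then show "fst (c \<xi>) \<in> carrier P" "snd (c \<xi>) \<in> J" by simp_all
  qed
  have completeP: "orthogonally_complete C V hat\<^sub>P" "orthogonally_complete C V (completion J)"
    using orthogonally_complete_completion submodule_P J by blast+
  have subs: "carrier P \<subseteq> hat\<^sub>P" "J \<subseteq> completion J" using subset_completion submodule_P J by blast+
  obtain s where s: "s \<in> hat\<^sub>P" "\<And>\<xi>. \<xi> \<in> \<Xi> \<Longrightarrow> \<xi> \<odot>\<^bsub>V\<^esub> s = \<xi> \<odot>\<^bsub>V\<^esub> fst (c \<xi>)"
  proof -
    have "(\<lambda>\<xi>. fst (c \<xi>)) \<in> \<Xi> \<rightarrow> hat\<^sub>P" using c_mem(1) subs(1) by blast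
    then show ?thesis
      using completeP(1) \<Xi> that unfolding orthogonally_complete_def orthogonal_sum_def by meson
  qed
  obtain i where i: "i \<in> completion J" "\<And>\<xi>. \<xi> \<in> \<Xi> \<Longrightarrow> \<xi> \<odot>\<^bsub>V\<^esub> i = \<xi> \<odot>\<^bsub>V\<^esub> snd (c \<xi>)"
  proof -
    have "(\<lambda>\<xi>. snd (c \<xi>)) \<in> \<Xi> \<rightarrow> completion J" using c_mem(2) subs(2) by blast
    then show ?thesis
      using completeP(2) \<Xi> that unfolding orthogonally_complete_def orthogonal_sum_def by meson
  qed
  have siQ: "s \<in> carrier Q" "i \<in> carrier Q"
    using s(1) i(1) completion_mono[OF JP] by auto
  show ?thesis
  proof (rule that[OF s(1) i(1)])
    fix \<gamma> \<xi>
    assume \<gamma>: "\<gamma> \<in> B" "\<gamma> \<odot>\<^bsub>V\<^esub> t s i = \<zero>\<^bsub>V\<^esub>" and \<xi>: "\<xi> \<in> \<Xi>"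
      and ex: "\<exists>s\<in>carrier P. \<exists>i\<in>J. \<forall>\<gamma>\<in>B. \<gamma> \<odot>\<^bsub>V\<^esub> t s i = \<zero>\<^bsub>V\<^esub> \<longrightarrow> \<gamma> \<otimes> \<xi> = \<zero>"
    have \<xi>B: "\<xi> \<in> B" using \<Xi> \<xi> unfolding dense_orthogonal_def by auto
    have "Ex (det \<xi>)" using ex unfolding det_def by auto
    then have det: "\<And>\<gamma>. \<lbrakk>\<gamma> \<in> B; \<gamma> \<odot>\<^bsub>V\<^esub> t (fst (c \<xi>)) (snd (c \<xi>)) = \<zero>\<^bsub>V\<^esub>\<rbrakk> \<Longrightarrow> \<gamma> \<otimes> \<xi> = \<zero>"
      using c_det[of \<xi>] unfolding det_def by blast
    have cQ: "fst (c \<xi>) \<in> carrier Q" "snd (c \<xi>) \<in> carrier Q" using c_mem[of \<xi>] JP by auto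
    \<comment> \<open>On \<xi> the glued arguments agree with the chosen pair, and \<open>t\<close>
      commutes with restriction to \<xi>.\<close>
    have "\<xi> \<odot>\<^bsub>V\<^esub> t s i = \<xi> \<odot>\<^bsub>V\<^esub> t (fst (c \<xi>)) (snd (c \<xi>))"
      using t(2)[OF \<xi>B siQ] t(2)[OF \<xi>B cQ] s(2)[OF \<xi>] i(2)[OF \<xi>] by simp
    then have "(\<gamma> \<otimes> \<xi>) \<odot>\<^bsub>V\<^esub> t (fst (c \<xi>)) (snd (c \<xi>)) = \<xi> \<odot>\<^bsub>V\<^esub> (\<gamma> \<odot>\<^bsub>V\<^esub> t s i)"
      using \<gamma>(1) \<xi>B t(1)[OF siQ] t(1)[OF cQ] by (simp add: V_smult_smult V_lcomm[of \<xi> \<gamma>])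
    then have "(\<gamma> \<otimes> \<xi>) \<odot>\<^bsub>V\<^esub> t (fst (c \<xi>)) (snd (c \<xi>)) = \<zero>\<^bsub>V\<^esub>"
      using \<gamma>(2) \<xi>B V.smult_r_null by simp
    then have "\<gamma> \<otimes> \<xi> \<otimes> \<xi> = \<zero>" using det[of "\<gamma> \<otimes> \<xi>"] \<gamma>(1) \<xi>B by simp
    then show "\<gamma> \<otimes> \<xi> = \<zero>" using \<gamma>(1) \<xi>B by (simp add: R.m_assoc)
  qed
qed

text \<open>Ann J = 0 is used through a dense set of idempotents on each of which either
  \<open>y\<close> is zero or one product detects \<open>y\<close>. The hypothesis, applied to the
  three glued pairs, yields three members of \<open>U\<close>; their product kills
  \<open>y\<close>.\<close>

lemma local_annihilator:
  assumes J: "submodule J C P" "ideal_of P (carrier P) J"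
      "\<And>x. \<lbrakk>x \<in> carrier P; annihilates P (carrier P) J x\<rbrakk> \<Longrightarrow> x = \<zero>\<^bsub>P\<^esub>"
    and y: "y \<in> carrier Q"
    and ann: "\<And>s i. \<lbrakk>s \<in> hat\<^sub>P; i \<in> completion J\<rbrakk> \<Longrightarrow> (\<exists>\<alpha>\<in>U. \<alpha> \<odot>\<^bsub>V\<^esub> triple Q y s i = \<zero>\<^bsub>V\<^esub>) \<and>
      (\<exists>\<alpha>\<in>U. \<alpha> \<odot>\<^bsub>V\<^esub> triple Q y i s = \<zero>\<^bsub>V\<^esub>) \<and> (\<exists>\<alpha>\<in>U. \<alpha> \<odot>\<^bsub>V\<^esub> triple Q i y s = \<zero>\<^bsub>V\<^esub>)"
  shows "\<exists>\<alpha>\<in>U. \<alpha> \<odot>\<^bsub>V\<^esub> y = \<zero>\<^bsub>V\<^esub>"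
proof -
  have JV: "submodule J C V" and JP: "J \<subseteq> carrier P"
    using ideal_submodule[OF J(1,2)] submodule_scalar J(2) unfolding ideal_of_def by auto
  \<comment> \<open>The idempotents on which one value of \<open>t\<close> is nowhere zero.\<close>
  define G where "G t = {\<beta> \<in> B. \<exists>s\<in>carrier P. \<exists>i\<in>J. \<forall>\<gamma>\<in>B. \<gamma> \<odot>\<^bsub>V\<^esub> t s i = \<zero>\<^bsub>V\<^esub> \<longrightarrow> \<gamma> \<otimes> \<beta> = \<zero>}" for t
  define t1 t2 t3 where "t1 s i = triple Q y s i" and "t2 s i = triple Q y i s" and "t3 s i = triple Q i y s" for s i
  note t_defs = t1_def t2_def t3_def
  define D where "D = {\<beta> \<in> B. \<beta> \<odot>\<^bsub>V\<^esub> y = \<zero>\<^bsub>V\<^esub>} \<union> (G t1 \<union> G t2 \<union> G t3)"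
  have G_ideal: "\<delta> \<otimes> \<beta> \<in> G t" if bG: "\<beta> \<in> G t" and "\<delta> \<in> B" for \<delta> \<beta> t
  proof -
    obtain s i where si: "\<beta> \<in> B" "s \<in> carrier P" "i \<in> J" "\<forall>\<gamma>\<in>B. \<gamma> \<odot>\<^bsub>V\<^esub> t s i = \<zero>\<^bsub>V\<^esub> \<longrightarrow> \<gamma> \<otimes> \<beta> = \<zero>"
      using bG unfolding G_def by blast
    have "\<gamma> \<otimes> (\<delta> \<otimes> \<beta>) = \<zero>" if "\<gamma> \<in> B" "\<gamma> \<odot>\<^bsub>V\<^esub> t s i = \<zero>\<^bsub>V\<^esub>" for \<gamma>
      using si(4) that \<open>\<delta> \<in> B\<close> si(1) by (simp add: R.m_lcomm[of \<gamma> \<delta> \<beta>])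
    then show ?thesis using si(1-3) \<open>\<delta> \<in> B\<close> unfolding G_def by blast
  qed
  have D_ideal: "idempotent_ideal D"
    unfolding idempotent_ideal_def
  proof (intro conjI ballI)
    show "D \<subseteq> B" unfolding D_def G_def by auto
    fix \<delta> \<beta> assume "\<delta> \<in> D" "\<beta> \<in> B"
    then show "\<beta> \<otimes> \<delta> \<in> D"
      unfolding D_def using G_ideal y by (auto simp: V_smult_smult)
  qed
  have D_dense: "dense D"
    unfolding dense_def
  proof (intro conjI ballI impI)
    show "D \<subseteq> B" unfolding D_def G_def by auto
    fix \<beta> assume \<beta>: "\<beta> \<in> B" and z: "\<forall>\<delta>\<in>D. \<beta> \<otimes> \<delta> = \<zero>"
    show "\<beta> = \<zero>"
    proof (cases "\<beta> \<odot>\<^bsub>V\<^esub> y = \<zero>\<^bsub>V\<^esub>")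
      case True
      then have "\<beta> \<in> D" using \<beta> unfolding D_def by simp
      then show ?thesis using z \<beta> by force
    next
      case False
      \<comment> \<open>The ideal has no annihilator in \<open>P\<close>, hence none in
        \<open>Q\<close>; so some product with \<open>y\<close> remains nonzero after multiplication
        by \<beta>.\<close>
      have "\<not> annihilates Q (carrier P) J (\<beta> \<odot>\<^bsub>V\<^esub> y)"
        using annihilator_zero[OF Q.linear_triple_jordan_axioms sub_hull embedding_Q J(2,3), of "\<beta> \<odot>\<^bsub>V\<^esub> y"]
          False \<beta> y V_zero by auto
      then obtain s i where si: "s \<in> carrier P" "i \<in> J"
        "t1 s i \<in> carrier Q \<and> \<beta> \<odot>\<^bsub>V\<^esub> t1 s i \<noteq> \<zero>\<^bsub>V\<^esub> \<or> t2 s i \<in> carrier Q \<and> \<beta> \<odot>\<^bsub>V\<^esub> t2 s i \<noteq> \<zero>\<^bsub>V\<^esub> \<or>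
         t3 s i \<in> carrier Q \<and> \<beta> \<odot>\<^bsub>V\<^esub> t3 s i \<noteq> \<zero>\<^bsub>V\<^esub>"
        unfolding annihilates_def t_defs using JP \<beta> y by (auto simp: Q_triple_smult Q_zero subset_iff)
      have "\<beta> = \<zero>" if t: "t s i \<in> carrier Q" "\<beta> \<odot>\<^bsub>V\<^esub> t s i \<noteq> \<zero>\<^bsub>V\<^esub>" and tD: "G t \<subseteq> D" for t
      proof -
        \<comment> \<open>Multiplied by \<beta>, this \<delta> becomes a member of
          \<open>G t\<close>. As \<beta> is orthogonal to \<open>D\<close>, this forces
          \<delta>\<beta> = 0.\<close>
        obtain \<delta> where \<delta>: "\<delta> \<in> B" "\<delta> \<noteq> \<zero>" "\<And>\<gamma>. \<lbrakk>\<gamma> \<in> B; \<gamma> \<odot>\<^bsub>V\<^esub> (\<beta> \<odot>\<^bsub>V\<^esub> t s i) = \<zero>\<^bsub>V\<^esub>\<rbrakk> \<Longrightarrow> \<gamma> \<otimes> \<delta> = \<zero>"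
          using support_hull[of "\<beta> \<odot>\<^bsub>V\<^esub> t s i"] t \<beta> by auto
        have "\<gamma> \<otimes> (\<delta> \<otimes> \<beta>) = \<zero>" if \<gamma>: "\<gamma> \<in> B" "\<gamma> \<odot>\<^bsub>V\<^esub> t s i = \<zero>\<^bsub>V\<^esub>" for \<gamma>
        proof -
          have "\<gamma> \<odot>\<^bsub>V\<^esub> (\<beta> \<odot>\<^bsub>V\<^esub> t s i) = \<zero>\<^bsub>V\<^esub>"
            using \<gamma> \<beta> t(1) V.smult_r_null by (simp add: V_lcomm[of \<gamma> \<beta>])
          then have "\<gamma> \<otimes> \<delta> = \<zero>" using \<delta>(3) \<gamma>(1) by blast
          then show ?thesis using \<gamma>(1) \<delta>(1) \<beta> by (simp flip: R.m_assoc)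
        qed
        then have "\<delta> \<otimes> \<beta> \<in> G t" unfolding G_def using \<delta>(1) \<beta> si(1,2) by blast
        then have "\<beta> \<otimes> (\<delta> \<otimes> \<beta>) = \<zero>" using z tD by blast
        moreover have "\<beta> \<otimes> (\<delta> \<otimes> \<beta>) = \<delta> \<otimes> \<beta>" using \<beta> \<delta>(1) by (simp add: R.m_lcomm[of \<beta> \<delta> \<beta>])
        ultimately have db: "\<delta> \<otimes> \<beta> = \<zero>" by simp
        \<comment> \<open>The complement 1 - \<beta> kills the value multiplied by \<beta>, hence is
          orthogonal to \<delta>. So \<delta> = \<beta>\<delta>, which contradicts \<delta>\<beta> =
          0 for a nonzero \<delta>.\<close>
        have c: "\<one> \<ominus> \<beta> \<in> carrier C" using \<beta> by simp
        have b0: "\<beta> \<otimes> (\<one> \<ominus> \<beta>) = \<zero>" using \<beta> by (simp add: R.minus_eq R.r_distr R.r_minus R.r_neg)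
        have comp: "\<one> \<ominus> \<beta> \<in> B" using LQ.complement_idempotent[OF \<beta>] .
        have "(\<one> \<ominus> \<beta>) \<odot>\<^bsub>V\<^esub> (\<beta> \<odot>\<^bsub>V\<^esub> t s i) = \<zero>\<^bsub>V\<^esub>"
          using b0 R.m_comm[of \<beta> "\<one> \<ominus> \<beta>"] c \<beta> t(1) V.smult_l_null by (simp flip: V_smult_smult)
        then have "(\<one> \<ominus> \<beta>) \<otimes> \<delta> = \<zero>" using \<delta>(3) comp by blast
        then have "\<delta> \<ominus> \<beta> \<otimes> \<delta> = \<zero>" using \<beta> \<delta>(1) by (simp add: R.minus_eq R.l_distr R.l_minus)
        then have "\<delta> = \<zero>" using db R.m_comm[of \<beta> \<delta>] \<beta> \<delta>(1) by (simp add: R.minus_eq)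
        then show ?thesis using \<delta>(2) by simp
      qed
      then show ?thesis using si(3) unfolding D_def by blast
    qed
  qed
  obtain \<Xi> where \<Xi>: "\<Xi> \<subseteq> D" "dense_orthogonal C \<Xi>"
    using dense_orthogonal_subset[OF D_dense D_ideal] by blast
  \<comment> \<open>One glued pair detects all members of \<Xi> in \<open>G t\<close> together, so a
    single member of \<open>U\<close> that kills its value is orthogonal to all of them.\<close>
  have kill: "\<exists>\<alpha>\<in>U. \<forall>\<xi>\<in>\<Xi> \<inter> G t. \<alpha> \<otimes> \<xi> = \<zero>"
    if t: "\<And>s i. \<lbrakk>s \<in> carrier Q; i \<in> carrier Q\<rbrakk> \<Longrightarrow> t s i \<in> carrier Q"
      "\<And>\<beta> s i. \<lbrakk>\<beta> \<in> B; s \<in> carrier Q; i \<in> carrier Q\<rbrakk> \<Longrightarrow> \<beta> \<odot>\<^bsub>V\<^esub> t s i = t (\<beta> \<odot>\<^bsub>V\<^esub> s) (\<beta> \<odot>\<^bsub>V\<^esub> i)"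
      and zero: "\<And>s i. \<lbrakk>s \<in> hat\<^sub>P; i \<in> completion J\<rbrakk> \<Longrightarrow> \<exists>\<alpha>\<in>U. \<alpha> \<odot>\<^bsub>V\<^esub> t s i = \<zero>\<^bsub>V\<^esub>" for t
  proof -
    obtain s i where si: "s \<in> hat\<^sub>P" "i \<in> completion J"
      "\<And>\<gamma> \<xi>. \<lbrakk>\<gamma> \<in> B; \<gamma> \<odot>\<^bsub>V\<^esub> t s i = \<zero>\<^bsub>V\<^esub>; \<xi> \<in> \<Xi>;
      \<exists>s\<in>carrier P. \<exists>i\<in>J. \<forall>\<gamma>\<in>B. \<gamma> \<odot>\<^bsub>V\<^esub> t s i = \<zero>\<^bsub>V\<^esub> \<longrightarrow> \<gamma> \<otimes> \<xi> = \<zero>\<rbrakk> \<Longrightarrow> \<gamma> \<otimes> \<xi> = \<zero>"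
      using glue_detecting[OF \<Xi>(2) JV, of t, OF t JP] by blast
    obtain \<alpha> where "\<alpha> \<in> U" "\<alpha> \<odot>\<^bsub>V\<^esub> t s i = \<zero>\<^bsub>V\<^esub>" using zero[OF si(1,2)] by blast
    then show ?thesis using si(3) U_B unfolding G_def by (intro bexI[of _ \<alpha>]) blast
  qed
  have tQ: "\<beta> \<odot>\<^bsub>V\<^esub> t1 s i = t1 (\<beta> \<odot>\<^bsub>V\<^esub> s) (\<beta> \<odot>\<^bsub>V\<^esub> i)" "\<beta> \<odot>\<^bsub>V\<^esub> t2 s i = t2 (\<beta> \<odot>\<^bsub>V\<^esub> s) (\<beta> \<odot>\<^bsub>V\<^esub> i)"
    "\<beta> \<odot>\<^bsub>V\<^esub> t3 s i = t3 (\<beta> \<odot>\<^bsub>V\<^esub> s) (\<beta> \<odot>\<^bsub>V\<^esub> i)" if "\<beta> \<in> B" "s \<in> carrier Q" "i \<in> carrier Q" for \<beta> s i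
    using that y unfolding t_defs by (simp_all add: Q_triple_smult)
  have tc: "t1 s i \<in> carrier Q" "t2 s i \<in> carrier Q" "t3 s i \<in> carrier Q"
    if "s \<in> carrier Q" "i \<in> carrier Q" for s i using that y unfolding t_defs by simp_all
  have "\<exists>\<alpha>\<in>U. \<forall>\<xi>\<in>\<Xi> \<inter> G t1. \<alpha> \<otimes> \<xi> = \<zero>"
    by (rule kill) (use tQ tc ann in \<open>auto simp: t1_def\<close>)
  then obtain \<alpha>1 where a1: "\<alpha>1 \<in> U" "\<And>\<xi>. \<lbrakk>\<xi> \<in> \<Xi>; \<xi> \<in> G t1\<rbrakk> \<Longrightarrow> \<alpha>1 \<otimes> \<xi> = \<zero>" by blast
  have "\<exists>\<alpha>\<in>U. \<forall>\<xi>\<in>\<Xi> \<inter> G t2. \<alpha> \<otimes> \<xi> = \<zero>"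
    by (rule kill) (use tQ tc ann in \<open>auto simp: t2_def\<close>)
  then obtain \<alpha>2 where a2: "\<alpha>2 \<in> U" "\<And>\<xi>. \<lbrakk>\<xi> \<in> \<Xi>; \<xi> \<in> G t2\<rbrakk> \<Longrightarrow> \<alpha>2 \<otimes> \<xi> = \<zero>" by blast
  have "\<exists>\<alpha>\<in>U. \<forall>\<xi>\<in>\<Xi> \<inter> G t3. \<alpha> \<otimes> \<xi> = \<zero>"
    by (rule kill) (use tQ tc ann in \<open>auto simp: t3_def\<close>)
  then obtain \<alpha>3 where a3: "\<alpha>3 \<in> U" "\<And>\<xi>. \<lbrakk>\<xi> \<in> \<Xi>; \<xi> \<in> G t3\<rbrakk> \<Longrightarrow> \<alpha>3 \<otimes> \<xi> = \<zero>" by blast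
  \<comment> \<open>Each \<xi> in \<Xi> is orthogonal to one of the three factors or kills
    \<open>y\<close>; in either case it kills \<alpha>y.\<close>
  define \<alpha> where "\<alpha> = \<alpha>1 \<otimes> (\<alpha>2 \<otimes> \<alpha>3)"
  have \<alpha>U: "\<alpha> \<in> U" unfolding \<alpha>_def using a1 a2 a3 LQ.U_mult by blast
  note ac = U_C[OF a1(1)] U_C[OF a2(1)] U_C[OF a3(1)]
  have "\<alpha> \<odot>\<^bsub>V\<^esub> y = \<zero>\<^bsub>V\<^esub>"
  proof (rule separated[of \<Xi>])
    show "dense \<Xi>" using \<Xi>(2) unfolding dense_orthogonal_iff by simp
    show "\<alpha> \<odot>\<^bsub>V\<^esub> y \<in> carrier E" using U_C[OF \<alpha>U] y by simp
    fix \<xi> assume \<xi>: "\<xi> \<in> \<Xi>"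
    have \<xi>C: "\<xi> \<in> carrier C" using \<Xi>(1) \<xi> D_def G_def by auto
    have step: "\<alpha>1 \<otimes> \<xi> = \<zero> \<or> \<alpha>2 \<otimes> \<xi> = \<zero> \<or> \<alpha>3 \<otimes> \<xi> = \<zero> \<or> \<xi> \<odot>\<^bsub>V\<^esub> y = \<zero>\<^bsub>V\<^esub>"
      using \<xi> \<Xi>(1) a1(2) a2(2) a3(2) unfolding D_def by blast
    have perm: "\<alpha> \<otimes> \<xi> = (\<alpha>2 \<otimes> \<alpha>3) \<otimes> (\<alpha>1 \<otimes> \<xi>)" "\<alpha> \<otimes> \<xi> = (\<alpha>1 \<otimes> \<alpha>3) \<otimes> (\<alpha>2 \<otimes> \<xi>)"
      "\<alpha> \<otimes> \<xi> = (\<alpha>1 \<otimes> \<alpha>2) \<otimes> (\<alpha>3 \<otimes> \<xi>)"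
      unfolding \<alpha>_def using ac \<xi>C by (simp_all add: R.m_ac)
    have "\<alpha> \<otimes> \<xi> = \<zero> \<or> \<xi> \<odot>\<^bsub>V\<^esub> y = \<zero>\<^bsub>V\<^esub>" using step perm ac by auto
    then show "\<xi> \<odot>\<^bsub>V\<^esub> (\<alpha> \<odot>\<^bsub>V\<^esub> y) = \<zero>\<^bsub>V\<^esub>"
    proof
      assume "\<alpha> \<otimes> \<xi> = \<zero>"
      then have "\<xi> \<otimes> \<alpha> = \<zero>" using R.m_comm[of \<alpha> \<xi>] \<xi>C U_C[OF \<alpha>U] by simp
      then show ?thesis using V_smult_smult[of \<xi> \<alpha> y] \<xi>C U_C[OF \<alpha>U] y V.smult_l_null[of y] by simp
    next
      assume "\<xi> \<odot>\<^bsub>V\<^esub> y = \<zero>\<^bsub>V\<^esub>"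
      then show ?thesis using V_lcomm[of \<xi> \<alpha> y] \<xi>C U_C[OF \<alpha>U] y V.smult_r_null[of \<alpha>] by simp
    qed
  qed
  then show ?thesis using \<alpha>U by blast
qed

text \<open>The ideal comes from a representative \<open>x\<close> of \<open>q\<close>, as the image
  of O(J) for an ideal J of \<open>P\<close> belonging to \<open>x\<close>. Absorption is local and
  passes from J to O(J); both conditions on annihilators are instances of
  \<open>local_annihilator\<close>.\<close>

lemma M_quotients_localisation: "M_quotients C LP incl LQ"
proof (rule M_quotientsI)
  show "linear_triple_jordan C LQ"
    using LQ.linear_triple_jordan_localisation Q.linear_triple_jordan_axioms by blast
  show "linear_triple_system C LP" by (rule LP.linear_triple_system_localisation)
  then interpret LPS: linear_triple_system C LP .
  show "triple_embedding C LP LQ incl" by (rule embedding_localisation)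
  have zeroQ: "LQ.cls w = LQ.cls \<zero>\<^bsub>Q\<^esub> \<longleftrightarrow> (\<exists>\<alpha>\<in>U. \<alpha> \<odot>\<^bsub>V\<^esub> w = \<zero>\<^bsub>V\<^esub>)" if "w \<in> carrier Q" for w
    using LQ.cls_zero_iff[OF that] U_C that by (simp add: Q_smult Q_zero)
  have zeroP: "LP.cls w = LP.cls \<zero>\<^bsub>OP\<^esub> \<longleftrightarrow> (\<exists>\<alpha>\<in>U. \<alpha> \<odot>\<^bsub>V\<^esub> w = \<zero>\<^bsub>V\<^esub>)" if "w \<in> hat\<^sub>P" for w
    using LP.cls_zero_iff[of w] that by simp
  fix q assume "q \<in> carrier LQ" "q \<noteq> \<zero>\<^bsub>LQ\<^esub>"
  then obtain x where q: "q = LQ.cls x" and x: "x \<in> carrier Q" "\<not> (\<exists>\<alpha>\<in>U. \<alpha> \<odot>\<^bsub>V\<^esub> x = \<zero>\<^bsub>V\<^esub>)"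
    using zeroQ unfolding LQ.localisation_simps(1,2) by auto
  have "x \<noteq> \<zero>\<^bsub>V\<^esub>" using x(2) LQ.one_U V.smult_one[of x] x(1) by auto
  then obtain J where J: "submodule J C P" "ideal_of P (carrier P) J"
      "\<And>x. \<lbrakk>x \<in> carrier P; annihilates P (carrier P) J x\<rbrakk> \<Longrightarrow> x = \<zero>\<^bsub>P\<^esub>"
      "absorbs Q ((\<lambda>x. x) ` carrier P) ((\<lambda>x. x) ` J) x"
    using M_quotientsE[OF quotients x(1)] Q_zero by metis
  have JV: "submodule J C V" and JP: "J \<subseteq> carrier P"
    using ideal_submodule[OF J(1,2)] submodule_scalar J(2) unfolding ideal_of_def by auto
  have JQ: "J \<subseteq> carrier Q" using JP by auto
  \<comment> \<open>The pairs produced by \<open>glue_detecting\<close> have their second entry in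
    O(J), which may be larger than \<open>J\<close>.\<close>
  let ?J = "completion J"
  have hJ: "j \<in> hat\<^sub>P" if "j \<in> ?J" for j using completion_mono[OF JP] that by blast
  note hJs = V.submoduleE[OF submodule_completion[OF JV]]
  have zJ: "\<zero>\<^bsub>V\<^esub> \<in> ?J" using subgroup.one_closed[OF submodule.axioms(1)[OF submodule_completion[OF JV]]] by simp
  have PQ: "carrier P \<subseteq> carrier Q" by auto
  have hJt: "triple Q j s s' \<in> ?J" "triple Q s j s' \<in> ?J" "triple Q s s' j \<in> ?J"
    if "j \<in> ?J" "s \<in> hat\<^sub>P" "s' \<in> hat\<^sub>P" for j s s'
  proof -
    have id: "triple Q j s s' \<in> J \<and> triple Q s j s' \<in> J \<and> triple Q s s' j \<in> J"
      if "j \<in> J" "s \<in> carrier P" "s' \<in> carrier P" for j s s'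
      using J(2) JP that unfolding ideal_of_def by (auto simp: triple_P subset_iff)
    show "triple Q j s s' \<in> ?J"
      by (rule completion_triple[OF JV JV submodule_P submodule_P JQ PQ PQ _ that]) (use id in blast)
    show "triple Q s j s' \<in> ?J"
      by (rule completion_triple[OF JV submodule_P JV submodule_P PQ JQ PQ _ that(2,1,3)]) (use id in blast)
    show "triple Q s s' j \<in> ?J"
      by (rule completion_triple[OF JV submodule_P submodule_P JV PQ PQ JQ _ that(2,3,1)]) (use id in blast)
  qed
  have absorb: "triple Q x s j \<in> hat\<^sub>P \<and> triple Q x j s \<in> hat\<^sub>P \<and> triple Q j x s \<in> hat\<^sub>P"
    if j: "j \<in> ?J" and s: "s \<in> hat\<^sub>P" for j s
  proof -
    note D = dense_Int[OF completion_domain[OF JV j] completion_domain[OF submodule_P s]]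
    have jQ: "j \<in> carrier Q" "s \<in> carrier Q" using hJ j s by auto
    \<comment> \<open>The idempotent is moved onto \<open>s\<close> and \<open>j\<close> but not
      onto \<open>x\<close>, since absorption of \<open>J\<close> is known for \<open>x\<close>
      itself.\<close>
    have "\<alpha> \<odot>\<^bsub>V\<^esub> triple Q x s j \<in> carrier P \<and> \<alpha> \<odot>\<^bsub>V\<^esub> triple Q x j s \<in> carrier P \<and>
        \<alpha> \<odot>\<^bsub>V\<^esub> triple Q j x s \<in> carrier P"
      if "\<alpha> \<in> idempotent_domain J j \<inter> idempotent_domain (carrier P) s" for \<alpha>
    proof -
      have \<alpha>: "\<alpha> \<in> B" "\<alpha> \<odot>\<^bsub>V\<^esub> j \<in> J" "\<alpha> \<odot>\<^bsub>V\<^esub> s \<in> carrier P" using that unfolding idempotent_domain_def by auto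
      have "\<alpha> \<odot>\<^bsub>V\<^esub> triple Q x s j = triple Q x (\<alpha> \<odot>\<^bsub>V\<^esub> s) (\<alpha> \<odot>\<^bsub>V\<^esub> j)"
        "\<alpha> \<odot>\<^bsub>V\<^esub> triple Q x j s = triple Q x (\<alpha> \<odot>\<^bsub>V\<^esub> j) (\<alpha> \<odot>\<^bsub>V\<^esub> s)"
        "\<alpha> \<odot>\<^bsub>V\<^esub> triple Q j x s = triple Q (\<alpha> \<odot>\<^bsub>V\<^esub> j) x (\<alpha> \<odot>\<^bsub>V\<^esub> s)"
        using \<alpha>(1) x(1) jQ by (simp_all add: Q_triple_smult)
      then show ?thesis using J(4) \<alpha> unfolding absorbs_def by simp
    qed
    then show ?thesis
      using x(1) jQ completion_mem_iff[OF submodule_P _ D] by simp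
  qed
  let ?I = "LP.cls ` ?J"
  have "submodule ?I C LP"
  proof (rule LPS.submoduleI)
    show "?I \<subseteq> carrier LP" using hJ LP.localisation_simps(1) by auto
    show "\<zero>\<^bsub>LP\<^esub> \<in> ?I" using zJ LP.localisation_simps(2) by auto
    fix X assume "X \<in> ?I"
    then obtain j where j: "X = LP.cls j" "j \<in> ?J" by blast
    show sm: "k \<odot>\<^bsub>LP\<^esub> X \<in> ?I" if "k \<in> carrier C" for k
      using j hJ[OF j(2)] hJs(4)[OF that j(2)] LP.localisation_simps(4)[OF that, of j] by simp
    have "X \<in> carrier LP" using j hJ LP.localisation_simps(1) by auto
    then have "\<ominus>\<^bsub>LP\<^esub> X = (\<ominus> \<one>) \<odot>\<^bsub>LP\<^esub> X" by (simp add: LPS.smult_l_minus)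
    then show "\<ominus>\<^bsub>LP\<^esub> X \<in> ?I" using sm[of "\<ominus> \<one>"] by simp
    fix Y assume "Y \<in> ?I"
    then obtain j' where j': "Y = LP.cls j'" "j' \<in> ?J" by blast
    show "X \<oplus>\<^bsub>LP\<^esub> Y \<in> ?I"
      using j j' hJ hJs(5)[OF j(2) j'(2)] LP.localisation_simps(3)[of j j'] by simp
  qed
  moreover have "ideal_of LP (carrier LP) ?I"
    unfolding ideal_of_def
  proof (intro conjI ballI)
    show "?I \<subseteq> carrier LP" using hJ LP.localisation_simps(1) by auto
    fix X Y Z assume "X \<in> ?I" "Y \<in> carrier LP" "Z \<in> carrier LP"
    then obtain j s s' where j: "X = LP.cls j" "j \<in> ?J" "Y = LP.cls s" "s \<in> hat\<^sub>P" "Z = LP.cls s'" "s' \<in> hat\<^sub>P"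
      unfolding LP.localisation_simps(1) OP_simps by blast
    then show "triple LP X Y Z \<in> ?I" "triple LP Y X Z \<in> ?I" "triple LP Y Z X \<in> ?I"
      using hJ[OF j(2)] hJt[OF j(2,4,6)] LP.localisation_simps(5)[of j s s'] LP.localisation_simps(5)[of s j s']
        LP.localisation_simps(5)[of s s' j]
      by (simp_all add: triple_OP)
  qed
  moreover have "X = \<zero>\<^bsub>LP\<^esub>" if X: "X \<in> carrier LP" "annihilates LP (carrier LP) ?I X" for X
  proof -
    obtain y where y: "X = LP.cls y" "y \<in> hat\<^sub>P" using X(1) unfolding LP.localisation_simps(1) OP_simps by blast
    \<comment> \<open>Here the lemma is used for a representative in O(P): a class annihilating the
      ideal is zero.\<close>
    have "\<exists>\<alpha>\<in>U. \<alpha> \<odot>\<^bsub>V\<^esub> y = \<zero>\<^bsub>V\<^esub>"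
    proof (rule local_annihilator[OF J(1,2)])
      show "y \<in> carrier Q" using y by simp
      fix s i assume s: "s \<in> hat\<^sub>P" and i: "i \<in> ?J"
      have "LP.cls i \<in> ?I" "LP.cls s \<in> carrier LP" using s i unfolding LP.localisation_simps(1) by auto
      then have "triple LP (LP.cls y) (LP.cls s) (LP.cls i) = LP.cls \<zero>\<^bsub>OP\<^esub>"
        "triple LP (LP.cls y) (LP.cls i) (LP.cls s) = LP.cls \<zero>\<^bsub>OP\<^esub>"
        "triple LP (LP.cls i) (LP.cls y) (LP.cls s) = LP.cls \<zero>\<^bsub>OP\<^esub>"
        using X(2) unfolding annihilates_def y(1) LP.localisation_simps(2) by blast+
      then have "LP.cls (triple Q y s i) = LP.cls \<zero>\<^bsub>OP\<^esub>" "LP.cls (triple Q y i s) = LP.cls \<zero>\<^bsub>OP\<^esub>"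
        "LP.cls (triple Q i y s) = LP.cls \<zero>\<^bsub>OP\<^esub>"
        using y(2) s hJ[OF i] LP.localisation_simps(5)[of y s i] LP.localisation_simps(5)[of y i s]
          LP.localisation_simps(5)[of i y s] by (simp_all add: triple_OP)
      then show "(\<exists>\<alpha>\<in>U. \<alpha> \<odot>\<^bsub>V\<^esub> triple Q y s i = \<zero>\<^bsub>V\<^esub>) \<and>
        (\<exists>\<alpha>\<in>U. \<alpha> \<odot>\<^bsub>V\<^esub> triple Q y i s = \<zero>\<^bsub>V\<^esub>) \<and> (\<exists>\<alpha>\<in>U. \<alpha> \<odot>\<^bsub>V\<^esub> triple Q i y s = \<zero>\<^bsub>V\<^esub>)"
        using zeroP y(2) s hJ[OF i] hat_P_triple by blast
    qed (rule J(3))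
    then show ?thesis unfolding y(1) LP.localisation_simps(2) using zeroP[OF y(2)] by simp
  qed
  moreover have im: "incl ` carrier LP = LQ.cls ` hat\<^sub>P" "incl ` ?I = LQ.cls ` ?J"
    unfolding LP.localisation_simps(1) OP_simps image_image using incl_cls hJ by (auto intro!: image_cong)
  have "\<not> annihilates LQ (incl ` carrier LP) (incl ` ?I) q"
  proof
    assume ann: "annihilates LQ (incl ` carrier LP) (incl ` ?I) q"
    \<comment> \<open>Here it is used for \<open>x\<close> in \<open>Q\<close>: were
      \<open>q\<close> to annihilate the ideal, \<open>x\<close> would vanish in the
      localisation.\<close>
    have "\<exists>\<alpha>\<in>U. \<alpha> \<odot>\<^bsub>V\<^esub> x = \<zero>\<^bsub>V\<^esub>"
    proof (rule local_annihilator[OF J(1,2) _ x(1)])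
      fix s i assume s: "s \<in> hat\<^sub>P" and i: "i \<in> ?J"
      have "triple LQ (LQ.cls x) (LQ.cls s) (LQ.cls i) = LQ.cls \<zero>\<^bsub>Q\<^esub>"
        "triple LQ (LQ.cls x) (LQ.cls i) (LQ.cls s) = LQ.cls \<zero>\<^bsub>Q\<^esub>"
        "triple LQ (LQ.cls i) (LQ.cls x) (LQ.cls s) = LQ.cls \<zero>\<^bsub>Q\<^esub>"
        using ann s i unfolding annihilates_def im q LQ.localisation_simps(2) by blast+
      then have "LQ.cls (triple Q x s i) = LQ.cls \<zero>\<^bsub>Q\<^esub>" "LQ.cls (triple Q x i s) = LQ.cls \<zero>\<^bsub>Q\<^esub>"
        "LQ.cls (triple Q i x s) = LQ.cls \<zero>\<^bsub>Q\<^esub>"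
        using x(1) s hJ[OF i] LQ.localisation_simps(5)[of x s i] LQ.localisation_simps(5)[of x i s]
          LQ.localisation_simps(5)[of i x s] by simp_all
      then show "(\<exists>\<alpha>\<in>U. \<alpha> \<odot>\<^bsub>V\<^esub> triple Q x s i = \<zero>\<^bsub>V\<^esub>) \<and>
        (\<exists>\<alpha>\<in>U. \<alpha> \<odot>\<^bsub>V\<^esub> triple Q x i s = \<zero>\<^bsub>V\<^esub>) \<and> (\<exists>\<alpha>\<in>U. \<alpha> \<odot>\<^bsub>V\<^esub> triple Q i x s = \<zero>\<^bsub>V\<^esub>)"
        using zeroQ x(1) s hJ[OF i] by simp
    qed (rule J(3))
    then show False using x(2) by simp
  qed
  moreover have "absorbs LQ (incl ` carrier LP) (incl ` ?I) q"
    unfolding absorbs_def im q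
  proof (intro ballI)
    fix X Y assume "X \<in> LQ.cls ` ?J" "Y \<in> LQ.cls ` hat\<^sub>P"
    then obtain i s where wit: "X = LQ.cls i" "i \<in> ?J" "Y = LQ.cls s" "s \<in> hat\<^sub>P" by blast
    then show "triple LQ (LQ.cls x) Y X \<in> LQ.cls ` hat\<^sub>P \<and> triple LQ (LQ.cls x) X Y \<in> LQ.cls ` hat\<^sub>P \<and>
      triple LQ X (LQ.cls x) Y \<in> LQ.cls ` hat\<^sub>P"
      using absorb[OF wit(2,4)] x(1) hJ[OF wit(2)] LQ.localisation_simps(5)[of x s i] LQ.localisation_simps(5)[of x i s]
          LQ.localisation_simps(5)[of i x s] by simp
  qed
  ultimately show "\<exists>I. submodule I C LP \<and> ideal_of LP (carrier LP) I \<and>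
      (\<forall>x\<in>carrier LP. annihilates LP (carrier LP) I x \<longrightarrow> x = \<zero>\<^bsub>LP\<^esub>) \<and>
      \<not> annihilates LQ (incl ` carrier LP) (incl ` I) q \<and> absorbs LQ (incl ` carrier LP) (incl ` I) q"
    by blast
qed

end

end


text \<open>Hulls and maximal systems are determined only up to isomorphism, so the statement speaks
  of all their realisations. Over \<open>F\<close> the maximal system may have elements of any type;
  over \<open>C\<close> it lies inside the hull, where orthogonal sums make sense.\<close>

theorem proposition3p5:
  fixes F :: "'k ring"
    and R :: "('k, 'a) triple_system"
    and I\<^sub>R :: "('a \<Rightarrow> 'a, 'a) module"
  assumes "cring F"
    and "add_pow F (6::nat) \<one>\<^bsub>F\<^esub> \<in> Units F"
    and "linear_triple_jordan F R"
    and "nondegenerate R"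
    and "carrier R \<noteq> {\<zero>\<^bsub>R\<^esub>}"
    and "is_injective_hull_of F R I\<^sub>R"
  defines "C \<equiv> CM F R I\<^sub>R"
    and "P \<equiv> P_over_CM F R I\<^sub>R"
    and "P\<^sub>F \<equiv> P_over_base F R I\<^sub>R"
  shows "M_quotients F R (\<lambda>x. x) P\<^sub>F \<and>
    (\<forall>(Q\<^sub>R :: ('k, 'q) triple_system) \<iota>. maximal_M_quotients F R \<iota> Q\<^sub>R \<longrightarrow>
      (\<exists>\<phi>. triple_embedding F P\<^sub>F Q\<^sub>R \<phi> \<and> (\<forall>x\<in>carrier R. \<phi> x = \<iota> x))) \<and>
    (\<forall>(I\<^sub>P :: ('a \<Rightarrow> 'a, 'a) module) (Q :: ('a \<Rightarrow> 'a, 'a) triple_system).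
      is_injective_hull_of C P I\<^sub>P \<and>
      maximal_M_quotients C P (\<lambda>x. x) Q \<and> submodule_of_hull C P I\<^sub>P Q \<longrightarrow>
      (let V = scalar_module P I\<^sub>P; OP = orthogonal_completion C V P in
        triple_subsystem C OP Q \<and>
        carrier Q = orthogonal_closure C V (carrier Q) \<and>
        (\<forall>B. is_ultrafilter C B \<longrightarrow>
          M_quotients C (localisation C B OP) (localised_inclusion C B Q) (localisation C B Q))))"
proof -
  interpret nondegenerate_hull F R I\<^sub>R
    using assms(3,4,6) linear_triple_jordan.axioms(1)[OF assms(3)]
    by (intro nondegenerate_hull.intro hulled_system.intro hulled_system_axioms.intro
        nondegenerate_hull_axioms.intro)
  have 1: "M_quotients F R (\<lambda>x. x) P\<^sub>F"
    using M_quotients_P unfolding P\<^sub>F_def .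
  have 2: "\<exists>\<phi>. triple_embedding F P\<^sub>F Q\<^sub>R \<phi> \<and> (\<forall>x\<in>carrier R. \<phi> x = \<iota> x)"
    if m: "maximal_M_quotients F R \<iota> Q\<^sub>R" for Q\<^sub>R :: "('k, 'q) triple_system" and \<iota>
    using M_quotients_lift[OF 1 m] .
  have P_simps: "carrier P = P_carrier F R I\<^sub>R" "\<zero>\<^bsub>P\<^esub> = \<zero>\<^bsub>I\<^sub>R\<^esub>" "k \<odot>\<^bsub>P\<^esub> x = k x" for k x
    by (simp_all add: P_def P_over_CM_def with_triple_def P_module_def)
  have 3: "let V = scalar_module P I\<^sub>P; OP = orthogonal_completion C V P in
      triple_subsystem C OP Q \<and> carrier Q = orthogonal_closure C V (carrier Q) \<and>
      (\<forall>B. is_ultrafilter C B \<longrightarrow>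
        M_quotients C (localisation C B OP) (localised_inclusion C B Q) (localisation C B Q))"
    if "is_injective_hull_of C P I\<^sub>P" "maximal_M_quotients C P (\<lambda>x. x) Q" "submodule_of_hull C P I\<^sub>P Q"
    for I\<^sub>P :: "('a \<Rightarrow> 'a, 'a) module" and Q :: "('a \<Rightarrow> 'a, 'a) triple_system"
  proof -
    \<comment> \<open>Linearity of \<open>P\<close> over \<open>C\<close> is read off from the
      system of quotients.\<close>
    have lP: "linear_triple_system C P"
      using that(2) unfolding maximal_M_quotients_def M_quotients_def by simp
    interpret Q: quotient_setting C P I\<^sub>P Q
    \<comment> \<open>The support idempotents are what the construction of P(R) contributes to the
      glueing; the remaining obligations are facts about the given hull and the given
      \<open>Q\<close>.\<close>
    proof (intro quotient_setting.intro supported_hull.intro hulled_system.intro hulled_system_axioms.intro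
        supported_hull_axioms.intro quotient_setting_axioms.intro lP that)
      show "\<exists>\<beta>\<in>idempotents C. \<beta> \<noteq> \<zero>\<^bsub>C\<^esub> \<and>
          (\<forall>\<gamma>\<in>idempotents C. \<gamma> \<odot>\<^bsub>P\<^esub> p = \<zero>\<^bsub>P\<^esub> \<longrightarrow> \<gamma> \<otimes>\<^bsub>C\<^esub> \<beta> = \<zero>\<^bsub>C\<^esub>)"
        if "p \<in> carrier P" "p \<noteq> \<zero>\<^bsub>P\<^esub>" for p
        using support_P[of p] that unfolding P_simps C_def by simp
    qed
    show ?thesis
      unfolding Let_def Q.orthogonal_closure_eq[OF Q.submodule_Q] Q.completion_Q
      by (intro conjI allI impI Q.M_quotients_localisation Q.subsystem_OP[THEN conjunct1]
          Q.subsystem_OP[THEN conjunct2] refl)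
  qed
  show ?thesis
    by (intro conjI allI impI) (erule conjE | rule 1 2 3 | assumption)+
qed

end
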